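(* Let $d\ge 3$ and let $\overrightarrow{F}\in\mathcal{D}'(\mathbb{R}^d)^d$ be a vector field of distributions. Suppose there is $C>0$ such that for all $u,v\in\mathcal{D}(\mathbb{R}^d)$, \[ \big|\langle\overrightarrow{F},\,v\nabla\overline{u}-\overline{u}\nabla v\rangle\big|\le C\|u\|_{\dot H^{1}}\|v\|_{\dot H^{1}}. \] Then the vector field $\overrightarrow{G}=\nabla(\Delta^{-1}\operatorname{div}\overrightarrow{F})$ belongs to $L^2_{loc}(\mathbb{R}^d)$ and there is a constant $C'$ such that \[ \int_{\mathbb{R}^{d}}|\overrightarrow{G}(x)|^{2}|u(x)|^{2}\,dx\le C'\|u\|_{\dot H^{1}}^{2}\quad\text{for all }u\in\mathcal{D}(\mathbb{R}^d). \]
   Context: $\|u\|_{\dot H^1}=\|\nabla u\|_{L^2(\mathbb{R}^d)}$; $\dot H^1(\mathbb{R}^d)$ is the completion of $\mathcal{D}(\mathbb{R}^d)$ in this norm. $\Delta$ is the Laplacian and $\langle\cdot,\cdot\rangle$ the distribution–test function pairing. *)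

theory Defs
  imports "HOL-Analysis.Analysis"
begin

definition pd :: "'d::finite \<Rightarrow> (real^'d \<Rightarrow> complex) \<Rightarrow> real^'d \<Rightarrow> complex" where
  "pd i f x = frechet_derivative f (at x) (axis i 1)"

fun dpart :: "'d::finite list \<Rightarrow> (real^'d \<Rightarrow> complex) \<Rightarrow> real^'d \<Rightarrow> complex" where
  "dpart [] f = f"
| "dpart (i # is) f = pd i (dpart is f)"

definition smooth_fun :: "(real^'d::finite \<Rightarrow> complex) \<Rightarrow> bool" where
  "smooth_fun f \<longleftrightarrow> (\<forall>is x. dpart is f differentiable (at x))"

definition tsupp :: "(real^'d::finite \<Rightarrow> complex) \<Rightarrow> (real^'d) set" where
  "tsupp f = closure {x. f x \<noteq> 0}"

definition test_fun :: "(real^'d::finite \<Rightarrow> complex) \<Rightarrow> bool" where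
  "test_fun f \<longleftrightarrow> smooth_fun f \<and> compact (tsupp f)"

(* D'(R^d): linear functionals on D that are continuous, in the standard
   seminorm characterisation: for every compact K there are C and N with
   |T phi| <= C * sum_{|alpha|<=N} sup |d^alpha phi| for phi supported in K *)
definition distribution :: "((real^'d::finite \<Rightarrow> complex) \<Rightarrow> complex) \<Rightarrow> bool" where
  "distribution T \<longleftrightarrow>
     (\<forall>a b f g. test_fun f \<longrightarrow> test_fun g \<longrightarrow>
        T (\<lambda>x. a * f x + b * g x) = a * T f + b * T g) \<and>
     (\<forall>K. compact K \<longrightarrow> (\<exists>C N. \<forall>f. test_fun f \<and> tsupp f \<subseteq> K \<longrightarrow>
        cmod (T f) \<le> C * (\<Sum>is\<in>{is. length is \<le> N}. (SUP x. cmod (dpart is f x)))))"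

definition dist_pd :: "'d::finite \<Rightarrow> ((real^'d \<Rightarrow> complex) \<Rightarrow> complex) \<Rightarrow> (real^'d \<Rightarrow> complex) \<Rightarrow> complex" where
  "dist_pd i T f = - T (pd i f)"

definition lap :: "(real^'d::finite \<Rightarrow> complex) \<Rightarrow> real^'d \<Rightarrow> complex" where
  "lap f x = (\<Sum>i\<in>UNIV. pd i (pd i f) x)"

definition dist_lap :: "((real^'d::finite \<Rightarrow> complex) \<Rightarrow> complex) \<Rightarrow> (real^'d \<Rightarrow> complex) \<Rightarrow> complex" where
  "dist_lap T f = T (lap f)"

definition dist_div :: "('d::finite \<Rightarrow> (real^'d \<Rightarrow> complex) \<Rightarrow> complex) \<Rightarrow> (real^'d \<Rightarrow> complex) \<Rightarrow> complex" where
  "dist_div F f = (\<Sum>j\<in>UNIV. dist_pd j (F j) f)"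

definition hnorm :: "(real^'d::finite \<Rightarrow> complex) \<Rightarrow> real" where
  "hnorm u = sqrt (integral\<^sup>L lborel (\<lambda>x. \<Sum>j\<in>UNIV. (cmod (pd j u x))\<^sup>2))"

definition L2loc :: "(real^'d::finite \<Rightarrow> complex) \<Rightarrow> bool" where
  "L2loc g \<longleftrightarrow> g \<in> borel_measurable lborel \<and>
     (\<forall>K. compact K \<longrightarrow> (\<integral>\<^sup>+ x. indicator K x * ennreal ((cmod (g x))\<^sup>2) \<partial>lborel) < \<infinity>)"

definition represented_by :: "((real^'d::finite \<Rightarrow> complex) \<Rightarrow> complex) \<Rightarrow> (real^'d \<Rightarrow> complex) \<Rightarrow> bool" where
  "represented_by T g \<longleftrightarrow> (\<forall>f. test_fun f \<longrightarrow> T f = integral\<^sup>L lborel (\<lambda>x. g x * f x))"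

end

theory Submission
  imports Defs
begin

text \<open>
Real and imaginary parts of \<open>F\<close> are treated separately. For a real test function \<open>p\<close>, inserting
\<open>a = p cos \<eta>\<close>, \<open>b = p sin \<eta>\<close> with \<open>\<eta> = log (p\<^sup>2 + \<epsilon>\<^sup>2) / 2\<close> into the skew form and letting \<open>\<epsilon> \<rightarrow> 0\<close> shows that
\<open>V = div F\<close> is form bounded: \<open>|\<langle>V, p\<^sup>2\<rangle>| \<le> 4 C \<parallel>\<nabla>p\<parallel>\<^sup>2\<close>. After mollification and scaling so that the bound is
\<open>\<parallel>\<nabla>p\<parallel>\<^sup>2 / 2\<close>, a near minimiser \<open>u \<ge> 0\<close> of \<open>\<parallel>\<nabla>u\<parallel>\<^sup>2 / 2 - \<langle>V, u\<^sup>2\<rangle> / 2 - \<langle>f, u\<rangle>\<close>, with \<open>f \<ge> V\<close> on a ball, yields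
\<open>\<Phi> = log (1 + u)\<close> (mollified) with \<open>- \<Delta>\<Phi> - |\<nabla>\<Phi>|\<^sup>2 \<ge> V - \<epsilon>\<close> there. Hence \<open>|\<nabla>\<Phi>|\<^sup>2\<close> satisfies the trace inequality, and
\<open>\<mu> = - \<Delta>\<Phi> - V + \<epsilon>\<close> is a positive measure with \<open>\<integral>u\<^sup>2 d\<mu> \<le> K \<parallel>\<nabla>u\<parallel>\<^sup>2\<close>. For such \<open>\<mu>\<close> the Riesz potential \<open>W = I\<^sub>1 \<mu>\<close> satisfies
\<open>I\<^sub>1 (W\<^sup>2) \<le> c W\<close>, which gives \<open>\<integral>W\<^sup>2 u\<^sup>2 \<le> c' \<parallel>\<nabla>u\<parallel>\<^sup>2\<close>; since the Newton potential of \<open>\<mu>\<close> has gradient at most \<open>c W\<close>,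
\<open>\<psi> = - \<Phi> + \<Delta>\<^sup>-\<^sup>1(- \<mu>)\<close> solves \<open>\<Delta>\<psi> = V - \<epsilon>\<close> on the ball with \<open>\<integral>|\<nabla>\<psi>|\<^sup>2 u\<^sup>2 \<le> c'' \<parallel>\<nabla>u\<parallel>\<^sup>2\<close>, uniformly in the ball, the mollification and \<open>\<epsilon>\<close>.
These potentials form decreasing convex sets, in which near minimisers of weighted energies have gradients converging in \<open>L\<^sup>2\<^sub>l\<^sub>o\<^sub>c\<close>.
\<close>

text \<open>The obstacle is that \<open>V\<close> has neither sign nor decay. Its Newton potential
  makes no sense globally, and bounding kernels by absolute values would destroy the cancellation
  that the hypothesis encodes. The logarithmic substitution concentrates the difficulty in one
  positive measure, for which absolute values cost nothing. The form constant 1/2 leaves half of the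
  Dirichlet energy over, so the functional is coercive. Exact minimisers would lie only in the
  completion; near minimisers keep every function smooth, at the price of a square root error in the
  Euler-Lagrange equation. The inverse Laplacian is fixed only up to harmonic functions, so
  potentials found on different balls need not converge. Requiring the gradient bound, the
  approximate Poisson equation and a normalisation on growing balls gives nested convex sets, on
  which the parallelogram identity replaces weak compactness. After scaling, all constants depend
  only on the dimension.\<close>

abbreviation lborel_nn :: "('a::euclidean_space \<Rightarrow> ennreal) \<Rightarrow> ennreal" (binder "LBNN " 10) where
  "lborel_nn f \<equiv> nn_integral lborel f"

section \<open>Smooth real functions\<close>

text \<open>Real-valued counterparts of \<^const>\<open>pd\<close> and \<^const>\<open>dpart\<close>; \<open>sm\<close> is smoothness, \<open>smn n\<close> its \<open>n\<close>-th order truncation used for inductions.\<close>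

definition rpd :: "'d::finite \<Rightarrow> (real^'d \<Rightarrow> real) \<Rightarrow> real^'d \<Rightarrow> real" where
  "rpd i f x = frechet_derivative f (at x) (axis i 1)"

abbreviation gsq :: "(real^'d::finite \<Rightarrow> real) \<Rightarrow> real^'d \<Rightarrow> real" where
  "gsq u x \<equiv> \<Sum>j\<in>UNIV. (rpd j u x)^2"

fun dp :: "'d::finite list \<Rightarrow> (real^'d \<Rightarrow> real) \<Rightarrow> real^'d \<Rightarrow> real" where
  "dp [] f = f"
| "dp (i # is) f = rpd i (dp is f)"

definition smn :: "nat \<Rightarrow> (real^'d::finite \<Rightarrow> real) \<Rightarrow> bool" where
  "smn n f \<longleftrightarrow> (\<forall>is x. length is \<le> n \<longrightarrow> dp is f differentiable (at x))"

definition sm :: "(real^'d::finite \<Rightarrow> real) \<Rightarrow> bool" where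
  "sm f \<longleftrightarrow> (\<forall>is x. dp is f differentiable (at x))"

lemma rpd_eqI: "(f has_derivative f') (at x) \<Longrightarrow> rpd i f x = f' (axis i 1)"
  unfolding rpd_def by (metis frechet_derivative_at)

lemma dp_snoc: "dp (is @ [i]) f = dp is (rpd i f)"
  by (induction "is") auto

lemma sm_iff_smn: "sm f \<longleftrightarrow> (\<forall>n. smn n f)"
  unfolding sm_def smn_def by blast

lemma smn_0: "smn 0 f \<longleftrightarrow> (\<forall>x. f differentiable (at x))"
  by (simp add: smn_def)

text \<open>The derivative split off is the innermost one (\<open>dp_snoc\<close>). Smoothness of
  \<open>f\<close> thus reduces to that of its first derivatives, which the product and chain rules
  express explicitly.\<close>

lemma smn_Suc: "smn (Suc n) f \<longleftrightarrow> (\<forall>x. f differentiable (at x)) \<and> (\<forall>i. smn n (rpd i f))"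
proof
  assume a: "smn (Suc n) f"
  have "dp is (rpd i f) differentiable (at x)" if "length is \<le> n" for i x "is"
    using a that unfolding smn_def dp_snoc[symmetric] by simp
  moreover have "f differentiable (at x)" for x
    using a[unfolded smn_def, rule_format, of "[]"] by simp
  ultimately show "(\<forall>x. f differentiable (at x)) \<and> (\<forall>i. smn n (rpd i f))"
    unfolding smn_def by blast
next
  assume a: "(\<forall>x. f differentiable (at x)) \<and> (\<forall>i. smn n (rpd i f))"
  show "smn (Suc n) f" unfolding smn_def
  proof (intro allI impI)
    fix "is" :: "'a list" and x assume l: "length is \<le> Suc n"
    show "dp is f differentiable (at x)"
    proof (cases "is" rule: rev_cases)
      case Nil then show ?thesis using a by simp
    next
      case (snoc ys y)
      then show ?thesis using a l by (simp add: dp_snoc smn_def)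
    qed
  qed
qed

lemma smn_diff: "smn n f \<Longrightarrow> f differentiable (at x)"
  by (cases n) (auto simp: smn_0 smn_Suc)

lemma smn_mono: "smn n f \<Longrightarrow> m \<le> n \<Longrightarrow> smn m f"
  unfolding smn_def by auto

lemma sm_diff: "sm f \<Longrightarrow> f differentiable (at x)"
  using smn_diff sm_iff_smn by blast

lemma sm_rpd: "sm f \<Longrightarrow> sm (rpd i f)"
  unfolding sm_iff_smn using smn_Suc by blast

lemma smI: "(\<And>x. f differentiable (at x)) \<Longrightarrow> (\<And>i. sm (rpd i f)) \<Longrightarrow> sm f"
  unfolding sm_iff_smn by (metis smn_Suc smn_mono lessI less_imp_le_nat)

lemma sm_dp: "sm f \<Longrightarrow> sm (dp is f)"
  by (induction "is") (auto intro: sm_rpd)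

lemma sm_cont: "sm f \<Longrightarrow> continuous_on S f"
  by (meson differentiable_imp_continuous_within continuous_at_imp_continuous_on sm_diff)

lemma rpd_add: "f differentiable (at x) \<Longrightarrow> g differentiable (at x) \<Longrightarrow>
    rpd i (\<lambda>x. f x + g x) x = rpd i f x + rpd i g x"
proof -
  assume "f differentiable (at x)" "g differentiable (at x)"
  note a = this[unfolded frechet_derivative_works]
  show ?thesis by (subst rpd_eqI[OF has_derivative_add[OF a]]) (simp add: rpd_def)
qed

lemma rpd_mult:
  assumes "f differentiable (at x)" "g differentiable (at x)"
  shows "rpd i (\<lambda>x. f x * g x) x = rpd i f x * g x + f x * rpd i g x"
proof -
  note a = assms[unfolded frechet_derivative_works]
  show ?thesis
    by (subst rpd_eqI[OF has_derivative_mult[OF a]]) (simp add: rpd_def)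
qed

lemma rpd_const [simp]: "rpd i (\<lambda>x. c) x = 0"
  by (subst rpd_eqI[OF has_derivative_const]) simp

lemma smn_const: "smn n (\<lambda>x. c)"
proof (induction n arbitrary: c)
  case (Suc n)
  have "rpd i (\<lambda>x. c) = (\<lambda>x. 0)" for i :: 'a by auto
  then show ?case using Suc by (simp add: smn_Suc)
qed (simp add: smn_0)

lemma smn_add: "smn n f \<Longrightarrow> smn n g \<Longrightarrow> smn n (\<lambda>x. f x + g x)"
proof (induction n arbitrary: f g)
  case (Suc n)
  have "rpd i (\<lambda>x. f x + g x) = (\<lambda>x. rpd i f x + rpd i g x)" for i
    using Suc.prems by (auto simp: fun_eq_iff smn_Suc intro!: rpd_add)
  then show ?case using Suc by (auto simp: smn_Suc)
qed (auto simp: smn_0)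

lemma smn_mult: "smn n f \<Longrightarrow> smn n g \<Longrightarrow> smn n (\<lambda>x. f x * g x)"
proof (induction n arbitrary: f g)
  case (Suc n)
  have "rpd i (\<lambda>x. f x * g x) = (\<lambda>x. rpd i f x * g x + f x * rpd i g x)" for i
    using Suc.prems by (auto simp: fun_eq_iff smn_Suc intro!: rpd_mult)
  moreover have "smn n f" "smn n g" using Suc.prems smn_mono[of "Suc n" _ n] by auto
  ultimately show ?case using Suc by (auto simp: smn_Suc intro!: smn_add)
qed (auto simp: smn_0)

lemma sm_const: "sm (\<lambda>x. c)" by (simp add: sm_iff_smn smn_const)
lemma sm_add: "sm f \<Longrightarrow> sm g \<Longrightarrow> sm (\<lambda>x. f x + g x)" by (simp add: sm_iff_smn smn_add)
lemma sm_mult: "sm f \<Longrightarrow> sm g \<Longrightarrow> sm (\<lambda>x. f x * g x)" by (simp add: sm_iff_smn smn_mult)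
lemma sm_minus: "sm f \<Longrightarrow> sm (\<lambda>x. - f x)" using sm_mult[OF sm_const[of "-1"]] by simp
lemma sm_sub: "sm f \<Longrightarrow> sm g \<Longrightarrow> sm (\<lambda>x. f x - g x)" using sm_add[OF _ sm_minus] by fastforce
lemma sm_sum: "(\<And>i. i \<in> I \<Longrightarrow> sm (f i)) \<Longrightarrow> sm (\<lambda>x. \<Sum>i\<in>I. f i x)"
  by (induction I rule: infinite_finite_induct) (auto intro: sm_const sm_add)
lemma sm_power: "sm f \<Longrightarrow> sm (\<lambda>x. f x ^ n)"
  by (induction n) (auto intro: sm_const sm_mult)

section \<open>Chain rule and smoothness of compositions\<close>

lemma rpd_chain:
  assumes "(h has_real_derivative h') (at (p x))" "p differentiable (at x)"
  shows "(\<lambda>x. h (p x)) differentiable (at x)" "rpd i (\<lambda>x. h (p x)) x = h' * rpd i p x"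
proof -
  have a: "((\<lambda>x. h (p x)) has_derivative (\<lambda>v. frechet_derivative p (at x) v * h')) (at x)"
    using has_derivative_compose[OF assms(2)[unfolded frechet_derivative_works] assms(1)[unfolded has_field_derivative_def]]
    by (simp add: mult.commute)
  show "(\<lambda>x. h (p x)) differentiable (at x)" using a by (auto simp: differentiable_def)
  show "rpd i (\<lambda>x. h (p x)) x = h' * rpd i p x" using rpd_eqI[OF a] by (simp add: rpd_def)
qed

text \<open>\<open>H k\<close> plays the role of the k-th derivative of \<open>H 0\<close>. All k
  are treated at once because the chain rule turns \<open>H k\<close> into \<open>H (Suc k)\<close>
  while the order \<open>n\<close> drops by one.\<close>

lemma smn_comp:
  assumes "\<And>k t. t \<in> S \<Longrightarrow> (H k has_real_derivative H (Suc k) t) (at t)" "\<And>x. p x \<in> S"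
  shows "smn n p \<Longrightarrow> smn n (\<lambda>x. H k (p x))"
proof (induction n arbitrary: k)
  case 0 then show ?case using rpd_chain(1)[where p=p, OF assms(1)[OF assms(2)]] unfolding smn_0 by blast
next
  case (Suc n)
  have d: "p differentiable (at x)" for x using Suc.prems smn_diff by blast
  have "rpd i (\<lambda>x. H k (p x)) = (\<lambda>x. H (Suc k) (p x) * rpd i p x)" for i
    using rpd_chain(2)[OF assms(1)[OF assms(2)] d] by auto
  moreover have "smn n p" using Suc.prems smn_mono[of "Suc n" _ n] by auto
  ultimately show ?case using Suc rpd_chain(1)[OF assms(1)[OF assms(2)] d]
    by (auto simp: smn_Suc intro!: smn_mult)
qed

lemma sm_comp:
  assumes "\<And>k t. t \<in> S \<Longrightarrow> (H k has_real_derivative H (Suc k) t) (at t)" "\<And>x. p x \<in> S" "sm p"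
  shows "sm (\<lambda>x. H 0 (p x))"
  using assms smn_comp[of S H p _ 0] by (auto simp: sm_iff_smn)

lemma sm_powr:
  assumes "sm p" "\<And>x. 0 < p x" shows "sm (\<lambda>x. p x powr a)"
proof -
  define H where "H k t = (\<Prod>j<k. a - real j) * t powr (a - real k)" for k t
  have "(H k has_real_derivative H (Suc k) t) (at t)" if "t \<in> {0<..}" for k t
    using that unfolding H_def
    by (auto intro!: derivative_eq_intros simp: algebra_simps)
  from sm_comp[where S="{0<..}" and H=H, OF this _ assms(1)] assms(2)
  show ?thesis by (simp add: H_def)
qed

lemma sm_inverse: assumes "sm p" "\<And>x. 0 < p x" shows "sm (\<lambda>x. inverse (p x))"
proof -
  have "(\<lambda>x. inverse (p x)) = (\<lambda>x. p x powr (-1))"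
    using assms(2) by (auto simp: powr_minus less_imp_le)
  then show ?thesis using sm_powr[OF assms, of "-1"] by metis
qed

lemma sm_divide: assumes "sm q" "sm p" "\<And>x. 0 < p x" shows "sm (\<lambda>x. q x / p x)"
  using sm_mult[OF assms(1) sm_inverse[OF assms(2,3)]] by (simp add: field_simps)

lemma sm_sqrt: assumes "sm p" "\<And>x. 0 < p x" shows "sm (\<lambda>x. sqrt (p x))"
proof -
  have "(\<lambda>x. sqrt (p x)) = (\<lambda>x. p x powr (1/2))" using assms(2) by (auto simp: powr_half_sqrt less_imp_le)
  then show ?thesis using sm_powr[OF assms, of "1/2"] by metis
qed

lemma rpd_ln: assumes "sm p" "\<And>x. 0 < p x" shows "rpd i (\<lambda>x. ln (p x)) x = rpd i p x / p x"
  using rpd_chain(2)[OF DERIV_ln[OF assms(2)] sm_diff[OF assms(1)]] by (simp add: field_simps)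

lemma sm_ln: assumes "sm p" "\<And>x. 0 < p x" shows "sm (\<lambda>x. ln (p x))"
proof (rule smI)
  show "(\<lambda>x. ln (p x)) differentiable (at x)" for x
    using rpd_chain(1)[OF DERIV_ln[OF assms(2)] sm_diff[OF assms(1)]] .
  have "rpd i (\<lambda>x. ln (p x)) = (\<lambda>x. rpd i p x / p x)" for i using rpd_ln[OF assms] by auto
  then show "sm (rpd i (\<lambda>x. ln (p x)))" for i using sm_divide[OF sm_rpd[OF assms(1)] assms] by simp
qed

lemma sm_cos_sin: assumes "sm p" shows "sm (\<lambda>x. cos (p x))" "sm (\<lambda>x. sin (p x))"
proof -
  \<comment> \<open>Shifting by quarter periods puts all derivatives into one family; the offset
    \<open>a\<close> lets the same family serve for the sine, with
    \<open>a = - pi / 2\<close>.\<close>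
  have D: "((\<lambda>t. cos (t + real k * pi / 2 + a)) has_real_derivative cos (t + real (Suc k) * pi / 2 + a)) (at t)" for k t a
  proof -
    have e: "cos (t + real (Suc k) * pi / 2 + a) = - sin (t + real k * pi / 2 + a)"
      using cos_add[of "t + real k * pi / 2 + a" "pi/2"] by (simp add: field_simps)
    show ?thesis unfolding e by (auto intro!: derivative_eq_intros)
  qed
  from sm_comp[where S=UNIV and H="\<lambda>k t. cos (t + real k * pi / 2 + 0)", OF D _ assms]
  show "sm (\<lambda>x. cos (p x))" by simp
  have "cos (t + - pi / 2) = sin t" for t :: real using cos_add[of t "-pi/2"] by simp
  with sm_comp[where S=UNIV and H="\<lambda>k t. cos (t + real k * pi / 2 + - pi / 2)", OF D _ assms]
  show "sm (\<lambda>x. sin (p x))" by simp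
qed

section \<open>Affine changes of variable and coordinate functions\<close>

lemma rpd_affine:
  assumes "f differentiable (at (c *\<^sub>R x + a))"
  shows "(\<lambda>x. f (c *\<^sub>R x + a)) differentiable (at x)"
        "rpd i (\<lambda>x. f (c *\<^sub>R x + a)) x = c * rpd i f (c *\<^sub>R x + a)"
proof -
  have l: "((\<lambda>x. c *\<^sub>R x + a) has_derivative (\<lambda>v. c *\<^sub>R v)) (at x)"
    by (auto intro!: derivative_eq_intros)
  have D: "(f has_derivative frechet_derivative f (at (c *\<^sub>R x + a))) (at (c *\<^sub>R x + a))"
    using assms unfolding frechet_derivative_works .
  have a: "((\<lambda>x. f (c *\<^sub>R x + a)) has_derivative (\<lambda>v. frechet_derivative f (at (c *\<^sub>R x + a)) (c *\<^sub>R v))) (at x)"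
    using has_derivative_compose[OF l D] by simp
  show "(\<lambda>x. f (c *\<^sub>R x + a)) differentiable (at x)" using a by (auto simp: differentiable_def)
  show "rpd i (\<lambda>x. f (c *\<^sub>R x + a)) x = c * rpd i f (c *\<^sub>R x + a)"
    using rpd_eqI[OF a] linear_scale[OF has_derivative_linear[OF D]] by (simp add: rpd_def)
qed

lemma dp_affine:
  assumes "sm f" shows "dp is (\<lambda>x. f (c *\<^sub>R x + a)) = (\<lambda>x. c ^ length is * dp is f (c *\<^sub>R x + a))"
proof (induction "is")
  case (Cons i "is")
  have "rpd i (\<lambda>x. c ^ length is * dp is f (c *\<^sub>R x + a)) x = c ^ length is * (c * rpd i (dp is f) (c *\<^sub>R x + a))" for x
    using rpd_mult[OF differentiable_const rpd_affine(1)[OF sm_diff[OF sm_dp[OF assms]]]]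
      rpd_affine(2)[OF sm_diff[OF sm_dp[OF assms]]] by simp
  then show ?case by (simp only: dp.simps Cons) (auto simp: algebra_simps)
qed simp

lemma sm_affine: "sm f \<Longrightarrow> sm (\<lambda>x. f (c *\<^sub>R x + a))"
  unfolding sm_def[of "\<lambda>x. f (c *\<^sub>R x + a)"]
  by (simp only: dp_affine) (intro allI differentiable_mult differentiable_const rpd_affine(1) sm_diff[OF sm_dp])

lemma sm_translate: "sm f \<Longrightarrow> sm (\<lambda>x. f (x - a))" "sm f \<Longrightarrow> sm (\<lambda>x. f (a - x))"
  "sm f \<Longrightarrow> sm (\<lambda>x. f (x + a))"
  using sm_affine[of f 1 "-a"] sm_affine[of f "-1" a] sm_affine[of f 1 a] by auto

lemma rpd_translate:
  "sm f \<Longrightarrow> rpd i (\<lambda>x. f (x - a)) x = rpd i f (x - a)"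
  "sm f \<Longrightarrow> rpd i (\<lambda>x. f (a - x)) x = - rpd i f (a - x)"
  "sm f \<Longrightarrow> rpd i (\<lambda>x. f (x + a)) x = rpd i f (x + a)"
  using rpd_affine(2)[of f 1 x "-a" i] rpd_affine(2)[of f "-1" x a i] rpd_affine(2)[of f 1 x a i]
   sm_diff[of f] by auto

lemma sm_has_derivative:
  assumes "sm f" shows "(f has_derivative (\<lambda>h. \<Sum>j\<in>UNIV. rpd j f x * h $ j)) (at x)"
proof -
  have D: "(f has_derivative frechet_derivative f (at x)) (at x)"
    using sm_diff[OF assms] unfolding frechet_derivative_works .
  have L: "linear (frechet_derivative f (at x))" by (rule has_derivative_linear[OF D])
  have "frechet_derivative f (at x) h = (\<Sum>j\<in>UNIV. rpd j f x * h $ j)" for h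
  proof -
    have "frechet_derivative f (at x) h = frechet_derivative f (at x) (\<Sum>j\<in>UNIV. h $ j *\<^sub>R axis j 1)"
      by (subst basis_expansion[of h, symmetric]) (simp add: scalar_mult_eq_scaleR)
    also have "\<dots> = (\<Sum>j\<in>UNIV. h $ j * frechet_derivative f (at x) (axis j 1))"
      using L by (simp add: linear_sum linear_scale)
    finally show ?thesis by (simp add: rpd_def mult.commute)
  qed
  then show ?thesis using D by presburger
qed

lemma rpd_component: "rpd i (\<lambda>x. x $ j) x = (if i = j then 1 else 0)"
  by (subst rpd_eqI[where f'="\<lambda>v. v $ j"]) (auto intro!: bounded_linear_imp_has_derivative bounded_linear_vec_nth simp: axis_def)

lemma sm_component: "sm (\<lambda>x. x $ j)"
proof (rule smI)
  have "((\<lambda>x. x $ j) has_derivative (\<lambda>v. v $ j)) (at x)" for x :: "real^'a"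
    by (rule bounded_linear_imp_has_derivative[OF bounded_linear_vec_nth])
  then show "(\<lambda>x. x $ j) differentiable (at x)" for x :: "real^'a" unfolding differentiable_def by blast
  have "rpd i (\<lambda>x. x $ j) = (\<lambda>x. if i = j then 1 else 0)" for i :: 'a by (auto simp: rpd_component)
  then show "sm (rpd i (\<lambda>x. x $ j))" for i :: 'a by (simp add: sm_const)
qed

lemma norm_sq_vec: "(norm (x::real^'d::finite))^2 = (\<Sum>j\<in>UNIV. (x $ j)^2)"
  unfolding power2_norm_eq_inner inner_vec_def by (simp add: power2_eq_square)

lemma sm_norm_sq: "sm (\<lambda>x. (norm x)^2)"
  unfolding norm_sq_vec by (intro sm_sum sm_power sm_component)

lemma rpd_norm_sq: "rpd i (\<lambda>x. (norm x)^2) x = 2 * x $ i"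
proof -
  have "((\<lambda>x. (norm x)^2) has_derivative (\<lambda>v. 2 * (x \<bullet> v))) (at x)"
    unfolding power2_norm_eq_inner by (auto intro!: derivative_eq_intros simp: inner_commute)
  from rpd_eqI[OF this] show ?thesis by (simp add: inner_axis)
qed

text \<open>The classical flat function is the case \<open>k = 0\<close>; the extra power of
  \<open>inverse t\<close> makes the family closed under differentiation up to linear
  combinations.\<close>

definition flat_exp :: "nat \<Rightarrow> real \<Rightarrow> real" where
  "flat_exp k t = (if t \<le> 0 then 0 else exp (- inverse t) * inverse t ^ k)"

lemma flat_exp_tendsto: "((\<lambda>t. exp (- inverse t) * inverse t ^ k) \<longlongrightarrow> 0) (at_right (0::real))"
proof -
  have "((\<lambda>t. t ^ k / exp t) \<longlongrightarrow> 0) (at_top :: real filter)" by (rule tendsto_power_div_exp_0)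
  from filterlim_compose[OF this filterlim_inverse_at_top_right]
  show ?thesis by (simp add: exp_minus field_simps)
qed

lemma flat_exp_deriv: "(flat_exp k has_real_derivative flat_exp (k+2) t - real k * flat_exp (k+1) t) (at t)"
proof -
  consider "t < 0" | "t = 0" | "t > 0" by linarith
  then show ?thesis
  proof cases
    case 1
    have "((\<lambda>t. 0) has_real_derivative 0) (at t)" by simp
    then have "(flat_exp k has_real_derivative 0) (at t)"
      by (rule has_field_derivative_transform_within_open[where S="{..<0}"]) (use 1 in \<open>auto simp: flat_exp_def\<close>)
    then show ?thesis using 1 by (simp add: flat_exp_def)
  next
    case 3
    have "((\<lambda>t. exp (- inverse t) * inverse t ^ k) has_real_derivative flat_exp (k+2) t - real k * flat_exp (k+1) t) (at t)"
    proof (cases k)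
      case 0 then show ?thesis using 3
        by (auto intro!: derivative_eq_intros simp: flat_exp_def power2_eq_square)
    next
      case (Suc n)
      have "((\<lambda>t. inverse t ^ k) has_real_derivative real k * (inverse t ^ n * - (inverse t ^ 2))) (at t)"
        unfolding Suc using 3 DERIV_power_Suc[of inverse "- (inverse t ^ 2)" t UNIV n] DERIV_inverse[of t UNIV]
        by (simp add: power2_eq_square mult_ac)
      moreover have "((\<lambda>t. exp (- inverse t)) has_real_derivative exp (- inverse t) * inverse t ^ 2) (at t)"
        using 3 by (auto intro!: derivative_eq_intros simp: power2_eq_square)
      ultimately have "((\<lambda>t. exp (- inverse t) * inverse t ^ k) has_real_derivative
          exp (- inverse t) * (real k * (inverse t ^ n * - (inverse t ^ 2))) + exp (- inverse t) * inverse t ^ 2 * inverse t ^ k) (at t)"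
        using DERIV_mult' by blast
      then show ?thesis using 3 Suc by (simp add: flat_exp_def algebra_simps power2_eq_square)
    qed
    then show ?thesis
      by (rule has_field_derivative_transform_within_open[where S="{0<..}"]) (use 3 in \<open>auto simp: flat_exp_def\<close>)
  next
    case 2
    have L: "((\<lambda>h. flat_exp k h / h) \<longlongrightarrow> 0) (at_left 0)"
      by (rule tendsto_eventually, rule eventually_at_leftI[of "-1"]) (auto simp: flat_exp_def)
    have R: "((\<lambda>h. flat_exp k h / h) \<longlongrightarrow> 0) (at_right 0)"
      \<comment> \<open>For positive h the difference quotient of \<open>flat_exp k\<close> at 0 is
        \<open>flat_exp (Suc k) h\<close>, which tends to 0.\<close>
      by (rule Lim_transform_eventually[OF flat_exp_tendsto[of "Suc k"]])
        (rule eventually_at_rightI[of 0 1], auto simp: flat_exp_def field_simps)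
    have "((\<lambda>h. flat_exp k h / h) \<longlongrightarrow> 0) (at 0)" using L R by (simp add: filterlim_split_at)
    then show ?thesis using 2 by (simp add: DERIV_def flat_exp_def)
  qed
qed

text \<open>The derivative of \<open>flat_exp k\<close> involves two members of the family, so
  \<open>smn_comp\<close> does not apply; the induction is done for the whole family
  instead.\<close>

lemma smn_flat_exp: "sm p \<Longrightarrow> smn n (\<lambda>x. flat_exp k (p x))"
proof (induction n arbitrary: k)
  case 0 then show ?case using rpd_chain(1)[where p=p, OF flat_exp_deriv] sm_diff[of p] unfolding smn_0 by blast
next
  case (Suc n)
  have "rpd i (\<lambda>x. flat_exp k (p x)) = (\<lambda>x. (flat_exp (k+2) (p x) + (- real k) * flat_exp (k+1) (p x)) * rpd i p x)" for i
    using rpd_chain(2)[OF flat_exp_deriv sm_diff[OF Suc.prems]] by auto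
  moreover have "smn n (rpd i p)" for i using sm_rpd[OF Suc.prems] sm_iff_smn by blast
  moreover have "smn n (\<lambda>x. (flat_exp (k+2) (p x) + (- real k) * flat_exp (k+1) (p x)) * rpd i p x)" for i
    by (intro smn_mult smn_add smn_const Suc.IH[OF Suc.prems] \<open>smn n (rpd i p)\<close>)
  ultimately show ?case using rpd_chain(1)[where p=p, OF flat_exp_deriv sm_diff[OF Suc.prems]]
    unfolding smn_Suc by presburger
qed

lemma sm_flat_exp: "sm p \<Longrightarrow> sm (\<lambda>x. flat_exp k (p x))"
  by (simp add: sm_iff_smn[of "\<lambda>x. flat_exp k (p x)"] smn_flat_exp)

text \<open>\<open>vanish R f\<close> is strict in \<open>R < norm x\<close> so that it passes to derivatives.\<close>

definition vanish :: "real \<Rightarrow> (real^'d::finite \<Rightarrow> real) \<Rightarrow> bool" where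
  "vanish R f \<longleftrightarrow> (\<forall>x. R < norm x \<longrightarrow> f x = 0)"

definition rtest :: "(real^'d::finite \<Rightarrow> real) \<Rightarrow> bool" where
  "rtest f \<longleftrightarrow> sm f \<and> (\<exists>R. vanish R f)"

section \<open>Real test functions\<close>

lemma vanish_mono: "vanish R f \<Longrightarrow> R \<le> R' \<Longrightarrow> vanish R' f" by (auto simp: vanish_def)

lemma vanish_rpd: assumes "vanish R f" shows "vanish R (rpd i f)"
  unfolding vanish_def
proof (intro allI impI)
  fix x :: "real^'a" assume x: "R < norm x"
  have "((\<lambda>x. 0) has_derivative (\<lambda>x. 0)) (at x)" by simp
  then have "(f has_derivative (\<lambda>x. 0)) (at x)"
    by (rule has_derivative_transform_within_open[where s="{x. R < norm x}"])
      (use assms x in \<open>auto simp: vanish_def open_Collect_less continuous_on_norm continuous_on_const continuous_on_id\<close>)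
  from rpd_eqI[OF this] show "rpd i f x = 0" by simp
qed

lemma vanish_dp: "vanish R f \<Longrightarrow> vanish R (dp is f)"
  by (induction "is") (auto intro: vanish_rpd)

lemma rtestE: assumes "rtest f" obtains R where "R > 0" "vanish R f" "sm f"
proof -
  obtain R where "vanish R f" "sm f" using assms by (auto simp: rtest_def)
  then show ?thesis using that[of "max R 1"] vanish_mono[of R f "max R 1"] by auto
qed

lemma rtest_sm: "rtest f \<Longrightarrow> sm f" by (simp add: rtest_def)
lemma rtest_rpd: "rtest f \<Longrightarrow> rtest (rpd i f)" using vanish_rpd sm_rpd by (auto simp: rtest_def)
lemma rtest_dp: "rtest f \<Longrightarrow> rtest (dp is f)" using vanish_dp sm_dp by (auto simp: rtest_def)
lemma rtest_mult1: "rtest f \<Longrightarrow> sm g \<Longrightarrow> rtest (\<lambda>x. f x * g x)"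
  unfolding rtest_def vanish_def using sm_mult[of f g] by auto
lemma rtest_mult2: "sm f \<Longrightarrow> rtest g \<Longrightarrow> rtest (\<lambda>x. f x * g x)"
  unfolding rtest_def vanish_def using sm_mult[of f g] by auto
lemma rtest_zero: "rtest (\<lambda>x. 0)" by (auto simp: rtest_def sm_const vanish_def)
lemma vanish_add: "vanish R f \<Longrightarrow> vanish S g \<Longrightarrow> vanish (max R S) (\<lambda>x. f x + g x)"
  by (auto simp: vanish_def)
lemma rtest_add: "rtest f \<Longrightarrow> rtest g \<Longrightarrow> rtest (\<lambda>x. f x + g x)"
  unfolding rtest_def using sm_add[of f g] vanish_add by blast
lemma rtest_cmult: "rtest f \<Longrightarrow> rtest (\<lambda>x. c * f x)" by (rule rtest_mult2[OF sm_const])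
lemma rtest_minus: "rtest f \<Longrightarrow> rtest (\<lambda>x. - f x)" using rtest_cmult[of f "-1"] by simp
lemma rtest_sub: "rtest f \<Longrightarrow> rtest g \<Longrightarrow> rtest (\<lambda>x. f x - g x)"
  using rtest_add[OF _ rtest_minus, of f g] by simp
lemma rtest_sum: "(\<And>i. i \<in> I \<Longrightarrow> rtest (f i)) \<Longrightarrow> rtest (\<lambda>x. \<Sum>i\<in>I. f i x)"
  by (induction I rule: infinite_finite_induct) (auto intro: rtest_zero rtest_add)
lemma rtest_power2: "rtest f \<Longrightarrow> rtest (\<lambda>x. (f x)^2)"
  unfolding power2_eq_square by (rule rtest_mult1[OF _ rtest_sm])

lemma rtest_affine:
  assumes "rtest f" "c \<noteq> 0" shows "rtest (\<lambda>x. f (c *\<^sub>R x + a))"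
proof -
  obtain R where R: "vanish R f" "sm f" using assms by (auto simp: rtest_def)
  have "f (c *\<^sub>R x + a) = 0" if "(R + norm a) / \<bar>c\<bar> < norm x" for x
  proof -
    have "R + norm a < norm (c *\<^sub>R x)" using that assms(2) by (simp add: field_simps)
    also have "\<dots> \<le> norm (c *\<^sub>R x + a) + norm a" using norm_triangle_ineq4[of "c *\<^sub>R x + a" a] by simp
    finally show ?thesis using R by (auto simp: vanish_def)
  qed
  then show ?thesis using R sm_affine unfolding rtest_def vanish_def by blast
qed

lemma rtest_translate: "rtest f \<Longrightarrow> rtest (\<lambda>x. f (x - a))" "rtest f \<Longrightarrow> rtest (\<lambda>x. f (a - x))"
  "rtest f \<Longrightarrow> rtest (\<lambda>x. f (x + a))"
  using rtest_affine[of f 1 "-a"] rtest_affine[of f "-1" a] rtest_affine[of f 1 a] by auto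

lemma rtest_dp_bounded:
  assumes "continuous_on UNIV f" "vanish R f" obtains M where "M > 0" "\<And>x. \<bar>f x\<bar> \<le> M"
proof -
  have "compact (f ` cball 0 R)" using assms(1) by (intro compact_continuous_image) (auto intro: continuous_on_subset)
  then obtain M where "\<forall>y\<in>f ` cball 0 R. norm y \<le> M" by (meson bounded_iff compact_imp_bounded)
  then have "\<bar>f x\<bar> \<le> max M 1" for x
    using assms(2) by (cases "norm x \<le> R") (force simp: vanish_def)+
  then show ?thesis using that[of "max M 1"] by auto
qed

lemma rtest_bounded: assumes "rtest f" obtains M where "M > 0" "\<And>x. \<bar>f x\<bar> \<le> M"
  using assms rtest_dp_bounded[of f] sm_cont by (metis rtest_def)

text \<open>The numerator lives in the ball of radius 2 and the second summand of the denominator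
  outside the unit ball, so the quotient is 1 on the unit ball and 0 beyond radius 2. The squared
  norm keeps it smooth at the origin.\<close>

definition cutoff :: "real^'d::finite \<Rightarrow> real" where
  "cutoff x = flat_exp 0 (4 - (norm x)\<^sup>2) / (flat_exp 0 (4 - (norm x)\<^sup>2) + flat_exp 0 ((norm x)^2 - 1))"

lemma flat_exp_nonneg: "0 \<le> flat_exp k t" by (auto simp: flat_exp_def)
lemma flat_exp_pos: "0 < t \<Longrightarrow> 0 < flat_exp k t" by (auto simp: flat_exp_def)

lemma cutoff_denom: "0 < flat_exp 0 (4 - t) + flat_exp 0 (t - 1)"
  using flat_exp_nonneg[of 0 "4-t"] flat_exp_nonneg[of 0 "t-1"] flat_exp_pos[of "4-t" 0] flat_exp_pos[of "t-1" 0]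
  by (cases "t < 4") (auto simp: add_pos_nonneg add_nonneg_pos)

lemma sm_cutoff: "sm cutoff"
  unfolding cutoff_def[abs_def]
  by (intro sm_divide sm_add sm_flat_exp sm_sub sm_const sm_norm_sq cutoff_denom)

lemma cutoff_range: "0 \<le> cutoff x" "cutoff x \<le> 1"
  unfolding cutoff_def using cutoff_denom[of "(norm x)^2"] flat_exp_nonneg[of 0 "4 - (norm x)\<^sup>2"] flat_exp_nonneg[of 0 "(norm x)^2 - 1"]
  by (auto simp: divide_simps)

lemma cutoff_one: assumes "norm x \<le> 1" shows "cutoff x = 1"
proof -
  have "(norm x)^2 \<le> 1" using assms by (simp add: power_le_one)
  then have "flat_exp 0 ((norm x)^2 - 1) = 0" "flat_exp 0 (4 - (norm x)\<^sup>2) > 0" by (auto simp: flat_exp_def)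
  then show ?thesis by (simp add: cutoff_def)
qed

lemma cutoff_zero: assumes "2 \<le> norm x" shows "cutoff x = 0"
proof -
  have "(norm x)^2 \<ge> 4" using power_mono[OF assms, of 2] by simp
  then show ?thesis by (simp add: cutoff_def flat_exp_def)
qed

lemma rtest_cutoff: "rtest cutoff" unfolding rtest_def vanish_def using sm_cutoff by (auto intro!: exI[of _ 2] cutoff_zero)

section \<open>Integration by parts, convolution and the Dirichlet form\<close>

lemma sm_borel: "sm f \<Longrightarrow> f \<in> borel_measurable borel"
  by (rule borel_measurable_continuous_onI) (rule sm_cont)

lemma cont_vanish_integrable:
  fixes f :: "real^'d::finite \<Rightarrow> real"
  assumes "continuous_on UNIV f" "vanish R f" shows "integrable lborel f"
proof -
  have "integrable lborel (\<lambda>x. indicator (cball 0 R) x *\<^sub>R f x)"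
    using assms(1) by (intro borel_integrable_compact) (auto intro: continuous_on_subset)
  moreover have "(\<lambda>x. indicator (cball 0 R) x *\<^sub>R f x) = f"
    using assms(2) by (auto simp: vanish_def indicator_def fun_eq_iff)
  ultimately show ?thesis by simp
qed

lemma rtest_integrable: "rtest f \<Longrightarrow> integrable lborel f"
  using cont_vanish_integrable sm_cont unfolding rtest_def by blast

lemma integral_affine:
  fixes f :: "real^'d::finite \<Rightarrow> real"
  assumes [measurable]: "f \<in> borel_measurable borel" and "c \<noteq> 0"
  shows "integral\<^sup>L lborel f = \<bar>c\<bar> ^ CARD('d) * (LBINT x. f (a + c *\<^sub>R x))"
  by (subst lborel_affine[OF assms(2), of a]) (simp add: integral_density integral_distr)

lemma nn_integral_affine:
  fixes f :: "real^'d::finite \<Rightarrow> ennreal"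
  assumes [measurable]: "f \<in> borel_measurable borel" and "c \<noteq> 0"
  shows "(LBNN x. f x) = ennreal (\<bar>c\<bar> ^ CARD('d)) * (LBNN x. f (a + c *\<^sub>R x))"
  by (subst lborel_affine[OF assms(2), of a]) (simp add: nn_integral_density nn_integral_distr nn_integral_cmult)

lemma integral_shift:
  fixes f :: "real^'d::finite \<Rightarrow> real"
  assumes "f \<in> borel_measurable borel"
  shows "(LBINT x. f (x + a)) = integral\<^sup>L lborel f" "(LBINT x. f (x - a)) = integral\<^sup>L lborel f"
    "(LBINT x. f (a - x)) = integral\<^sup>L lborel f"
  using integral_affine[OF assms, of 1 a] integral_affine[OF assms, of 1 "-a"] integral_affine[OF assms, of "-1" a]
  by (auto simp: add.commute)

lemma nn_integral_shift:
  fixes f :: "real^'d::finite \<Rightarrow> ennreal"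
  assumes "f \<in> borel_measurable borel"
  shows "(LBNN x. f (x - a)) = (LBNN x. f x)"
    "(LBNN x. f (a - x)) = (LBNN x. f x)" "(LBNN x. f (x + a)) = (LBNN x. f x)"
  using nn_integral_affine[OF assms, of 1 "-a"] nn_integral_affine[OF assms, of "-1" a] nn_integral_affine[OF assms, of 1 a]
  by (auto simp: add.commute)

section \<open>Lipschitz and Taylor bounds, integration by parts\<close>

lemma directional_deriv:
  assumes "sm f"
  shows "((\<lambda>t. f (x + t *\<^sub>R v)) has_real_derivative (\<Sum>j\<in>UNIV. rpd j f (x + t *\<^sub>R v) * v $ j)) (at t)"
proof -
  have l: "((\<lambda>t. x + t *\<^sub>R v) has_derivative (\<lambda>s. s *\<^sub>R v)) (at t)" by (auto intro!: derivative_eq_intros)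
  have "((\<lambda>t. f (x + t *\<^sub>R v)) has_derivative (\<lambda>s. \<Sum>j\<in>UNIV. rpd j f (x + t *\<^sub>R v) * (s *\<^sub>R v) $ j)) (at t)"
    by (rule has_derivative_compose[OF l sm_has_derivative[OF assms]])
  then show ?thesis unfolding has_field_derivative_def
    by (rule has_derivative_eq_rhs) (auto simp: fun_eq_iff sum_distrib_left sum_distrib_right mult_ac)
qed

lemma lin_form_bound: "\<bar>\<Sum>j\<in>UNIV. c j * (h::real^'d::finite) $ j\<bar> \<le> (\<Sum>j\<in>UNIV. \<bar>c j\<bar>) * norm h"
proof -
  have "\<bar>\<Sum>j\<in>UNIV. c j * h $ j\<bar> \<le> (\<Sum>j\<in>UNIV. \<bar>c j * h $ j\<bar>)" by (rule sum_abs)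
  also have "\<dots> \<le> (\<Sum>j\<in>UNIV. \<bar>c j\<bar> * norm h)"
    by (intro sum_mono) (auto simp: abs_mult intro!: mult_left_mono component_le_norm_cart)
  finally show ?thesis by (simp add: sum_distrib_right)
qed

lemma rtest_lipschitz:
  fixes f :: "real^'d::finite \<Rightarrow> real"
  assumes "rtest f" obtains L where "L > 0" "\<And>x y. \<bar>f x - f y\<bar> \<le> L * norm (x - y)"
proof -
  have "\<forall>j. \<exists>M. \<forall>x. \<bar>rpd j f x\<bar> \<le> M" using rtest_bounded[OF rtest_rpd[OF assms]] by metis
  then obtain M where M: "\<And>j x. \<bar>rpd j f x\<bar> \<le> M j" by metis
  let ?B = "(\<Sum>j\<in>UNIV. M j)"
  have B: "?B \<ge> 0" by (intro sum_nonneg) (use M in \<open>auto intro: order_trans[OF abs_ge_zero]\<close>)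
  have "\<bar>f x - f y\<bar> \<le> ?B * norm (x - y)" for x y
  proof -
    have "norm (f x - f y) \<le> ?B * norm (x - y)"
    proof (rule differentiable_bound[where S=UNIV])
      show "(f has_derivative (\<lambda>h. \<Sum>j\<in>UNIV. rpd j f x * h $ j)) (at x within UNIV)" for x
        using sm_has_derivative[OF rtest_sm[OF assms]] by simp
      show "onorm (\<lambda>h. \<Sum>j\<in>UNIV. rpd j f x * h $ j) \<le> ?B" for x
      proof (rule onorm_le)
        fix h
        have "\<bar>\<Sum>j\<in>UNIV. rpd j f x * h $ j\<bar> \<le> (\<Sum>j\<in>UNIV. \<bar>rpd j f x\<bar>) * norm h" by (rule lin_form_bound)
        also have "\<dots> \<le> ?B * norm h" by (intro mult_right_mono sum_mono M) auto
        finally show "norm (\<Sum>j\<in>UNIV. rpd j f x * h $ j) \<le> ?B * norm h" by simp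
      qed
    qed auto
    then show ?thesis by simp
  qed
  then show ?thesis using that[of "?B + 1"] B
    by (smt (verit, best) mult_right_mono norm_ge_zero)
qed

text \<open>Since the gradient is Lipschitz, \<open>f\<close> minus its linear part at x has
  derivative of size O(\<open>norm h\<close>) on the ball of radius \<open>norm h\<close>.
  Uniformity in x is what allows differentiation under the integral in
  \<open>conv_has_derivative\<close>.\<close>

lemma rtest_taylor:
  fixes f :: "real^'d::finite \<Rightarrow> real"
  assumes "rtest f"
  obtains M where "M > 0" "\<And>x h. \<bar>f (x + h) - f x - (\<Sum>j\<in>UNIV. rpd j f x * h $ j)\<bar> \<le> M * (norm h)^2"
proof -
  have "\<forall>j. \<exists>M. M > 0 \<and> (\<forall>x y. \<bar>rpd j f x - rpd j f y\<bar> \<le> M * norm (x - y))"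
    using rtest_lipschitz[OF rtest_rpd[OF assms]] by metis
  then obtain M where M: "\<And>j. M j > 0" "\<And>j x y. \<bar>rpd j f x - rpd j f y\<bar> \<le> M j * norm (x - y)" by metis
  let ?B = "(\<Sum>j\<in>UNIV. M j)"
  have B: "?B > 0" using M(1) by (intro sum_pos) auto
  have "\<bar>f (x + h) - f x - (\<Sum>j\<in>UNIV. rpd j f x * h $ j)\<bar> \<le> ?B * (norm h)^2" for x h
  proof -
    let ?F = "\<lambda>y. f y - (\<Sum>j\<in>UNIV. rpd j f x * y $ j)"
    have "norm (?F (x + h) - ?F x) \<le> (?B * norm h) * norm ((x + h) - x)"
    proof (rule differentiable_bound[where S="cball x (norm h)"])
      show "(?F has_derivative (\<lambda>k. (\<Sum>j\<in>UNIV. rpd j f z * k $ j) - (\<Sum>j\<in>UNIV. rpd j f x * k $ j))) (at z within cball x (norm h))" for z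
        by (intro has_derivative_diff has_derivative_at_withinI[OF sm_has_derivative[OF rtest_sm[OF assms]]]
            has_derivative_sum has_derivative_mult_right bounded_linear_imp_has_derivative bounded_linear_vec_nth)
      show "onorm (\<lambda>k. (\<Sum>j\<in>UNIV. rpd j f z * k $ j) - (\<Sum>j\<in>UNIV. rpd j f x * k $ j)) \<le> ?B * norm h"
        if "z \<in> cball x (norm h)" for z
      proof (rule onorm_le)
        fix k
        have z: "norm (z - x) \<le> norm h" using that by (simp add: dist_norm norm_minus_commute)
        have "\<bar>\<Sum>j\<in>UNIV. (rpd j f z - rpd j f x) * k $ j\<bar> \<le> (\<Sum>j\<in>UNIV. \<bar>rpd j f z - rpd j f x\<bar>) * norm k" by (rule lin_form_bound)
        also have "\<dots> \<le> (\<Sum>j\<in>UNIV. M j * norm h) * norm k"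
          by (intro mult_right_mono sum_mono order_trans[OF M(2)] mult_left_mono z) (auto intro: less_imp_le M)
        finally show "norm ((\<Sum>j\<in>UNIV. rpd j f z * k $ j) - (\<Sum>j\<in>UNIV. rpd j f x * k $ j)) \<le> ?B * norm h * norm k"
          by (simp add: sum_subtractf[symmetric] sum_distrib_right left_diff_distrib)
      qed
    qed (auto simp: dist_norm)
    then show ?thesis by (simp add: power2_eq_square sum.distrib algebra_simps)
  qed
  then show ?thesis using that B by blast
qed

text \<open>Difference quotients integrate to 0 by translation invariance. They are dominated by the
  Lipschitz constant on a fixed ball, because the increments \<open>e n\<close> stay below
  1.\<close>

lemma integral_rpd_zero:
  fixes f :: "real^'d::finite \<Rightarrow> real"
  assumes "rtest f" shows "(LBINT x. rpd i f x) = 0"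
proof -
  obtain R where R: "vanish R f" "sm f" using assms by (auto simp: rtest_def)
  obtain L where L: "L > 0" "\<And>x y. \<bar>f x - f y\<bar> \<le> L * norm (x - y)" using rtest_lipschitz[OF assms] by metis
  note [measurable] = sm_borel[OF R(2)] sm_borel[OF sm_rpd[OF R(2)]]
  define e where "e n = inverse (real (Suc n))" for n
  have e: "e n > 0" "e n \<le> 1" for n by (auto simp: e_def field_simps)
  have elim: "e \<longlonglongrightarrow> 0" unfolding e_def by (rule LIMSEQ_inverse_real_of_nat)
  define g where "g n x = (f (x + e n *\<^sub>R axis i 1) - f x) / e n" for n x
  have "(\<lambda>n. integral\<^sup>L lborel (g n)) \<longlonglongrightarrow> (LBINT x. rpd i f x)"
  proof (rule integral_dominated_convergence[where w="\<lambda>x. L * indicator (cball 0 (R + 1)) x"])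
    show "integrable lborel (\<lambda>x. L * indicator (cball (0::real^'d) (R + 1)) x)"
      by (auto intro!: integrable_mult_right integrable_real_indicator simp: emeasure_lborel_cball_finite[unfolded infinity_ennreal_def])
    show "AE x in lborel. (\<lambda>n. g n x) \<longlonglongrightarrow> rpd i f x"
    proof (rule AE_I2)
      fix x
      have "((\<lambda>h. (f (x + (0 + h) *\<^sub>R axis i 1) - f (x + 0 *\<^sub>R axis i 1)) / h) \<longlongrightarrow> (\<Sum>j\<in>UNIV. rpd j f (x + 0 *\<^sub>R axis i 1) * axis i 1 $ j)) (at 0)"
        using directional_deriv[OF R(2), of x "axis i 1" 0] unfolding DERIV_def .
      moreover have "(\<Sum>j\<in>UNIV. rpd j f x * axis i 1 $ j) = rpd i f x" by (simp add: axis_def if_distrib cong: if_cong)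
      moreover have "filterlim e (at 0) sequentially" using elim e(1) by (auto simp: filterlim_at intro!: always_eventually less_imp_neq[symmetric])
      ultimately show "(\<lambda>n. g n x) \<longlonglongrightarrow> rpd i f x"
        unfolding g_def by (auto dest: filterlim_compose)
    qed
    show "AE x in lborel. norm (g n x) \<le> L * indicator (cball 0 (R + 1)) x" for n
    proof (rule AE_I2)
      fix x :: "real^'d"
      show "norm (g n x) \<le> L * indicator (cball 0 (R + 1)) x"
      proof (cases "norm x \<le> R + 1")
        case True
        then show ?thesis using L(2)[of "x + e n *\<^sub>R axis i 1" x] e[of n] by (simp add: g_def field_simps)
      next
        case False
        have "norm x \<le> norm (x + e n *\<^sub>R axis i 1) + e n" using norm_triangle_ineq4[of "x + e n *\<^sub>R axis i 1" "e n *\<^sub>R axis i 1"] e[of n] by simp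
        with False e[of n] have "R < norm (x + e n *\<^sub>R axis i 1)" "R < norm x" by linarith+
        then show ?thesis using R False by (simp add: g_def vanish_def)
      qed
    qed
    show "g n \<in> borel_measurable lborel" for n unfolding g_def by measurable
  qed measurable
  moreover have "integral\<^sup>L lborel (g n) = 0" for n
    unfolding g_def using integral_shift(1)[OF sm_borel[OF R(2)]] rtest_integrable[OF rtest_translate(3)[OF assms]] rtest_integrable[OF assms] by simp
  ultimately have "(\<lambda>n. 0::real) \<longlonglongrightarrow> (LBINT x. rpd i f x)" by simp
  then show ?thesis using LIMSEQ_unique tendsto_const by blast
qed

lemma integral_by_parts:
  assumes "sm f" "sm g" "rtest f \<or> rtest g"
  shows "(LBINT x. f x * rpd i g x) = - (LBINT x. rpd i f x * g x)"
proof -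
  have t: "rtest (\<lambda>x. f x * g x)" "rtest (\<lambda>x. rpd i f x * g x)" "rtest (\<lambda>x. f x * rpd i g x)"
    using assms rtest_mult1 rtest_mult2 sm_rpd rtest_rpd by blast+
  have "(\<lambda>x. rpd i f x * g x + f x * rpd i g x) = rpd i (\<lambda>x. f x * g x)"
    by (rule ext) (simp add: rpd_mult sm_diff assms)
  then have "(LBINT x. rpd i f x * g x + f x * rpd i g x) = 0" using integral_rpd_zero[OF t(1)] by simp
  then show ?thesis using t[THEN rtest_integrable] by simp
qed

section \<open>Convolution with locally integrable kernels\<close>

definition locint :: "(real^'d::finite \<Rightarrow> real) \<Rightarrow> bool" where
  "locint k \<longleftrightarrow> k \<in> borel_measurable borel \<and> (\<forall>R. integrable lborel (\<lambda>x. indicator (cball 0 R) x * k x))"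

definition conv :: "(real^'d::finite \<Rightarrow> real) \<Rightarrow> (real^'d \<Rightarrow> real) \<Rightarrow> real^'d \<Rightarrow> real" where
  "conv k f x = (LBINT y. k y * f (x - y))"

lemma locint_borel: "locint k \<Longrightarrow> k \<in> borel_measurable borel" by (simp add: locint_def)

lemma locint_cont: assumes "continuous_on UNIV k" shows "locint k"
  unfolding locint_def
proof (intro conjI allI)
  show "k \<in> borel_measurable borel" by (rule borel_measurable_continuous_onI[OF assms])
  have "integrable lborel (\<lambda>x. indicator (cball 0 R) x *\<^sub>R k x)" for R
    by (rule borel_integrable_compact[OF compact_cball continuous_on_subset[OF assms]]) simp
  then show "integrable lborel (\<lambda>x. indicator (cball 0 R) x * k x)" for R by simp
qed

lemma locint_mult_integrable:
  assumes "locint k" and [measurable]: "g \<in> borel_measurable borel" and "vanish R g" "\<And>x. \<bar>g x\<bar> \<le> M"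
  shows "integrable lborel (\<lambda>x. k x * g x)"
proof (rule Bochner_Integration.integrable_bound)
  note [measurable] = locint_borel[OF assms(1)]
  show "integrable lborel (\<lambda>x. M * (indicator (cball 0 R) x * k x))" using assms(1) by (simp add: locint_def)
  show "(\<lambda>x. k x * g x) \<in> borel_measurable lborel" by measurable
  show "AE x in lborel. norm (k x * g x) \<le> norm (M * (indicator (cball 0 R) x * k x))"
  proof (rule AE_I2)
    fix x
    show "norm (k x * g x) \<le> norm (M * (indicator (cball 0 R) x * k x))"
    proof (cases "norm x \<le> R")
      case True
      have "\<bar>k x * g x\<bar> \<le> \<bar>k x\<bar> * \<bar>M\<bar>" unfolding abs_mult
        using assms(4)[of x] by (intro mult_left_mono) auto
      then show ?thesis using True by (simp add: abs_mult mult.commute)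
    next
      case False then show ?thesis using assms(3) by (simp add: vanish_def)
    qed
  qed
qed

lemma integral_abs_le:
  fixes f g :: "'a \<Rightarrow> real"
  assumes "f \<in> borel_measurable M" "integrable M g" "\<And>x. \<bar>f x\<bar> \<le> g x"
  shows "integrable M f" "\<bar>integral\<^sup>L M f\<bar> \<le> integral\<^sup>L M g"
proof -
  show i: "integrable M f"
    by (rule Bochner_Integration.integrable_bound[OF assms(2,1)])
      (use assms(3) in \<open>auto intro!: AE_I2 intro: order_trans[OF _ abs_ge_self]\<close>)
  show "\<bar>integral\<^sup>L M f\<bar> \<le> integral\<^sup>L M g"
  proof -
    have "\<bar>integral\<^sup>L M f\<bar> \<le> (\<integral>x. \<bar>f x\<bar> \<partial>M)" by (rule integral_abs_bound)
    also have "\<dots> \<le> integral\<^sup>L M g" using assms(3) by (intro integral_mono integrable_abs i assms(2)) auto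
    finally show ?thesis .
  qed
qed

lemma locint_rtest_integrable: "locint k \<Longrightarrow> rtest g \<Longrightarrow> integrable lborel (\<lambda>x. k x * g x)"
proof -
  assume k: "locint k" and g: "rtest g"
  obtain R where R: "vanish R g" "sm g" using g by (auto simp: rtest_def)
  obtain M where M: "\<And>x. \<bar>g x\<bar> \<le> M" using rtest_bounded[OF g] by metis
  show ?thesis by (rule locint_mult_integrable[OF k sm_borel[OF R(2)] R(1) M])
qed

lemma conv_integrable: "locint k \<Longrightarrow> rtest f \<Longrightarrow> integrable lborel (\<lambda>y. k y * f (x - y))"
  using locint_rtest_integrable[OF _ rtest_translate(2)] .

lemma has_derivative_quadratic:
  fixes f :: "real^'d::finite \<Rightarrow> real"
  assumes "\<And>h. norm h \<le> 1 \<Longrightarrow> \<bar>f (x + h) - f x - (\<Sum>j\<in>UNIV. c j * h $ j)\<bar> \<le> B * (norm h)^2"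
  shows "(f has_derivative (\<lambda>h. \<Sum>j\<in>UNIV. c j * h $ j)) (at x)"
  unfolding has_derivative_at
proof
  show "bounded_linear (\<lambda>h. \<Sum>j\<in>UNIV. c j * h $ j)"
    by (intro bounded_linear_sum bounded_linear_mult_right[THEN bounded_linear_compose] bounded_linear_vec_nth)
  have B: "B \<ge> 0" using assms[of "axis undefined 1"] by (auto intro: order_trans[OF abs_ge_zero])
  have ev: "eventually (\<lambda>h. norm h \<le> 1) (at (0::real^'d))"
    unfolding eventually_at by (auto intro!: exI[of _ 1])
  have "((\<lambda>h::real^'d. B * norm h) \<longlongrightarrow> B * norm (0::real^'d)) (at 0)" by (intro tendsto_intros)
  then have l: "((\<lambda>h::real^'d. B * norm h) \<longlongrightarrow> 0) (at 0)" by simp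
  have "eventually (\<lambda>h. norm (norm (f (x + h) - f x - (\<Sum>j\<in>UNIV. c j * h $ j)) / norm h) \<le> B * norm h) (at 0)"
    using ev
  proof eventually_elim
    case (elim h)
    then show ?case using assms[of h] B by (cases "h = 0") (auto simp: field_simps power2_eq_square)
  qed
  then show "(\<lambda>h. norm (f (x + h) - f x - (\<Sum>j\<in>UNIV. c j * h $ j)) / norm h) \<midarrow>0\<rightarrow> 0"
    by (rule Lim_null_comparison[OF _ l])
qed

text \<open>The derivative falls on the test function, so the kernel needs no regularity. For
  \<open>norm h \<le> 1\<close> the Taylor remainder is supported in one ball, where the kernel has
  finite L1 norm \<open>A\<close>.\<close>

lemma conv_has_derivative:
  fixes f :: "real^'d::finite \<Rightarrow> real"
  assumes k: "locint k" and f: "rtest f"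
  shows "(conv k f has_derivative (\<lambda>h. \<Sum>j\<in>UNIV. conv k (rpd j f) x * h $ j)) (at x)"
proof -
  obtain R where R: "vanish R f" "sm f" "R > 0" using f rtestE by blast
  obtain M where M: "M > 0" "\<And>x h. \<bar>f (x + h) - f x - (\<Sum>j\<in>UNIV. rpd j f x * h $ j)\<bar> \<le> M * (norm h)^2"
    using rtest_taylor[OF f] by metis
  define A where "A = (LBINT y. indicator (cball 0 (R + 1 + norm x)) y * \<bar>k y\<bar>)"
  note [measurable] = locint_borel[OF k] sm_borel[OF R(2)] sm_borel[OF sm_rpd[OF R(2)]]
  have iA: "integrable lborel (\<lambda>y. indicator (cball 0 S) y * \<bar>k y\<bar>)" for S
    using k[unfolded locint_def, THEN conjunct2, rule_format, THEN integrable_abs, of S] by (simp add: abs_mult)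
  show ?thesis
  proof (rule has_derivative_quadratic[where B="M * A"])
    fix h :: "real^'d" assume h: "norm h \<le> 1"
    let ?r = "\<lambda>y. f (x + h - y) - f (x - y) - (\<Sum>j\<in>UNIV. rpd j f (x - y) * h $ j)"
    have int: "integrable lborel (\<lambda>y. k y * f (x + h - y))" "integrable lborel (\<lambda>y. k y * f (x - y))"
      "integrable lborel (\<lambda>y. k y * rpd j f (x - y))" for j
      using conv_integrable[OF k f] conv_integrable[OF k rtest_rpd[OF f]] by auto
    have "conv k f (x + h) - conv k f x - (\<Sum>j\<in>UNIV. conv k (rpd j f) x * h $ j)
       = (LBINT y. k y * f (x + h - y)) - (LBINT y. k y * f (x - y)) - (LBINT y. (\<Sum>j\<in>UNIV. k y * rpd j f (x - y) * h $ j))"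
      unfolding conv_def by (subst Bochner_Integration.integral_sum) (auto intro!: integrable_mult_left int)
    also have "\<dots> = (LBINT y. k y * f (x + h - y) - k y * f (x - y) - (\<Sum>j\<in>UNIV. k y * rpd j f (x - y) * h $ j))"
      by (subst Bochner_Integration.integral_diff Bochner_Integration.integral_diff; (intro Bochner_Integration.integrable_diff Bochner_Integration.integrable_sum integrable_mult_left int)?)+ simp
    also have "\<dots> = (LBINT y. k y * ?r y)"
      by (intro Bochner_Integration.integral_cong) (auto simp: algebra_simps sum_distrib_left)
    finally have e: "conv k f (x + h) - conv k f x - (\<Sum>j\<in>UNIV. conv k (rpd j f) x * h $ j) = (LBINT y. k y * ?r y)" .
    have "\<bar>LBINT y. k y * ?r y\<bar> \<le> (LBINT y. (M * (norm h)^2) * (indicator (cball 0 (R + 1 + norm x)) y * \<bar>k y\<bar>))"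
    proof (rule integral_abs_le)
      show "\<bar>k y * ?r y\<bar> \<le> M * (norm h)^2 * (indicator (cball 0 (R + 1 + norm x)) y * \<bar>k y\<bar>)" for y
      proof (cases "norm y \<le> R + 1 + norm x")
        case True
        have "\<bar>?r y\<bar> \<le> M * (norm h)^2" using M(2)[of "x - y" h] by (simp add: algebra_simps)
        then show ?thesis using True by (auto simp: abs_mult mult.commute intro!: mult_left_mono)
      next
        case False
        have "norm y \<le> norm (x - y) + norm x" "norm y \<le> norm (x + h - y) + norm x + norm h"
          using norm_triangle_ineq4[of x "x - y"] norm_triangle_ineq4[of "x + h" "x + h - y"] norm_triangle_ineq[of x h] by auto
        then have "R < norm (x - y)" "R < norm (x + h - y)" using False h by linarith+
        then have "?r y = 0" using R vanish_rpd[OF R(1)] by (simp add: vanish_def)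
        then show ?thesis using M(1) by simp
      qed
      show "integrable lborel (\<lambda>y. M * (norm h)^2 * (indicator (cball 0 (R + 1 + norm x)) y * \<bar>k y\<bar>))"
        using iA by simp
    qed measurable
    also have "\<dots> = M * A * (norm h)^2" by (simp add: A_def)
    finally show "\<bar>conv k f (x + h) - conv k f x - (\<Sum>j\<in>UNIV. conv k (rpd j f) x * h $ j)\<bar> \<le> M * A * (norm h)^2"
      using e by simp
  qed
qed

lemma rpd_conv: assumes "locint k" "rtest f" shows "rpd i (conv k f) = conv k (rpd i f)"
  using rpd_eqI[OF conv_has_derivative[OF assms], of i]
  by (auto simp: axis_def if_distrib cong: if_cong)

lemma dp_conv: "locint k \<Longrightarrow> rtest f \<Longrightarrow> dp is (conv k f) = conv k (dp is f)"
  by (induction "is") (auto simp: rpd_conv rtest_dp)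

lemma sm_conv: assumes "locint k" "rtest f" shows "sm (conv k f)"
  unfolding sm_def using conv_has_derivative[OF assms(1) rtest_dp[OF assms(2)]]
  by (auto simp: dp_conv[OF assms] differentiable_def)

lemma conv_commute:
  assumes [measurable]: "k \<in> borel_measurable borel" "f \<in> borel_measurable borel"
  shows "conv k f = conv f k"
proof
  fix x
  show "conv k f x = conv f k x"
    unfolding conv_def using integral_shift(3)[of "\<lambda>y. k y * f (x - y)" x] by (simp add: mult.commute)
qed

lemma vanish_conv: assumes "vanish R k" "vanish S f" shows "vanish (R + S) (conv k f)"
  unfolding vanish_def conv_def
proof (intro allI impI)
  fix x :: "real^'a" assume x: "R + S < norm x"
  have "k y * f (x - y) = 0" for y
  proof (cases "norm y \<le> R")
    case True
    then have "S < norm (x - y)" using x norm_triangle_ineq[of "x - y" y] by simp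
    then show ?thesis using assms by (simp add: vanish_def)
  qed (use assms in \<open>simp add: vanish_def\<close>)
  then have "(\<lambda>y. k y * f (x - y)) = (\<lambda>y. 0)" by blast
  then show "(LBINT y. k y * f (x - y)) = 0" by simp
qed

lemma rtest_conv: "continuous_on UNIV k \<Longrightarrow> vanish R k \<Longrightarrow> rtest f \<Longrightarrow> rtest (conv k f)"
  using sm_conv[OF locint_cont] vanish_conv unfolding rtest_def by blast

lemma integrable_prod:
  fixes a b :: "real^'d::finite \<Rightarrow> real"
  assumes "integrable lborel a" "integrable lborel b"
  shows "integrable (lborel \<Otimes>\<^sub>M lborel) (\<lambda>(x,y). a x * b y)"
proof -
  note [measurable] = borel_measurable_integrable[OF assms(1)] borel_measurable_integrable[OF assms(2)]
  show ?thesis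
    by (rule lborel_pair.Fubini_integrable) (use assms in \<open>auto simp: abs_mult intro!: AE_I2\<close>)
qed

lemma integrable_prod_bound:
  fixes a b :: "real^'d::finite \<Rightarrow> real"
  assumes "integrable lborel a" "integrable lborel b"
    and "case_prod f \<in> borel_measurable (borel \<Otimes>\<^sub>M borel)" "\<And>x y. \<bar>f x y\<bar> \<le> M * (\<bar>a x\<bar> * \<bar>b y\<bar>)"
  shows "integrable (lborel \<Otimes>\<^sub>M lborel) (\<lambda>(x,y). (f x y :: real))"
proof (rule Bochner_Integration.integrable_bound)
  show "integrable (lborel \<Otimes>\<^sub>M lborel) (\<lambda>z. M * (\<lambda>(x,y). \<bar>a x\<bar> * \<bar>b y\<bar>) z)"
    by (intro integrable_mult_right integrable_prod integrable_abs assms)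
  show "(\<lambda>(x,y). f x y) \<in> borel_measurable (lborel \<Otimes>\<^sub>M lborel)" using assms(3) by simp
  show "AE z in lborel \<Otimes>\<^sub>M lborel. norm (case z of (x, y) \<Rightarrow> f x y) \<le> norm (M * (\<lambda>(x,y). \<bar>a x\<bar> * \<bar>b y\<bar>) z)"
    using assms(4) by (auto intro!: AE_I2 order_trans[OF _ abs_ge_self])
qed

lemma conv_fubini:
  fixes k :: "real^'d::finite \<Rightarrow> real"
  assumes k: "locint k" and f: "rtest f" and g: "continuous_on UNIV g" "vanish S g"
  shows "(LBINT x. conv k f x * g x) = (LBINT y. k y * (LBINT x. f (x - y) * g x))"
proof -
  obtain R where R: "vanish R f" "sm f" using f by (auto simp: rtest_def)
  obtain M where M: "M > 0" "\<And>x. \<bar>f x\<bar> \<le> M" using rtest_bounded[OF f] by metis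
  have [measurable]: "g \<in> borel_measurable borel" by (rule borel_measurable_continuous_onI[OF g(1)])
  note [measurable] = locint_borel[OF k] sm_borel[OF R(2)]
  have "integrable (lborel \<Otimes>\<^sub>M lborel) (\<lambda>(x,y). k y * f (x - y) * g x)"
  proof (rule integrable_prod_bound[where a=g and b="\<lambda>y. indicator (cball 0 (R + S)) y * k y" and M=M])
    show "integrable lborel g" using cont_vanish_integrable g by blast
    show "integrable lborel (\<lambda>y. indicator (cball 0 (R + S)) y * k y)" using k by (simp add: locint_def)
    show "\<bar>k y * f (x - y) * g x\<bar> \<le> M * (\<bar>g x\<bar> * \<bar>indicator (cball 0 (R + S)) y * k y\<bar>)" for x y
    proof (cases "norm y \<le> R + S")
      case True
      have "(\<bar>g x\<bar> * \<bar>k y\<bar>) * \<bar>f (x - y)\<bar> \<le> (\<bar>g x\<bar> * \<bar>k y\<bar>) * M" using M(2) by (intro mult_left_mono) auto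
      then show ?thesis using True by (simp add: abs_mult mult_ac)
    next
      case False
      have "f (x - y) * g x = 0"
      proof (cases "norm x \<le> S")
        case True then have "R < norm (x - y)" using False norm_triangle_ineq4[of x "x - y"] by simp
        then show ?thesis using R by (simp add: vanish_def)
      qed (use g in \<open>simp add: vanish_def\<close>)
      then show ?thesis using M by auto
    qed
  qed measurable
  from lborel_pair.Fubini_integral[OF this]
  have "(LBINT x. (LBINT y. k y * f (x - y) * g x)) = (LBINT y. k y * (LBINT x. f (x - y) * g x))"
    by (simp add: mult.assoc)
  moreover have "conv k f x * g x = (LBINT y. k y * f (x - y) * g x)" for x by (simp add: conv_def)
  ultimately show ?thesis by (simp only:)
qed

text \<open>The sign of \<open>A\<close> is derived rather than assumed, and \<open>A = 0\<close> is
  included. The same lemma gives Cauchy-Schwarz and, later, the approximate Euler-Lagrange equation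
  of a near minimiser.\<close>

lemma quadratic_discriminant:
  assumes "\<And>t::real. 0 \<le> t^2 * A + 2 * t * B + C" shows "B^2 \<le> A * C"
proof (cases "A = 0")
  case True
  have "B = 0"
  proof (rule ccontr)
    assume "B \<noteq> 0"
    then have "2 * (- (\<bar>C\<bar> + 1) / (2 * B)) * B = - (\<bar>C\<bar> + 1)" by simp
    with assms[of "- (\<bar>C\<bar> + 1) / (2 * B)"] True have "0 \<le> - (\<bar>C\<bar> + 1) + C" by simp
    then show False by linarith
  qed
  then show ?thesis using True by simp
next
  case False
  have "A \<ge> 0"
  proof (rule ccontr)
    assume "\<not> A \<ge> 0"
    then have n: "A < 0" by simp
    \<comment> \<open>Chosen so that \<open>t * A + 2 * B\<close> is at most
      \<open>A - \<bar>C\<bar>\<close>; as \<open>t \<ge> 1\<close>, this forces the quadratic below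
      0.\<close>
    define t where "t = 1 + (2 * \<bar>B\<bar> + \<bar>C\<bar>) / (- A)"
    have t: "t \<ge> 1" "t * A = A - (2 * \<bar>B\<bar> + \<bar>C\<bar>)" using n by (auto simp: t_def field_simps)
    have "t^2 * A + 2 * t * B + C = t * (t * A + 2 * B) + C" by (simp add: power2_eq_square algebra_simps)
    also have "\<dots> \<le> t * (A - \<bar>C\<bar>) + C" using t by (intro add_right_mono mult_left_mono) (auto simp: t(2))
    also have "\<dots> < 0" using t(1) n mult_right_mono[of 1 t "\<bar>C\<bar>"] mult_pos_neg[of t A] by (simp add: algebra_simps)
    finally show False using assms[of t] by simp
  qed
  then show ?thesis using assms[of "- B / A"] False by (simp add: power2_eq_square field_simps)
qed

section \<open>Cauchy-Schwarz, the Dirichlet form and Hardy's inequality\<close>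

lemma integral_CS:
  fixes a b :: "'i \<Rightarrow> 'a \<Rightarrow> real"
  assumes fin: "finite I" and [measurable]: "\<And>i. i \<in> I \<Longrightarrow> a i \<in> borel_measurable M" "\<And>i. i \<in> I \<Longrightarrow> b i \<in> borel_measurable M"
    and ia: "integrable M (\<lambda>x. \<Sum>i\<in>I. (a i x)^2)" and ib: "integrable M (\<lambda>x. \<Sum>i\<in>I. (b i x)^2)"
  shows "integrable M (\<lambda>x. \<Sum>i\<in>I. a i x * b i x)"
    "\<bar>\<integral>x. (\<Sum>i\<in>I. a i x * b i x) \<partial>M\<bar> \<le> sqrt (\<integral>x. (\<Sum>i\<in>I. (a i x)^2) \<partial>M) * sqrt (\<integral>x. (\<Sum>i\<in>I. (b i x)^2) \<partial>M)"
proof -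
  show iab: "integrable M (\<lambda>x. \<Sum>i\<in>I. a i x * b i x)"
  proof (rule Bochner_Integration.integrable_bound[OF Bochner_Integration.integrable_add[OF ia ib]])
    have "\<bar>\<Sum>i\<in>I. a i x * b i x\<bar> \<le> (\<Sum>i\<in>I. (a i x)^2) + (\<Sum>i\<in>I. (b i x)^2)" for x
    proof -
      have "\<bar>\<Sum>i\<in>I. a i x * b i x\<bar> \<le> (\<Sum>i\<in>I. \<bar>a i x * b i x\<bar>)" by (rule sum_abs)
      also have "\<dots> \<le> (\<Sum>i\<in>I. (a i x)^2 + (b i x)^2)"
      proof (intro sum_mono)
        fix i
        have "2 * (\<bar>a i x\<bar> * \<bar>b i x\<bar>) \<le> (a i x)^2 + (b i x)^2" using sum_squares_bound[of "\<bar>a i x\<bar>" "\<bar>b i x\<bar>"] by simp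
        moreover have "0 \<le> \<bar>a i x\<bar> * \<bar>b i x\<bar>" by simp
        ultimately show "\<bar>a i x * b i x\<bar> \<le> (a i x)^2 + (b i x)^2" unfolding abs_mult by linarith
      qed
      finally show ?thesis by (simp add: sum.distrib)
    qed
    then show "AE x in M. norm (\<Sum>i\<in>I. a i x * b i x) \<le> norm ((\<Sum>i\<in>I. (a i x)^2) + (\<Sum>i\<in>I. (b i x)^2))"
      by (intro AE_I2) (auto intro: order_trans[OF _ abs_ge_self])
  qed measurable
  let ?A = "(\<integral>x. (\<Sum>i\<in>I. (a i x)^2) \<partial>M)" and ?C = "(\<integral>x. (\<Sum>i\<in>I. (b i x)^2) \<partial>M)" and ?B = "\<integral>x. (\<Sum>i\<in>I. a i x * b i x) \<partial>M"
  have "?B^2 \<le> ?A * ?C"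
  proof (rule quadratic_discriminant)
    fix t :: real
    have "0 \<le> (\<integral>x. (\<Sum>i\<in>I. (t * a i x + b i x)^2) \<partial>M)" by (intro integral_nonneg_AE AE_I2 sum_nonneg) auto
    also have "\<dots> = (\<integral>x. t^2 * (\<Sum>i\<in>I. (a i x)^2) + 2 * t * (\<Sum>i\<in>I. a i x * b i x) + (\<Sum>i\<in>I. (b i x)^2) \<partial>M)"
      by (intro Bochner_Integration.integral_cong) (auto simp: power2_eq_square algebra_simps sum.distrib sum_distrib_left)
    also have "\<dots> = t^2 * ?A + 2 * t * ?B + ?C" using ia ib iab by simp
    finally show "0 \<le> t^2 * ?A + 2 * t * ?B + ?C" .
  qed
  then have "sqrt (?B^2) \<le> sqrt (?A * ?C)" by (rule real_sqrt_le_mono)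
  then show "\<bar>?B\<bar> \<le> sqrt ?A * sqrt ?C" by (simp add: real_sqrt_mult)
qed

lemma integral_CS1:
  fixes a b :: "'a \<Rightarrow> real"
  assumes "a \<in> borel_measurable M" "b \<in> borel_measurable M" "integrable M (\<lambda>x. (a x)^2)" "integrable M (\<lambda>x. (b x)^2)"
  shows "integrable M (\<lambda>x. a x * b x)" "\<bar>\<integral>x. a x * b x \<partial>M\<bar> \<le> sqrt (\<integral>x. (a x)^2 \<partial>M) * sqrt (\<integral>x. (b x)^2 \<partial>M)"
  using integral_CS[of "{()}" "\<lambda>_. a" M "\<lambda>_. b"] assms by auto

definition dirb :: "(real^'d::finite \<Rightarrow> real) \<Rightarrow> (real^'d \<Rightarrow> real) \<Rightarrow> real" where
  "dirb u v = (LBINT x. (\<Sum>j\<in>UNIV. rpd j u x * rpd j v x))"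

definition dir :: "(real^'d::finite \<Rightarrow> real) \<Rightarrow> real" where
  "dir u = (LBINT x. gsq u x)"

lemma dir_dirb: "dir u = dirb u u" by (simp add: dir_def dirb_def power2_eq_square)
lemma dir_nonneg: "0 \<le> dir u" unfolding dir_def by (intro integral_nonneg_AE AE_I2 sum_nonneg) auto

lemma rtest_grad_prod: "rtest u \<Longrightarrow> sm v \<Longrightarrow> rtest (\<lambda>x. \<Sum>j\<in>UNIV. rpd j u x * rpd j v x)"
  by (intro rtest_sum rtest_mult1 rtest_rpd sm_rpd)
lemma rtest_grad_sq: "rtest u \<Longrightarrow> rtest (\<lambda>x. gsq u x)"
  by (intro rtest_sum rtest_power2 rtest_rpd)

text \<open>With w = 1 / (1 + |x|^2), the vector field x w has divergence at least (d - 2) w.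
  Integrating this against u^2 by parts and applying Cauchy-Schwarz bounds the left side by a
  multiple of its own square root. The weight without singularity avoids an excision at the
  origin.\<close>

lemma hardy:
  fixes u :: "real^'d::finite \<Rightarrow> real"
  assumes d: "CARD('d) \<ge> 3" and u: "rtest u"
  shows "(LBINT x. (u x)^2 / (1 + (norm x)^2)) \<le> 4 * dir u"
proof -
  define w where "w x = inverse (1 + (norm x)^2)" for x :: "real^'d"
  have pos: "0 < 1 + (norm x)^2" for x :: "real^'d" by (simp add: add_pos_nonneg)
  have sp: "sm (\<lambda>x::real^'d. 1 + (norm x)^2)" by (intro sm_add sm_const sm_norm_sq)
  have w: "sm w" unfolding w_def by (intro sm_inverse sp pos)
  have wp: "w x > 0" "(norm x)^2 * w x \<le> 1" for x using pos[of x] by (auto simp: w_def field_simps)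
  have rp: "rpd j (\<lambda>x. 1 + (norm x)^2) x = 2 * x $ j" for j and x :: "real^'d"
    by (simp add: rpd_norm_sq rpd_add[OF differentiable_const sm_diff[OF sm_norm_sq]])
  have dw: "rpd j w x = - 2 * x $ j * (w x)^2" for j x
  proof -
    have "(inverse has_real_derivative - (inverse (1 + (norm x)^2) ^ Suc (Suc 0))) (at (1 + (norm x)^2))"
      using DERIV_inverse pos[of x] by (metis less_irrefl)
    from rpd_chain(2)[OF this sm_diff[OF sp]]
    have "rpd j w x = - (inverse (1 + (norm x)^2) ^ Suc (Suc 0)) * (2 * x $ j)" unfolding rp w_def[abs_def] .
    then show ?thesis by (simp add: w_def power2_eq_square)
  qed
  have dX: "rpd j (\<lambda>x. x $ j * w x) x = w x - 2 * (x $ j)^2 * (w x)^2" for j x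
    by (simp add: rpd_mult[OF sm_diff[OF sm_component] sm_diff[OF w]] rpd_component dw power2_eq_square)
  have sX: "sm (\<lambda>x. x $ j * w x)" for j by (intro sm_mult sm_component w)
  let ?H = "LBINT x. (u x)^2 * w x"
  have su: "sm u" by (rule rtest_sm[OF u])
  have u2: "rtest (\<lambda>x. (u x)^2)" by (rule rtest_power2[OF u])
  have H0: "0 \<le> ?H" by (intro integral_nonneg_AE AE_I2 mult_nonneg_nonneg zero_le_power2 less_imp_le wp(1))
  have iH: "integrable lborel (\<lambda>x. (u x)^2 * w x)" by (intro rtest_integrable rtest_mult1 u2 w)
  have "real (CARD('d) - 2) * ?H = (LBINT x. real (CARD('d) - 2) * ((u x)^2 * w x))" by simp
  also have "\<dots> \<le> (LBINT x. (\<Sum>j\<in>UNIV. (u x)^2 * rpd j (\<lambda>x. x $ j * w x) x))"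
  proof (rule integral_mono)
    show "integrable lborel (\<lambda>x. \<Sum>j\<in>UNIV. (u x)^2 * rpd j (\<lambda>x. x $ j * w x) x)"
      by (intro rtest_integrable rtest_sum rtest_mult1 u2 sm_rpd sX)
    fix x
    have "(\<Sum>j\<in>UNIV. rpd j (\<lambda>x. x $ j * w x) x) = real CARD('d) * w x - 2 * ((norm x)^2 * w x) * w x"
      unfolding dX norm_sq_vec by (simp add: sum_subtractf sum_distrib_left sum_distrib_right power2_eq_square mult_ac)
    also have "\<dots> \<ge> real (CARD('d) - 2) * w x"
      using mult_right_mono[OF wp(2)[of x], of "w x"] wp(1)[of x] d by (simp add: of_nat_diff algebra_simps)
    finally have q: "real (CARD('d) - 2) * w x \<le> (\<Sum>j\<in>UNIV. rpd j (\<lambda>x. x $ j * w x) x)" .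
    show "real (CARD('d) - 2) * ((u x)^2 * w x) \<le> (\<Sum>j\<in>UNIV. (u x)^2 * rpd j (\<lambda>x. x $ j * w x) x)"
      unfolding sum_distrib_left[symmetric] using mult_left_mono[OF q, of "(u x)^2"] by (simp add: mult.left_commute)
  qed (use iH in simp)
  also have "\<dots> = (\<Sum>j\<in>UNIV. (LBINT x. (u x)^2 * rpd j (\<lambda>x. x $ j * w x) x))"
    by (intro Bochner_Integration.integral_sum rtest_integrable rtest_mult1 u2 sm_rpd sX)
  also have "\<dots> = (\<Sum>j\<in>UNIV. (LBINT x. -2 * (rpd j u x * (u x * (x $ j * w x)))))"
  proof (intro sum.cong refl)
    fix j :: 'd
    have "rpd j (\<lambda>x. (u x)^2) x = 2 * u x * rpd j u x" for x
      using rpd_mult[OF sm_diff[OF su] sm_diff[OF su]] by (simp add: power2_eq_square)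
    then show "(LBINT x. (u x)^2 * rpd j (\<lambda>x. x $ j * w x) x) = (LBINT x. -2 * (rpd j u x * (u x * (x $ j * w x))))"
      using integral_by_parts[OF rtest_sm[OF u2] sX, of j j] u2
      by (simp add: mult_ac flip: integral_minus)
  qed
  also have "\<dots> = (LBINT x. -2 * (\<Sum>j\<in>UNIV. rpd j u x * (u x * (x $ j * w x))))"
    unfolding sum_distrib_left
    by (intro Bochner_Integration.integral_sum[symmetric] rtest_integrable rtest_cmult rtest_mult1 rtest_rpd u sm_mult su sm_component w)
  also have "\<dots> \<le> 2 * \<bar>LBINT x. (\<Sum>j\<in>UNIV. rpd j u x * (u x * (x $ j * w x)))\<bar>" by simp
  also have "\<dots> \<le> 2 * (sqrt (dir u) * sqrt (LBINT x. (\<Sum>j\<in>UNIV. (u x * (x $ j * w x))^2)))"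
    unfolding dir_def
    by (intro mult_left_mono integral_CS rtest_integrable rtest_grad_sq rtest_sum rtest_power2 rtest_mult1 u sX)
      (auto intro!: sm_borel sm_rpd su sm_mult sm_component w)
  also have "\<dots> \<le> 2 * (sqrt (dir u) * sqrt ?H)"
  proof (intro mult_left_mono real_sqrt_le_mono integral_mono)
    fix x
    have "(\<Sum>j\<in>UNIV. (u x * (x $ j * w x))^2) = (u x)^2 * w x * ((norm x)^2 * w x)"
      unfolding norm_sq_vec sum_distrib_left sum_distrib_right by (simp add: power2_eq_square mult_ac)
    also have "\<dots> \<le> (u x)^2 * w x * 1" using wp[of x] by (intro mult_left_mono) auto
    finally show "(\<Sum>j\<in>UNIV. (u x * (x $ j * w x))^2) \<le> (u x)^2 * w x" by simp
  qed (auto intro!: rtest_integrable rtest_sum rtest_power2 rtest_mult1 u sX u2 w dir_nonneg)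
  finally have "real (CARD('d) - 2) * ?H \<le> 2 * (sqrt (dir u) * sqrt ?H)" .
  \<comment> \<open>From here on only \<open>d - 2 \<ge> 1\<close> is used, which is why the
    constant 4 does not depend on the dimension.\<close>
  moreover have "1 * ?H \<le> real (CARD('d) - 2) * ?H" using d by (intro mult_right_mono H0) auto
  ultimately have a: "?H \<le> 2 * (sqrt (dir u) * sqrt ?H)" by simp
  have "?H \<le> 4 * dir u"
  proof (cases "?H = 0")
    case True then show ?thesis using dir_nonneg by simp
  next
    case False
    then have "sqrt ?H > 0" using H0 by simp
    moreover have "sqrt ?H * sqrt ?H \<le> (2 * sqrt (dir u)) * sqrt ?H" using a H0 by simp
    ultimately have "sqrt ?H \<le> 2 * sqrt (dir u)" using mult_right_le_imp_le by blast
    then have "(sqrt ?H)^2 \<le> (2 * sqrt (dir u))^2" using H0 by (intro power_mono) auto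
    then show ?thesis using H0 dir_nonneg[of u] by (simp add: power_mult_distrib)
  qed
  then show ?thesis by (simp add: w_def divide_inverse)
qed

section \<open>Riesz and Newton kernels\<close>

text \<open>\<open>kk\<close> and \<open>kr\<close> are both \<open>|x|\<^sup>1\<^sup>-\<^sup>d\<close>, \<open>k2\<close> and \<open>gam\<close> both \<open>|x|\<^sup>2\<^sup>-\<^sup>d\<close>; they differ at the origin, where the extended versions are infinite and the real ones vanish.\<close>

definition kk :: "real^'d::finite \<Rightarrow> ennreal" where "kk x = inverse (ennreal (norm x ^ (CARD('d) - 1)))"
definition k2 :: "real^'d::finite \<Rightarrow> ennreal" where "k2 x = inverse (ennreal (norm x ^ (CARD('d) - 2)))"
definition gam :: "real^'d::finite \<Rightarrow> real" where "gam x = 1 / norm x ^ (CARD('d) - 2)"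
definition kr :: "real^'d::finite \<Rightarrow> real" where "kr x = 1 / norm x ^ (CARD('d) - 1)"

lemma kk_borel [measurable]: "kk \<in> borel_measurable borel" unfolding kk_def by measurable
lemma k2_borel [measurable]: "k2 \<in> borel_measurable borel" unfolding k2_def by measurable
lemma gam_borel [measurable]: "gam \<in> borel_measurable borel" unfolding gam_def by measurable
lemma kr_borel [measurable]: "kr \<in> borel_measurable borel" unfolding kr_def by measurable

lemma inverse_ennreal_power: "r > 0 \<Longrightarrow> inverse (ennreal (r ^ n)) = ennreal (1 / r ^ n)"
  by (simp add: inverse_ennreal inverse_eq_divide)

lemma kk_kr: "x \<noteq> 0 \<Longrightarrow> kk x = ennreal (kr x)" unfolding kk_def kr_def by (simp add: inverse_ennreal_power)
lemma k2_gam: "x \<noteq> 0 \<Longrightarrow> k2 x = ennreal (gam x)" unfolding k2_def gam_def by (simp add: inverse_ennreal_power)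

lemma AE_neq: "AE x in lborel. x \<noteq> (a::real^'d::finite)"
  by (rule AE_lborel_singleton)

section \<open>Integrals of powers of the norm\<close>

lemma layer_cake:
  assumes "r > 0" "a \<ge> 1"
  shows "(LBNN s. ennreal (real a / s ^ (a + 1)) * indicator {r..} s) = ennreal (1 / r ^ a)"
proof -
  have l: "((\<lambda>s::real. - (1 / s ^ a)) \<longlongrightarrow> - 0) at_top"
    by (intro tendsto_minus tendsto_divide_0[OF tendsto_const] filterlim_at_top_imp_at_infinity filterlim_pow_at_top filterlim_ident)
      (use assms in auto)
  have "(LBNN s. ennreal (real a / s ^ (a + 1)) * indicator {r..} s) = ennreal (0 - (- (1 / r ^ a)))"
  proof (rule nn_integral_FTC_atLeast)
    show "((\<lambda>s. - (1 / s ^ a)) has_real_derivative real a / s ^ (a + 1)) (at s)" if "r \<le> s" for s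
    proof -
      have s: "s > 0" using that assms by simp
      obtain b where b: "a = Suc b" using assms by (cases a) auto
      have "((\<lambda>s. - (1 / s ^ a)) has_real_derivative - (- (real a * s ^ (a - 1)) / (s ^ a * s ^ a))) (at s)"
        using s by (auto intro!: derivative_eq_intros)
      moreover have "- (- (real a * s ^ (a - 1)) / (s ^ a * s ^ a)) = real a / s ^ (a + 1)"
        using s b by (simp add: field_simps)
      ultimately show ?thesis by simp
    qed
    show "0 \<le> real a / s ^ (a + 1)" if "r \<le> s" for s using that assms by simp
    show "((\<lambda>s::real. - (1 / s ^ a)) \<longlongrightarrow> 0) at_top" using l by simp
  qed measurable
  then show ?thesis by simp
qed

lemma measure_annulus:
  "emeasure lborel {x::real^'d::finite. P x \<and> norm x \<le> s} \<le> ennreal (unit_ball_vol (real CARD('d)) * s ^ CARD('d))" if "s \<ge> 0" "{x::real^'d. P x} \<in> sets borel"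
proof -
  have "emeasure lborel {x::real^'d. P x \<and> norm x \<le> s} \<le> emeasure lborel (cball (0::real^'d) s)"
    by (rule emeasure_mono) auto
  also have "\<dots> = ennreal (unit_ball_vol (real CARD('d)) * s ^ CARD('d))" using emeasure_cball[OF that(1), of "0::real^'d"] by simp
  finally show ?thesis .
qed

text \<open>This replaces polar coordinates: after the exchange of integrals, only volumes of
  sublevel sets of the norm have to be estimated.\<close>

lemma nn_integral_power_layer:
  assumes "a \<ge> 1" and P [measurable]: "Measurable.pred borel (P :: real^'d::finite \<Rightarrow> bool)"
  shows "(LBNN x. indicator {x. P x} x * inverse (ennreal (norm x ^ a)))
    = (LBNN s. indicator {0<..} s * (ennreal (real a / s ^ (a + 1)) * emeasure lborel {x::real^'d. P x \<and> norm x \<le> s}))"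
proof -
  have "(LBNN x. indicator {x. P x} x * inverse (ennreal (norm x ^ a)))
     = (LBNN x. (LBNN s. indicator {x. P x} x * (indicator {0<..} s * (ennreal (real a / s ^ (a + 1)) * indicator {norm x..} s))))"
  proof (rule nn_integral_cong_AE, use AE_neq[of 0] in eventually_elim)
    fix x :: "real^'d" assume x: "x \<noteq> 0"
    have "(LBNN s. indicator {x. P x} x * (indicator {0<..} s * (ennreal (real a / s ^ (a + 1)) * indicator {norm x..} s)))
      = indicator {x. P x} x * (LBNN s. indicator {0<..} s * (ennreal (real a / s ^ (a + 1)) * indicator {norm x..} s))"
      by (intro nn_integral_cmult) measurable
    also have "(LBNN s. indicator {0<..} s * (ennreal (real a / s ^ (a + 1)) * indicator {norm x..} s))
      = (LBNN s. ennreal (real a / s ^ (a + 1)) * indicator {norm x..} s)"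
      using x zero_less_norm_iff[of x] by (intro nn_integral_cong) (auto simp: indicator_def simp del: zero_less_norm_iff)
    also have "\<dots> = inverse (ennreal (norm x ^ a))" using layer_cake[of "norm x" a] x assms(1) by (simp add: inverse_ennreal_power)
    finally show "indicator {x. P x} x * inverse (ennreal (norm x ^ a)) = (LBNN s. indicator {x. P x} x * (indicator {0<..} s * (ennreal (real a / s ^ (a + 1)) * indicator {norm x..} s)))" ..
  qed
  also have "\<dots> = (LBNN s. (LBNN x. indicator {x. P x} x * (indicator {0<..} s * (ennreal (real a / s ^ (a + 1)) * indicator {norm x..} s))))"
    by (rule lborel_pair.Fubini') (simp only: indicator_def of_bool_def atLeast_iff mem_Collect_eq greaterThan_iff, measurable)
  also have "\<dots> = (LBNN s. indicator {0<..} s * (ennreal (real a / s ^ (a + 1)) * emeasure lborel {x::real^'d. P x \<and> norm x \<le> s}))"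
  proof (intro nn_integral_cong)
    fix s :: real
    have "(LBNN x. indicator {x. P x} x * (indicator {0<..} s * (ennreal (real a / s ^ (a + 1)) * indicator {norm x..} s)))
      = (LBNN x. (indicator {0<..} s * ennreal (real a / s ^ (a + 1))) * indicator {x::real^'d. P x \<and> norm x \<le> s} x)"
      by (intro nn_integral_cong) (auto simp: indicator_def)
    also have "\<dots> = (indicator {0<..} s * ennreal (real a / s ^ (a + 1))) * emeasure lborel {x::real^'d. P x \<and> norm x \<le> s}"
      by (rule nn_integral_cmult_indicator) measurable
    finally show "(LBNN x. indicator {x. P x} x * (indicator {0<..} s * (ennreal (real a / s ^ (a + 1)) * indicator {norm x..} s)))
      = indicator {0<..} s * (ennreal (real a / s ^ (a + 1)) * emeasure lborel {x::real^'d. P x \<and> norm x \<le> s})" by (simp add: mult.assoc)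
  qed
  finally show ?thesis .
qed

definition vb :: "'d itself \<Rightarrow> real" where "vb _ = unit_ball_vol (real CARD('d))"

lemma vb_pos: "vb TYPE('d::finite) > 0" by (simp add: vb_def)

lemma kk_ball:
  assumes d: "CARD('d::finite) \<ge> 2" and r: "r > 0"
  shows "(LBNN x. indicator {x::real^'d. norm x < r} x * kk x) \<le> ennreal (real CARD('d) * vb TYPE('d) * r)"
proof -
  let ?a = "CARD('d) - 1"
  have a: "?a \<ge> 1" "Suc ?a = CARD('d)" using d by auto
  have "(LBNN x. indicator {x::real^'d. norm x < r} x * kk x)
    = (LBNN s. indicator {0<..} s * (ennreal (real ?a / s ^ (?a + 1)) * emeasure lborel {x::real^'d. norm x < r \<and> norm x \<le> s}))"
    unfolding kk_def by (rule nn_integral_power_layer[OF a(1)]) measurable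
  \<comment> \<open>For \<open>s \<le> r\<close> the volume grows like s^d and cancels the density;
    beyond r it is bounded by that of the ball of radius r. The two parts contribute (d - 1) v r and
    v r, where v is the volume of the unit ball.\<close>
  also have "\<dots> \<le> (LBNN s. ennreal (real ?a * vb TYPE('d)) * indicator {0..r} s + ennreal (vb TYPE('d) * r ^ CARD('d)) * (ennreal (real ?a / s ^ (?a + 1)) * indicator {r..} s))"
  proof (rule nn_integral_mono)
    fix s :: real
    show "indicator {0<..} s * (ennreal (real ?a / s ^ (?a + 1)) * emeasure lborel {x::real^'d. norm x < r \<and> norm x \<le> s})
      \<le> ennreal (real ?a * vb TYPE('d)) * indicator {0..r} s + ennreal (vb TYPE('d) * r ^ CARD('d)) * (ennreal (real ?a / s ^ (?a + 1)) * indicator {r..} s)"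
    proof (cases "s > 0")
      case s: True
      show ?thesis
      proof (cases "s \<le> r")
        case True
        have "ennreal (real ?a / s ^ (?a + 1)) * emeasure lborel {x::real^'d. norm x < r \<and> norm x \<le> s}
          \<le> ennreal (real ?a / s ^ (?a + 1)) * ennreal (vb TYPE('d) * s ^ CARD('d))"
          unfolding vb_def by (intro mult_left_mono measure_annulus) (use s in auto)
        also have "\<dots> = ennreal (real ?a * vb TYPE('d))"
          using s a(2) vb_pos[where 'd='d] by (subst ennreal_mult[symmetric]) (auto simp: less_imp_le)
        finally show ?thesis using s True by (auto simp: indicator_def intro: add_increasing2)
      next
        case False
        have "emeasure lborel {x::real^'d. norm x < r \<and> norm x \<le> s} \<le> emeasure lborel {x::real^'d. norm x < r \<and> norm x \<le> r}"
          by (intro emeasure_mono) auto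
        also have "\<dots> \<le> ennreal (vb TYPE('d) * r ^ CARD('d))" unfolding vb_def by (intro measure_annulus) (use r in auto)
        finally have "ennreal (real ?a / s ^ (?a + 1)) * emeasure lborel {x::real^'d. norm x < r \<and> norm x \<le> s}
          \<le> ennreal (real ?a / s ^ (?a + 1)) * ennreal (vb TYPE('d) * r ^ CARD('d))" by (intro mult_left_mono) auto
        then show ?thesis using s False by (simp add: mult.commute)
      qed
    qed auto
  qed
  also have "\<dots> = ennreal (real ?a * vb TYPE('d)) * ennreal r + ennreal (vb TYPE('d) * r ^ CARD('d)) * ennreal (1 / r ^ ?a)"
    by (subst nn_integral_add, measurable, measurable, subst nn_integral_cmult, measurable, subst nn_integral_cmult, measurable)
      (use r layer_cake[OF r a(1)] in simp)
  also have "\<dots> = ennreal (real ?a * vb TYPE('d) * r + vb TYPE('d) * (r ^ CARD('d) * (1 / r ^ ?a)))"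
    using r vb_pos[where 'd='d] by (simp add: ennreal_mult[symmetric] ennreal_plus[symmetric] less_imp_le del: ennreal_plus)
  also have "r ^ CARD('d) * (1 / r ^ ?a) = r" using r power_Suc[of r ?a] unfolding a(2) by simp
  also have "real ?a * vb TYPE('d) * r + vb TYPE('d) * r = real CARD('d) * vb TYPE('d) * r"
    using d by (simp add: of_nat_diff algebra_simps)
  finally show ?thesis by (simp add: mult.assoc)
qed

lemma power_outside_ball:
  assumes a: "a > CARD('d::finite)" and r: "r > 0"
  shows "(LBNN x. indicator {x::real^'d. r \<le> norm x} x * inverse (ennreal (norm x ^ a)))
     \<le> ennreal (real a * vb TYPE('d) * (1 / r ^ (a - CARD('d))))"
proof -
  let ?b = "a - CARD('d)"
  have b: "?b \<ge> 1" "a + 1 = CARD('d) + (?b + 1)" "a \<ge> 1" using a by auto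
  have "(LBNN x. indicator {x::real^'d. r \<le> norm x} x * inverse (ennreal (norm x ^ a)))
    = (LBNN s. indicator {0<..} s * (ennreal (real a / s ^ (a + 1)) * emeasure lborel {x::real^'d. r \<le> norm x \<and> norm x \<le> s}))"
    by (rule nn_integral_power_layer[OF b(3)]) measurable
  also have "\<dots> \<le> (LBNN s. ennreal (real a * vb TYPE('d)) * (ennreal (real ?b / s ^ (?b + 1)) * indicator {r..} s))"
  proof (rule nn_integral_mono)
    fix s :: real
    show "indicator {0<..} s * (ennreal (real a / s ^ (a + 1)) * emeasure lborel {x::real^'d. r \<le> norm x \<and> norm x \<le> s})
      \<le> ennreal (real a * vb TYPE('d)) * (ennreal (real ?b / s ^ (?b + 1)) * indicator {r..} s)"
    proof (cases "r \<le> s")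
      case False
      then have "{x::real^'d. r \<le> norm x \<and> norm x \<le> s} = {}" by auto
      then show ?thesis by (simp only: emeasure_empty mult_zero_right) simp
    next
      case True
      then have s: "s > 0" using r by simp
      have "ennreal (real a / s ^ (a + 1)) * emeasure lborel {x::real^'d. r \<le> norm x \<and> norm x \<le> s}
        \<le> ennreal (real a / s ^ (a + 1)) * ennreal (vb TYPE('d) * s ^ CARD('d))"
        unfolding vb_def by (intro mult_left_mono measure_annulus) (use s in auto)
      also have "\<dots> = ennreal (real a * vb TYPE('d) * (1 / s ^ (?b + 1)))"
        unfolding b(2) power_add[of s "CARD('d)"]
        using s vb_pos[where 'd='d] by (subst ennreal_mult[symmetric]) (auto simp: less_imp_le)
      \<comment> \<open>Inserting the factor \<open>real ?b \<ge> 1\<close> gives exactly the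
        density integrated by \<open>layer_cake\<close>.\<close>
      also have "\<dots> \<le> ennreal (real a * vb TYPE('d) * (real ?b / s ^ (?b + 1)))"
        using b(1) s vb_pos[where 'd='d] by (intro ennreal_leI mult_left_mono divide_right_mono) (auto simp: less_imp_le)
      finally show ?thesis using s True vb_pos[where 'd='d]
        by (auto simp: ennreal_mult[symmetric] less_imp_le)
    qed
  qed
  also have "\<dots> = ennreal (real a * vb TYPE('d)) * ennreal (1 / r ^ ?b)"
    using layer_cake[OF r b(1)] by (subst nn_integral_cmult) auto
  also have "\<dots> = ennreal (real a * vb TYPE('d) * (1 / r ^ ?b))"
    using vb_pos[where 'd='d] r by (subst ennreal_mult[symmetric]) (auto simp: less_imp_le)
  finally show ?thesis .
qed

lemma kk_sq: "kk (x::real^'d::finite) * kk x = inverse (ennreal (norm x ^ (2 * (CARD('d) - 1))))"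
proof (cases "x = 0 \<and> CARD('d) - 1 > 0")
  case True then show ?thesis by (simp add: kk_def zero_power)
next
  case False
  then show ?thesis
    by (cases "x = 0") (auto simp: kk_def inverse_ennreal_power ennreal_mult[symmetric] power_add[symmetric] mult_2 inverse_eq_divide)
qed

lemma kk_le: assumes "0 < r" "r \<le> norm (x::real^'d::finite)" shows "kk x \<le> ennreal (1 / r ^ (CARD('d) - 1))"
proof -
  have "x \<noteq> 0" using assms by auto
  then show ?thesis using assms by (auto simp: kk_kr kr_def intro!: ennreal_leI divide_left_mono power_mono mult_pos_pos)
qed

text \<open>The composition of two kernels of order 1 is of order 2. Within half the distance of y
  to z from either point, the other kernel is bounded by its value there; away from both points the
  product is at most the sum of the squares, and |w|^(2 - 2d) is integrable at infinity because d is
  at least 3.\<close>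

lemma kk_compose:
  assumes d: "CARD('d::finite) \<ge> 3"
  obtains C where "C > 0" "\<And>y z::real^'d. (LBNN x. kk (x - y) * kk (x - z)) \<le> ennreal C * k2 (y - z)"
proof -
  define A where "A = real CARD('d) * vb TYPE('d)"
  define B where "B = real (2 * (CARD('d) - 1)) * vb TYPE('d)"
  \<comment> \<open>Each of the two balls contributes \<open>A * e\<close> times e^(1 - d), each
    exterior region B times e^(2 - d); the powers of 2 come from rewriting
    \<open>e = D / 2\<close>.\<close>
  define C where "C = 2 ^ (CARD('d) - 1) * A + 2 * B * 2 ^ (CARD('d) - 2)"
  have AB: "A > 0" "B > 0" using vb_pos[where 'd='d] d by (auto simp: A_def B_def)
  then have C: "C > 0" by (simp add: C_def add_pos_pos)
  have main: "(LBNN x. kk (x - y) * kk (x - z)) \<le> ennreal C * k2 (y - z)" for y z :: "real^'d"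
  proof (cases "y = z")
    case True
    have "k2 (y - z) = \<infinity>" using True d by (simp add: k2_def)
    then show ?thesis using C by (simp add: ennreal_mult_top)
  next
    case False
    define D where "D = norm (y - z)"
    have D: "D > 0" using False by (simp add: D_def)
    define e where "e = D / 2"
    have e: "e > 0" using D by (simp add: e_def)
    let ?K = "ennreal (1 / e ^ (CARD('d) - 1))"
    let ?in = "\<lambda>w::real^'d. indicator {x. norm x < e} w * kk w"
    let ?out = "\<lambda>w::real^'d. indicator {x. e \<le> norm x} w * inverse (ennreal (norm w ^ (2 * (CARD('d) - 1))))"
    have pw: "kk (x - y) * kk (x - z) \<le> ?K * (?in (x - y) + ?in (x - z)) + (?out (x - y) + ?out (x - z))" for x
    proof -
      have tri: "2 * e \<le> norm (x - y) + norm (x - z)"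
        using norm_triangle_ineq4[of "x - z" "x - y"] by (simp add: e_def D_def)
      consider "norm (x - y) < e" | "norm (x - z) < e" | "e \<le> norm (x - y)" "e \<le> norm (x - z)" by linarith
      then show ?thesis
      proof cases
        case 1
        then have "e \<le> norm (x - z)" using tri by linarith
        then have "kk (x - y) * kk (x - z) \<le> kk (x - y) * ?K" by (intro mult_left_mono kk_le e) auto
        also have "\<dots> \<le> ?K * (?in (x - y) + ?in (x - z))"
          unfolding mult.commute[of "kk (x - y)"] using 1 by (intro mult_left_mono) auto
        finally show ?thesis by (auto intro: add_increasing2)
      next
        case 2
        then have "e \<le> norm (x - y)" using tri by linarith
        then have "kk (x - y) * kk (x - z) \<le> ?K * kk (x - z)" by (intro mult_right_mono kk_le e) auto
        also have "\<dots> \<le> ?K * (?in (x - y) + ?in (x - z))" using 2 by (auto intro!: mult_left_mono)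
        finally show ?thesis by (auto intro: add_increasing2)
      next
        case 3
        have "kk (x - y) * kk (x - z) \<le> kk (x - y) * kk (x - y) + kk (x - z) * kk (x - z)"
        proof (cases "kk (x - y) \<le> kk (x - z)")
          case True
          then have "kk (x - y) * kk (x - z) \<le> kk (x - z) * kk (x - z)" by (intro mult_right_mono) auto
          then show ?thesis by (auto intro: add_increasing)
        next
          case False
          then have "kk (x - y) * kk (x - z) \<le> kk (x - y) * kk (x - y)" by (intro mult_left_mono) auto
          then show ?thesis by (auto intro: add_increasing2)
        qed
        also have "\<dots> = ?out (x - y) + ?out (x - z)" using 3 by (simp add: kk_sq)
        finally show ?thesis by (auto intro: add_increasing)
      qed
    qed
    have "(LBNN x. kk (x - y) * kk (x - z)) \<le> (LBNN x. ?K * (?in (x - y) + ?in (x - z)) + (?out (x - y) + ?out (x - z)))"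
      by (intro nn_integral_mono pw)
    also have "\<dots> = ?K * ((LBNN x. ?in (x - y)) + (LBNN x. ?in (x - z))) + ((LBNN x. ?out (x - y)) + (LBNN x. ?out (x - z)))"
      by (simp add: nn_integral_add nn_integral_cmult)
    also have "\<dots> = ?K * ((LBNN x. ?in x) + (LBNN x. ?in x)) + ((LBNN x. ?out x) + (LBNN x. ?out x))"
      using nn_integral_shift(1)[of ?in] nn_integral_shift(1)[of ?out] by simp
    also have "\<dots> \<le> ?K * (ennreal (A * e) + ennreal (A * e)) + (ennreal (B * (1 / e ^ (2 * (CARD('d) - 1) - CARD('d)))) + ennreal (B * (1 / e ^ (2 * (CARD('d) - 1) - CARD('d)))))"
      unfolding A_def B_def by (intro add_mono mult_left_mono kk_ball power_outside_ball e) (use d in auto)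
    also have "\<dots> = ennreal ((1 / e ^ (CARD('d) - 1)) * (A * e + A * e) + (B * (1 / e ^ (2 * (CARD('d) - 1) - CARD('d))) + B * (1 / e ^ (2 * (CARD('d) - 1) - CARD('d)))))"
      using AB e by (simp add: ennreal_mult[symmetric] ennreal_plus[symmetric] less_imp_le del: ennreal_plus)
    also have "(1 / e ^ (CARD('d) - 1)) * (A * e + A * e) + (B * (1 / e ^ (2 * (CARD('d) - 1) - CARD('d))) + B * (1 / e ^ (2 * (CARD('d) - 1) - CARD('d)))) = C * (1 / D ^ (CARD('d) - 2))"
    proof -
      have i: "2 * (CARD('d) - 1) - CARD('d) = CARD('d) - 2" "CARD('d) - 1 = Suc (CARD('d) - 2)" using d by auto
      have "D = 2 * e" by (simp add: e_def)
      then show ?thesis unfolding C_def unfolding i(1) unfolding i(2) using e by (simp add: power_mult_distrib field_simps)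
    qed
    also have "ennreal (C * (1 / D ^ (CARD('d) - 2))) = ennreal C * k2 (y - z)"
      using False C D by (subst ennreal_mult) (auto simp: k2_gam gam_def D_def)
    finally show ?thesis .
  qed
  show thesis by (rule that[OF C main])
qed

section \<open>Local integrability of the kernels\<close>

lemma kr_nonneg: "0 \<le> kr x" by (simp add: kr_def)
lemma gam_nonneg: "0 \<le> gam x" by (simp add: gam_def)

lemma locint_kr: assumes d: "CARD('d::finite) \<ge> 2" shows "locint (kr :: real^'d \<Rightarrow> real)"
  unfolding locint_def
proof (intro conjI allI kr_borel)
  fix R :: real
  show "integrable lborel (\<lambda>x. indicator (cball 0 R) x * kr (x::real^'d))"
  proof (rule integrableI_nonneg)
    have "(LBNN x. ennreal (indicator (cball 0 R) x * kr (x::real^'d))) \<le> (LBNN x. indicator {x::real^'d. norm x < max R 0 + 1} x * kk x)"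
      by (rule nn_integral_mono_AE, use AE_neq[of 0] in eventually_elim) (auto simp: kk_kr indicator_def)
    also have "\<dots> \<le> ennreal (real CARD('d) * vb TYPE('d) * (max R 0 + 1))" by (rule kk_ball) (use d in auto)
    also have "\<dots> < \<infinity>" by simp
    finally show "(LBNN x. ennreal (indicator (cball 0 R) x * kr (x::real^'d))) < \<infinity>" .
    show "(\<lambda>x. indicator (cball 0 R) x * kr (x::real^'d)) \<in> borel_measurable lborel"
      by (intro borel_measurable_times borel_measurable_indicator) (auto simp: kr_borel)
  qed (auto simp: kr_nonneg)
qed

lemma gam_kr: assumes "CARD('d::finite) \<ge> 2" "x \<noteq> 0" shows "gam (x::real^'d) = norm x * kr x"
proof -
  have "CARD('d) - 1 = Suc (CARD('d) - 2)" using assms by auto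
  then show ?thesis using assms(2) by (simp add: gam_def kr_def)
qed

lemma locint_gam: assumes d: "CARD('d::finite) \<ge> 3" shows "locint (gam :: real^'d \<Rightarrow> real)"
  unfolding locint_def
proof (intro conjI allI gam_borel)
  fix R :: real
  show "integrable lborel (\<lambda>x. indicator (cball 0 R) x * gam (x::real^'d))"
  proof (rule Bochner_Integration.integrable_bound)
    show "integrable lborel (\<lambda>x. R * (indicator (cball 0 R) x * kr (x::real^'d)))"
      using locint_kr[where 'd='d] d by (simp add: locint_def)
    have "norm (indicator (cball 0 R) x * gam x) \<le> norm (R * (indicator (cball 0 R) x * kr x))" for x :: "real^'d"
    proof (cases "x = 0 \<or> x \<notin> cball 0 R")
      case True then show ?thesis using d by (auto simp: gam_def zero_power)
    next
      case False
      then show ?thesis using gam_kr[of x] d kr_nonneg[of x]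
        by (auto simp: abs_mult gam_nonneg intro!: mult_right_mono)
    qed
    then show "AE x in lborel. norm (indicator (cball 0 R) x * gam (x::real^'d)) \<le> norm (R * (indicator (cball 0 R) x * kr x))" by simp
    show "(\<lambda>x. indicator (cball 0 R) x * gam (x::real^'d)) \<in> borel_measurable lborel"
      by (intro borel_measurable_times borel_measurable_indicator) (auto simp: gam_borel)
  qed
qed

lemma cball_borel [measurable]: "cball (a::'a::metric_space) r \<in> sets borel" by simp

section \<open>The Newton kernel as a fundamental solution\<close>

definition lapl :: "(real^'d::finite \<Rightarrow> real) \<Rightarrow> real^'d \<Rightarrow> real" where
  "lapl f x = (\<Sum>i\<in>UNIV. rpd i (rpd i f) x)"

lemma rpd_cmult: "f differentiable (at x) \<Longrightarrow> rpd i (\<lambda>x. c * f x) x = c * rpd i f x"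
  using rpd_mult[OF differentiable_const[of c], of f x i] by simp

lemma power2_powr: "0 < (t::real) \<Longrightarrow> (t^2) powr a = t powr (2 * a)"
  using powr_powr[of t 2 a] by simp

lemma rtest_lapl: "rtest f \<Longrightarrow> rtest (lapl f)"
  unfolding lapl_def[abs_def] by (intro rtest_sum rtest_rpd)
lemma sm_lapl: "sm f \<Longrightarrow> sm (lapl f)"
  unfolding lapl_def[abs_def] by (intro sm_sum sm_rpd)

lemma conv_sum: assumes "locint k" "\<And>i. i \<in> I \<Longrightarrow> rtest (f i)"
  shows "conv k (\<lambda>x. \<Sum>i\<in>I. f i x) x = (\<Sum>i\<in>I. conv k (f i) x)"
  unfolding conv_def sum_distrib_left
  by (intro Bochner_Integration.integral_sum conv_integrable assms)

lemma lapl_conv: assumes "locint k" "rtest f" shows "lapl (conv k f) = conv k (lapl f)"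
  unfolding lapl_def[abs_def] using assms
  by (auto simp: fun_eq_iff rpd_conv rtest_rpd conv_sum)

lemma conv_by_parts: assumes "sm k" "rtest g" shows "conv k (rpd i g) x = conv (rpd i k) g x"
proof -
  have t: "rtest (\<lambda>y. g (x - y))" by (rule rtest_translate(2)[OF assms(2)])
  have "(\<lambda>y. rpd i (\<lambda>y. g (x - y)) y) = (\<lambda>y. - rpd i g (x - y))"
    using rpd_translate(2)[OF rtest_sm[OF assms(2)]] by auto
  then show ?thesis using integral_by_parts[OF assms(1) rtest_sm[OF t], of i] t
    by (simp add: conv_def)
qed

text \<open>The Newton kernel with |x|^2 replaced by |x|^2 + e^2. It is smooth at the origin and
  stays below \<open>gam\<close>, so derivatives can be moved onto it freely and the limit is
  dominated.\<close>

definition gam_e :: "real \<Rightarrow> real^'d::finite \<Rightarrow> real" where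
  "gam_e e x = ((norm x)^2 + e^2) powr (1 - real CARD('d) / 2)"

lemma regq: assumes "e \<noteq> 0"
  shows "0 < (norm x)^2 + e^2" "sm (\<lambda>x. (norm x)^2 + e^2)" "rpd i (\<lambda>x. (norm x)^2 + e^2) x = 2 * x $ i"
proof -
  show "0 < (norm x)^2 + e^2" using assms by (simp add: add_nonneg_pos)
  show "sm (\<lambda>x. (norm x)^2 + e^2)" by (intro sm_add sm_const sm_norm_sq)
  show "rpd i (\<lambda>x. (norm x)^2 + e^2) x = 2 * x $ i"
    by (simp add: rpd_norm_sq rpd_add[OF sm_diff[OF sm_norm_sq] differentiable_const])
qed

lemma sm_regq_powr: assumes "e \<noteq> 0" shows "sm (\<lambda>x. ((norm x)^2 + e^2) powr p)"
  by (intro sm_powr regq assms)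

lemma rpd_regq_powr: assumes "e \<noteq> 0"
  shows "rpd i (\<lambda>x. ((norm x)^2 + e^2) powr p) x = 2 * p * x $ i * ((norm x)^2 + e^2) powr (p - 1)"
proof -
  have "rpd i (\<lambda>x. ((norm x)^2 + e^2) powr p) x = p * ((norm x)^2 + e^2) powr (p - 1) * rpd i (\<lambda>x. (norm x)^2 + e^2) x"
    by (rule rpd_chain(2)[where p="\<lambda>x. (norm x)^2 + e^2"])
      (rule has_real_derivative_powr[OF regq(1)[OF assms]], rule sm_diff[OF regq(2)[OF assms]])
  then show ?thesis by (simp only: regq(3)[OF assms]) (simp only: mult_ac)
qed

lemma sm_gam_e: "e \<noteq> 0 \<Longrightarrow> sm (gam_e e)"
  unfolding gam_e_def[abs_def] by (rule sm_regq_powr)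

lemma rpd_gam_e: assumes "e \<noteq> 0"
  shows "rpd i (gam_e e) (x::real^'d::finite) = - (real CARD('d) - 2) * x $ i * ((norm x)^2 + e^2) powr (- real CARD('d) / 2)"
proof -
  have "2 * (1 - real CARD('d) / 2) = - (real CARD('d) - 2)" "1 - real CARD('d) / 2 - 1 = - real CARD('d) / 2" by auto
  then show ?thesis unfolding gam_e_def[abs_def] rpd_regq_powr[OF assms] by (simp only:)
qed

text \<open>The two terms of order |x|^2 cancel after writing one power of |x|^2 + e^2 as a factor.
  What remains has one sign and is concentrated at scale \<open>e\<close>: a multiple of an
  approximate identity.\<close>

lemma lapl_gam_e: assumes e: "e \<noteq> 0"
  shows "lapl (gam_e e) (x::real^'d::finite) =
    - (real CARD('d) - 2) * real CARD('d) * e^2 * ((norm x)^2 + e^2) powr (- real CARD('d) / 2 - 1)"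
proof -
  have alg: "- (d - 2) * A + (- (d - 2) * y) * (2 * (- d / 2) * y * B) = - (d - 2) * (A - d * y^2 * B)" for d A B y :: real
    by (simp add: power2_eq_square algebra_simps)
  have alg2: "- (d - 2) * (d * ((n + f) * B) - d * n * B) = - (d - 2) * d * f * B" for d n f B :: real
    by (simp add: algebra_simps)
  let ?d = "real CARD('d)" and ?q = "(norm x)^2 + e^2"
  have "rpd i (rpd i (gam_e e)) x = - (?d - 2) * (?q powr (- ?d / 2) - ?d * (x $ i)^2 * ?q powr (- ?d / 2 - 1))" for i
  proof -
    have e1: "rpd i (gam_e e) = (\<lambda>x::real^'d. (- (?d - 2) * x $ i) * ((norm x)^2 + e^2) powr (- ?d / 2))"
      using rpd_gam_e[OF e] by (auto simp: fun_eq_iff)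
    have e2: "rpd i (\<lambda>x::real^'d. - (?d - 2) * x $ i) x = - (?d - 2)"
      by (subst rpd_cmult[OF sm_diff[OF sm_component]]) (simp add: rpd_component)
    have sX: "sm (\<lambda>x::real^'d. - (?d - 2) * x $ i)" by (intro sm_mult sm_const sm_component)
    have "rpd i (rpd i (gam_e e)) x = rpd i (\<lambda>x::real^'d. - (?d - 2) * x $ i) x * ?q powr (- ?d / 2)
       + (- (?d - 2) * x $ i) * rpd i (\<lambda>x::real^'d. ((norm x)^2 + e^2) powr (- ?d / 2)) x"
      unfolding e1 by (rule rpd_mult[OF sm_diff[OF sX] sm_diff[OF sm_regq_powr[OF e]]])
    also have "\<dots> = - (?d - 2) * ?q powr (- ?d / 2) + (- (?d - 2) * x $ i) * (2 * (- ?d / 2) * x $ i * ?q powr (- ?d / 2 - 1))"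
      by (simp only: e2 rpd_regq_powr[OF e])
    also have "\<dots> = - (?d - 2) * (?q powr (- ?d / 2) - ?d * (x $ i)^2 * ?q powr (- ?d / 2 - 1))"
      by (rule alg)
    finally show ?thesis .
  qed
  then have "lapl (gam_e e) x = (\<Sum>i\<in>UNIV. - (?d - 2) * (?q powr (- ?d / 2) - ?d * (x $ i)^2 * ?q powr (- ?d / 2 - 1)))"
    by (simp add: lapl_def)
  also have "\<dots> = - (?d - 2) * (?d * ?q powr (- ?d / 2) - ?d * (norm x)^2 * ?q powr (- ?d / 2 - 1))"
  proof -
    have "(\<Sum>i\<in>UNIV. A - ?d * (x $ i)^2 * B) = ?d * A - ?d * (norm x)^2 * B" for A B :: real
      unfolding norm_sq_vec[of x] by (simp add: sum_subtractf sum_distrib_left sum_distrib_right mult_ac)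
    then show ?thesis unfolding sum_distrib_left[symmetric] by simp
  qed
  also have "?q powr (- ?d / 2) = ?q * ?q powr (- ?d / 2 - 1)"
    using powr_mult_base[of ?q "- ?d / 2 - 1"] regq(1)[OF e, of x] by simp
  finally show ?thesis by (simp only: alg2)
qed

lemma regq_powr_le: assumes "x \<noteq> 0"
  shows "((norm x)^2 + e^2) powr (- real n / 2) \<le> 1 / norm x ^ n"
proof -
  have "((norm x)^2 + e^2) powr (- real n / 2) \<le> ((norm x)^2) powr (- real n / 2)"
    using assms by (intro powr_mono2') auto
  also have "((norm x)^2) powr (- real n / 2) = norm x powr (- real n)" using assms by (simp add: power2_powr)
  also have "\<dots> = 1 / norm x ^ n" using assms by (simp add: powr_minus powr_realpow divide_inverse)
  finally show ?thesis .
qed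

lemma gam_e_nonneg: "0 \<le> gam_e e x" by (simp add: gam_e_def)

lemma gam_e_le: assumes "CARD('d::finite) \<ge> 3" "x \<noteq> 0" shows "gam_e e (x::real^'d) \<le> gam x"
  using regq_powr_le[OF assms(2), of e "CARD('d) - 2"] assms(1)
  by (simp add: gam_e_def gam_def of_nat_diff diff_divide_distrib)

lemma rpd_gam_e_le: assumes d: "CARD('d::finite) \<ge> 3" and x: "x \<noteq> 0" and e: "e \<noteq> 0"
  shows "\<bar>rpd i (gam_e e) (x::real^'d)\<bar> \<le> (real CARD('d) - 2) * kr x"
proof -
  have i: "norm x ^ CARD('d) = norm x * norm x ^ (CARD('d) - 1)" using d power_Suc[of "norm x" "CARD('d) - 1"] by simp
  have "\<bar>rpd i (gam_e e) x\<bar> = (real CARD('d) - 2) * (\<bar>x $ i\<bar> * ((norm x)^2 + e^2) powr (- real CARD('d) / 2))"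
  proof -
    have "\<bar>- a * y * B\<bar> = a * (\<bar>y\<bar> * B)" if "0 \<le> a" "0 \<le> B" for a y B :: real using that by (simp add: abs_mult)
    then show ?thesis unfolding rpd_gam_e[OF e] by this (use d in auto)
  qed
  also have "\<dots> \<le> (real CARD('d) - 2) * (norm x * (1 / norm x ^ CARD('d)))"
    using d by (intro mult_left_mono mult_mono component_le_norm_cart regq_powr_le x) auto
  also have "norm x * (1 / norm x ^ CARD('d)) = kr x" unfolding kr_def i using x by simp
  finally show ?thesis .
qed

lemma gam_e_tendsto: assumes d: "CARD('d::finite) \<ge> 3" and x: "x \<noteq> 0" and e: "e \<longlonglongrightarrow> 0"
  shows "(\<lambda>n. gam_e (e n) (x::real^'d)) \<longlonglongrightarrow> gam x"
proof -
  have "(\<lambda>n. gam_e (e n) x) \<longlonglongrightarrow> ((norm x)^2 + 0^2) powr (1 - real CARD('d) / 2)"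
    unfolding gam_e_def using x by (intro tendsto_intros e) auto
  also have "((norm x)^2 + 0^2) powr (1 - real CARD('d) / 2) = gam x"
  proof -
    have "((norm x)^2 + 0^2) powr (1 - real CARD('d) / 2) = norm x powr (2 * (1 - real CARD('d) / 2))"
    proof -
      have z: "(norm x)^2 + 0^2 = (norm x)^2" by simp
      show ?thesis unfolding z by (rule power2_powr) (use x in simp)
    qed
    also have "2 * (1 - real CARD('d) / 2) = - real (CARD('d) - 2)" using d by (simp add: of_nat_diff)
    also have "norm x powr (- real (CARD('d) - 2)) = gam x" unfolding gam_def powr_minus using x by (subst powr_realpow) (auto simp: divide_inverse)
    finally show ?thesis .
  qed
  finally show ?thesis .
qed

text \<open>This is minus the Laplacian of \<open>gam_e 1\<close>; by \<open>newt_scale\<close>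
  every other \<open>e\<close> reduces to it by dilation.\<close>

definition newt :: "real^'d::finite \<Rightarrow> real" where
  "newt z = (real CARD('d) - 2) * real CARD('d) * ((norm z)^2 + 1^2) powr (- real CARD('d) / 2 - 1)"

text \<open>The constant in \<open>\<Delta> gam = - cN \<delta>\<^sub>0\<close>.\<close>

definition cN :: "'d::finite itself \<Rightarrow> real" where
  "cN _ = integral\<^sup>L lborel (newt :: real^'d \<Rightarrow> real)"

lemma newt_borel: "newt \<in> borel_measurable borel"
  unfolding newt_def[abs_def] by (intro sm_borel sm_mult sm_const sm_regq_powr) auto

lemma newt_pos: "CARD('d::finite) \<ge> 3 \<Longrightarrow> 0 < newt (z::real^'d)"
  unfolding newt_def using regq(1)[of 1 z] by auto

lemma newt_integrable: assumes d: "CARD('d::finite) \<ge> 3" shows "integrable lborel (newt :: real^'d \<Rightarrow> real)"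
proof (rule integrableI_nonneg)
  let ?c = "(real CARD('d) - 2) * real CARD('d)"
  have c: "?c \<ge> 0" using d by auto
  let ?g = "\<lambda>x::real^'d. ennreal ?c * (indicator (cball 0 1) x + indicator {x. 1 \<le> norm x} x * inverse (ennreal (norm x ^ (CARD('d) + 2))))"
  have le: "ennreal (newt x) \<le> ?g x" for x :: "real^'d"
  proof -
    let ?p = "((norm x)^2 + 1^2) powr (- real (CARD('d) + 2) / 2)"
    have "- real CARD('d) / 2 - 1 = - real (CARD('d) + 2) / 2" by simp
    then have n: "newt x = ?c * ?p" unfolding newt_def by (simp only:)
    have "ennreal ?p \<le> indicator (cball 0 1) x + indicator {x. 1 \<le> norm x} x * inverse (ennreal (norm x ^ (CARD('d) + 2)))"
    proof (cases "norm x \<le> 1")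
      case True
      have "?p \<le> 1 powr (- real (CARD('d) + 2) / 2)" by (intro powr_mono2') auto
      then have "ennreal ?p \<le> 1" by simp
      then show ?thesis using True by (auto intro: add_increasing2)
    next
      case False
      then have x0: "x \<noteq> 0" by auto
      show ?thesis using regq_powr_le[OF x0, of 1 "CARD('d) + 2"] False x0
        by (auto simp: inverse_ennreal_power simp del: power_Suc intro!: ennreal_leI)
    qed
    then show ?thesis unfolding n ennreal_mult[OF c powr_ge_zero] by (rule mult_left_mono) simp
  qed
  have "(LBNN x. ennreal (newt (x::real^'d))) \<le> (LBNN x. ?g x)" by (intro nn_integral_mono le)
  also have "\<dots> = ennreal ?c * (emeasure lborel (cball (0::real^'d) 1) + (LBNN x. indicator {x::real^'d. 1 \<le> norm x} x * inverse (ennreal (norm x ^ (CARD('d) + 2)))))"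
    by (subst nn_integral_cmult, measurable, subst nn_integral_add) auto
  also have "\<dots> < \<infinity>"
    using order.strict_trans1[OF power_outside_ball[of "CARD('d) + 2" 1, where 'd='d]] emeasure_lborel_cball_finite[of "0::real^'d" 1]
    by (auto simp: ennreal_mult_less_top)
  finally show "(LBNN x. ennreal (newt (x::real^'d))) < \<infinity>" .
qed (use newt_pos[OF d] newt_borel in \<open>auto intro: less_imp_le\<close>)

lemma cN_pos: assumes d: "CARD('d::finite) \<ge> 3" shows "cN TYPE('d) > 0"
proof -
  have "cN TYPE('d) \<ge> 0" unfolding cN_def using newt_pos[OF d] by (intro integral_nonneg_AE AE_I2) (auto intro: less_imp_le)
  moreover have "cN TYPE('d) \<noteq> 0"
  proof
    assume "cN TYPE('d) = 0"
    then have "AE x in lborel. newt (x::real^'d) = 0" unfolding cN_def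
      by (subst (asm) integral_nonneg_eq_0_iff_AE[OF newt_integrable[OF d]]) (use newt_pos[OF d] in \<open>auto intro: less_imp_le\<close>)
    then have "AE x in (lborel :: (real^'d) measure). False" by eventually_elim (metis newt_pos[OF d] less_irrefl)
    then have "emeasure lborel (UNIV :: (real^'d) set) = 0" by (subst (asm) AE_iff_measurable[of UNIV]) auto
    then show False by simp
  qed
  ultimately show ?thesis by simp
qed

lemma newt_scale: assumes e: "e > 0"
  shows "(real CARD('d) - 2) * real CARD('d) * e^2 * ((norm (e *\<^sub>R z))^2 + e^2) powr (- real CARD('d) / 2 - 1) * e ^ CARD('d) = newt (z::real^'d::finite)"
proof -
  have "(norm (e *\<^sub>R z))^2 + e^2 = e^2 * ((norm z)^2 + 1^2)" using e by (simp add: power_mult_distrib algebra_simps)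
  then have "((norm (e *\<^sub>R z))^2 + e^2) powr (- real CARD('d) / 2 - 1) = (e^2) powr (- real CARD('d) / 2 - 1) * ((norm z)^2 + 1^2) powr (- real CARD('d) / 2 - 1)"
    by (simp only: powr_mult)
  also have "(e^2) powr (- real CARD('d) / 2 - 1) = e powr (2 * (- real CARD('d) / 2 - 1))" by (rule power2_powr[OF e])
  also have "2 * (- real CARD('d) / 2 - 1) = - real CARD('d) - 2" by simp
  finally have "((norm (e *\<^sub>R z))^2 + e^2) powr (- real CARD('d) / 2 - 1) = e powr (- real CARD('d) - 2) * ((norm z)^2 + 1^2) powr (- real CARD('d) / 2 - 1)" .
  moreover have "e powr (- real CARD('d) - 2) * e ^ CARD('d) * e^2 = 1"
  proof -
    have "e ^ CARD('d) = e powr real CARD('d)" "e^2 = e powr 2" using e by (auto simp: powr_realpow)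
    then have "e powr (- real CARD('d) - 2) * e ^ CARD('d) * e^2 = e powr ((- real CARD('d) - 2) + real CARD('d) + 2)"
      by (simp only: powr_add)
    also have "(- real CARD('d) - 2) + real CARD('d) + 2 = 0" by simp
    finally show ?thesis using e by simp
  qed
  moreover have "c * d * E2 * (A * B) * E = c * d * B" if "A * E * E2 = 1" for c d E2 A B E :: real
  proof -
    have "c * d * E2 * (A * B) * E = c * d * B * (A * E * E2)" by (simp only: mult_ac)
    then show ?thesis using that by simp
  qed
  ultimately show ?thesis unfolding newt_def by (simp only:)
qed

text \<open>Both derivatives on the kernel give the approximate identity, hence the value of
  \<open>f\<close> in the limit. Only one on the kernel gives a form whose kernel is bounded by
  \<open>kr\<close> uniformly in \<open>e\<close>, hence pointwise estimates by the
  gradient.\<close>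

lemma conv_lapl_gam_e:
  assumes e: "e > 0" and f: "rtest f"
  shows "conv (gam_e e) (lapl f) x = - (LBINT z. newt z * f ((x::real^'d::finite) - e *\<^sub>R z))"
    "conv (gam_e e) (lapl f) x = (\<Sum>i\<in>UNIV. conv (rpd i (gam_e e)) (rpd i f) x)"
proof -
  have e0: "e \<noteq> 0" using e by simp
  have sg: "sm (gam_e e :: real^'d \<Rightarrow> real)" by (rule sm_gam_e[OF e0])
  have li: "locint (gam_e e :: real^'d \<Rightarrow> real)" by (intro locint_cont sm_cont sg)
  have 1: "conv (gam_e e) (lapl f) x = (\<Sum>i\<in>UNIV. conv (gam_e e) (rpd i (rpd i f)) x)"
    unfolding lapl_def[abs_def] by (intro conv_sum li rtest_rpd f)
  then show 2: "conv (gam_e e) (lapl f) x = (\<Sum>i\<in>UNIV. conv (rpd i (gam_e e)) (rpd i f) x)"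
    using conv_by_parts[OF sg rtest_rpd[OF f]] by simp
  have "\<dots> = (\<Sum>i\<in>UNIV. conv (rpd i (rpd i (gam_e e))) f x)"
    using conv_by_parts[OF sm_rpd[OF sg] f] by simp
  also have "\<dots> = (LBINT y. lapl (gam_e e) y * f (x - y))"
    unfolding conv_def lapl_def sum_distrib_right
    by (intro Bochner_Integration.integral_sum[symmetric] conv_integrable f locint_cont sm_cont sm_rpd sg)
  also have "\<dots> = (LBINT y. - (real CARD('d) - 2) * real CARD('d) * e^2 * ((norm y)^2 + e^2) powr (- real CARD('d) / 2 - 1) * f (x - y))"
    by (simp only: lapl_gam_e[OF e0])
  also have "\<dots> = \<bar>e\<bar> ^ CARD('d) * (LBINT z. - (real CARD('d) - 2) * real CARD('d) * e^2 * ((norm (0 + e *\<^sub>R z))^2 + e^2) powr (- real CARD('d) / 2 - 1) * f (x - (0 + e *\<^sub>R z)))"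
    by (rule integral_affine[OF _ e0]) (intro sm_borel sm_mult sm_const sm_regq_powr e0 sm_translate rtest_sm[OF f])
  also have "\<dots> = (LBINT z. - (newt z * f (x - e *\<^sub>R z)))"
    using e by (subst integral_mult_right_zero[symmetric]) (intro Bochner_Integration.integral_cong, simp, subst newt_scale[OF e, symmetric], simp add: algebra_simps)
  finally show "conv (gam_e e) (lapl f) x = - (LBINT z. newt z * f (x - e *\<^sub>R z))" using 2 by simp
qed

lemma tendsto_conv_gam_e:
  assumes d: "CARD('d::finite) \<ge> 3" and g: "rtest g" and e: "e \<longlonglongrightarrow> 0" "\<And>n. e n \<noteq> 0"
  shows "(\<lambda>n. conv (gam_e (e n)) g (x::real^'d)) \<longlonglongrightarrow> conv gam g x"
  unfolding conv_def
proof (rule integral_dominated_convergence[where w="\<lambda>y. \<bar>gam y * g (x - y)\<bar>"])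
  have [measurable]: "g \<in> borel_measurable borel" by (rule sm_borel[OF rtest_sm[OF g]])
  show "(\<lambda>y. gam_e (e n) y * g (x - y)) \<in> borel_measurable lborel" for n
    using sm_borel[OF sm_gam_e[OF e(2)]] by measurable
  show "(\<lambda>y. gam y * g (x - y)) \<in> borel_measurable lborel" by measurable
  show "integrable lborel (\<lambda>y. \<bar>gam y * g (x - y)\<bar>)" by (intro integrable_abs conv_integrable locint_gam d g)
  show "AE y in lborel. (\<lambda>n. gam_e (e n) y * g (x - y)) \<longlonglongrightarrow> gam y * g (x - y)"
    using AE_neq[of 0] by eventually_elim (intro tendsto_intros gam_e_tendsto d e)
  show "AE y in lborel. norm (gam_e (e n) y * g (x - y)) \<le> \<bar>gam y * g (x - y)\<bar>" for n
    using AE_neq[of 0] by eventually_elim (auto simp: abs_mult gam_e_nonneg gam_nonneg intro!: mult_right_mono gam_e_le d)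
qed

lemma fundamental_solution:
  assumes d: "CARD('d::finite) \<ge> 3" and f: "rtest f"
  shows "conv gam (lapl f) x = - cN TYPE('d) * f (x::real^'d)"
proof -
  define e where "e n = inverse (real (Suc n))" for n
  have e: "e n > 0" for n by (simp add: e_def)
  have el: "e \<longlonglongrightarrow> 0" unfolding e_def by (rule LIMSEQ_inverse_real_of_nat)
  obtain M where M: "M > 0" "\<And>x. \<bar>f x\<bar> \<le> M" using rtest_bounded[OF f] by metis
  have [measurable]: "f \<in> borel_measurable borel" "newt \<in> borel_measurable borel"
    by (auto intro: sm_borel[OF rtest_sm[OF f]] newt_borel)
  have l1: "(\<lambda>n. conv (gam_e (e n)) (lapl f) x) \<longlonglongrightarrow> conv gam (lapl f) x"
    using e by (intro tendsto_conv_gam_e d rtest_lapl f el) (auto simp: less_imp_neq[symmetric])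
  have "(\<lambda>n. (LBINT z. newt z * f (x - e n *\<^sub>R z))) \<longlonglongrightarrow> (LBINT z. newt (z::real^'d) * f x)"
  proof (rule integral_dominated_convergence[where w="\<lambda>z. newt z * M"])
    show "integrable lborel (\<lambda>z::real^'d. newt z * M)" using newt_integrable[OF d] by simp
    have "(\<lambda>n. f (x - e n *\<^sub>R z)) \<longlonglongrightarrow> f x" for z
    proof (rule isCont_tendsto_compose[where g=f])
      show "isCont f x" using sm_cont[OF rtest_sm[OF f], of UNIV] by (simp add: continuous_on_eq_continuous_at)
      have "(\<lambda>n. x - e n *\<^sub>R z) \<longlonglongrightarrow> x - 0 *\<^sub>R z" by (intro tendsto_intros el)
      then show "(\<lambda>n. x - e n *\<^sub>R z) \<longlonglongrightarrow> x" by simp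
    qed
    then show "AE z in lborel. (\<lambda>n. newt z * f (x - e n *\<^sub>R z)) \<longlonglongrightarrow> newt (z::real^'d) * f x" by (intro AE_I2 tendsto_intros)
    show "AE z in lborel. norm (newt z * f (x - e n *\<^sub>R z)) \<le> newt (z::real^'d) * M" for n
      using newt_pos[OF d] M(2) by (intro AE_I2) (auto simp: abs_mult less_imp_le intro!: mult_left_mono)
  qed measurable
  then have "(\<lambda>n. - (LBINT z. newt z * f (x - e n *\<^sub>R z))) \<longlonglongrightarrow> - (LBINT z. newt (z::real^'d) * f x)" by (rule tendsto_minus)
  then have l2: "(\<lambda>n. conv (gam_e (e n)) (lapl f) x) \<longlonglongrightarrow> - (LBINT z. newt (z::real^'d) * f x)"
    using conv_lapl_gam_e(1)[OF e f] by simp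
  show ?thesis using LIMSEQ_unique[OF l1 l2] by (simp add: cN_def)
qed

lemma conv_rpd_gam_e_le:
  assumes d: "CARD('d::finite) \<ge> 3" and e: "e \<noteq> 0" and g: "rtest g"
  shows "\<bar>conv (rpd i (gam_e e)) g (x::real^'d)\<bar> \<le> (real CARD('d) - 2) * (LBINT y. kr y * \<bar>g (x - y)\<bar>)"
proof -
  have [measurable]: "g \<in> borel_measurable borel" by (rule sm_borel[OF rtest_sm[OF g]])
  have li: "locint (kr :: real^'d \<Rightarrow> real)" using d by (intro locint_kr) auto
  have i: "integrable lborel (\<lambda>y. kr y * \<bar>g (x - y)\<bar>)"
    using integrable_abs[OF conv_integrable[OF li g, of x]] by (simp add: abs_mult kr_nonneg)
  have ii: "integrable lborel (\<lambda>y. rpd i (gam_e e) y * g (x - y))"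
    by (intro conv_integrable g locint_cont sm_cont sm_rpd sm_gam_e e)
  have "\<bar>conv (rpd i (gam_e e)) g x\<bar> \<le> (LBINT y. \<bar>rpd i (gam_e e) y * g (x - y)\<bar>)"
    unfolding conv_def by (rule integral_abs_bound)
  also have "\<dots> \<le> (LBINT y. (real CARD('d) - 2) * (kr y * \<bar>g (x - y)\<bar>))"
  proof (rule integral_mono_AE)
    show "AE y in lborel. \<bar>rpd i (gam_e e) y * g (x - y)\<bar> \<le> (real CARD('d) - 2) * (kr y * \<bar>g (x - y)\<bar>)"
      using AE_neq[of 0]
    proof eventually_elim
      case (elim y)
      show ?case using mult_right_mono[OF rpd_gam_e_le[OF d elim e, of i], of "\<bar>g (x - y)\<bar>"] by (simp add: abs_mult mult.assoc)
    qed
  qed (use i ii in \<open>auto intro: integrable_abs\<close>)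
  finally show ?thesis by simp
qed

text \<open>The gradient form of \<open>conv_lapl_gam_e\<close> in the limit
  \<open>e \<longlonglongrightarrow> 0\<close>; the bound on the regularised kernels does not depend
  on \<open>e\<close>. In terms of \<open>I1\<close> it controls a test function by the Riesz
  potential of its gradient.\<close>

lemma rtest_le_kr_grad:
  assumes d: "CARD('d::finite) \<ge> 3" and f: "rtest f"
  shows "cN TYPE('d) * \<bar>f (x::real^'d)\<bar> \<le> (real CARD('d) - 2) * (\<Sum>i\<in>UNIV. (LBINT y. kr y * \<bar>rpd i f (x - y)\<bar>))"
proof -
  define e where "e n = inverse (real (Suc n))" for n
  have e: "e n > 0" "e n \<noteq> 0" for n by (auto simp: e_def)
  have el: "e \<longlonglongrightarrow> 0" unfolding e_def by (rule LIMSEQ_inverse_real_of_nat)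
  have "(\<lambda>n. \<bar>conv (gam_e (e n)) (lapl f) x\<bar>) \<longlonglongrightarrow> \<bar>conv gam (lapl f) x\<bar>"
    by (intro tendsto_rabs tendsto_conv_gam_e d rtest_lapl f el e)
  moreover have "\<bar>conv (gam_e (e n)) (lapl f) x\<bar> \<le> (real CARD('d) - 2) * (\<Sum>i\<in>UNIV. (LBINT y. kr y * \<bar>rpd i f (x - y)\<bar>))" for n
    unfolding conv_lapl_gam_e(2)[OF e(1) f] sum_distrib_left
    by (intro order_trans[OF sum_abs] sum_mono conv_rpd_gam_e_le d e rtest_rpd f)
  ultimately have "\<bar>conv gam (lapl f) x\<bar> \<le> (real CARD('d) - 2) * (\<Sum>i\<in>UNIV. (LBINT y. kr y * \<bar>rpd i f (x - y)\<bar>))"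
    by (intro tendsto_upperbound[where F=sequentially]) auto
  then show ?thesis using cN_pos[OF d] unfolding fundamental_solution[OF d f] by (simp add: abs_mult)
qed

lemma rpd_potential_le:
  assumes d: "CARD('d::finite) \<ge> 3" and f: "rtest f"
  shows "\<bar>rpd i (conv gam f) (x::real^'d)\<bar> \<le> (real CARD('d) - 2) * (LBINT y. kr y * \<bar>f (x - y)\<bar>)"
proof -
  define e where "e n = inverse (real (Suc n))" for n
  have e: "e n \<noteq> 0" for n by (auto simp: e_def)
  have el: "e \<longlonglongrightarrow> 0" unfolding e_def by (rule LIMSEQ_inverse_real_of_nat)
  have "(\<lambda>n. \<bar>conv (gam_e (e n)) (rpd i f) x\<bar>) \<longlonglongrightarrow> \<bar>conv gam (rpd i f) x\<bar>"
    by (intro tendsto_rabs tendsto_conv_gam_e d rtest_rpd f el e)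
  moreover have "\<bar>conv (gam_e (e n)) (rpd i f) x\<bar> \<le> (real CARD('d) - 2) * (LBINT y. kr y * \<bar>f (x - y)\<bar>)" for n
    unfolding conv_by_parts[OF sm_gam_e[OF e] f] by (intro conv_rpd_gam_e_le d e f)
  ultimately have "\<bar>conv gam (rpd i f) x\<bar> \<le> (real CARD('d) - 2) * (LBINT y. kr y * \<bar>f (x - y)\<bar>)"
    by (intro tendsto_upperbound[where F=sequentially]) auto
  then show ?thesis by (simp add: rpd_conv[OF locint_gam[OF d] f])
qed

text \<open>If x - y lies in the support of \<open>f\<close>, then y has at least half the norm of
  x, so the kernel can be taken out of the integral. The decay makes cutoff errors vanish in
  \<open>potential_trace\<close>.\<close>

lemma potential_decay:
  assumes d: "CARD('d::finite) \<ge> 3" and f: "rtest f" and R: "vanish R f" "R > 0" and x: "2 * R \<le> norm (x::real^'d)"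
  shows "\<bar>conv gam f x\<bar> \<le> (2 / norm x) ^ (CARD('d) - 2) * (LBINT y. \<bar>f y\<bar>)"
proof -
  have [measurable]: "f \<in> borel_measurable borel" by (rule sm_borel[OF rtest_sm[OF f]])
  have i: "integrable lborel (\<lambda>y. \<bar>f (x - y)\<bar>)" by (intro integrable_abs rtest_integrable rtest_translate f)
  have "\<bar>conv gam f x\<bar> \<le> (LBINT y. (2 / norm x) ^ (CARD('d) - 2) * \<bar>f (x - y)\<bar>)"
    unfolding conv_def
  proof (rule integral_abs_le)
    show "\<bar>gam y * f (x - y)\<bar> \<le> (2 / norm x) ^ (CARD('d) - 2) * \<bar>f (x - y)\<bar>" for y
    proof (cases "norm (x - y) \<le> R")
      case True
      have y: "norm x / 2 \<le> norm y" "0 < norm x / 2" using True x R(2) norm_triangle_ineq[of "x - y" y] by auto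
      have "gam y \<le> (2 / norm x) ^ (CARD('d) - 2)"
      proof -
        have "gam y \<le> 1 / (norm x / 2) ^ (CARD('d) - 2)" unfolding gam_def
          using y by (intro divide_left_mono power_mono mult_pos_pos zero_less_power) (auto intro: less_le_trans)
        then show ?thesis by (simp add: power_divide)
      qed
      then show ?thesis by (simp add: abs_mult gam_nonneg mult_right_mono)
    next
      case False then show ?thesis using R(1) by (simp add: vanish_def)
    qed
  qed (use i in auto)
  also have "\<dots> = (2 / norm x) ^ (CARD('d) - 2) * (LBINT y. \<bar>f y\<bar>)"
    using integral_shift(3)[of "\<lambda>y. \<bar>f y\<bar>" x] by simp
  finally show ?thesis .
qed

section \<open>Trace inequalities for positive measures\<close>

definition I1 :: "(real^'d::finite \<Rightarrow> ennreal) \<Rightarrow> real^'d \<Rightarrow> ennreal" where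
  "I1 f x = (LBNN y. kk (x - y) * f y)"

lemma I1_borel [measurable]: assumes [measurable]: "f \<in> borel_measurable borel" shows "I1 f \<in> borel_measurable borel"
  unfolding I1_def[abs_def] by measurable

lemma kk_sym: "kk (x - y) = kk (y - x)" by (simp add: kk_def norm_minus_commute)

lemma I1_mono: "(\<And>x. f x \<le> g x) \<Longrightarrow> I1 f x \<le> I1 g x"
  unfolding I1_def by (intro nn_integral_mono mult_left_mono) auto

lemma I1_cmult: "f \<in> borel_measurable borel \<Longrightarrow> I1 (\<lambda>x. c * f x) x = c * I1 f x"
  unfolding I1_def by (subst nn_integral_cmult[symmetric]) (auto simp: mult_ac)

lemma I1_symmetric:
  assumes [measurable]: "f \<in> borel_measurable borel" "g \<in> borel_measurable borel"
  shows "(LBNN x. f x * I1 g x) = (LBNN x. I1 f x * g x)"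
proof -
  have "(LBNN x. f x * I1 g x) = (LBNN x. (LBNN y. f x * (kk (x - y) * g y)))"
    unfolding I1_def by (intro nn_integral_cong nn_integral_cmult[symmetric]) measurable
  also have "\<dots> = (LBNN y. (LBNN x. f x * (kk (x - y) * g y)))"
    by (rule lborel_pair.Fubini') measurable
  also have "\<dots> = (LBNN y. (LBNN x. (kk (y - x) * f x) * g y))"
    by (intro nn_integral_cong) (simp add: kk_sym mult_ac)
  also have "\<dots> = (LBNN y. I1 f y * g y)"
    unfolding I1_def by (intro nn_integral_cong nn_integral_multc) measurable
  finally show ?thesis .
qed

lemma kk_half:
  assumes d: "CARD('d::finite) \<ge> 2" and le: "norm (b::real^'d) \<le> 2 * norm (a::real^'d)"
  shows "kk a \<le> ennreal (2 ^ (CARD('d) - 1)) * kk b"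
proof (cases "b = 0")
  case True
  then have "kk b = \<infinity>" using d by (simp add: kk_def zero_power)
  then show ?thesis by (simp add: ennreal_mult_top)
next
  case False
  then have a: "a \<noteq> 0" and nb: "norm b > 0" using le by auto
  have "kr a \<le> 1 / (norm b / 2) ^ (CARD('d) - 1)" unfolding kr_def
    using le nb a by (intro divide_left_mono power_mono mult_pos_pos zero_less_power) auto
  also have "\<dots> = 2 ^ (CARD('d) - 1) * kr b" by (simp add: kr_def power_divide)
  finally show ?thesis unfolding kk_kr[OF a] kk_kr[OF False]
    by (subst ennreal_mult[symmetric]) (auto simp: kr_nonneg intro!: ennreal_leI)
qed

lemma nn_integral_product:
  assumes [measurable]: "a \<in> borel_measurable borel" "b \<in> borel_measurable borel"
  shows "(LBNN y. a y) * (LBNN z. b z) = (LBNN y. (LBNN z. a y * b z))"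
proof -
  have "(LBNN y. (LBNN z. a y * b z)) = (LBNN y. a y * (LBNN z. b z))"
    by (intro nn_integral_cong nn_integral_cmult) measurable
  also have "\<dots> = (LBNN y. a y) * (LBNN z. b z)" by (rule nn_integral_multc) measurable
  finally show ?thesis by simp
qed

text \<open>Of two points y and z, the one farther from x is at distance at least half of
  \<open>norm (y - z)\<close>, so its kernel may be exchanged for \<open>kk (y - z)\<close>. The two
  cases contribute equally, 2^(d - 1) each.\<close>

lemma I1_square_le:
  assumes d: "CARD('d::finite) \<ge> 2" and [measurable]: "f \<in> borel_measurable borel"
  shows "(I1 f x)^2 \<le> ennreal (2 ^ CARD('d)) * I1 (\<lambda>y. f y * I1 f y) (x::real^'d)"
proof -
  let ?c = "ennreal (2 ^ (CARD('d) - 1))"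
  have pw: "kk (x - y) * kk (x - z) \<le> ?c * (kk (x - y) * kk (y - z)) + ?c * (kk (x - z) * kk (z - y))" for y z
  proof (cases "norm (x - z) \<le> norm (x - y)")
    case True
    then have "norm (z - y) \<le> 2 * norm (x - y)" using norm_triangle_ineq4[of "x - y" "x - z"] by simp
    from kk_half[OF d this] have "kk (x - z) * kk (x - y) \<le> kk (x - z) * (?c * kk (z - y))" by (intro mult_left_mono) auto
    then have "kk (x - y) * kk (x - z) \<le> ?c * (kk (x - z) * kk (z - y))" by (simp only: mult_ac)
    then show ?thesis by (rule add_increasing[OF zero_le])
  next
    case False
    then have "norm (y - z) \<le> 2 * norm (x - z)" using norm_triangle_ineq4[of "x - z" "x - y"] by simp
    from kk_half[OF d this] have "kk (x - y) * kk (x - z) \<le> kk (x - y) * (?c * kk (y - z))" by (intro mult_left_mono) auto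
    then have "kk (x - y) * kk (x - z) \<le> ?c * (kk (x - y) * kk (y - z))" by (simp only: mult_ac)
    then show ?thesis by (rule add_increasing2[OF zero_le])
  qed
  let ?J = "\<lambda>y z. kk (x - y) * (f y * (kk (y - z) * f z))"
  have J: "(LBNN y. (LBNN z. ?J y z)) = I1 (\<lambda>y. f y * I1 f y) x"
    unfolding I1_def by (intro nn_integral_cong) (simp add: nn_integral_cmult)
  have "(I1 f x)^2 = (LBNN y. (LBNN z. (kk (x - y) * f y) * (kk (x - z) * f z)))"
    unfolding power2_eq_square I1_def by (rule nn_integral_product) measurable
  also have "\<dots> \<le> (LBNN y. (LBNN z. ?c * ?J y z + ?c * ?J z y))"
  proof (intro nn_integral_mono)
    fix y z
    have "(kk (x - y) * f y) * (kk (x - z) * f z) = (kk (x - y) * kk (x - z)) * (f y * f z)" by (simp only: mult_ac)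
    also have "\<dots> \<le> (?c * (kk (x - y) * kk (y - z)) + ?c * (kk (x - z) * kk (z - y))) * (f y * f z)"
      by (intro mult_right_mono pw) auto
    also have "\<dots> = ?c * ?J y z + ?c * ?J z y" unfolding distrib_right by (simp only: mult_ac)
    finally show "(kk (x - y) * f y) * (kk (x - z) * f z) \<le> ?c * ?J y z + ?c * ?J z y" .
  qed
  also have "\<dots> = (LBNN y. (LBNN z. ?c * ?J y z)) + (LBNN y. (LBNN z. ?c * ?J z y))"
    by (simp add: nn_integral_add)
  also have "(LBNN y. (LBNN z. ?c * ?J z y)) = (LBNN z. (LBNN y. ?c * ?J z y))"
    by (rule lborel_pair.Fubini') measurable
  also have "(LBNN y. (LBNN z. ?c * ?J y z)) = ?c * I1 (\<lambda>y. f y * I1 f y) x"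
    unfolding J[symmetric] by (simp add: nn_integral_cmult)
  also have "?c * I1 (\<lambda>y. f y * I1 f y) x + ?c * I1 (\<lambda>y. f y * I1 f y) x = (?c + ?c) * I1 (\<lambda>y. f y * I1 f y) x"
    by (simp add: distrib_right)
  also have "?c + ?c = ennreal (2 ^ CARD('d))"
  proof -
    have "(2::real) ^ CARD('d) = 2 ^ (CARD('d) - 1) + 2 ^ (CARD('d) - 1)"
      using d power_Suc[of "2::real" "CARD('d) - 1"] by simp
    then show ?thesis by (simp add: ennreal_plus[symmetric] del: ennreal_plus)
  qed
  finally show ?thesis .
qed

section \<open>Scaled cutoffs and the trace condition\<close>

lemma dir_scale:
  assumes f: "rtest (f :: real^'d::finite \<Rightarrow> real)" and r: "r > 0" and d: "CARD('d) \<ge> 2"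
  shows "dir (\<lambda>z. f ((1 / r) *\<^sub>R z + a)) = r ^ (CARD('d) - 2) * dir f"
proof -
  let ?h = "\<lambda>x. \<Sum>j\<in>UNIV. (rpd j f x)^2"
  have "dir (\<lambda>z. f ((1 / r) *\<^sub>R z + a)) = (LBINT z. (1 / r)^2 * ?h (a + (1 / r) *\<^sub>R z))"
    unfolding dir_def using rpd_affine(2)[OF sm_diff[OF rtest_sm[OF f]], where c="1/r" and a=a]
    by (intro Bochner_Integration.integral_cong) (auto simp: power_mult_distrib sum_distrib_left add.commute power_divide)
  also have "\<dots> = (1 / r)^2 * (LBINT z. ?h (a + (1 / r) *\<^sub>R z))" by simp
  also have "(LBINT z. ?h (a + (1 / r) *\<^sub>R z)) = r ^ CARD('d) * dir f"
  proof -
    have "dir f = \<bar>1 / r\<bar> ^ CARD('d) * (LBINT z. ?h (a + (1 / r) *\<^sub>R z))"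
      unfolding dir_def by (rule integral_affine[OF sm_borel[OF rtest_sm[OF rtest_grad_sq[OF f]]]]) (use r in auto)
    then have "r ^ CARD('d) * dir f = (r * \<bar>1 / r\<bar>) ^ CARD('d) * (LBINT z. ?h (a + (1 / r) *\<^sub>R z))"
      by (simp only: power_mult_distrib mult.assoc)
    then show ?thesis using r by simp
  qed
  also have "(1 / r)^2 * (r ^ CARD('d) * dir f) = r ^ (CARD('d) - 2) * dir f"
  proof -
    have "r ^ CARD('d) = r^2 * r ^ (CARD('d) - 2)" using power_add[of r 2 "CARD('d) - 2", unfolded le_add_diff_inverse[OF d]] .
    then show ?thesis using r by (simp add: power_divide)
  qed
  finally show ?thesis .
qed

text \<open>Written as a multiple of x plus a constant so that \<open>rtest_affine\<close> and
  \<open>dir_scale\<close> apply literally; \<open>cutat_eq\<close> is the geometric form.\<close>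

definition cutat :: "real^'d::finite \<Rightarrow> real \<Rightarrow> real^'d \<Rightarrow> real" where
  "cutat a r x = cutoff ((1 / r) *\<^sub>R x + (- (1 / r)) *\<^sub>R a)"

lemma cutat_eq: "cutat a r x = cutoff ((1 / r) *\<^sub>R (x - a))" by (simp add: cutat_def algebra_simps)
lemma cutat_rtest: "r > 0 \<Longrightarrow> rtest (cutat a r)"
  unfolding cutat_def[abs_def] by (rule rtest_affine[OF rtest_cutoff]) auto
lemma cutat_range: "0 \<le> cutat a r x" "cutat a r x \<le> 1" by (simp_all add: cutat_def cutoff_range)
lemma cutat_one: "r > 0 \<Longrightarrow> norm (x - a) \<le> r \<Longrightarrow> cutat a r x = 1"
  unfolding cutat_eq by (rule cutoff_one) (simp add: divide_le_eq del: scaleR_right_diff_distrib)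
lemma cutat_zero: "r > 0 \<Longrightarrow> 2 * r \<le> norm (x - a) \<Longrightarrow> cutat a r x = 0"
  unfolding cutat_eq by (rule cutoff_zero) (simp add: le_divide_eq del: scaleR_right_diff_distrib)
lemma dir_cutat: "r > 0 \<Longrightarrow> CARD('d::finite) \<ge> 2 \<Longrightarrow> dir (cutat (a::real^'d) r) = r ^ (CARD('d) - 2) * dir (cutoff :: real^'d \<Rightarrow> real)"
  unfolding cutat_def[abs_def] by (rule dir_scale[OF rtest_cutoff])

lemma cutat_grad_zero: assumes "r > 0" "norm (x - a) < r" shows "rpd j (cutat a r) x = 0"
proof -
  have "((\<lambda>x. 1) has_derivative (\<lambda>x. 0)) (at x)" by simp
  then have "(cutat a r has_derivative (\<lambda>x. 0)) (at x)"
  proof (rule has_derivative_transform_within_open)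
    show "open (ball a r)" "x \<in> ball a r" using assms by (auto simp: dist_norm norm_minus_commute)
    show "1 = cutat a r y" if "y \<in> ball a r" for y
      using that cutat_one[OF assms(1), of y a] by (simp add: dist_norm norm_minus_commute)
  qed
  from rpd_eqI[OF this] show ?thesis by simp
qed

text \<open>Measures are represented by smooth compactly supported densities. Regularity and support
  will only guarantee finiteness; the estimates depend on the density through \<open>K\<close>
  alone.\<close>

definition trace_on :: "real \<Rightarrow> (real^'d::finite \<Rightarrow> real) \<Rightarrow> bool" where
  "trace_on K \<mu> \<longleftrightarrow> rtest \<mu> \<and> (\<forall>x. 0 \<le> \<mu> x) \<and> (\<forall>v. rtest v \<longrightarrow> (LBINT x. (v x)^2 * \<mu> x) \<le> K * dir v)"

text \<open>The trace inequality is tested with the cutoff of scale r, whose energy scales like r^(d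
  - 2).\<close>

lemma trace_growth:
  assumes d: "CARD('d::finite) \<ge> 2" and t: "trace_on K (\<mu> :: real^'d \<Rightarrow> real)" and r: "r > 0"
  shows "(LBNN z. indicator {z. norm (z - x) \<le> r} z * ennreal (\<mu> z)) \<le> ennreal (K * dir (cutoff :: real^'d \<Rightarrow> real) * r ^ (CARD('d) - 2))"
proof -
  have mu: "rtest \<mu>" "\<And>x. 0 \<le> \<mu> x" using t by (auto simp: trace_on_def)
  have c: "rtest (cutat x r)" using cutat_rtest r by blast
  have "(LBNN z. indicator {z. norm (z - x) \<le> r} z * ennreal (\<mu> z)) \<le> (LBNN z. ennreal ((cutat x r z)^2 * \<mu> z))"
  proof (intro nn_integral_mono)
    fix z show "indicator {z. norm (z - x) \<le> r} z * ennreal (\<mu> z) \<le> ennreal ((cutat x r z)^2 * \<mu> z)"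
      using cutat_one[OF r, of z x] by (cases "norm (z - x) \<le> r") auto
  qed
  also have "\<dots> = ennreal (LBINT z. (cutat x r z)^2 * \<mu> z)"
    by (intro nn_integral_eq_integral rtest_integrable rtest_mult1 rtest_power2 c rtest_sm[OF mu(1)]) (use mu(2) in auto)
  also have "\<dots> \<le> ennreal (K * dir (cutat x r))" using t c by (intro ennreal_leI) (auto simp: trace_on_def)
  finally show ?thesis using dir_cutat[OF r d, of x] by (simp add: mult_ac)
qed

text \<open>Pointwise, |grad (s \<theta>)|^2 = grad s . grad (s \<theta>^2) + s^2 |grad \<theta>|^2,
  and the first term is integrated by parts. This admits functions \<open>s\<close> without compact
  support into the trace inequality.\<close>

lemma dir_mult:
  assumes s: "sm s" and t: "rtest \<theta>"
  shows "dir (\<lambda>x. s x * \<theta> x) = - (LBINT x. lapl s x * (s x * (\<theta> x)^2)) + (LBINT x. (s x)^2 * gsq \<theta> x)"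
proof -
  have st: "sm \<theta>" by (rule rtest_sm[OF t])
  have t2: "rtest (\<lambda>x. s x * (\<theta> x)^2)" by (intro rtest_mult2 s rtest_power2 t)
  have r2: "rpd j (\<lambda>x. (\<theta> x)^2) x = 2 * \<theta> x * rpd j \<theta> x" for j x
    using rpd_mult[OF sm_diff[OF st] sm_diff[OF st]] by (simp add: power2_eq_square)
  have e1: "rpd j (\<lambda>x. s x * \<theta> x) x = rpd j s x * \<theta> x + s x * rpd j \<theta> x" for j x
    by (rule rpd_mult[OF sm_diff[OF s] sm_diff[OF st]])
  have e2: "rpd j (\<lambda>x. s x * (\<theta> x)^2) x = rpd j s x * (\<theta> x)^2 + s x * (2 * \<theta> x * rpd j \<theta> x)" for j x
    using rpd_mult[OF sm_diff[OF s] sm_diff[OF rtest_sm[OF rtest_power2[OF t]]]] by (simp add: r2)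
  have i1: "integrable lborel (\<lambda>x. \<Sum>j\<in>UNIV. rpd j s x * rpd j (\<lambda>x. s x * (\<theta> x)^2) x)"
    by (intro rtest_integrable rtest_sum rtest_mult2 sm_rpd s rtest_rpd t2)
  have i2: "integrable lborel (\<lambda>x. (s x)^2 * gsq \<theta> x)"
    by (intro rtest_integrable rtest_mult2 sm_power s rtest_grad_sq t)
  have "dir (\<lambda>x. s x * \<theta> x) = (LBINT x. (\<Sum>j\<in>UNIV. rpd j s x * rpd j (\<lambda>x. s x * (\<theta> x)^2) x) + (s x)^2 * gsq \<theta> x)"
    unfolding dir_def e1 e2 sum_distrib_left sum.distrib[symmetric]
    by (intro Bochner_Integration.integral_cong sum.cong refl) (simp add: power2_eq_square algebra_simps)
  also have "\<dots> = (LBINT x. (\<Sum>j\<in>UNIV. rpd j s x * rpd j (\<lambda>x. s x * (\<theta> x)^2) x)) + (LBINT x. (s x)^2 * gsq \<theta> x)"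
    by (rule Bochner_Integration.integral_add[OF i1 i2])
  also have "(LBINT x. (\<Sum>j\<in>UNIV. rpd j s x * rpd j (\<lambda>x. s x * (\<theta> x)^2) x)) = (\<Sum>j\<in>UNIV. (LBINT x. rpd j s x * rpd j (\<lambda>x. s x * (\<theta> x)^2) x))"
    by (intro Bochner_Integration.integral_sum rtest_integrable rtest_mult2 sm_rpd s rtest_rpd t2)
  also have "\<dots> = (\<Sum>j\<in>UNIV. - (LBINT x. rpd j (rpd j s) x * (s x * (\<theta> x)^2)))"
    by (intro sum.cong refl integral_by_parts sm_rpd s rtest_sm[OF t2] disjI2 t2)
  also have "\<dots> = - (LBINT x. lapl s x * (s x * (\<theta> x)^2))"
    unfolding lapl_def sum_distrib_right sum_negf
    by (subst Bochner_Integration.integral_sum) (auto intro!: rtest_integrable rtest_mult2 sm_rpd s t2)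
  finally show ?thesis .
qed

text \<open>Let s be the potential of \<nu> = \<eta> \<mu>. The trace inequality for s bounds X =
  \<integral> s^2 \<mu> by K times its energy, which is \<open>cN\<close> times S = \<integral> s
  \<nu>. Cauchy-Schwarz in L2(\<mu>) gives S^2 \<le> X Y with Y = \<integral> \<eta>^2 \<mu>, and S
  cancels.\<close>

lemma potential_trace:
  assumes d: "CARD('d::finite) \<ge> 3" and t: "trace_on K (\<mu> :: real^'d \<Rightarrow> real)" and K: "K \<ge> 0"
    and chi: "rtest \<eta>" "\<And>x. 0 \<le> \<eta> x"
  shows "(LBINT x. conv gam (\<lambda>y. \<eta> y * \<mu> y) x * (\<eta> x * \<mu> x)) \<le> K * cN TYPE('d) * (LBINT x. (\<eta> x)^2 * \<mu> x)"
proof -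
  have mu: "rtest \<mu>" "\<And>x. 0 \<le> \<mu> x" using t by (auto simp: trace_on_def)
  define \<nu> where "\<nu> y = \<eta> y * \<mu> y" for y
  have nu: "rtest \<nu>" unfolding \<nu>_def[abs_def] by (intro rtest_mult1 chi rtest_sm[OF mu(1)])
  define s where "s = conv gam \<nu>"
  have s: "sm s" unfolding s_def by (intro sm_conv locint_gam d nu)
  have ls: "lapl s x = - cN TYPE('d) * \<nu> x" for x
    unfolding s_def lapl_conv[OF locint_gam[OF d] nu] by (rule fundamental_solution[OF d nu])
  obtain R0 where R0: "R0 > 0" "vanish R0 \<mu>" using rtestE[OF mu(1)] by metis
  have nv: "vanish R0 \<nu>" using R0(2) by (auto simp: vanish_def \<nu>_def)
  define A where "A = (LBINT y. \<bar>\<nu> y\<bar>)"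
  define B where "B = (2 ^ (CARD('d) - 2) * A)^2 * dir (cutoff :: real^'d \<Rightarrow> real)"
  let ?S = "LBINT x. s x * \<nu> x" and ?X = "LBINT x. (s x)^2 * \<mu> x"
  \<comment> \<open>The error of cutting off at radius R is s^2, of size R^(4 - 2d), times the
    energy R^(d - 2) of the cutoff; it vanishes as R grows.\<close>
  have b: "?X \<le> K * (cN TYPE('d) * ?S + B * (1 / R ^ (CARD('d) - 2)))" if R: "R \<ge> 2 * R0" for R
  proof -
    have Rp: "R > 0" "R \<ge> R0" using R R0 by auto
    let ?th = "cutat 0 R :: real^'d \<Rightarrow> real"
    have th: "rtest ?th" by (rule cutat_rtest[OF Rp(1)])
    have one: "\<mu> x * (?th x)^2 = \<mu> x" for x
      using R0(2) cutat_one[OF Rp(1), of x 0] Rp by (cases "norm x \<le> R0") (auto simp: vanish_def)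
    have one': "\<nu> x * (?th x)^2 = \<nu> x" for x using one[of x] by (simp add: \<nu>_def)
    have "?X = (LBINT x. (s x * ?th x)^2 * \<mu> x)"
    proof (intro Bochner_Integration.integral_cong refl)
      fix x
      have "(s x * ?th x)^2 * \<mu> x = (s x)^2 * (\<mu> x * (?th x)^2)" by (simp add: power_mult_distrib)
      then show "(s x)^2 * \<mu> x = (s x * ?th x)^2 * \<mu> x" unfolding one ..
    qed
    also have "\<dots> \<le> K * dir (\<lambda>x. s x * ?th x)"
      using t rtest_mult2[OF s th] unfolding trace_on_def by blast
    also have "dir (\<lambda>x. s x * ?th x) = cN TYPE('d) * ?S + (LBINT x. (s x)^2 * gsq ?th x)"
    proof -
      have "(LBINT x. lapl s x * (s x * (?th x)^2)) = (LBINT x. - cN TYPE('d) * (s x * \<nu> x))"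
      proof (intro Bochner_Integration.integral_cong refl)
        fix x
        have "lapl s x * (s x * (?th x)^2) = - cN TYPE('d) * (s x * (\<nu> x * (?th x)^2))" by (simp add: ls)
        then show "lapl s x * (s x * (?th x)^2) = - cN TYPE('d) * (s x * \<nu> x)" unfolding one' .
      qed
      then show ?thesis unfolding dir_mult[OF s th] by simp
    qed
    also have "(LBINT x. (s x)^2 * gsq ?th x) \<le> (LBINT x. ((2 / R) ^ (CARD('d) - 2) * A)^2 * gsq ?th x)"
    proof (rule integral_mono)
      show "integrable lborel (\<lambda>x. (s x)^2 * gsq ?th x)"
        by (intro rtest_integrable rtest_mult2 sm_power s rtest_grad_sq th)
      show "integrable lborel (\<lambda>x. ((2 / R) ^ (CARD('d) - 2) * A)^2 * gsq ?th x)"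
        by (intro rtest_integrable rtest_cmult rtest_grad_sq th)
      fix x :: "real^'d"
      show "(s x)^2 * gsq ?th x \<le> ((2 / R) ^ (CARD('d) - 2) * A)^2 * gsq ?th x"
      proof (cases "norm x < R")
        case True then show ?thesis using cutat_grad_zero[OF Rp(1), of x 0] by simp
      next
        case False
        have A0: "A \<ge> 0" by (simp add: A_def)
        have "\<bar>s x\<bar> \<le> (2 / norm x) ^ (CARD('d) - 2) * A"
          unfolding s_def A_def by (rule potential_decay[OF d nu nv R0(1)]) (use False R in auto)
        also have "\<dots> \<le> (2 / R) ^ (CARD('d) - 2) * A"
          using False Rp A0 by (intro mult_right_mono power_mono divide_left_mono mult_pos_pos) auto
        finally have "\<bar>s x\<bar>\<^sup>2 \<le> ((2 / R) ^ (CARD('d) - 2) * A)^2" by (intro power_mono) auto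
        then show ?thesis by (intro mult_right_mono sum_nonneg) auto
      qed
    qed
    also have "\<dots> = ((2 / R) ^ (CARD('d) - 2) * A)^2 * (R ^ (CARD('d) - 2) * dir (cutoff :: real^'d \<Rightarrow> real))"
      using dir_cutat[OF Rp(1), of "0::real^'d"] d by (simp add: dir_def)
    also have "\<dots> = B * (1 / R ^ (CARD('d) - 2))"
      using Rp by (simp add: B_def power_divide power2_eq_square field_simps)
    finally show ?thesis using K by (simp add: mult_left_mono)
  qed
  have "((\<lambda>R::real. K * (cN TYPE('d) * ?S + B * (1 / R ^ (CARD('d) - 2)))) \<longlongrightarrow> K * (cN TYPE('d) * ?S + B * 0)) at_top"
    by (intro tendsto_intros tendsto_divide_0[OF tendsto_const] filterlim_at_top_imp_at_infinity filterlim_pow_at_top filterlim_ident)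
      (use d in auto)
  then have X: "?X \<le> K * (cN TYPE('d) * ?S + B * 0)"
  proof (rule tendsto_lowerbound)
    show "\<forall>\<^sub>F R in at_top. ?X \<le> K * (cN TYPE('d) * ?S + B * (1 / R ^ (CARD('d) - 2)))"
      using b by (rule eventually_at_top_linorderI)
  qed simp
  let ?Y = "LBINT x. (\<eta> x)^2 * \<mu> x"
  have Y0: "?Y \<ge> 0" using mu(2) by (intro integral_nonneg_AE) auto
  have X0: "?X \<ge> 0" using mu(2) by (intro integral_nonneg_AE) auto
  have m: "(\<lambda>x. sqrt (\<mu> x)) \<in> borel_measurable lborel" "s \<in> borel_measurable lborel" "\<eta> \<in> borel_measurable lborel"
    using sm_borel[OF rtest_sm[OF mu(1)]] sm_borel[OF s] sm_borel[OF rtest_sm[OF chi(1)]] by auto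
  \<comment> \<open>Splitting the density as a product of two square roots turns this into
    Cauchy-Schwarz with respect to \<mu>.\<close>
  have "\<bar>LBINT x. (s x * sqrt (\<mu> x)) * (\<eta> x * sqrt (\<mu> x))\<bar> \<le> sqrt (LBINT x. (s x * sqrt (\<mu> x))^2) * sqrt (LBINT x. (\<eta> x * sqrt (\<mu> x))^2)"
  proof (rule integral_CS1)
    show "integrable lborel (\<lambda>x. (s x * sqrt (\<mu> x))^2)"
      using mu(2) by (simp add: power_mult_distrib) (intro rtest_integrable rtest_mult2 sm_power s mu)
    show "integrable lborel (\<lambda>x. (\<eta> x * sqrt (\<mu> x))^2)"
      using mu(2) by (simp add: power_mult_distrib) (intro rtest_integrable rtest_mult2 sm_power rtest_sm[OF chi(1)] mu)
  qed (use m in measurable)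
  moreover have "(s x * sqrt (\<mu> x)) * (\<eta> x * sqrt (\<mu> x)) = s x * \<nu> x" for x
  proof -
    have "(s x * sqrt (\<mu> x)) * (\<eta> x * sqrt (\<mu> x)) = s x * (\<eta> x * (sqrt (\<mu> x) * sqrt (\<mu> x)))" by (simp only: mult_ac)
    then show ?thesis using mu(2)[of x] by (simp add: \<nu>_def)
  qed
  ultimately have "\<bar>?S\<bar> \<le> sqrt ?X * sqrt ?Y" using mu(2) by (simp add: power_mult_distrib)
  then have "\<bar>?S\<bar>\<^sup>2 \<le> (sqrt ?X * sqrt ?Y)^2" by (intro power_mono) auto
  then have "?S * ?S \<le> ?X * ?Y" unfolding power_mult_distrib real_sqrt_pow2[OF X0] real_sqrt_pow2[OF Y0] power2_abs power2_eq_square[of ?S] .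
  also have "\<dots> \<le> (K * cN TYPE('d) * ?Y) * ?S" using mult_right_mono[OF X Y0] by (simp add: mult_ac)
  finally have "?S * ?S \<le> (K * cN TYPE('d) * ?Y) * ?S" .
  then have "?S \<le> K * cN TYPE('d) * ?Y"
  proof (cases "?S > 0")
    case True
    assume "?S * ?S \<le> (K * cN TYPE('d) * ?Y) * ?S"
    with True show ?thesis using mult_right_le_imp_le by blast
  next
    case False
    have "0 \<le> K * cN TYPE('d) * ?Y" using K Y0 cN_pos[OF d] by (simp add: less_imp_le)
    with False show ?thesis by linarith
  qed
  then show ?thesis by (simp add: s_def \<nu>_def[abs_def])
qed

lemma k2_potential:
  assumes d: "CARD('d::finite) \<ge> 3" and nu: "rtest \<nu>" "\<And>x. 0 \<le> \<nu> x"
  shows "(LBNN z. k2 (y - z) * ennreal (\<nu> z)) = ennreal (conv gam \<nu> (y::real^'d))"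
proof -
  have [measurable]: "\<nu> \<in> borel_measurable borel" by (rule sm_borel[OF rtest_sm[OF nu(1)]])
  have "(LBNN z. k2 (y - z) * ennreal (\<nu> z)) = (LBNN z. k2 (y - (y - z)) * ennreal (\<nu> (y - z)))"
    by (rule nn_integral_shift(2)[symmetric]) measurable
  also have "\<dots> = (LBNN z. ennreal (gam z * \<nu> (y - z)))"
    by (rule nn_integral_cong_AE, use AE_neq[of 0] in eventually_elim) (simp add: k2_gam gam_nonneg nu ennreal_mult)
  also have "\<dots> = ennreal (conv gam \<nu> y)"
    unfolding conv_def by (intro nn_integral_eq_integral conv_integrable locint_gam d nu) (auto simp: gam_nonneg nu)
  finally show ?thesis .
qed

text \<open>Expanding the square and integrating first in x, the two kernels compose to
  \<open>k2\<close> by \<open>kk_compose\<close>, which leaves the Newtonian energy of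
  \<nu>.\<close>

lemma I1_energy:
  assumes d: "CARD('d::finite) \<ge> 3"
    and C: "\<And>y z::real^'d. (LBNN x. kk (x - y) * kk (x - z)) \<le> ennreal C * k2 (y - z)"
    and nu: "rtest (\<nu> :: real^'d \<Rightarrow> real)" "\<And>x. 0 \<le> \<nu> x"
  shows "(LBNN x. (I1 (\<lambda>y. ennreal (\<nu> y)) x)^2) \<le> ennreal C * ennreal (LBINT x. conv gam \<nu> x * \<nu> x)"
proof -
  have [measurable]: "\<nu> \<in> borel_measurable borel" by (rule sm_borel[OF rtest_sm[OF nu(1)]])
  let ?n = "\<lambda>y. ennreal (\<nu> y)"
  have sc: "sm (conv gam \<nu>)" by (intro sm_conv locint_gam d nu)
  have c0: "0 \<le> conv gam \<nu> x" for x unfolding conv_def by (intro integral_nonneg_AE AE_I2) (simp add: gam_nonneg nu)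
  have "(LBNN x. (I1 ?n x)^2) = (LBNN x. (LBNN y. (LBNN z. (kk (x - y) * ?n y) * (kk (x - z) * ?n z))))"
    unfolding power2_eq_square I1_def by (intro nn_integral_cong nn_integral_product) measurable
  also have "\<dots> = (LBNN y. (LBNN x. (LBNN z. (kk (x - y) * ?n y) * (kk (x - z) * ?n z))))"
    by (rule lborel_pair.Fubini') measurable
  also have "\<dots> = (LBNN y. (LBNN z. (LBNN x. (kk (x - y) * ?n y) * (kk (x - z) * ?n z))))"
    by (intro nn_integral_cong lborel_pair.Fubini') measurable
  also have "\<dots> = (LBNN y. (LBNN z. (LBNN x. kk (x - y) * kk (x - z)) * (?n y * ?n z)))"
    by (intro nn_integral_cong, subst nn_integral_multc[symmetric]) (auto simp: mult_ac)
  also have "\<dots> \<le> (LBNN y. (LBNN z. (ennreal C * k2 (y - z)) * (?n y * ?n z)))"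
    by (intro nn_integral_mono mult_right_mono C) auto
  also have "\<dots> = (LBNN y. (LBNN z. (ennreal C * ?n y) * (k2 (y - z) * ?n z)))"
    by (simp only: mult_ac)
  also have "\<dots> = (LBNN y. (ennreal C * ?n y) * ennreal (conv gam \<nu> y))"
    by (subst nn_integral_cmult) (auto simp: k2_potential[OF d nu])
  also have "\<dots> = (LBNN y. ennreal C * ennreal (conv gam \<nu> y * \<nu> y))"
    by (intro nn_integral_cong) (simp add: ennreal_mult c0 nu mult_ac)
  also have "\<dots> = ennreal C * (LBNN y. ennreal (conv gam \<nu> y * \<nu> y))"
    using sm_borel[OF sc] by (subst nn_integral_cmult) auto
  also have "(LBNN y. ennreal (conv gam \<nu> y * \<nu> y)) = ennreal (LBINT x. conv gam \<nu> x * \<nu> x)"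
    by (intro nn_integral_eq_integral rtest_integrable rtest_mult2 sc nu) (auto simp: c0 nu)
  finally show ?thesis .
qed

text \<open>Density of the layer cake representation of \<open>kk\<close>.\<close>

definition lw :: "'d::finite itself \<Rightarrow> real \<Rightarrow> ennreal" where
  "lw _ s = indicator {0<..} s * ennreal (real (CARD('d) - 1) / s ^ (CARD('d) - 1 + 1))"

lemma lw_borel [measurable]: "lw T \<in> borel_measurable borel" unfolding lw_def[abs_def] by measurable

section \<open>Iterated potentials of measures satisfying a trace inequality\<close>

lemma lw_integral:
  assumes d: "CARD('d::finite) \<ge> 2" and r: "r > 0"
  shows "(LBNN s. lw TYPE('d) s * indicator {r..} s) = ennreal (1 / r ^ (CARD('d) - 1))"
proof -
  have "(LBNN s. lw TYPE('d) s * indicator {r..} s) = (LBNN s. ennreal (real (CARD('d) - 1) / s ^ (CARD('d) - 1 + 1)) * indicator {r..} s)"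
    using r by (intro nn_integral_cong) (auto simp: lw_def indicator_def)
  then show ?thesis using layer_cake[OF r, of "CARD('d) - 1"] d by simp
qed

text \<open>The free factor \<open>c\<close> accounts for enlarged balls: a condition on
  \<open>norm x\<close> up to 4 s corresponds to \<open>c = 1/4\<close>.\<close>

lemma kk_lw:
  assumes "CARD('d::finite) \<ge> 2" "x \<noteq> (0::real^'d)" "c > 0"
  shows "(LBNN s. lw TYPE('d) s * indicator {c * norm x..} s) = ennreal (1 / c ^ (CARD('d) - 1)) * kk x"
  using lw_integral[OF assms(1), of "c * norm x"] assms
  by (simp add: kk_kr kr_def power_mult_distrib ennreal_mult[symmetric] inverse_eq_divide)

text \<open>In the layer cake formula the growth s^(d - 2) of the measure meets the density s^(-d),
  leaving s^(-2), which integrates to 1 / r.\<close>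

lemma trace_far:
  assumes d: "CARD('d::finite) \<ge> 3" and t: "trace_on K (\<mu> :: real^'d \<Rightarrow> real)" and K: "K \<ge> 0" and r: "r > 0"
  shows "(LBNN z. indicator {z. r \<le> norm (z - x)} z * (kk (x - z) * ennreal (\<mu> z)))
    \<le> ennreal (K * dir (cutoff :: real^'d \<Rightarrow> real) * real (CARD('d) - 1) * (1 / r))"
proof -
  have [measurable]: "\<mu> \<in> borel_measurable borel" using t by (auto simp: trace_on_def intro: sm_borel rtest_sm)
  have d2: "CARD('d) \<ge> 2" using d by simp
  let ?D = "K * dir (cutoff :: real^'d \<Rightarrow> real)"
  have D0: "?D \<ge> 0" by (intro mult_nonneg_nonneg K dir_nonneg)
  have "(LBNN z. indicator {z. r \<le> norm (z - x)} z * (kk (x - z) * ennreal (\<mu> z)))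
    = (LBNN z. (LBNN s. (indicator {z. r \<le> norm (z - x)} z * ennreal (\<mu> z)) * (lw TYPE('d) s * indicator {1 * norm (x - z)..} s)))"
  proof (rule nn_integral_cong)
    fix z
    show "indicator {z. r \<le> norm (z - x)} z * (kk (x - z) * ennreal (\<mu> z)) = (LBNN s. (indicator {z. r \<le> norm (z - x)} z * ennreal (\<mu> z)) * (lw TYPE('d) s * indicator {1 * norm (x - z)..} s))"
    proof (cases "x = z")
      case True then show ?thesis using r by simp
    next
      case False
      then have n: "x - z \<noteq> 0" by simp
      have "(LBNN s. (indicator {z. r \<le> norm (z - x)} z * ennreal (\<mu> z)) * (lw TYPE('d) s * indicator {1 * norm (x - z)..} s))
        = (indicator {z. r \<le> norm (z - x)} z * ennreal (\<mu> z)) * (LBNN s. lw TYPE('d) s * indicator {1 * norm (x - z)..} s)"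
        by (rule nn_integral_cmult) measurable
      also have "\<dots> = (indicator {z. r \<le> norm (z - x)} z * ennreal (\<mu> z)) * kk (x - z)"
        unfolding kk_lw[OF d2 n zero_less_one] by simp
      finally show ?thesis by (simp only: mult_ac)
    qed
  qed
  also have "\<dots> \<le> (LBNN z. (LBNN s. (lw TYPE('d) s * indicator {r..} s) * (indicator {z. norm (z - x) \<le> s} z * ennreal (\<mu> z))))"
    by (intro nn_integral_mono) (auto simp: indicator_def norm_minus_commute mult_ac)
  also have "\<dots> = (LBNN s. (LBNN z. (lw TYPE('d) s * indicator {r..} s) * (indicator {z. norm (z - x) \<le> s} z * ennreal (\<mu> z))))"
    by (rule lborel_pair.Fubini') (simp only: indicator_def of_bool_def atLeast_iff mem_Collect_eq greaterThan_iff, measurable)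
  also have "\<dots> = (LBNN s. (lw TYPE('d) s * indicator {r..} s) * (LBNN z. indicator {z. norm (z - x) \<le> s} z * ennreal (\<mu> z)))"
    by (intro nn_integral_cong nn_integral_cmult) measurable
  also have "\<dots> \<le> (LBNN s. ennreal (?D * real (CARD('d) - 1)) * (ennreal (real 1 / s ^ (1 + 1)) * indicator {r..} s))"
  proof (rule nn_integral_mono)
    fix s :: real
    show "(lw TYPE('d) s * indicator {r..} s) * (LBNN z. indicator {z. norm (z - x) \<le> s} z * ennreal (\<mu> z))
       \<le> ennreal (?D * real (CARD('d) - 1)) * (ennreal (real 1 / s ^ (1 + 1)) * indicator {r..} s)"
    proof (cases "r \<le> s")
      case True
      then have s: "s > 0" using r by simp
      have p: "s ^ (CARD('d) - 1 + 1) = s ^ 2 * s ^ (CARD('d) - 2)"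
        unfolding power_add[symmetric] using d by (intro arg_cong[where f="\<lambda>n. s ^ n"]) auto
      have "lw TYPE('d) s * (LBNN z. indicator {z. norm (z - x) \<le> s} z * ennreal (\<mu> z))
        \<le> ennreal (real (CARD('d) - 1) / s ^ (CARD('d) - 1 + 1)) * ennreal (?D * s ^ (CARD('d) - 2))"
        using s by (intro mult_mono trace_growth[OF d2 t s]) (auto simp: lw_def)
      also have "\<dots> = ennreal (real (CARD('d) - 1) / s ^ (CARD('d) - 1 + 1) * (?D * s ^ (CARD('d) - 2)))"
        using s D0 by (subst ennreal_mult) auto
      also have "real (CARD('d) - 1) / s ^ (CARD('d) - 1 + 1) * (?D * s ^ (CARD('d) - 2)) = (?D * real (CARD('d) - 1)) * (real 1 / s ^ (1 + 1))"
        unfolding p using s by (simp add: power2_eq_square)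
      also have "ennreal \<dots> = ennreal (?D * real (CARD('d) - 1)) * ennreal (real 1 / s ^ (1 + 1))"
        using D0 s by (intro ennreal_mult) auto
      finally show ?thesis using True by simp
    qed simp
  qed
  also have "\<dots> = ennreal (?D * real (CARD('d) - 1)) * ennreal (1 / r ^ 1)"
    by (subst nn_integral_cmult) (use layer_cake[OF r, of 1] in auto)
  also have "\<dots> = ennreal (?D * real (CARD('d) - 1) * (1 / r))"
    using D0 r by (subst ennreal_mult) auto
  finally show ?thesis .
qed

text \<open>Passing through the maximum avoids subtraction of possibly infinite values, at the cost
  of the factor 4 instead of 2.\<close>

lemma ennreal_square_sum_le: "((a::ennreal) + b)^2 \<le> 4 * (a^2 + b^2)"
proof -
  define m where "m = max a b"
  have "(a + b)^2 \<le> (m + m)^2" unfolding m_def by (intro power_mono add_mono) auto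
  also have "\<dots> = 4 * m^2" by (simp add: mult_2[symmetric] power_mult_distrib)
  also have "m^2 \<le> a^2 + b^2" unfolding m_def max_def by (auto intro: add_increasing add_increasing2)
  finally show ?thesis by (simp add: mult_left_mono)
qed

text \<open>The outer kernel is written as an integral over scales s. At scale s the near part sees
  the measure only within 2 s of x; its energy is at most a constant times the mass of the ball of
  radius 4 s, by \<open>I1_energy\<close> and \<open>potential_trace\<close>. Integrating these
  masses over s gives the kernel back.\<close>

lemma I1_W_local:
  assumes d: "CARD('d::finite) \<ge> 3" and t: "trace_on K (\<mu> :: real^'d \<Rightarrow> real)" and K: "K \<ge> 0"
    and C0: "C > 0" and C: "\<And>y z::real^'d. (LBNN x. kk (x - y) * kk (x - z)) \<le> ennreal C * k2 (y - z)"
  shows "(LBNN y. kk (x - y) * (LBNN z. indicator {z. norm (z - x) \<le> 2 * norm (y - x)} z * (kk (y - z) * ennreal (\<mu> z)))^2)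
    \<le> ennreal (C * K * cN TYPE('d) * 4 ^ (CARD('d) - 1)) * I1 (\<lambda>y. ennreal (\<mu> y)) x"
proof -
  have mu: "rtest \<mu>" "\<And>x. 0 \<le> \<mu> x" using t by (auto simp: trace_on_def)
  have [measurable]: "\<mu> \<in> borel_measurable borel" by (rule sm_borel[OF rtest_sm[OF mu(1)]])
  have d2: "CARD('d) \<ge> 2" using d by simp
  let ?L = "\<lambda>y. (LBNN z. indicator {z. norm (z - x) \<le> 2 * norm (y - x)} z * (kk (y - z) * ennreal (\<mu> z)))"
  let ?D = "C * K * cN TYPE('d)"
  have D0: "?D \<ge> 0" using C0 K cN_pos[OF d] by (simp add: less_imp_le)
  have [measurable]: "?L \<in> borel_measurable borel"
    by (rule lborel.borel_measurable_nn_integral) (simp only: split_beta' indicator_def of_bool_def mem_Collect_eq, measurable)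
  have "(LBNN y. kk (x - y) * (?L y)^2)
    = (LBNN y. (LBNN s. (lw TYPE('d) s * indicator {1 * norm (x - y)..} s) * (?L y)^2))"
  proof (rule nn_integral_cong_AE, use AE_neq[of x] in eventually_elim)
    fix y assume "y \<noteq> x"
    then have n: "x - y \<noteq> 0" by simp
    show "kk (x - y) * (?L y)^2 = (LBNN s. (lw TYPE('d) s * indicator {1 * norm (x - y)..} s) * (?L y)^2)"
      by (subst nn_integral_multc) (auto simp: kk_lw[OF d2 n zero_less_one, simplified])
  qed
  also have "\<dots> = (LBNN s. (LBNN y. (lw TYPE('d) s * indicator {1 * norm (x - y)..} s) * (?L y)^2))"
    by (rule lborel_pair.Fubini') (simp only: indicator_def[of "{1 * _ ..}"] of_bool_def atLeast_iff, measurable)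
  also have "\<dots> \<le> (LBNN s. lw TYPE('d) s * (ennreal ?D * (LBNN z. indicator {z. norm (z - x) \<le> 4 * s} z * ennreal (\<mu> z))))"
  proof (rule nn_integral_mono)
    fix s :: real
    show "(LBNN y. (lw TYPE('d) s * indicator {1 * norm (x - y)..} s) * (?L y)^2)
      \<le> lw TYPE('d) s * (ennreal ?D * (LBNN z. indicator {z. norm (z - x) \<le> 4 * s} z * ennreal (\<mu> z)))"
    proof (cases "s > 0")
      case False then show ?thesis by (simp add: lw_def)
    next
      case s: True
      \<comment> \<open>Equal to 1 where the near part sees the measure when y is within s of x, and
        zero beyond 4 s, the radius of the mass on the right.\<close>
      let ?c = "cutat x (2 * s)"
      have c: "rtest ?c" "\<And>x. 0 \<le> ?c x" using s by (auto intro: cutat_rtest cutat_range)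
      have cm: "rtest (\<lambda>y. ?c y * \<mu> y)" "\<And>y. 0 \<le> ?c y * \<mu> y" using c mu by (auto intro!: rtest_mult1 rtest_sm)
      note [measurable] = sm_borel[OF rtest_sm[OF c(1)]]
      have "(LBNN y. (lw TYPE('d) s * indicator {1 * norm (x - y)..} s) * (?L y)^2)
         \<le> (LBNN y. lw TYPE('d) s * (I1 (\<lambda>y. ennreal (?c y * \<mu> y)) y)^2)"
      proof (rule nn_integral_mono)
        fix y
        show "(lw TYPE('d) s * indicator {1 * norm (x - y)..} s) * (?L y)^2 \<le> lw TYPE('d) s * (I1 (\<lambda>y. ennreal (?c y * \<mu> y)) y)^2"
        proof (cases "norm (x - y) \<le> s")
          case True
          have "?L y \<le> I1 (\<lambda>y. ennreal (?c y * \<mu> y)) y"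
            unfolding I1_def
          proof (rule nn_integral_mono)
            fix z
            show "indicator {z. norm (z - x) \<le> 2 * norm (y - x)} z * (kk (y - z) * ennreal (\<mu> z)) \<le> kk (y - z) * ennreal (?c z * \<mu> z)"
            proof (cases "norm (z - x) \<le> 2 * norm (y - x)")
              case True
              then have "?c z = 1" using \<open>norm (x - y) \<le> s\<close> s by (intro cutat_one) (auto simp: norm_minus_commute)
              then show ?thesis using True by simp
            qed simp
          qed
          then show ?thesis using True by (auto intro!: mult_left_mono power_mono)
        qed simp
      qed
      also have "\<dots> = lw TYPE('d) s * (LBNN y. (I1 (\<lambda>y. ennreal (?c y * \<mu> y)) y)^2)"
        by (rule nn_integral_cmult) measurable
      also have "\<dots> \<le> lw TYPE('d) s * (ennreal C * ennreal (LBINT y. conv gam (\<lambda>y. ?c y * \<mu> y) y * (?c y * \<mu> y)))"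
        by (intro mult_left_mono I1_energy[OF d C cm]) auto
      also have "\<dots> \<le> lw TYPE('d) s * (ennreal C * ennreal (K * cN TYPE('d) * (LBINT z. (?c z)^2 * \<mu> z)))"
        by (intro mult_left_mono ennreal_leI potential_trace[OF d t K c]) auto
      also have "ennreal C * ennreal (K * cN TYPE('d) * (LBINT z. (?c z)^2 * \<mu> z)) = ennreal ?D * ennreal (LBINT z. (?c z)^2 * \<mu> z)"
        using C0 K cN_pos[OF d] mu(2) by (simp add: ennreal_mult[symmetric] less_imp_le mult_ac)
      also have "ennreal (LBINT z. (?c z)^2 * \<mu> z) = (LBNN z. ennreal ((?c z)^2 * \<mu> z))"
        using mu(2) by (intro nn_integral_eq_integral[symmetric] rtest_integrable rtest_mult1 rtest_power2 c rtest_sm[OF mu(1)]) auto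
      also have "\<dots> \<le> (LBNN z. indicator {z. norm (z - x) \<le> 4 * s} z * ennreal (\<mu> z))"
      proof (rule nn_integral_mono)
        fix z
        show "ennreal ((?c z)^2 * \<mu> z) \<le> indicator {z. norm (z - x) \<le> 4 * s} z * ennreal (\<mu> z)"
        proof (cases "norm (z - x) \<le> 4 * s")
          case True
          have "(?c z)^2 * \<mu> z \<le> 1 * \<mu> z" using cutat_range[of x "2 * s" z] mu(2)[of z] by (intro mult_right_mono power_le_one) auto
          then show ?thesis using True by (simp add: ennreal_leI)
        next
          case False
          then have "?c z = 0" using s by (intro cutat_zero) auto
          then show ?thesis by simp
        qed
      qed
      finally show ?thesis by (simp add: mult_left_mono)
    qed
  qed
  also have "\<dots> = (LBNN s. (LBNN z. ennreal ?D * (lw TYPE('d) s * (indicator {z. norm (z - x) \<le> 4 * s} z * ennreal (\<mu> z)))))"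
    by (intro nn_integral_cong) (simp add: nn_integral_cmult mult.left_commute)
  also have "\<dots> = (LBNN z. (LBNN s. ennreal ?D * (lw TYPE('d) s * (indicator {z. norm (z - x) \<le> 4 * s} z * ennreal (\<mu> z)))))"
    by (rule lborel_pair.Fubini') (simp only: indicator_def of_bool_def mem_Collect_eq, measurable)
  also have "\<dots> = (LBNN z. ennreal (?D * 4 ^ (CARD('d) - 1)) * (kk (x - z) * ennreal (\<mu> z)))"
  proof (rule nn_integral_cong_AE, use AE_neq[of x] in eventually_elim)
    fix z assume "z \<noteq> x"
    then have n: "x - z \<noteq> 0" by simp
    have "(LBNN s. ennreal ?D * (lw TYPE('d) s * (indicator {z. norm (z - x) \<le> 4 * s} z * ennreal (\<mu> z))))
      = (LBNN s. (ennreal ?D * ennreal (\<mu> z)) * (lw TYPE('d) s * indicator {1/4 * norm (x - z)..} s))"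
      by (intro nn_integral_cong) (auto simp: indicator_def norm_minus_commute mult_ac)
    also have "\<dots> = (ennreal ?D * ennreal (\<mu> z)) * (LBNN s. lw TYPE('d) s * indicator {1/4 * norm (x - z)..} s)"
      by (rule nn_integral_cmult) measurable
    also have "\<dots> = (ennreal ?D * ennreal (\<mu> z)) * (ennreal (1 / (1/4) ^ (CARD('d) - 1)) * kk (x - z))"
      by (subst kk_lw[OF d2 n]) auto
    also have "1 / (1/4) ^ (CARD('d) - 1) = (4::real) ^ (CARD('d) - 1)" by (simp add: power_divide)
    also have "(ennreal ?D * ennreal (\<mu> z)) * (ennreal (4 ^ (CARD('d) - 1)) * kk (x - z)) = (ennreal ?D * ennreal (4 ^ (CARD('d) - 1))) * (kk (x - z) * ennreal (\<mu> z))"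
      by (simp only: mult_ac)
    also have "ennreal ?D * ennreal (4 ^ (CARD('d) - 1)) = ennreal (?D * 4 ^ (CARD('d) - 1))" using D0 by (subst ennreal_mult) auto
    finally show "(LBNN s. ennreal ?D * (lw TYPE('d) s * (indicator {z. norm (z - x) \<le> 4 * s} z * ennreal (\<mu> z))))
      = ennreal (?D * 4 ^ (CARD('d) - 1)) * (kk (x - z) * ennreal (\<mu> z))" .
  qed
  also have "\<dots> = ennreal (?D * 4 ^ (CARD('d) - 1)) * I1 (\<lambda>y. ennreal (\<mu> y)) x"
    unfolding I1_def by (rule nn_integral_cmult) measurable
  finally show ?thesis .
qed

text \<open>For z far from x compared with y, \<open>kk (y - z)\<close> is comparable to
  \<open>kk (x - z)\<close>, so the far part depends on y only through a cutoff radius: it is at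
  most a multiple of \<open>Q (norm (y - x))\<close>. Its square is controlled by the 1 / r decay of
  \<open>trace_far\<close>, and the integral over y compensates that decay.\<close>

lemma I1_W_far:
  assumes d: "CARD('d::finite) \<ge> 3" and t: "trace_on K (\<mu> :: real^'d \<Rightarrow> real)" and K: "K \<ge> 0"
  shows "(LBNN y. kk (x - y) * (LBNN z. indicator {z. 2 * norm (y - x) < norm (z - x)} z * (kk (y - z) * ennreal (\<mu> z)))^2)
    \<le> ennreal (4 ^ (CARD('d) - 1) * (K * dir (cutoff :: real^'d \<Rightarrow> real) * real (CARD('d) - 1)) * real CARD('d) * vb TYPE('d)) * I1 (\<lambda>y. ennreal (\<mu> y)) x"
proof -
  have mu: "rtest \<mu>" "\<And>x. 0 \<le> \<mu> x" using t by (auto simp: trace_on_def)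
  have [measurable]: "\<mu> \<in> borel_measurable borel" by (rule sm_borel[OF rtest_sm[OF mu(1)]])
  have d2: "CARD('d) \<ge> 2" using d by simp
  let ?A = "K * dir (cutoff :: real^'d \<Rightarrow> real) * real (CARD('d) - 1)"
  have A0: "?A \<ge> 0" by (intro mult_nonneg_nonneg K dir_nonneg) simp
  let ?c = "ennreal (2 ^ (CARD('d) - 1))"
  define g where "g z = kk (x - z) * ennreal (\<mu> z)" for z
  have [measurable]: "g \<in> borel_measurable borel" unfolding g_def by measurable
  define Q where "Q \<rho> = (LBNN z. indicator {z. 2 * \<rho> < norm (z - x)} z * g z)" for \<rho>
  have T: "(LBNN z. indicator {z. 2 * norm (y - x) < norm (z - x)} z * (kk (y - z) * ennreal (\<mu> z))) \<le> ?c * Q (norm (y - x))" for y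
  proof -
    have "(LBNN z. indicator {z. 2 * norm (y - x) < norm (z - x)} z * (kk (y - z) * ennreal (\<mu> z)))
       \<le> (LBNN z. ?c * (indicator {z. 2 * norm (y - x) < norm (z - x)} z * g z))"
    proof (rule nn_integral_mono)
      fix z
      show "indicator {z. 2 * norm (y - x) < norm (z - x)} z * (kk (y - z) * ennreal (\<mu> z)) \<le> ?c * (indicator {z. 2 * norm (y - x) < norm (z - x)} z * g z)"
      proof (cases "2 * norm (y - x) < norm (z - x)")
        case True
        have "norm (z - x) \<le> norm (y - z) + norm (y - x)"
          using norm_triangle_ineq[of "z - y" "y - x"] by (simp add: norm_minus_commute)
        then have "norm (x - z) \<le> 2 * norm (y - z)" using True norm_minus_commute[of x z] by linarith
        from kk_half[OF d2 this] have "kk (y - z) * ennreal (\<mu> z) \<le> (?c * kk (x - z)) * ennreal (\<mu> z)" by (intro mult_right_mono) auto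
        then show ?thesis using True by (simp add: g_def mult_ac)
      qed simp
    qed
    also have "\<dots> = ?c * Q (norm (y - x))" unfolding Q_def by (rule nn_integral_cmult) measurable
    finally show ?thesis .
  qed
  have Q2: "(Q \<rho>)^2 \<le> 2 * (LBNN z. indicator {z. 2 * \<rho> < norm (z - x)} z * (g z * ennreal (?A * (1 / norm (z - x)))))" if r: "\<rho> \<ge> 0" for \<rho>
  proof -
    let ?i = "\<lambda>z::real^'d. indicator {z. 2 * \<rho> < norm (z - x)} z :: ennreal"
    \<comment> \<open>The square is a double integral over pairs; by symmetry only pairs with z' at
      least as far from x as z are kept, at the cost of a factor 2. The integral over z' is then a
      tail to which \<open>trace_far\<close> applies.\<close>
    let ?H = "\<lambda>z z'. (?i z * g z) * (indicator {z'. norm (z - x) \<le> norm (z' - x)} z' * g z')"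
    have [measurable]: "(\<lambda>(z, z'). ?H z z') \<in> borel_measurable (borel \<Otimes>\<^sub>M borel)"
      by (simp only: split_beta' indicator_def of_bool_def mem_Collect_eq, measurable)
    have "(Q \<rho>)^2 = (LBNN z. (LBNN z'. (?i z * g z) * (?i z' * g z')))"
      unfolding power2_eq_square Q_def by (rule nn_integral_product) measurable
    also have "\<dots> \<le> (LBNN z. (LBNN z'. ?H z z' + ?H z' z))"
      by (intro nn_integral_mono) (auto simp: indicator_def mult_ac)
    also have "\<dots> = (LBNN z. (LBNN z'. ?H z z')) + (LBNN z. (LBNN z'. ?H z' z))"
      by (subst nn_integral_add[symmetric], measurable, intro nn_integral_cong nn_integral_add) measurable
    also have "(LBNN z. (LBNN z'. ?H z' z)) = (LBNN z'. (LBNN z. ?H z' z))"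
      by (rule lborel_pair.Fubini') measurable
    also have "(LBNN z. (LBNN z'. ?H z z')) + (LBNN z. (LBNN z'. ?H z z')) = 2 * (LBNN z. (LBNN z'. ?H z z'))"
      by (rule mult_2[symmetric])
    also have "(LBNN z. (LBNN z'. ?H z z')) \<le> (LBNN z. ?i z * (g z * ennreal (?A * (1 / norm (z - x)))))"
    proof (rule nn_integral_mono)
      fix z
      have "(LBNN z'. ?H z z') = (?i z * g z) * (LBNN z'. indicator {z'. norm (z - x) \<le> norm (z' - x)} z' * g z')"
        by (rule nn_integral_cmult) measurable
      also have "\<dots> \<le> (?i z * g z) * ennreal (?A * (1 / norm (z - x)))"
      proof (cases "2 * \<rho> < norm (z - x)")
        case True
        then have "norm (z - x) > 0" using r by linarith
        then show ?thesis unfolding g_def by (intro mult_left_mono trace_far[OF d t K]) auto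
      qed simp
      finally show "(LBNN z'. ?H z z') \<le> ?i z * (g z * ennreal (?A * (1 / norm (z - x))))" by (simp add: mult.assoc)
    qed
    finally show ?thesis by (simp add: mult_left_mono)
  qed
  have [measurable]: "Q \<in> borel_measurable borel" unfolding Q_def[abs_def]
    by (rule lborel.borel_measurable_nn_integral) (simp only: split_beta' indicator_def of_bool_def mem_Collect_eq, measurable)
  have "(LBNN y. kk (x - y) * (LBNN z. indicator {z. 2 * norm (y - x) < norm (z - x)} z * (kk (y - z) * ennreal (\<mu> z)))^2)
    \<le> (LBNN y. (?c^2 * 2) * (LBNN z. kk (x - y) * (indicator {z. 2 * norm (y - x) < norm (z - x)} z * (g z * ennreal (?A * (1 / norm (z - x)))))))"
  proof (rule nn_integral_mono)
    fix y
    have "kk (x - y) * (LBNN z. indicator {z. 2 * norm (y - x) < norm (z - x)} z * (kk (y - z) * ennreal (\<mu> z)))^2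
      \<le> kk (x - y) * (?c^2 * (2 * (LBNN z. indicator {z. 2 * norm (y - x) < norm (z - x)} z * (g z * ennreal (?A * (1 / norm (z - x)))))))"
    proof (intro mult_left_mono)
      have "(LBNN z. indicator {z. 2 * norm (y - x) < norm (z - x)} z * (kk (y - z) * ennreal (\<mu> z)))^2 \<le> (?c * Q (norm (y - x)))^2"
        by (intro power_mono T) auto
      also have "\<dots> \<le> ?c^2 * (2 * (LBNN z. indicator {z. 2 * norm (y - x) < norm (z - x)} z * (g z * ennreal (?A * (1 / norm (z - x))))))"
        unfolding power_mult_distrib by (intro mult_left_mono Q2) auto
      finally show "(LBNN z. indicator {z. 2 * norm (y - x) < norm (z - x)} z * (kk (y - z) * ennreal (\<mu> z)))^2
        \<le> ?c^2 * (2 * (LBNN z. indicator {z. 2 * norm (y - x) < norm (z - x)} z * (g z * ennreal (?A * (1 / norm (z - x))))))" .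
    qed simp
    also have "\<dots> = (?c^2 * 2) * (kk (x - y) * (LBNN z. indicator {z. 2 * norm (y - x) < norm (z - x)} z * (g z * ennreal (?A * (1 / norm (z - x))))))"
      by (simp only: mult_ac)
    also have "kk (x - y) * (LBNN z. indicator {z. 2 * norm (y - x) < norm (z - x)} z * (g z * ennreal (?A * (1 / norm (z - x)))))
       = (LBNN z. kk (x - y) * (indicator {z. 2 * norm (y - x) < norm (z - x)} z * (g z * ennreal (?A * (1 / norm (z - x))))))"
      by (rule nn_integral_cmult[symmetric]) measurable
    finally show "kk (x - y) * (LBNN z. indicator {z. 2 * norm (y - x) < norm (z - x)} z * (kk (y - z) * ennreal (\<mu> z)))^2
      \<le> (?c^2 * 2) * (LBNN z. kk (x - y) * (indicator {z. 2 * norm (y - x) < norm (z - x)} z * (g z * ennreal (?A * (1 / norm (z - x))))))" .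
  qed
  also have "\<dots> = (?c^2 * 2) * (LBNN y. (LBNN z. kk (x - y) * (indicator {z. 2 * norm (y - x) < norm (z - x)} z * (g z * ennreal (?A * (1 / norm (z - x)))))))"
    by (rule nn_integral_cmult, rule lborel.borel_measurable_nn_integral)
      (simp only: split_beta' indicator_def of_bool_def mem_Collect_eq, measurable)
  also have "(LBNN y. (LBNN z. kk (x - y) * (indicator {z. 2 * norm (y - x) < norm (z - x)} z * (g z * ennreal (?A * (1 / norm (z - x)))))))
    = (LBNN z. (LBNN y. kk (x - y) * (indicator {z. 2 * norm (y - x) < norm (z - x)} z * (g z * ennreal (?A * (1 / norm (z - x)))))))"
    by (rule lborel_pair.Fubini') (simp only: indicator_def of_bool_def mem_Collect_eq, measurable)
  also have "\<dots> \<le> (LBNN z. ennreal (?A * (real CARD('d) * vb TYPE('d)) * (1/2)) * g z)"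
  proof (rule nn_integral_mono_AE, use AE_neq[of x] in eventually_elim)
    fix z assume "z \<noteq> x"
    then have n: "norm (z - x) > 0" by simp
    \<comment> \<open>The kernel integrated over y within half of \<open>norm (z - x)\<close> from x
      is proportional to \<open>norm (z - x)\<close>, which cancels the decay in
      \<open>?k\<close>.\<close>
    let ?k = "ennreal (?A * (1 / norm (z - x)))"
    have "(LBNN y. kk (x - y) * (indicator {z. 2 * norm (y - x) < norm (z - x)} z * (g z * ?k)))
      = (LBNN y. (indicator {w. norm w < norm (z - x) / 2} (x - y) * kk (x - y)) * (g z * ?k))"
      by (intro nn_integral_cong) (auto simp: indicator_def norm_minus_commute)
    also have "\<dots> = (LBNN y. indicator {w. norm w < norm (z - x) / 2} (x - y) * kk (x - y)) * (g z * ?k)"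
      by (rule nn_integral_multc) measurable
    also have "(LBNN y. indicator {w. norm w < norm (z - x) / 2} (x - y) * kk (x - y)) = (LBNN y. indicator {w. norm w < norm (z - x) / 2} y * kk (y::real^'d))"
      by (rule nn_integral_shift(2)[where f="\<lambda>w. indicator {w. norm w < norm (z - x) / 2} w * kk w"]) measurable
    also have "\<dots> * (g z * ?k) \<le> ennreal (real CARD('d) * vb TYPE('d) * (norm (z - x) / 2)) * (g z * ?k)"
      using n by (intro mult_right_mono kk_ball d2) auto
    also have "\<dots> = (ennreal (real CARD('d) * vb TYPE('d) * (norm (z - x) / 2)) * ?k) * g z" by (simp only: mult_ac)
    also have "ennreal (real CARD('d) * vb TYPE('d) * (norm (z - x) / 2)) * ?k = ennreal ((real CARD('d) * vb TYPE('d) * (norm (z - x) / 2)) * (?A * (1 / norm (z - x))))"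
      using A0 n vb_pos[where 'd='d] by (subst ennreal_mult) (auto simp: less_imp_le)
    also have "(real CARD('d) * vb TYPE('d) * (norm (z - x) / 2)) * (?A * (1 / norm (z - x))) = ?A * (real CARD('d) * vb TYPE('d)) * (1/2)"
    proof -
      have "(p * q * (m / 2)) * (a * (1 / m)) = a * (p * q) * (1 / 2)" if "m > 0" for p q m a :: real using that by simp
      from this[OF n] show ?thesis .
    qed
    finally show "(LBNN y. kk (x - y) * (indicator {z. 2 * norm (y - x) < norm (z - x)} z * (g z * ?k)))
      \<le> ennreal (?A * (real CARD('d) * vb TYPE('d)) * (1/2)) * g z" .
  qed
  also have "\<dots> = ennreal (?A * (real CARD('d) * vb TYPE('d)) * (1/2)) * I1 (\<lambda>y. ennreal (\<mu> y)) x"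
    unfolding I1_def g_def by (rule nn_integral_cmult) measurable
  finally have "(LBNN y. kk (x - y) * (LBNN z. indicator {z. 2 * norm (y - x) < norm (z - x)} z * (kk (y - z) * ennreal (\<mu> z)))^2)
    \<le> (?c^2 * 2) * (ennreal (?A * (real CARD('d) * vb TYPE('d)) * (1/2)) * I1 (\<lambda>y. ennreal (\<mu> y)) x)"
    by (simp add: mult_left_mono)
  also have "\<dots> = ((?c^2 * 2) * ennreal (?A * (real CARD('d) * vb TYPE('d)) * (1/2))) * I1 (\<lambda>y. ennreal (\<mu> y)) x"
    by (simp only: mult.assoc)
  also have "(?c^2 * 2) * ennreal (?A * (real CARD('d) * vb TYPE('d)) * (1/2)) = ennreal (4 ^ (CARD('d) - 1) * ?A * real CARD('d) * vb TYPE('d))"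
  proof -
    have "?c^2 * 2 = ennreal (4 ^ (CARD('d) - 1) * 2)"
    proof -
      have "((2::real) ^ (CARD('d) - 1))^2 = 4 ^ (CARD('d) - 1)" by (simp add: power_mult[symmetric] mult.commute[of _ 2]) (simp add: power_mult)
      then have "?c^2 = ennreal (4 ^ (CARD('d) - 1))" by (simp add: ennreal_power)
      then show ?thesis by (simp add: ennreal_mult)
    qed
    then have "(?c^2 * 2) * ennreal (?A * (real CARD('d) * vb TYPE('d)) * (1/2)) = ennreal ((4 ^ (CARD('d) - 1) * 2) * (?A * (real CARD('d) * vb TYPE('d)) * (1/2)))"
      using A0 vb_pos[where 'd='d] by (simp only:, subst ennreal_mult[symmetric]) (auto simp: less_imp_le)
    also have "(4 ^ (CARD('d) - 1) * 2) * (?A * (real CARD('d) * vb TYPE('d)) * (1/2)) = 4 ^ (CARD('d) - 1) * ?A * real CARD('d) * vb TYPE('d)"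
    proof -
      have "(p * 2) * (a * (q * r) * (1/2)) = p * a * q * r" for p a q r :: real by simp
      then show ?thesis .
    qed
    finally show ?thesis .
  qed
  finally show ?thesis .
qed

text \<open>For fixed x the integral defining the inner potential at y is cut at distance
  \<open>2 * norm (y - x)\<close> from x: the near part is an energy estimate, the far part a growth
  estimate.\<close>

lemma I1_W_square:
  assumes d: "CARD('d::finite) \<ge> 3" and K: "K \<ge> 0"
  obtains C where "C > 0" "\<And>(\<mu> :: real^'d \<Rightarrow> real) x. trace_on K \<mu> \<Longrightarrow> I1 (\<lambda>y. (I1 (\<lambda>z. ennreal (\<mu> z)) y)^2) x \<le> ennreal C * I1 (\<lambda>z. ennreal (\<mu> z)) x"
proof -
  obtain C where C: "C > 0" "\<And>y z::real^'d. (LBNN x. kk (x - y) * kk (x - z)) \<le> ennreal C * k2 (y - z)"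
    using kk_compose[OF d] by metis
  define c1 where "c1 = C * K * cN TYPE('d) * 4 ^ (CARD('d) - 1)"
  define c2 where "c2 = 4 ^ (CARD('d) - 1) * (K * dir (cutoff :: real^'d \<Rightarrow> real) * real (CARD('d) - 1)) * real CARD('d) * vb TYPE('d)"
  have c1: "c1 \<ge> 0" unfolding c1_def using C K cN_pos[OF d] by (simp add: less_imp_le)
  have c2: "c2 \<ge> 0" unfolding c2_def by (intro mult_nonneg_nonneg K dir_nonneg) (use vb_pos[where 'd='d] in \<open>auto intro: less_imp_le\<close>)
  have main: "I1 (\<lambda>y. (I1 (\<lambda>z. ennreal (\<mu> z)) y)^2) x \<le> ennreal (4 * (c1 + c2) + 1) * I1 (\<lambda>z. ennreal (\<mu> z)) x"
    if t: "trace_on K \<mu>" for \<mu> :: "real^'d \<Rightarrow> real" and x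
  proof -
    have [measurable]: "\<mu> \<in> borel_measurable borel" using t by (auto simp: trace_on_def intro: sm_borel rtest_sm)
    let ?L = "\<lambda>y. (LBNN z. indicator {z. norm (z - x) \<le> 2 * norm (y - x)} z * (kk (y - z) * ennreal (\<mu> z)))"
    let ?T = "\<lambda>y. (LBNN z. indicator {z. 2 * norm (y - x) < norm (z - x)} z * (kk (y - z) * ennreal (\<mu> z)))"
    let ?W = "I1 (\<lambda>z. ennreal (\<mu> z))"
    have [measurable]: "?L \<in> borel_measurable borel" "?T \<in> borel_measurable borel"
      by (rule lborel.borel_measurable_nn_integral, simp only: split_beta' indicator_def of_bool_def mem_Collect_eq, measurable)+
    have W: "?W y = ?L y + ?T y" for y
      unfolding I1_def by (subst nn_integral_add[symmetric], measurable, measurable, intro nn_integral_cong) (auto simp: indicator_def)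
    have "I1 (\<lambda>y. (?W y)^2) x \<le> (LBNN y. 4 * (kk (x - y) * (?L y)^2) + 4 * (kk (x - y) * (?T y)^2))"
      unfolding I1_def[of "\<lambda>y. (?W y)^2"]
    proof (rule nn_integral_mono)
      fix y
      have "kk (x - y) * (?W y)^2 \<le> kk (x - y) * (4 * ((?L y)^2 + (?T y)^2))"
        unfolding W by (intro mult_left_mono ennreal_square_sum_le) auto
      also have "\<dots> = 4 * (kk (x - y) * (?L y)^2) + 4 * (kk (x - y) * (?T y)^2)"
        unfolding distrib_left by (simp only: mult_ac)
      finally show "kk (x - y) * (?W y)^2 \<le> 4 * (kk (x - y) * (?L y)^2) + 4 * (kk (x - y) * (?T y)^2)" .
    qed
    also have "\<dots> = (LBNN y. 4 * (kk (x - y) * (?L y)^2)) + (LBNN y. 4 * (kk (x - y) * (?T y)^2))"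
      by (rule nn_integral_add) measurable
    also have "(LBNN y. 4 * (kk (x - y) * (?L y)^2)) = 4 * (LBNN y. kk (x - y) * (?L y)^2)"
      by (rule nn_integral_cmult) measurable
    also have "(LBNN y. 4 * (kk (x - y) * (?T y)^2)) = 4 * (LBNN y. kk (x - y) * (?T y)^2)"
      by (rule nn_integral_cmult) measurable
    also have "4 * (LBNN y. kk (x - y) * (?L y)^2) + 4 * (LBNN y. kk (x - y) * (?T y)^2)
      \<le> 4 * (ennreal c1 * ?W x) + 4 * (ennreal c2 * ?W x)"
      unfolding c1_def c2_def
      by (intro add_mono mult_left_mono I1_W_local[OF d t K C] I1_W_far[OF d t K]) auto
    also have "\<dots> = (4 * ennreal c1 + 4 * ennreal c2) * ?W x" by (simp add: distrib_right mult.assoc)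
    also have "4 * ennreal c1 + 4 * ennreal c2 = ennreal (4 * (c1 + c2))"
    proof -
      have "(4::ennreal) = ennreal 4" by simp
      then show ?thesis using c1 c2 by (simp only: ennreal_mult[symmetric] ennreal_plus[symmetric]) (simp add: ennreal_mult[symmetric] ennreal_plus[symmetric] distrib_left del: ennreal_plus)
    qed
    also have "ennreal (4 * (c1 + c2)) * ?W x \<le> ennreal (4 * (c1 + c2) + 1) * ?W x"
      by (intro mult_right_mono ennreal_leI) auto
    finally show ?thesis .
  qed
  show thesis using c1 c2 by (intro that[OF _ main]) auto
qed

section \<open>Trace inequality for the squared Riesz potential\<close>

lemma I1_bounded:
  assumes d: "CARD('d::finite) \<ge> 3" and mu: "rtest \<mu>" "\<And>x. 0 \<le> \<mu> x"
  obtains B where "\<And>x::real^'d. I1 (\<lambda>z. ennreal (\<mu> z)) x \<le> ennreal B"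
proof -
  have [measurable]: "\<mu> \<in> borel_measurable borel" by (rule sm_borel[OF rtest_sm[OF mu(1)]])
  obtain M where M: "M > 0" "\<And>x. \<bar>\<mu> x\<bar> \<le> M" using rtest_bounded[OF mu(1)] by metis
  define B where "B = M * (real CARD('d) * vb TYPE('d) * 1) + (LBINT x. \<mu> x)"
  have "I1 (\<lambda>z. ennreal (\<mu> z)) x \<le> ennreal B" for x
  proof -
    have "I1 (\<lambda>z. ennreal (\<mu> z)) x \<le> (LBNN z. ennreal M * (indicator {w. norm w < 1} (x - z) * kk (x - z)) + ennreal (\<mu> z))"
      unfolding I1_def
    proof (rule nn_integral_mono)
      fix z
      show "kk (x - z) * ennreal (\<mu> z) \<le> ennreal M * (indicator {w. norm w < 1} (x - z) * kk (x - z)) + ennreal (\<mu> z)"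
      proof (cases "norm (x - z) < 1")
        case True
        have "kk (x - z) * ennreal (\<mu> z) \<le> kk (x - z) * ennreal M" using M(2)[of z] by (intro mult_left_mono ennreal_leI) auto
        then show ?thesis using True by (simp add: mult.commute add_increasing2)
      next
        case False
        then have "kk (x - z) \<le> ennreal (1 / 1 ^ (CARD('d) - 1))" by (intro kk_le) auto
        then have "kk (x - z) * ennreal (\<mu> z) \<le> 1 * ennreal (\<mu> z)" by (intro mult_right_mono) auto
        then show ?thesis using False by simp
      qed
    qed
    also have "\<dots> = (LBNN z. ennreal M * (indicator {w. norm w < 1} (x - z) * kk (x - z))) + (LBNN z. ennreal (\<mu> z))"
      by (rule nn_integral_add) measurable
    also have "(LBNN z. ennreal (\<mu> z)) = ennreal (LBINT x. \<mu> x)"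
      by (intro nn_integral_eq_integral rtest_integrable mu AE_I2)
    also have "(LBNN z. ennreal M * (indicator {w. norm w < 1} (x - z) * kk (x - z))) = ennreal M * (LBNN z. indicator {w. norm w < 1} (x - z) * kk (x - z))"
      by (rule nn_integral_cmult) measurable
    also have "(LBNN z. indicator {w. norm w < 1} (x - z) * kk (x - z)) = (LBNN w. indicator {w. norm w < 1} w * kk (w::real^'d))"
      by (rule nn_integral_shift(2)[where f="\<lambda>w. indicator {w. norm w < 1} w * kk w"]) measurable
    also have "ennreal M * \<dots> + ennreal (LBINT x. \<mu> x) \<le> ennreal M * ennreal (real CARD('d) * vb TYPE('d) * 1) + ennreal (LBINT x. \<mu> x)"
      using d by (intro add_mono mult_left_mono kk_ball) auto
    also have "\<dots> = ennreal B" unfolding B_def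
      using M vb_pos[where 'd='d] mu(2)
      by (simp add: ennreal_mult[symmetric] ennreal_plus[symmetric] less_imp_le del: ennreal_plus)
    finally show ?thesis .
  qed
  then show thesis using that by blast
qed

lemma ennreal_square_le_imp:
  assumes "(N::ennreal)^2 \<le> c * N" "N < \<infinity>" shows "N \<le> c"
proof (cases "N = 0")
  case False
  then show ?thesis using assms by (metis power2_eq_square ennreal_mult_le_mult_iff mult.commute infinity_ennreal_def less_irrefl)
qed simp

text \<open>With f the sum of the absolute partial derivatives of u, it suffices to bound N =
  \<integral> W^2 (I1 f)^2. By \<open>I1_square_le\<close> and symmetry N is at most a multiple of
  \<integral> I1(W^2) f I1 f, and \<open>I1_W_square\<close> replaces I1(W^2) by W. Cauchy-Schwarz
  then bounds N by the L2 norm of f times the square root of N.\<close>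

lemma trace_potential:
  assumes d: "CARD('d::finite) \<ge> 3" and K: "K \<ge> 0"
  obtains C where "C > 0" "\<And>(\<mu> :: real^'d \<Rightarrow> real) u. trace_on K \<mu> \<Longrightarrow> rtest u \<Longrightarrow>
    (LBNN x. (I1 (\<lambda>z. ennreal (\<mu> z)) x)^2 * ennreal ((u x)^2)) \<le> ennreal (C * dir u)"
proof -
  obtain C2 where C2: "C2 > 0" "\<And>(\<mu> :: real^'d \<Rightarrow> real) x. trace_on K \<mu> \<Longrightarrow> I1 (\<lambda>y. (I1 (\<lambda>z. ennreal (\<mu> z)) y)^2) x \<le> ennreal C2 * I1 (\<lambda>z. ennreal (\<mu> z)) x"
    using I1_W_square[OF d K] by metis
  obtain Ck where Ck: "Ck > 0" "\<And>y z::real^'d. (LBNN x. kk (x - y) * kk (x - z)) \<le> ennreal Ck * k2 (y - z)"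
    using kk_compose[OF d] by metis
  define c where "c = 2 ^ CARD('d) * C2"
  define b where "b = (real CARD('d) - 2) / cN TYPE('d)"
  have cb: "c > 0" "b > 0" using C2 cN_pos[OF d] d by (auto simp: c_def b_def)
  have main: "(LBNN x. (I1 (\<lambda>z. ennreal (\<mu> z)) x)^2 * ennreal ((u x)^2)) \<le> ennreal (b^2 * c^2 * real CARD('d) * dir u)"
    if t: "trace_on K \<mu>" and u: "rtest u" for \<mu> u :: "real^'d \<Rightarrow> real"
  proof -
    have mu: "rtest \<mu>" "\<And>x. 0 \<le> \<mu> x" using t by (auto simp: trace_on_def)
    have [measurable]: "\<mu> \<in> borel_measurable borel" by (rule sm_borel[OF rtest_sm[OF mu(1)]])
    have su: "sm u" by (rule rtest_sm[OF u])
    note [measurable] = sm_borel[OF su] sm_borel[OF sm_rpd[OF su]]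
    let ?W = "I1 (\<lambda>z. ennreal (\<mu> z))"
    define g where "g x = (\<Sum>i\<in>UNIV. \<bar>rpd i u x\<bar>)" for x
    have g0: "0 \<le> g x" for x by (simp add: g_def sum_nonneg)
    have [measurable]: "g \<in> borel_measurable borel" unfolding g_def by measurable
    let ?f = "\<lambda>x. ennreal (g x)"
    have ub: "ennreal \<bar>u x\<bar> \<le> ennreal b * I1 ?f x" for x
    proof -
      have li: "locint (kr :: real^'d \<Rightarrow> real)" using d by (intro locint_kr) auto
      have ii: "integrable lborel (\<lambda>y. kr y * \<bar>rpd i u (x - y)\<bar>)" for i
        using integrable_abs[OF conv_integrable[OF li rtest_rpd[OF u], where x=x]] by (simp add: abs_mult kr_nonneg)
      have "cN TYPE('d) * \<bar>u x\<bar> \<le> (real CARD('d) - 2) * (\<Sum>i\<in>UNIV. (LBINT y. kr y * \<bar>rpd i u (x - y)\<bar>))"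
        by (rule rtest_le_kr_grad[OF d u])
      also have "(\<Sum>i\<in>UNIV. (LBINT y. kr y * \<bar>rpd i u (x - y)\<bar>)) = (LBINT y. kr y * g (x - y))"
        unfolding g_def sum_distrib_left by (rule Bochner_Integration.integral_sum[symmetric]) (rule ii)
      finally have "\<bar>u x\<bar> \<le> b * (LBINT y. kr y * g (x - y))" unfolding b_def using cN_pos[OF d] by (simp add: field_simps)
      then have "ennreal \<bar>u x\<bar> \<le> ennreal b * ennreal (LBINT y. kr y * g (x - y))"
        using cb by (subst ennreal_mult'[symmetric]) (auto intro: ennreal_leI)
      also have "ennreal (LBINT y. kr y * g (x - y)) = (LBNN y. ennreal (kr y * g (x - y)))"
        by (rule nn_integral_eq_integral[symmetric]) (auto simp: kr_nonneg g_def sum_distrib_left intro!: Bochner_Integration.integrable_sum ii AE_I2 sum_nonneg mult_nonneg_nonneg)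
      also have "\<dots> = (LBNN y. kk (x - (x - y)) * ?f (x - y))"
        by (rule nn_integral_cong_AE, use AE_neq[of 0] in eventually_elim) (simp add: kk_kr kr_nonneg g0 ennreal_mult)
      also have "\<dots> = I1 ?f x" unfolding I1_def
        by (rule nn_integral_shift(2)[where f="\<lambda>y. kk (x - y) * ?f y"]) measurable
      finally show ?thesis .
    qed
    define N where "N = (LBNN x. (?W x)^2 * (I1 ?f x)^2)"
    \<comment> \<open>Cancelling the square root of N needs finiteness beforehand. It comes from the
      qualitative facts that W is bounded and f is at most a multiple of a cutoff, whose Riesz
      potential is square integrable by \<open>I1_energy\<close>.\<close>
    have fin: "N < \<infinity>"
    proof -
      obtain B where B: "\<And>x. ?W x \<le> ennreal B" using I1_bounded[OF d mu] by metis
      obtain R where R: "R > 0" "vanish R u" using rtestE[OF u] by metis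
      have "\<forall>j. \<exists>M. M > 0 \<and> (\<forall>x. \<bar>rpd j u x\<bar> \<le> M)" using rtest_bounded[OF rtest_rpd[OF u]] by metis
      then obtain M where M: "\<And>j. M j > 0" "\<And>j x. \<bar>rpd j u x\<bar> \<le> M j" by metis
      let ?S = "\<Sum>j\<in>UNIV. M j"
      let ?c = "cutat 0 R :: real^'d \<Rightarrow> real"
      have c: "rtest ?c" "\<And>x. 0 \<le> ?c x" using R by (auto intro: cutat_rtest cutat_range)
      note [measurable] = sm_borel[OF rtest_sm[OF c(1)]]
      have fc: "?f x \<le> ennreal ?S * ennreal (?c x)" for x
      proof (cases "norm x \<le> R")
        case True
        then have "?c x = 1" using R by (intro cutat_one) auto
        moreover have "g x \<le> ?S" unfolding g_def by (intro sum_mono M)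
        ultimately show ?thesis by (simp add: ennreal_leI)
      next
        case False
        then have "g x = 0" using vanish_rpd[OF R(2)] by (auto simp: g_def vanish_def)
        then show ?thesis by simp
      qed
      have If: "I1 ?f x \<le> ennreal ?S * I1 (\<lambda>x. ennreal (?c x)) x" for x
        using I1_mono[of ?f "\<lambda>x. ennreal ?S * ennreal (?c x)", OF fc] by (simp add: I1_cmult)
      have "N \<le> (LBNN x. ((ennreal B)^2 * (ennreal ?S)^2) * (I1 (\<lambda>x. ennreal (?c x)) x)^2)"
        unfolding N_def
      proof (rule nn_integral_mono)
        fix x
        have "(?W x)^2 * (I1 ?f x)^2 \<le> (ennreal B)^2 * (ennreal ?S * I1 (\<lambda>x. ennreal (?c x)) x)^2"
          by (intro mult_mono power_mono B If) auto
        then show "(?W x)^2 * (I1 ?f x)^2 \<le> ((ennreal B)^2 * (ennreal ?S)^2) * (I1 (\<lambda>x. ennreal (?c x)) x)^2"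
          by (simp only: power_mult_distrib mult.assoc)
      qed
      also have "\<dots> = ((ennreal B)^2 * (ennreal ?S)^2) * (LBNN x. (I1 (\<lambda>x. ennreal (?c x)) x)^2)"
        by (rule nn_integral_cmult) measurable
      also have "\<dots> \<le> ((ennreal B)^2 * (ennreal ?S)^2) * (ennreal Ck * ennreal (LBINT x. conv gam ?c x * ?c x))"
        by (intro mult_left_mono I1_energy[OF d Ck(2) c]) auto
      also have "\<dots> < \<infinity>" by (simp add: ennreal_mult_less_top ennreal_power power_less_top_ennreal)
      finally show ?thesis .
    qed
    have "N \<le> (LBNN x. (?W x)^2 * (ennreal (2 ^ CARD('d)) * I1 (\<lambda>y. ?f y * I1 ?f y) x))"
      unfolding N_def using d by (intro nn_integral_mono mult_left_mono I1_square_le) auto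
    also have "\<dots> = (LBNN x. ennreal (2 ^ CARD('d)) * ((?W x)^2 * I1 (\<lambda>y. ?f y * I1 ?f y) x))"
      by (simp only: mult.left_commute)
    also have "\<dots> = ennreal (2 ^ CARD('d)) * (LBNN x. (?W x)^2 * I1 (\<lambda>y. ?f y * I1 ?f y) x)"
      by (rule nn_integral_cmult) measurable
    also have "(LBNN x. (?W x)^2 * I1 (\<lambda>y. ?f y * I1 ?f y) x) = (LBNN x. I1 (\<lambda>y. (?W y)^2) x * (?f x * I1 ?f x))"
      by (rule I1_symmetric) measurable
    also have "\<dots> \<le> (LBNN x. (ennreal C2 * ?W x) * (?f x * I1 ?f x))"
      by (intro nn_integral_mono mult_right_mono C2 t) auto
    also have "\<dots> = (LBNN x. ennreal C2 * (?f x * (?W x * I1 ?f x)))" by (simp only: mult_ac)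
    also have "\<dots> = ennreal C2 * (LBNN x. ?f x * (?W x * I1 ?f x))" by (rule nn_integral_cmult) measurable
    finally have N1: "N \<le> ennreal (2 ^ CARD('d)) * (ennreal C2 * (LBNN x. ?f x * (?W x * I1 ?f x)))"
      by (simp add: mult_left_mono)
    then have N2: "N \<le> ennreal c * (LBNN x. ?f x * (?W x * I1 ?f x))"
      unfolding c_def using C2 by (simp add: ennreal_mult mult.assoc)
    have "N^2 \<le> (ennreal c)^2 * (LBNN x. ?f x * (?W x * I1 ?f x))^2"
      using power_mono[OF N2, of 2] by (simp add: power_mult_distrib)
    also have "\<dots> \<le> (ennreal c)^2 * ((LBNN x. (?f x)^2) * (LBNN x. (?W x * I1 ?f x)^2))"
      by (intro mult_left_mono Cauchy_Schwarz_nn_integral) auto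
    also have "(LBNN x. (?W x * I1 ?f x)^2) = N" unfolding N_def by (simp only: power_mult_distrib)
    finally have "N^2 \<le> ((ennreal c)^2 * (LBNN x. (?f x)^2)) * N" by (simp only: mult.assoc)
    from ennreal_square_le_imp[OF this fin] have N3: "N \<le> (ennreal c)^2 * (LBNN x. (?f x)^2)" .
    have "(LBNN x. (?f x)^2) \<le> (LBNN x. ennreal (real CARD('d) * gsq u x))"
    proof (rule nn_integral_mono)
      fix x
      have "(g x)^2 \<le> real CARD('d) * gsq u x"
        using Cauchy_Schwarz_ineq_sum[of "\<lambda>_. 1" "\<lambda>j. \<bar>rpd j u x\<bar>" "UNIV :: 'd set"] by (simp add: g_def)
      then show "(?f x)^2 \<le> ennreal (real CARD('d) * gsq u x)" by (simp add: ennreal_power g0 ennreal_leI)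
    qed
    also have "\<dots> = ennreal (LBINT x. real CARD('d) * gsq u x)"
      by (intro nn_integral_eq_integral rtest_integrable rtest_cmult rtest_grad_sq u) (auto intro!: AE_I2 mult_nonneg_nonneg sum_nonneg)
    also have "\<dots> = ennreal (real CARD('d) * dir u)" by (simp add: dir_def)
    finally have N4: "N \<le> (ennreal c)^2 * ennreal (real CARD('d) * dir u)" using N3 by (meson mult_left_mono order_trans zero_le)
    have "(LBNN x. (?W x)^2 * ennreal ((u x)^2)) \<le> (LBNN x. (ennreal b)^2 * ((?W x)^2 * (I1 ?f x)^2))"
    proof (rule nn_integral_mono)
      fix x
      have "ennreal ((u x)^2) = (ennreal \<bar>u x\<bar>)^2" by (simp add: ennreal_power)
      also have "\<dots> \<le> (ennreal b * I1 ?f x)^2" by (intro power_mono ub) auto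
      finally have "(?W x)^2 * ennreal ((u x)^2) \<le> (?W x)^2 * (ennreal b * I1 ?f x)^2" by (intro mult_left_mono) auto
      then show "(?W x)^2 * ennreal ((u x)^2) \<le> (ennreal b)^2 * ((?W x)^2 * (I1 ?f x)^2)"
        by (simp only: power_mult_distrib mult.left_commute)
    qed
    also have "\<dots> = (ennreal b)^2 * N" unfolding N_def by (rule nn_integral_cmult) measurable
    also have "\<dots> \<le> (ennreal b)^2 * ((ennreal c)^2 * ennreal (real CARD('d) * dir u))" by (intro mult_left_mono N4) auto
    also have "\<dots> = ennreal (b^2 * c^2 * real CARD('d) * dir u)"
      using cb dir_nonneg[of u] by (simp add: ennreal_power less_imp_le ennreal_mult[symmetric] mult.assoc)
    finally show ?thesis .
  qed
  show thesis using cb by (intro that[OF _ main]) auto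
qed

section \<open>Supersolutions and local potentials\<close>

lemma rpd_power2: "sm u \<Longrightarrow> rpd j (\<lambda>x. (u x)^2) x = 2 * u x * rpd j u x"
  using rpd_mult[OF sm_diff sm_diff, of u u] by (simp add: power2_eq_square)

lemma rpd_add_const: "sm f \<Longrightarrow> rpd j (\<lambda>x. f x + c) x = rpd j f x" "sm f \<Longrightarrow> rpd j (\<lambda>x. f x - c) x = rpd j f x"
  using rpd_add[OF sm_diff differentiable_const, of f _ c] rpd_add[OF sm_diff differentiable_const, of f _ "-c"] by auto

lemma dirb_add_right: assumes "rtest u" "rtest v" "rtest w" shows "dirb u (\<lambda>x. v x + c * w x) = dirb u v + c * dirb u w"
proof -
  have e: "rpd j (\<lambda>x. v x + c * w x) x = rpd j v x + c * rpd j w x" for j x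
    using assms by (simp add: rpd_add rpd_cmult sm_diff rtest_sm rtest_cmult)
  have "(\<lambda>x. \<Sum>j\<in>UNIV. rpd j u x * (rpd j v x + c * rpd j w x)) = (\<lambda>x. (\<Sum>j\<in>UNIV. rpd j u x * rpd j v x) + c * (\<Sum>j\<in>UNIV. rpd j u x * rpd j w x))"
    by (auto simp: fun_eq_iff algebra_simps sum.distrib sum_distrib_left)
  then show ?thesis unfolding dirb_def e
    using rtest_integrable[OF rtest_grad_prod[OF assms(1) rtest_sm[OF assms(2)]]] rtest_integrable[OF rtest_grad_prod[OF assms(1) rtest_sm[OF assms(3)]]] by simp
qed

lemma dirb_sym: "dirb u v = dirb v u" by (simp add: dirb_def mult.commute)

lemma dir_add: assumes "rtest v" "rtest w" shows "dir (\<lambda>x. v x + c * w x) = dir v + 2 * c * dirb v w + c^2 * dir w"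
proof -
  have t: "rtest (\<lambda>x. v x + c * w x)" by (intro rtest_add rtest_cmult assms)
  show ?thesis unfolding dir_dirb dirb_add_right[OF t assms]
    unfolding dirb_sym[of "\<lambda>x. v x + c * w x"] dirb_add_right[OF assms(1) assms] dirb_add_right[OF assms(2) assms]
    by (simp add: dirb_sym[of w v] power2_eq_square algebra_simps)
qed

lemma dir_mono: assumes "rtest u" "rtest v" "\<And>j x. \<bar>rpd j v x\<bar> \<le> \<bar>rpd j u x\<bar>" shows "dir v \<le> dir u"
  unfolding dir_def
  by (intro integral_mono rtest_integrable rtest_grad_sq assms sum_mono) (use assms(3) in \<open>auto simp: abs_le_square_iff[symmetric]\<close>)

lemma dir_translate:
  assumes "rtest u" shows "dir (\<lambda>y. u (a - y)) = dir u" "dir (\<lambda>y. u (y + a)) = dir u" "dir (\<lambda>y. u (y - a)) = dir u"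
proof -
  have s: "sm u" using assms rtest_sm by blast
  have b: "(\<lambda>x. gsq u x) \<in> borel_measurable borel" by (rule sm_borel[OF rtest_sm[OF rtest_grad_sq[OF assms]]])
  show "dir (\<lambda>y. u (a - y)) = dir u" unfolding dir_def rpd_translate[OF s] using integral_shift(3)[OF b, of a] by simp
  show "dir (\<lambda>y. u (y + a)) = dir u" unfolding dir_def rpd_translate[OF s] using integral_shift(1)[OF b, of a] by simp
  show "dir (\<lambda>y. u (y - a)) = dir u" unfolding dir_def rpd_translate[OF s] using integral_shift(2)[OF b, of a] by simp
qed

text \<open>The factor sqrt(1 + |x|^2) is moved from u to f; Hardy's inequality bounds the remaining
  norm of u. This makes the linear term of the energy functional continuous.\<close>

lemma hardy_pairing:
  fixes f :: "real^'d::finite \<Rightarrow> real"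
  assumes d: "CARD('d) \<ge> 3" and f: "rtest f"
  obtains A where "A \<ge> 0" "\<And>u. rtest u \<Longrightarrow> \<bar>LBINT x. f x * u x\<bar> \<le> A * sqrt (dir u)"
proof -
  let ?q = "\<lambda>x::real^'d. 1 + (norm x)^2"
  have qp: "?q x > 0" for x by (simp add: add_pos_nonneg)
  have sq: "sm ?q" by (intro sm_add sm_const sm_norm_sq)
  have ss: "sm (\<lambda>x. sqrt (?q x))" by (intro sm_sqrt sq qp)
  have sp: "sqrt (?q x) > 0" for x using qp by simp
  define B where "B = (LBINT x. (f x * sqrt (?q x))^2)"
  have B0: "B \<ge> 0" by (simp add: B_def)
  have "\<bar>LBINT x. f x * u x\<bar> \<le> (sqrt B * 2) * sqrt (dir u)" if u: "rtest u" for u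
  proof -
    have "(\<lambda>x. (f x * sqrt (?q x)) * (u x / sqrt (?q x))) = (\<lambda>x. f x * u x)" using sp by (auto simp: fun_eq_iff less_imp_neq[symmetric])
    moreover have t1: "rtest (\<lambda>x. f x * sqrt (?q x))" by (intro rtest_mult1 f ss)
    moreover have t2: "rtest (\<lambda>x. u x / sqrt (?q x))" using rtest_mult1[OF u sm_inverse[OF ss sp]] by (simp add: divide_inverse)
    moreover have "\<bar>LBINT x. (f x * sqrt (?q x)) * (u x / sqrt (?q x))\<bar> \<le> sqrt B * sqrt (LBINT x. (u x / sqrt (?q x))^2)"
      unfolding B_def using t1 t2 by (intro integral_CS1 rtest_integrable rtest_power2) (auto intro: sm_borel rtest_sm)
    moreover have "(u x / sqrt (?q x))^2 = (u x)^2 / ?q x" for x using qp[of x] by (simp add: power_divide)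
    ultimately have "\<bar>LBINT x. f x * u x\<bar> \<le> sqrt B * sqrt (LBINT x. (u x)^2 / ?q x)" by simp
    also have "\<dots> \<le> sqrt B * sqrt (4 * dir u)" by (intro mult_left_mono real_sqrt_le_mono hardy[OF d u]) (simp add: B0)
    finally show ?thesis by (simp add: real_sqrt_mult)
  qed
  then show thesis using that[of "sqrt B * 2"] B0 by simp
qed

text \<open>A smooth substitute for |u|: nonnegative, compactly supported and without additional
  energy. The exact relation between its square and u^2 lets a quadratic functional with signed
  \<open>V\<close> be compared at u and v.\<close>

lemma sqrt_reg:
  assumes u: "rtest u" and t: "\<tau> > 0" and v_def: "v = (\<lambda>x. sqrt ((u x)^2 + \<tau>\<^sup>2) - \<tau>)"
  shows "rtest v" "\<And>x. 0 \<le> v x" "dir v \<le> dir u" "\<And>x. (v x)^2 = (u x)^2 - 2 * \<tau> * v x" "\<And>x. \<bar>u x\<bar> - \<tau> \<le> v x" "\<And>x. v x \<le> \<bar>u x\<bar>"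
proof -
  have p: "(u x)^2 + \<tau>\<^sup>2 > 0" for x using t by (simp add: add_nonneg_pos)
  have su: "sm u" by (rule rtest_sm[OF u])
  have sp: "sm (\<lambda>x. (u x)^2 + \<tau>\<^sup>2)" by (intro sm_add sm_power sm_const su)
  have sv: "sm v" unfolding v_def by (intro sm_sub sm_sqrt sp p sm_const)
  obtain R where R: "vanish R u" using u by (auto simp: rtest_def)
  have "vanish R v" using R t by (auto simp: vanish_def v_def)
  then show rv: "rtest v" using sv unfolding rtest_def by blast
  show "0 \<le> v x" for x unfolding v_def using real_sqrt_le_mono[of "\<tau>\<^sup>2" "(u x)^2 + \<tau>\<^sup>2"] t by simp
  show "(v x)^2 = (u x)^2 - 2 * \<tau> * v x" for x unfolding v_def using p[of x] by (simp add: power2_diff algebra_simps power2_eq_square)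
  have "\<bar>u x\<bar> \<le> sqrt ((u x)^2 + \<tau>\<^sup>2)" for x using real_sqrt_le_mono[of "(u x)^2" "(u x)^2 + \<tau>\<^sup>2"] by simp
  then show "\<bar>u x\<bar> - \<tau> \<le> v x" for x unfolding v_def by simp
  show "v x \<le> \<bar>u x\<bar>" for x unfolding v_def using sqrt_add_le_add_sqrt[of "(u x)^2" "\<tau>\<^sup>2"] t by simp
  show "dir v \<le> dir u"
  proof (rule dir_mono[OF u rv])
    fix j x
    have "rpd j (\<lambda>x. (u x)^2 + \<tau>\<^sup>2) x = 2 * u x * rpd j u x"
      unfolding rpd_add_const(1)[OF sm_power[OF su]] by (rule rpd_power2[OF su])
    then have "rpd j (\<lambda>x. sqrt ((u x)^2 + \<tau>\<^sup>2)) x = inverse (sqrt ((u x)^2 + \<tau>\<^sup>2)) / 2 * (2 * u x * rpd j u x)"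
      using rpd_chain(2)[OF DERIV_real_sqrt[OF p[of x]] sm_diff[OF sp], of j] by simp
    moreover have "rpd j v x = rpd j (\<lambda>x. sqrt ((u x)^2 + \<tau>\<^sup>2)) x"
      unfolding v_def by (rule rpd_add_const(2)[OF sm_sqrt[OF sp p]])
    moreover have "inverse s / 2 * (2 * a * b) = a / s * b" for a b s :: real by (cases "s = 0") (auto simp: field_simps)
    ultimately have e: "rpd j v x = u x / sqrt ((u x)^2 + \<tau>\<^sup>2) * rpd j u x" by simp
    have "\<bar>u x / sqrt ((u x)^2 + \<tau>\<^sup>2)\<bar> \<le> 1" using p[of x] \<open>\<bar>u x\<bar> \<le> sqrt ((u x)^2 + \<tau>\<^sup>2)\<close> by (simp add: abs_divide divide_le_eq)
    then show "\<bar>rpd j v x\<bar> \<le> \<bar>rpd j u x\<bar>" unfolding e abs_mult by (intro mult_left_le_one_le) auto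
  qed
qed

text \<open>The form bound gives the functional \<open>E\<close> a lower bound by coercivity. A
  point within 2 \<delta> of the infimum satisfies the Euler-Lagrange equation up to an error of
  order sqrt \<delta> in the dual norm, and replacing u by \<open>sqrt_reg\<close> makes it
  nonnegative without spoiling this.\<close>

lemma near_minimiser:
  fixes V f :: "real^'d::finite \<Rightarrow> real"
  assumes d: "CARD('d) \<ge> 3" and V: "continuous_on UNIV V"
    and form: "\<And>u. rtest u \<Longrightarrow> \<bar>LBINT x. V x * (u x)^2\<bar> \<le> dir u / 2"
    and f: "rtest f" "\<And>x. 0 \<le> f x"
  obtains M0 where "M0 \<ge> 0" "\<And>\<delta>. 0 < \<delta> \<Longrightarrow> \<delta> \<le> 1 \<Longrightarrow> \<exists>v. rtest v \<and> (\<forall>x. 0 \<le> v x) \<and> dir v \<le> M0^2 \<and>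
     (\<forall>\<eta>. rtest \<eta> \<longrightarrow> \<bar>dirb v \<eta> - (LBINT x. V x * (v x * \<eta> x)) - (LBINT x. f x * \<eta> x)\<bar> \<le> sqrt (8 * \<delta> * dir \<eta>))"
proof -
  obtain A where A: "A \<ge> 0" "\<And>u. rtest u \<Longrightarrow> \<bar>LBINT x. f x * u x\<bar> \<le> A * sqrt (dir u)" using hardy_pairing[OF d f(1)] by metis
  have li: "locint V" by (rule locint_cont[OF V])
  have iV: "integrable lborel (\<lambda>x. V x * g x)" if "rtest g" for g by (rule locint_rtest_integrable[OF li that])
  define E where "E u = dir u / 2 - (LBINT x. V x * (u x)^2) / 2 - (LBINT x. f x * u x)" for u
  have lowE: "dir u / 4 - A * sqrt (dir u) \<le> E u" if "rtest u" for u
    using form[OF that] A(2)[OF that] unfolding E_def by linarith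
  have lowE2: "- A\<^sup>2 \<le> E u" if "rtest u" for u
  proof -
    have "0 \<le> (sqrt (dir u) / 2 - A)^2" by simp
    also have "\<dots> = dir u / 4 - A * sqrt (dir u) + A^2" using dir_nonneg[of u] by (simp add: power2_diff power_divide)
    finally show ?thesis using lowE[OF that] by linarith
  qed
  define e where "e = Inf (E ` {u. rtest u})"
  have bdd: "bdd_below (E ` {u. rtest u})" using lowE2 by (intro bdd_belowI[of _ "- A\<^sup>2"]) auto
  have eE: "e \<le> E u" if "rtest u" for u unfolding e_def using bdd that by (intro cInf_lower) auto
  have E0: "E (\<lambda>x. 0) = 0" by (simp add: E_def dir_def)
  have e0: "e \<le> 0" using eE[OF rtest_zero] E0 by simp
  \<comment> \<open>At a near minimiser \<open>E\<close> is at most 2; for sqrt (dir v) above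
    \<open>4 * A + 4\<close> the lower bound \<open>lowE\<close> would exceed 4.\<close>
  define M0 where "M0 = 4 * A + 4"
  have "\<exists>v. rtest v \<and> (\<forall>x. 0 \<le> v x) \<and> dir v \<le> M0^2 \<and>
     (\<forall>\<eta>. rtest \<eta> \<longrightarrow> \<bar>dirb v \<eta> - (LBINT x. V x * (v x * \<eta> x)) - (LBINT x. f x * \<eta> x)\<bar> \<le> sqrt (8 * \<delta> * dir \<eta>))"
    if dl: "0 < \<delta>" "\<delta> \<le> 1" for \<delta>
  proof -
    have "\<exists>y \<in> E ` {u. rtest u}. y < e + \<delta>"
      unfolding e_def using dl rtest_zero by (intro cInf_lessD) auto
    then obtain u where u: "rtest u" "E u < e + \<delta>" by auto
    define P where "P = (LBINT x. \<bar>V x * u x\<bar>) + (LBINT x. f x)"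
    have P0: "P \<ge> 0" unfolding P_def using f(2) by (simp add: integral_nonneg_AE)
    \<comment> \<open>\<open>P\<close> bounds the rate at which the two lower-order terms can raise
      the functional when u is replaced by v, so the total loss is at most \<delta>.\<close>
    define \<tau> where "\<tau> = \<delta> / (P + 1)"
    have t: "\<tau> > 0" "\<tau> * P \<le> \<delta>" using dl P0 by (auto simp: \<tau>_def field_simps)
    define v where "v = (\<lambda>x. sqrt ((u x)^2 + \<tau>\<^sup>2) - \<tau>)"
    note v = sqrt_reg[OF u(1) t(1) v_def]
    have Vv: "(LBINT x. V x * (v x)^2) = (LBINT x. V x * (u x)^2) - 2 * \<tau> * (LBINT x. V x * v x)"
    proof -
      have "(LBINT x. V x * (v x)^2) = (LBINT x. V x * (u x)^2 - 2 * \<tau> * (V x * v x))"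
      proof (intro Bochner_Integration.integral_cong refl)
        fix x
        have "V x * (v x)^2 = V x * ((u x)^2 - 2 * \<tau> * v x)" by (simp only: v(4))
        then show "V x * (v x)^2 = V x * (u x)^2 - 2 * \<tau> * (V x * v x)" by (simp add: right_diff_distrib)
      qed
      then show ?thesis using iV[OF rtest_power2[OF u(1)]] iV[OF v(1)] by simp
    qed
    have Vv2: "\<bar>LBINT x. V x * v x\<bar> \<le> (LBINT x. \<bar>V x * u x\<bar>)"
    proof (rule integral_abs_le(2)[OF borel_measurable_integrable[OF iV[OF v(1)]] integrable_abs[OF iV[OF u(1)]]])
      fix x show "\<bar>V x * v x\<bar> \<le> \<bar>V x * u x\<bar>"
        unfolding abs_mult using v(2)[of x] v(6)[of x] by (intro mult_left_mono) auto
    qed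
    have fv: "(LBINT x. f x * u x) - \<tau> * (LBINT x. f x) \<le> (LBINT x. f x * v x)"
    proof -
      have i: "integrable lborel (\<lambda>x. f x * u x)" "integrable lborel (\<lambda>x. f x * v x)" "integrable lborel (\<lambda>x. \<tau> * f x)"
        by (intro rtest_integrable rtest_mult1 rtest_cmult f rtest_sm[OF u(1)] rtest_sm[OF v(1)])+
      have "(LBINT x. f x * u x) - \<tau> * (LBINT x. f x) = (LBINT x. f x * u x - \<tau> * f x)"
        using i by simp
      also have "\<dots> \<le> (LBINT x. f x * v x)"
      proof (intro integral_mono Bochner_Integration.integrable_diff i)
        fix x have "f x * (u x - \<tau>) \<le> f x * v x" using v(5)[of x] f(2)[of x] by (intro mult_left_mono) auto
        then show "f x * u x - \<tau> * f x \<le> f x * v x" by (simp add: algebra_simps)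
      qed
      finally show ?thesis .
    qed
    have Ev: "E v \<le> e + 2 * \<delta>"
    proof -
      have "\<tau> * (LBINT x. V x * v x) \<le> \<tau> * (LBINT x. \<bar>V x * u x\<bar>)" using Vv2 t(1) by (intro mult_left_mono) auto
      moreover have "\<tau> * (LBINT x. \<bar>V x * u x\<bar>) + \<tau> * (LBINT x. f x) \<le> \<delta>" using t(2) unfolding P_def by (simp add: distrib_left)
      ultimately show ?thesis using u(2) v(3) fv unfolding E_def Vv by (simp add: field_simps)
    qed
    have dv: "dir v \<le> M0^2"
    proof -
      define s where "s = sqrt (dir v)"
      have s: "s \<ge> 0" "dir v = s^2" using dir_nonneg[of v] by (auto simp: s_def)
      have "dir v / 4 - A * s \<le> 2" using lowE[OF v(1)] Ev e0 dl unfolding s_def[symmetric] by linarith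
      then have "s^2 / 4 - A * s \<le> 2" unfolding s(2) .
      have "s \<le> M0"
      proof (rule ccontr)
        assume "\<not> s \<le> M0"
        then have "s / 4 - A > 1" "s > 4" using A(1) by (auto simp: M0_def)
        then have "s * (s / 4 - A) \<ge> s * 1" by (intro mult_left_mono) auto
        with \<open>s > 4\<close> \<open>s\<^sup>2 / 4 - A * s \<le> 2\<close> show False by (simp add: power2_eq_square algebra_simps)
      qed
      then show ?thesis unfolding s(2) using s(1) by (intro power_mono) auto
    qed
    have "\<bar>dirb v \<eta> - (LBINT x. V x * (v x * \<eta> x)) - (LBINT x. f x * \<eta> x)\<bar> \<le> sqrt (8 * \<delta> * dir \<eta>)" if eta: "rtest \<eta>" for \<eta>
    proof -
      let ?D = "dirb v \<eta> - (LBINT x. V x * (v x * \<eta> x)) - (LBINT x. f x * \<eta> x)"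
      \<comment> \<open>Along the line \<open>v + s * \<eta>\<close> the functional cannot fall
        below its infimum \<open>e\<close>, while at v it is at most
        \<open>e + 2 * \<delta>\<close>. The resulting quadratic in s is nonnegative, and its
        discriminant bounds the first variation.\<close>
      have "(?D / 2)^2 \<le> dir \<eta> * (2 * \<delta>)"
      proof (rule quadratic_discriminant)
        fix s :: real
        have t': "rtest (\<lambda>x. v x + s * \<eta> x)" by (intro rtest_add rtest_cmult v eta)
        have "(LBINT x. V x * (v x + s * \<eta> x)^2) = (LBINT x. V x * (v x)^2 + (2 * s) * (V x * (v x * \<eta> x)) + s^2 * (V x * (\<eta> x)^2))"
          by (intro Bochner_Integration.integral_cong) (auto simp: power2_eq_square algebra_simps)
        also have "\<dots> = (LBINT x. V x * (v x)^2) + (2 * s) * (LBINT x. V x * (v x * \<eta> x)) + s^2 * (LBINT x. V x * (\<eta> x)^2)"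
          using iV[OF rtest_power2[OF v(1)]] iV[OF rtest_mult1[OF v(1) rtest_sm[OF eta]]] iV[OF rtest_power2[OF eta]] by simp
        finally have e1: "(LBINT x. V x * (v x + s * \<eta> x)^2) = (LBINT x. V x * (v x)^2) + (2 * s) * (LBINT x. V x * (v x * \<eta> x)) + s^2 * (LBINT x. V x * (\<eta> x)^2)" .
        have e2: "(LBINT x. f x * (v x + s * \<eta> x)) = (LBINT x. f x * v x) + s * (LBINT x. f x * \<eta> x)"
        proof -
          have "(LBINT x. f x * (v x + s * \<eta> x)) = (LBINT x. f x * v x + s * (f x * \<eta> x))"
            by (intro Bochner_Integration.integral_cong) (auto simp: algebra_simps)
          then show ?thesis using rtest_integrable[OF rtest_mult1[OF f(1) rtest_sm[OF v(1)]]] rtest_integrable[OF rtest_mult1[OF f(1) rtest_sm[OF eta]]] by simp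
        qed
        have "E (\<lambda>x. v x + s * \<eta> x) = E v + s * ?D + s^2 * ((dir \<eta> - (LBINT x. V x * (\<eta> x)^2)) / 2)"
          unfolding E_def dir_add[OF v(1) eta] e1 e2 by (simp add: field_simps)
        also have "\<dots> \<le> e + 2 * \<delta> + s * ?D + s^2 * dir \<eta>"
        proof -
          have "s^2 * ((dir \<eta> - (LBINT x. V x * (\<eta> x)^2)) / 2) \<le> s^2 * dir \<eta>"
            using form[OF eta] dir_nonneg[of \<eta>] by (intro mult_left_mono) auto
          then show ?thesis using Ev by linarith
        qed
        finally have "e \<le> e + 2 * \<delta> + s * ?D + s^2 * dir \<eta>" using eE[OF t'] by linarith
        then show "0 \<le> s^2 * dir \<eta> + 2 * s * (?D / 2) + 2 * \<delta>" by simp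
      qed
      then have "?D^2 \<le> 8 * \<delta> * dir \<eta>" by (simp add: power_divide algebra_simps)
      then show ?thesis using real_sqrt_le_mono by fastforce
    qed
    then show ?thesis using v(1,2) dv by blast
  qed
  moreover have "M0 \<ge> 0" using A(1) by (simp add: M0_def)
  ultimately show thesis using that by blast
qed

section \<open>Logarithmic supersolutions\<close>

definition mollifier :: "(real^'d::finite \<Rightarrow> real) \<Rightarrow> bool" where
  "mollifier \<rho> \<longleftrightarrow> rtest \<rho> \<and> (\<forall>x. 0 \<le> \<rho> x) \<and> vanish 1 \<rho> \<and> integral\<^sup>L lborel \<rho> = 1"

lemma rpd_divide:
  assumes g: "sm g" and w: "sm w" "\<And>x. 0 < w x"
  shows "rpd j (\<lambda>x. g x / w x) x = rpd j g x / w x - g x * rpd j w x / (w x)^2"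
proof -
  have "rpd j (\<lambda>x. inverse (w x)) x = - (inverse (w x) ^ Suc (Suc 0)) * rpd j w x"
    by (rule rpd_chain(2)[OF DERIV_inverse sm_diff[OF w(1)]]) (metis w(2) less_irrefl)
  moreover have "rpd j (\<lambda>x. g x * inverse (w x)) x = rpd j g x * inverse (w x) + g x * rpd j (\<lambda>x. inverse (w x)) x"
    by (rule rpd_mult[OF sm_diff[OF g] sm_diff[OF sm_inverse[OF w]]])
  ultimately show ?thesis by (simp add: divide_inverse power2_eq_square)
qed

text \<open>For w = 1 + v and \<eta> = g / w, the product grad v . grad \<eta> becomes grad \<phi> .
  grad g - g |grad \<phi>|^2, and V v \<eta> + f \<eta> dominates V g where f dominates V. One
  \<phi> has to serve all translates of a mollifier, so \<delta> is fixed in terms of the common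
  bounds \<open>G\<close> and \<open>Q\<close>.\<close>

lemma weak_supersolution:
  fixes V f :: "real^'d::finite \<Rightarrow> real"
  assumes d: "CARD('d) \<ge> 3" and V: "continuous_on UNIV V"
    and form: "\<And>u. rtest u \<Longrightarrow> \<bar>LBINT x. V x * (u x)^2\<bar> \<le> dir u / 2"
    and f: "rtest f" "\<And>x. 0 \<le> f x" "\<And>x. norm x \<le> S \<Longrightarrow> V x \<le> f x"
    and e: "\<epsilon> > 0" and Gp: "G \<ge> 0" "Q \<ge> 0"
  shows "\<exists>\<phi>. rtest \<phi> \<and> (\<forall>g. rtest g \<longrightarrow> vanish S g \<longrightarrow> (\<forall>x. 0 \<le> g x \<and> g x \<le> G) \<longrightarrow> dir g \<le> Q \<longrightarrow>
     (LBINT x. V x * g x) + (LBINT x. g x * gsq \<phi> x) - \<epsilon> \<le> dirb \<phi> g)"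
proof -
  obtain M0 where M0: "M0 \<ge> 0" "\<And>\<delta>. 0 < \<delta> \<Longrightarrow> \<delta> \<le> 1 \<Longrightarrow> \<exists>v. rtest v \<and> (\<forall>x. 0 \<le> v x) \<and> dir v \<le> M0^2 \<and>
     (\<forall>\<eta>. rtest \<eta> \<longrightarrow> \<bar>dirb v \<eta> - (LBINT x. V x * (v x * \<eta> x)) - (LBINT x. f x * \<eta> x)\<bar> \<le> sqrt (8 * \<delta> * dir \<eta>))"
    using near_minimiser[OF d V form f(1,2)] by blast
  have li: "locint V" by (rule locint_cont[OF V])
  have iV: "integrable lborel (\<lambda>x. V x * g x)" if "rtest g" for g by (rule locint_rtest_integrable[OF li that])
  \<comment> \<open>Eight times the bound on the energy of \<eta> = g / (1 + v) that follows from
    \<open>G\<close>, \<open>Q\<close> and the energy bound of v; then \<open>\<delta> * X\<close>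
    at most \<epsilon>^2 makes the Euler-Lagrange error at most \<epsilon>.\<close>
  define X where "X = 8 * (2 * Q + 2 * G^2 * M0^2)"
  have X0: "X \<ge> 0" using Gp by (simp add: X_def)
  define \<delta> where "\<delta> = min 1 (\<epsilon>\<^sup>2 / (X + 1))"
  have dl: "0 < \<delta>" "\<delta> \<le> 1" using e X0 by (auto simp: \<delta>_def)
  have dX: "\<delta> * X \<le> \<epsilon>\<^sup>2"
  proof -
    have "\<delta> * X \<le> (\<epsilon>\<^sup>2 / (X + 1)) * X" using X0 by (intro mult_right_mono) (auto simp: \<delta>_def)
    also have "\<dots> = \<epsilon>\<^sup>2 * (X / (X + 1))" by simp
    also have "\<dots> \<le> \<epsilon>\<^sup>2 * 1" using X0 by (intro mult_left_mono) auto
    finally show ?thesis by simp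
  qed
  obtain v where v: "rtest v" "\<And>x. 0 \<le> v x" "dir v \<le> M0^2"
    "\<And>\<eta>. rtest \<eta> \<Longrightarrow> \<bar>dirb v \<eta> - (LBINT x. V x * (v x * \<eta> x)) - (LBINT x. f x * \<eta> x)\<bar> \<le> sqrt (8 * \<delta> * dir \<eta>)"
    using M0(2)[OF dl] by blast
  have sv: "sm v" by (rule rtest_sm[OF v(1)])
  let ?w = "\<lambda>x. v x + 1"
  have w: "sm ?w" "\<And>x. 0 < ?w x" using v(2) by (auto intro: sm_add sv sm_const add_nonneg_pos)
  have w1: "1 \<le> ?w x" for x using v(2)[of x] by simp
  have rw: "rpd j ?w x = rpd j v x" for j x by (rule rpd_add_const(1)[OF sv])
  define \<phi> where "\<phi> x = ln (v x + 1)" for x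
  have ph: "rtest \<phi>"
  proof -
    obtain R where "vanish R v" using v(1) by (auto simp: rtest_def)
    then have "vanish R \<phi>" by (auto simp: vanish_def \<phi>_def)
    moreover have "sm \<phi>" unfolding \<phi>_def[abs_def] by (rule sm_ln[OF w])
    ultimately show ?thesis by (auto simp: rtest_def)
  qed
  have rp: "rpd j \<phi> x = rpd j v x / ?w x" for j x unfolding \<phi>_def[abs_def] rpd_ln[OF w] rw ..
  have "(LBINT x. V x * g x) + (LBINT x. g x * gsq \<phi> x) - \<epsilon> \<le> dirb \<phi> g"
    if g: "rtest g" "vanish S g" "\<And>x. 0 \<le> g x" "\<And>x. g x \<le> G" "dir g \<le> Q" for g
  proof -
    define \<eta> where "\<eta> x = g x / ?w x" for x
    have sg: "sm g" by (rule rtest_sm[OF g(1)])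
    have eta: "rtest \<eta>" using rtest_mult1[OF g(1) sm_inverse[OF w]] unfolding \<eta>_def[abs_def] divide_inverse .
    have re: "rpd j \<eta> x = rpd j g x / ?w x - g x * rpd j v x / (?w x)^2" for j x
      unfolding \<eta>_def[abs_def] rpd_divide[OF sg w] rw ..
    have re2: "(rpd j \<eta> x)^2 \<le> 2 * (rpd j g x)^2 + 2 * G^2 * (rpd j v x)^2" for j x
    proof -
      have ab: "(a - b)^2 \<le> 2 * a^2 + 2 * b^2" for a b :: real
        using zero_le_power2[of "a + b"] by (simp add: power2_eq_square algebra_simps)
      have 1: "(rpd j g x / ?w x)^2 \<le> (rpd j g x)^2"
      proof (rule abs_le_square_iff[THEN iffD1])
        have "\<bar>rpd j g x / ?w x\<bar> \<le> \<bar>rpd j g x\<bar> / 1" unfolding abs_divide using w1[of x] by (intro frac_le) auto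
        then show "\<bar>rpd j g x / ?w x\<bar> \<le> \<bar>rpd j g x\<bar>" by simp
      qed
      have "(g x * rpd j v x / (?w x)^2)^2 \<le> (G * rpd j v x)^2"
      proof (rule abs_le_square_iff[THEN iffD1])
        have "1 \<le> (?w x)^2" using w1[of x] by (rule one_le_power)
        then have "\<bar>g x * rpd j v x / (?w x)^2\<bar> \<le> \<bar>g x * rpd j v x\<bar> / 1" unfolding abs_divide by (intro frac_le) auto
        also have "\<dots> \<le> \<bar>G * rpd j v x\<bar>" unfolding abs_mult using g(3,4)[of x] by (auto intro!: mult_right_mono)
        finally show "\<bar>g x * rpd j v x / (?w x)^2\<bar> \<le> \<bar>G * rpd j v x\<bar>" .
      qed
      then have 2: "(g x * rpd j v x / (?w x)^2)^2 \<le> G^2 * (rpd j v x)^2" by (simp add: power_mult_distrib)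
      show ?thesis unfolding re using ab[of "rpd j g x / ?w x" "g x * rpd j v x / (?w x)^2"] 1 2 by linarith
    qed
    have "dir \<eta> \<le> (LBINT x. 2 * gsq g x + 2 * G^2 * gsq v x)"
      unfolding dir_def
    proof (intro integral_mono rtest_integrable rtest_grad_sq eta rtest_add rtest_cmult g v)
      fix x show "gsq \<eta> x \<le> 2 * gsq g x + 2 * G^2 * gsq v x"
        unfolding sum_distrib_left sum.distrib[symmetric] by (intro sum_mono re2)
    qed
    also have "\<dots> = 2 * dir g + 2 * G^2 * dir v"
      unfolding dir_def using rtest_integrable[OF rtest_grad_sq[OF g(1)]] rtest_integrable[OF rtest_grad_sq[OF v(1)]] by simp
    also have "\<dots> \<le> 2 * Q + 2 * G^2 * M0^2" using g(5) v(3) by (intro add_mono mult_left_mono) auto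
    finally have "8 * \<delta> * dir \<eta> \<le> 8 * \<delta> * (2 * Q + 2 * G^2 * M0^2)" using dl by (intro mult_left_mono) auto
    also have "\<dots> \<le> \<epsilon>\<^sup>2" using dX by (simp add: X_def algebra_simps)
    finally have "sqrt (8 * \<delta> * dir \<eta>) \<le> \<epsilon>" using e by (metis real_sqrt_le_mono real_sqrt_abs abs_of_pos)
    then have D: "- \<epsilon> \<le> dirb v \<eta> - (LBINT x. V x * (v x * \<eta> x)) - (LBINT x. f x * \<eta> x)"
      using v(4)[OF eta] by linarith
    have i1: "integrable lborel (\<lambda>x. V x * (v x * \<eta> x))" by (intro iV rtest_mult1 v sv rtest_sm[OF eta])
    have i2: "integrable lborel (\<lambda>x. f x * \<eta> x)" by (intro rtest_integrable rtest_mult1 f rtest_sm[OF eta])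
    have "(LBINT x. V x * g x) \<le> (LBINT x. V x * (v x * \<eta> x) + f x * \<eta> x)"
    proof (rule integral_mono[OF iV[OF g(1)] Bochner_Integration.integrable_add[OF i1 i2]])
      fix x
      show "V x * g x \<le> V x * (v x * \<eta> x) + f x * \<eta> x"
      proof (cases "norm x \<le> S")
        case True
        have "g x = ?w x * \<eta> x" unfolding \<eta>_def using w(2)[of x] by simp
        then have "V x * g x = V x * (v x * \<eta> x) + V x * \<eta> x" by (simp add: algebra_simps)
        moreover have "V x * \<eta> x \<le> f x * \<eta> x" using f(3)[OF True] g(3)[of x] w(2)[of x] by (intro mult_right_mono) (auto simp: \<eta>_def)
        ultimately show ?thesis by simp
      next
        case False then show ?thesis using g(2) by (simp add: vanish_def \<eta>_def)
      qed
    qed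
    also have "\<dots> = (LBINT x. V x * (v x * \<eta> x)) + (LBINT x. f x * \<eta> x)" by (rule Bochner_Integration.integral_add[OF i1 i2])
    finally have D2: "(LBINT x. V x * g x) - \<epsilon> \<le> dirb v \<eta>" using D by linarith
    have "dirb v \<eta> = (LBINT x. (\<Sum>j\<in>UNIV. rpd j \<phi> x * rpd j g x) - g x * gsq \<phi> x)"
      unfolding dirb_def
    proof (intro Bochner_Integration.integral_cong refl)
      fix x
      have "rpd j v x * rpd j \<eta> x = rpd j \<phi> x * rpd j g x - g x * (rpd j \<phi> x)^2" for j
        unfolding re rp by (simp add: power2_eq_square algebra_simps)
      then show "(\<Sum>j\<in>UNIV. rpd j v x * rpd j \<eta> x) = (\<Sum>j\<in>UNIV. rpd j \<phi> x * rpd j g x) - g x * gsq \<phi> x"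
        by (simp add: sum_subtractf sum_distrib_left)
    qed
    also have "\<dots> = dirb \<phi> g - (LBINT x. g x * gsq \<phi> x)"
      unfolding dirb_def by (intro Bochner_Integration.integral_diff rtest_integrable rtest_grad_prod ph sg rtest_mult1 g rtest_sm[OF rtest_grad_sq[OF ph]])
    finally show ?thesis using D2 by linarith
  qed
  with ph show ?thesis by blast
qed

text \<open>Translates of \<rho> share supremum and energy, so the weak inequality may be tested
  with all of them and becomes pointwise for \<Phi> = \<phi> * \<rho>. The squared gradient passes
  through the convolution by Cauchy-Schwarz, as \<rho> has mass 1.\<close>

lemma supersolution:
  fixes V :: "real^'d::finite \<Rightarrow> real"
  assumes d: "CARD('d) \<ge> 3" and V: "continuous_on UNIV V"
    and form: "\<And>u. rtest u \<Longrightarrow> \<bar>LBINT x. V x * (u x)^2\<bar> \<le> dir u / 2"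
    and m: "mollifier \<rho>" and R: "R > 0" and e: "\<epsilon> > 0"
  shows "\<exists>\<Phi>. rtest \<Phi> \<and> (\<forall>x. norm x \<le> R \<longrightarrow> (\<Sum>j\<in>UNIV. (rpd j \<Phi> x)^2) \<le> - lapl \<Phi> x - conv V \<rho> x + \<epsilon>)"
proof -
  have rho: "rtest \<rho>" "\<And>x. 0 \<le> \<rho> x" "vanish 1 \<rho>" "integral\<^sup>L lborel \<rho> = 1" using m by (auto simp: mollifier_def)
  have "compact (V ` cball 0 (R + 1))" using V by (intro compact_continuous_image) (auto intro: continuous_on_subset)
  then obtain M where M: "\<forall>y\<in>V ` cball 0 (R + 1). norm y \<le> M" by (meson bounded_iff compact_imp_bounded)
  \<comment> \<open>It has to dominate \<open>V\<close> only on the ball of radius R + 1, which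
    contains the supports of the translates of \<rho> centred within R.\<close>
  define f where "f x = \<bar>M\<bar> * cutat 0 (R + 1) x" for x :: "real^'d"
  have f: "rtest f" "\<And>x. 0 \<le> f x" unfolding f_def using R by (auto intro!: rtest_cmult cutat_rtest mult_nonneg_nonneg cutat_range)
  have fV: "V x \<le> f x" if "norm x \<le> R + 1" for x
  proof -
    have "cutat 0 (R + 1) x = 1" using that R by (intro cutat_one) auto
    moreover have "\<bar>V x\<bar> \<le> M" using M that by auto
    ultimately show ?thesis by (simp add: f_def)
  qed
  obtain G where G: "G > 0" "\<And>x. \<bar>\<rho> x\<bar> \<le> G" using rtest_bounded[OF rho(1)] by metis
  obtain \<phi> where ph: "rtest \<phi>" and sup: "\<And>g. rtest g \<Longrightarrow> vanish (R + 1) g \<Longrightarrow> (\<And>x. 0 \<le> g x \<and> g x \<le> G) \<Longrightarrow> dir g \<le> dir \<rho> \<Longrightarrow>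
     (LBINT x. V x * g x) + (LBINT x. g x * gsq \<phi> x) - \<epsilon> \<le> dirb \<phi> g"
    using weak_supersolution[OF d V form f fV e less_imp_le[OF G(1)] dir_nonneg[of \<rho>]] by blast
  have sp: "sm \<phi>" by (rule rtest_sm[OF ph])
  have lip: "locint \<phi>" by (intro locint_cont sm_cont sp)
  define \<Phi> where "\<Phi> = conv \<phi> \<rho>"
  obtain R' where R': "vanish R' \<phi>" using ph by (auto simp: rtest_def)
  have tP: "rtest \<Phi>" unfolding \<Phi>_def by (rule rtest_conv[OF sm_cont[OF sp] R' rho(1)])
  have rP: "rpd j \<Phi> x = conv (rpd j \<phi>) \<rho> x" for j x
    unfolding \<Phi>_def rpd_conv[OF lip rho(1)] by (rule conv_by_parts[OF sp rho(1)])
  have lP: "lapl \<Phi> x = (\<Sum>j\<in>UNIV. conv (rpd j \<phi>) (rpd j \<rho>) x)" for x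
  proof -
    have "rpd j (rpd j \<Phi>) x = conv (rpd j \<phi>) (rpd j \<rho>) x" for j
      unfolding \<Phi>_def rpd_conv[OF lip rho(1)] rpd_conv[OF lip rtest_rpd[OF rho(1)]] by (rule conv_by_parts[OF sp rtest_rpd[OF rho(1)]])
    then show ?thesis by (simp add: lapl_def)
  qed
  have "(\<Sum>j\<in>UNIV. (rpd j \<Phi> x)^2) \<le> - lapl \<Phi> x - conv V \<rho> x + \<epsilon>" if x: "norm x \<le> R" for x
  proof -
    let ?g = "\<lambda>y. \<rho> (x - y)"
    have g: "rtest ?g" by (rule rtest_translate(2)[OF rho(1)])
    have gv: "vanish (R + 1) ?g" unfolding vanish_def
    proof (intro allI impI)
      fix y :: "real^'d" assume "R + 1 < norm y"
      then have "1 < norm (x - y)" using norm_triangle_ineq4[of x "x - y"] x by simp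
      then show "\<rho> (x - y) = 0" using rho(3) by (simp add: vanish_def)
    qed
    have s: "(LBINT y. V y * ?g y) + (LBINT y. ?g y * gsq \<phi> y) - \<epsilon> \<le> dirb \<phi> ?g"
    proof (rule sup[OF g gv])
      show "0 \<le> \<rho> (x - y) \<and> \<rho> (x - y) \<le> G" for y using rho(2) G(2)[of "x - y"] by auto
      show "dir ?g \<le> dir \<rho>" using dir_translate(1)[OF rho(1)] by simp
    qed
    have "dirb \<phi> ?g = (LBINT y. (\<Sum>j\<in>UNIV. - (rpd j \<phi> y * rpd j \<rho> (x - y))))"
      unfolding dirb_def rpd_translate(2)[OF rtest_sm[OF rho(1)]] by simp
    also have "\<dots> = (\<Sum>j\<in>UNIV. (LBINT y. - (rpd j \<phi> y * rpd j \<rho> (x - y))))"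
      by (intro Bochner_Integration.integral_sum rtest_integrable rtest_minus rtest_mult1 rtest_rpd ph sm_translate sm_rpd rtest_sm[OF rho(1)])
    also have "\<dots> = - lapl \<Phi> x" unfolding lP conv_def by (simp add: sum_negf)
    finally have e1: "dirb \<phi> ?g = - lapl \<Phi> x" .
    have "(\<Sum>j\<in>UNIV. (rpd j \<Phi> x)^2) \<le> (\<Sum>j\<in>UNIV. (LBINT y. ?g y * (rpd j \<phi> y)^2))"
    proof (rule sum_mono)
      fix j
      let ?a = "\<lambda>y. sqrt (?g y)"
      have m: "?a \<in> borel_measurable lborel" "rpd j \<phi> \<in> borel_measurable lborel"
        using sm_borel[OF rtest_sm[OF g]] sm_borel[OF sm_rpd[OF sp]] by auto
      have sq: "(?a y)^2 = ?g y" "(?a y * rpd j \<phi> y)^2 = ?g y * (rpd j \<phi> y)^2" for y using rho(2) by (auto simp: power_mult_distrib)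
      have "\<bar>LBINT y. ?a y * (?a y * rpd j \<phi> y)\<bar> \<le> sqrt (LBINT y. (?a y)^2) * sqrt (LBINT y. (?a y * rpd j \<phi> y)^2)"
        by (rule integral_CS1) (use m in \<open>auto simp: sq intro!: rtest_integrable g rtest_mult1 sm_power sm_rpd sp\<close>)
      moreover have "(LBINT y. (?a y)^2) = 1" unfolding sq using integral_shift(3)[OF sm_borel[OF rtest_sm[OF rho(1)]], of x] rho(4) by simp
      moreover have "(LBINT y. ?a y * (?a y * rpd j \<phi> y)) = rpd j \<Phi> x"
      proof -
        have "?a y * (?a y * rpd j \<phi> y) = (?a y)^2 * rpd j \<phi> y" for y by (simp only: power2_eq_square mult.assoc)
        then show ?thesis unfolding rP conv_def sq by (simp only: mult.commute)
      qed
      ultimately have "\<bar>rpd j \<Phi> x\<bar> \<le> sqrt (LBINT y. ?g y * (rpd j \<phi> y)^2)" unfolding sq(2) by simp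
      then have "\<bar>rpd j \<Phi> x\<bar>\<^sup>2 \<le> (sqrt (LBINT y. ?g y * (rpd j \<phi> y)^2))^2" by (intro power_mono) auto
      then show "(rpd j \<Phi> x)^2 \<le> (LBINT y. ?g y * (rpd j \<phi> y)^2)" using rho(2) by (simp add: integral_nonneg_AE)
    qed
    also have "\<dots> = (LBINT y. ?g y * gsq \<phi> y)"
      unfolding sum_distrib_left by (intro Bochner_Integration.integral_sum[symmetric] rtest_integrable rtest_mult1 g sm_power sm_rpd sp)
    finally have "(\<Sum>j\<in>UNIV. (rpd j \<Phi> x)^2) \<le> (LBINT y. ?g y * gsq \<phi> y)" .
    with s show ?thesis unfolding e1 conv_def[symmetric] by linarith
  qed
  with tP show ?thesis by blast
qed

text \<open>The mollified form is an average over y of the original form at translates of u, and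
  translation preserves the energy.\<close>

lemma conv_form_bound:
  fixes V :: "real^'d::finite \<Rightarrow> real"
  assumes V: "continuous_on UNIV V"
    and form: "\<And>u. rtest u \<Longrightarrow> \<bar>LBINT x. V x * (u x)^2\<bar> \<le> dir u / 2"
    and m: "mollifier \<rho>" and u: "rtest u"
  shows "\<bar>LBINT x. conv V \<rho> x * (u x)^2\<bar> \<le> dir u / 2"
proof -
  have rho: "rtest \<rho>" "\<And>x. 0 \<le> \<rho> x" "vanish 1 \<rho>" "integral\<^sup>L lborel \<rho> = 1" using m by (auto simp: mollifier_def)
  have [measurable]: "V \<in> borel_measurable borel" by (rule borel_measurable_continuous_onI[OF V])
  note [measurable] = sm_borel[OF rtest_sm[OF rho(1)]] sm_borel[OF rtest_sm[OF u]]
  obtain S where S: "vanish S u" using u by (auto simp: rtest_def)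
  have "compact (V ` cball 0 (S + 1))" using V by (intro compact_continuous_image) (auto intro: continuous_on_subset)
  then obtain M where M: "\<forall>y\<in>V ` cball 0 (S + 1). norm y \<le> M" by (meson bounded_iff compact_imp_bounded)
  have "integrable (lborel \<Otimes>\<^sub>M lborel) (\<lambda>(x,y). \<rho> y * V (x - y) * (u x)^2)"
  proof (rule integrable_prod_bound[where a="\<lambda>x. (u x)^2" and b=\<rho> and M=M])
    show "integrable lborel (\<lambda>x. (u x)^2)" by (intro rtest_integrable rtest_power2 u)
    show "integrable lborel \<rho>" by (intro rtest_integrable rho)
    show "\<bar>\<rho> y * V (x - y) * (u x)^2\<bar> \<le> M * (\<bar>(u x)\<^sup>2\<bar> * \<bar>\<rho> y\<bar>)" for x y
    proof (cases "norm x \<le> S \<and> norm y \<le> 1")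
      case True
      then have "norm (x - y) \<le> S + 1" using norm_triangle_ineq4[of x y] by linarith
      then have "\<bar>V (x - y)\<bar> \<le> M" using M by auto
      then have "\<bar>V (x - y)\<bar> * (\<bar>(u x)\<^sup>2\<bar> * \<bar>\<rho> y\<bar>) \<le> M * (\<bar>(u x)\<^sup>2\<bar> * \<bar>\<rho> y\<bar>)" by (intro mult_right_mono) auto
      then show ?thesis by (simp add: abs_mult mult_ac)
    next
      case False
      then have "\<rho> y * (u x)^2 = 0" using S rho(3) by (auto simp: vanish_def)
      then show ?thesis by auto
    qed
  qed measurable
  note fub = lborel_pair.Fubini_integral[OF this]
  have eq: "(LBINT x. conv V \<rho> x * (u x)^2) = (LBINT y. \<rho> y * (LBINT x. V x * (u (x + y))^2))"
  proof -
    have "(LBINT x. conv V \<rho> x * (u x)^2) = (LBINT x. (LBINT y. \<rho> y * V (x - y) * (u x)^2))"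
    proof (intro Bochner_Integration.integral_cong refl)
      fix x
      have "conv V \<rho> x = conv \<rho> V x" by (simp add: conv_commute[of V \<rho>])
      then show "conv V \<rho> x * (u x)^2 = (LBINT y. \<rho> y * V (x - y) * (u x)^2)" by (simp add: conv_def)
    qed
    also have "\<dots> = (LBINT y. (LBINT x. \<rho> y * V (x - y) * (u x)^2))" using fub by simp
    also have "\<dots> = (LBINT y. \<rho> y * (LBINT x. V x * (u (x + y))^2))"
    proof (intro Bochner_Integration.integral_cong refl)
      fix y
      have "(LBINT x. V (x - y) * (u x)^2) = (LBINT x. V (x + y - y) * (u (x + y))^2)"
        by (rule integral_shift(1)[symmetric]) measurable
      then show "(LBINT x. \<rho> y * V (x - y) * (u x)^2) = \<rho> y * (LBINT x. V x * (u (x + y))^2)"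
        by (simp add: mult.assoc)
    qed
    finally show ?thesis .
  qed
  have [measurable]: "(\<lambda>y. (LBINT x. V x * (u (x + y))^2)) \<in> borel_measurable borel"
    by (rule lborel.borel_measurable_lebesgue_integral) measurable
  have "\<bar>LBINT y. \<rho> y * (LBINT x. V x * (u (x + y))^2)\<bar> \<le> (LBINT y. \<rho> y * (dir u / 2))"
  proof (rule integral_abs_le(2))
    show "integrable lborel (\<lambda>y. \<rho> y * (dir u / 2))" using rtest_integrable[OF rho(1)] by simp
    fix y
    have "\<bar>LBINT x. V x * (u (x + y))^2\<bar> \<le> dir u / 2"
      using form[OF rtest_translate(3)[OF u]] unfolding dir_translate(2)[OF u] .
    then show "\<bar>\<rho> y * (LBINT x. V x * (u (x + y))^2)\<bar> \<le> \<rho> y * (dir u / 2)"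
      unfolding abs_mult abs_of_nonneg[OF rho(2)] by (intro mult_left_mono rho)
  qed measurable
  also have "\<dots> = dir u / 2" using rho(4) by simp
  finally show ?thesis unfolding eq .
qed

section \<open>Assembling potentials on balls\<close>

lemma cutat_vanish: "R > 0 \<Longrightarrow> vanish (2 * R) (cutat 0 R)"
  unfolding vanish_def by (intro allI impI cutat_zero) auto

text \<open>The gradient of the cutoff is at most a multiple of the Hardy weight, uniformly in R.
  Without this uniformity the trace constant of the localised measure would depend on the
  ball.\<close>

lemma dir_cutat_mult:
  assumes d: "CARD('d::finite) \<ge> 3"
  obtains \<kappa> where "\<kappa> > 0" "\<And>R (v::real^'d \<Rightarrow> real). R \<ge> 1 \<Longrightarrow> rtest v \<Longrightarrow> dir (\<lambda>x. v x * cutat 0 R x) \<le> \<kappa> * dir v"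
proof -
  have "\<forall>j. \<exists>M. M > 0 \<and> (\<forall>x. \<bar>rpd j (cutoff :: real^'d \<Rightarrow> real) x\<bar> \<le> M)" using rtest_bounded[OF rtest_rpd[OF rtest_cutoff]] by metis
  then obtain M where M: "\<And>j. M j > 0" "\<And>j x. \<bar>rpd j (cutoff :: real^'d \<Rightarrow> real) x\<bar> \<le> M j" by metis
  define m where "m = (\<Sum>j\<in>UNIV. (M j)^2)"
  have m: "m \<ge> 0" by (simp add: m_def sum_nonneg)
  \<comment> \<open>The 40 is 2 * 5 * 4: the square of a sum, the bound \<open>g\<close> below, and
    the constant of \<open>hardy\<close>.\<close>
  have "dir (\<lambda>x. v x * cutat 0 R x) \<le> (2 + 40 * m) * dir v" if R: "R \<ge> 1" and v: "rtest v" for R and v :: "real^'d \<Rightarrow> real"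
  proof -
    let ?c = "cutat 0 R :: real^'d \<Rightarrow> real"
    have c: "rtest ?c" using R by (intro cutat_rtest) auto
    have sv: "sm v" and sc: "sm ?c" using v c rtest_sm by auto
    have ct: "?c x = cutoff ((1 / R) *\<^sub>R x + 0)" for x by (simp add: cutat_def)
    have rc: "rpd j ?c x = (1 / R) * rpd j cutoff ((1 / R) *\<^sub>R x)" for j x
      using rpd_affine(2)[OF sm_diff[OF sm_cutoff], where c="1/R" and a=0] unfolding ct[abs_def] by simp
    \<comment> \<open>Where the gradient of the cutoff can be nonzero, |x| is at most 2 R, so 1 +
      |x|^2 is at most 5 R^2.\<close>
    have g: "gsq ?c x \<le> 5 * m / (1 + (norm x)^2)" for x
    proof (cases "norm x \<le> 2 * R")
      case True
      have q: "0 < 1 + (norm x)^2" by (simp add: add_pos_nonneg)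
      have "gsq ?c x \<le> (\<Sum>j\<in>UNIV. (1 / R)^2 * (M j)^2)"
      proof (rule sum_mono)
        fix j
        have "\<bar>rpd j (cutoff :: real^'d \<Rightarrow> real) ((1 / R) *\<^sub>R x)\<bar>\<^sup>2 \<le> (M j)^2" by (intro power_mono M) auto
        then show "(rpd j ?c x)^2 \<le> (1 / R)^2 * (M j)^2" unfolding rc power_mult_distrib by (intro mult_left_mono) auto
      qed
      also have "\<dots> = (1 / R)^2 * m" by (simp add: m_def sum_distrib_left)
      also have "(1 / R)^2 \<le> 5 / (1 + (norm x)^2)"
      proof -
        have "(norm x)^2 \<le> (2 * R)^2" using True by (intro power_mono) auto
        moreover have "1 \<le> R^2" using R by (simp add: one_le_power)
        ultimately have "1 + (norm x)^2 \<le> 5 * R^2" by (simp add: power_mult_distrib)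
        then show ?thesis using R q by (simp add: power_divide field_simps)
      qed
      finally show ?thesis using m by (simp add: mult_right_mono)
    next
      case False
      have "vanish (2 * R) ?c" using R by (intro cutat_vanish) auto
      then have "vanish (2 * R) (rpd j ?c)" for j by (rule vanish_rpd)
      then have "rpd j ?c x = 0" for j using False by (simp add: vanish_def)
      then show ?thesis using m by simp
    qed
    have "dir (\<lambda>x. v x * ?c x) \<le> (LBINT x. 2 * gsq v x + 2 * (5 * m) * ((v x)^2 / (1 + (norm x)^2)))"
      unfolding dir_def
    proof (rule integral_mono)
      show "integrable lborel (\<lambda>x. \<Sum>j\<in>UNIV. (rpd j (\<lambda>x. v x * ?c x) x)^2)" by (intro rtest_integrable rtest_grad_sq rtest_mult1 v sc)
      have "rtest (\<lambda>x. (v x)^2 * inverse (1 + (norm x)^2))"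
        by (intro rtest_mult1 rtest_power2 v sm_inverse sm_add sm_const sm_norm_sq) (simp add: add_pos_nonneg)
      then show "integrable lborel (\<lambda>x. 2 * gsq v x + 2 * (5 * m) * ((v x)^2 / (1 + (norm x)^2)))"
        unfolding divide_inverse by (intro rtest_integrable rtest_add rtest_cmult rtest_grad_sq v)
      fix x
      have "(rpd j (\<lambda>x. v x * ?c x) x)^2 \<le> 2 * (rpd j v x)^2 + 2 * (v x)^2 * (rpd j ?c x)^2" for j
      proof -
        have ab: "(a + b)^2 \<le> 2 * a^2 + 2 * b^2" for a b :: real
          using zero_le_power2[of "a - b"] by (simp add: power2_eq_square algebra_simps)
        have "rpd j (\<lambda>x. v x * ?c x) x = rpd j v x * ?c x + v x * rpd j ?c x" by (rule rpd_mult[OF sm_diff[OF sv] sm_diff[OF sc]])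
        moreover have "(rpd j v x * ?c x)^2 \<le> (rpd j v x)^2"
          unfolding power_mult_distrib using cutat_range[of 0 R x] by (intro mult_left_le) (auto intro: power_le_one)
        ultimately show ?thesis using ab[of "rpd j v x * ?c x" "v x * rpd j ?c x"] by (simp add: power_mult_distrib)
      qed
      then have "(\<Sum>j\<in>UNIV. (rpd j (\<lambda>x. v x * ?c x) x)^2) \<le> (\<Sum>j\<in>UNIV. 2 * (rpd j v x)^2 + 2 * (v x)^2 * (rpd j ?c x)^2)" by (intro sum_mono)
      also have "\<dots> = 2 * gsq v x + 2 * (v x)^2 * gsq ?c x"
        by (simp add: sum.distrib sum_distrib_left)
      also have "\<dots> \<le> 2 * gsq v x + 2 * (v x)^2 * (5 * m / (1 + (norm x)^2))" by (intro add_left_mono mult_left_mono g) auto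
      finally show "(\<Sum>j\<in>UNIV. (rpd j (\<lambda>x. v x * ?c x) x)^2) \<le> 2 * gsq v x + 2 * (5 * m) * ((v x)^2 / (1 + (norm x)^2))"
        by (simp add: mult_ac)
    qed
    also have "\<dots> = 2 * dir v + 2 * (5 * m) * (LBINT x. (v x)^2 / (1 + (norm x)^2))"
    proof -
      have t: "rtest (\<lambda>x. (v x)^2 * inverse (1 + (norm x)^2))"
        by (intro rtest_mult1 rtest_power2 v sm_inverse sm_add sm_const sm_norm_sq) (simp add: add_pos_nonneg)
      show ?thesis unfolding dir_def divide_inverse using rtest_integrable[OF t] rtest_integrable[OF rtest_grad_sq[OF v]] by simp
    qed
    also have "\<dots> \<le> 2 * dir v + 2 * (5 * m) * (4 * dir v)" using m by (intro add_left_mono mult_left_mono hardy[OF d v]) auto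
    finally show ?thesis by (simp add: algebra_simps)
  qed
  then show thesis using that[of "2 + 40 * m"] m by (simp add: add_pos_nonneg)
qed

lemma I1_conv_kr:
  assumes d: "CARD('d::finite) \<ge> 3" and mu: "rtest \<mu>" "\<And>x. 0 \<le> \<mu> x"
  shows "ennreal (LBINT y. kr y * \<bar>\<mu> (x - y)\<bar>) = I1 (\<lambda>z. ennreal (\<mu> z)) (x::real^'d)"
proof -
  have [measurable]: "\<mu> \<in> borel_measurable borel" by (rule sm_borel[OF rtest_sm[OF mu(1)]])
  have li: "locint (kr :: real^'d \<Rightarrow> real)" using d by (intro locint_kr) auto
  have "ennreal (LBINT y. kr y * \<mu> (x - y)) = (LBNN y. ennreal (kr y * \<mu> (x - y)))"
    by (rule nn_integral_eq_integral[symmetric]) (auto simp: kr_nonneg mu intro!: conv_integrable li)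
  also have "\<dots> = (LBNN y. kk (x - (x - y)) * ennreal (\<mu> (x - y)))"
    by (rule nn_integral_cong_AE, use AE_neq[of 0] in eventually_elim) (simp add: kk_kr kr_nonneg mu ennreal_mult)
  also have "\<dots> = I1 (\<lambda>z. ennreal (\<mu> z)) x" unfolding I1_def
    by (rule nn_integral_shift(2)[where f="\<lambda>y. kk (x - y) * ennreal (\<mu> y)"]) measurable
  finally show ?thesis using mu(2) by simp
qed

text \<open>The supersolution is taken on the ball of radius 2 R, so the measure can be cut off
  between R and 2 R and remain positive everywhere. Replacing it by a truncation changes the Poisson
  equation only outside the ball of radius R.\<close>

lemma local_potential:
  assumes d: "CARD('d::finite) \<ge> 3"
  obtains C where "C > 0" "\<And>(V::real^'d \<Rightarrow> real) \<rho> R e0. continuous_on UNIV V \<Longrightarrow>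
     (\<And>u. rtest u \<Longrightarrow> \<bar>LBINT x. V x * (u x)^2\<bar> \<le> dir u / 2) \<Longrightarrow> mollifier \<rho> \<Longrightarrow> R \<ge> 1 \<Longrightarrow> e0 > 0 \<Longrightarrow>
     \<exists>\<psi> \<epsilon>. sm \<psi> \<and> 0 < \<epsilon> \<and> \<epsilon> \<le> e0 \<and> (\<forall>x. norm x \<le> R \<longrightarrow> lapl \<psi> x = conv V \<rho> x - \<epsilon>) \<and>
       (\<forall>u. rtest u \<longrightarrow> vanish R u \<longrightarrow> (LBINT x. gsq \<psi> x * (u x)^2) \<le> C * dir u)"
proof -
  obtain \<kappa> where kappa: "\<kappa> > 0" "\<And>R (v::real^'d \<Rightarrow> real). R \<ge> 1 \<Longrightarrow> rtest v \<Longrightarrow> dir (\<lambda>x. v x * cutat 0 R x) \<le> \<kappa> * dir v"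
    using dir_cutat_mult[OF d] by blast
  have K0: "8 * \<kappa> \<ge> 0" using kappa(1) by simp
  obtain C0 where C0: "C0 > 0" "\<And>(\<mu> :: real^'d \<Rightarrow> real) u. trace_on (8 * \<kappa>) \<mu> \<Longrightarrow> rtest u \<Longrightarrow>
    (LBNN x. (I1 (\<lambda>z. ennreal (\<mu> z)) x)^2 * ennreal ((u x)^2)) \<le> ennreal (C0 * dir u)" using trace_potential[OF d K0] by blast
  let ?c = "cN TYPE('d)" and ?d = "real CARD('d)"
  have cp: "?c > 0" by (rule cN_pos[OF d])
  \<comment> \<open>The 14 is twice the bound 7 for \<Phi>; the second summand collects the d
    components of the gradient of the Newton potential, divided by the normalising constant
    \<open>cN\<close>.\<close>
  define C where "C = 14 + 2 * (?d * ((?d - 2)^2 * C0 / ?c^2))"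
  have main: "\<exists>\<psi> \<epsilon>. sm \<psi> \<and> 0 < \<epsilon> \<and> \<epsilon> \<le> e0 \<and> (\<forall>x. norm x \<le> R \<longrightarrow> lapl \<psi> x = conv V \<rho> x - \<epsilon>) \<and>
       (\<forall>u. rtest u \<longrightarrow> vanish R u \<longrightarrow> (LBINT x. gsq \<psi> x * (u x)^2) \<le> C * dir u)"
    if V: "continuous_on UNIV V" and form: "\<And>u. rtest u \<Longrightarrow> \<bar>LBINT x. V x * (u x)^2\<bar> \<le> dir u / 2"
      and m: "mollifier \<rho>" and R: "R \<ge> 1" and e0: "e0 > 0" for V \<rho> :: "real^'d \<Rightarrow> real" and R e0
  proof -
    have rho: "rtest \<rho>" using m by (auto simp: mollifier_def)
    define V' where "V' = conv V \<rho>"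
    have sV: "sm V'" unfolding V'_def by (intro sm_conv locint_cont V rho)
    have fV: "\<bar>LBINT x. V' x * (u x)^2\<bar> \<le> dir u / 2" if "rtest u" for u
      unfolding V'_def by (rule conv_form_bound[OF V form m that])
    \<comment> \<open>The second bound makes \<epsilon> times the squared L2 norm of u at most its
      energy, by Hardy on the ball of radius 2 R.\<close>
    define \<epsilon> where "\<epsilon> = min e0 (1 / (4 * (1 + (2 * R)^2)))"
    have ep: "0 < \<epsilon>" "\<epsilon> \<le> e0" using e0 by (auto simp: \<epsilon>_def add_pos_nonneg)
    have R2: "2 * R > 0" using R by simp
    obtain \<Phi> where Phi: "rtest \<Phi>" and sup: "\<And>x. norm x \<le> 2 * R \<Longrightarrow> (\<Sum>j\<in>UNIV. (rpd j \<Phi> x)^2) \<le> - lapl \<Phi> x - V' x + \<epsilon>"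
      using supersolution[OF d V form m R2 ep(1)] unfolding V'_def by blast
    have sP: "sm \<Phi>" by (rule rtest_sm[OF Phi])
    define P where "P x = - lapl \<Phi> x - V' x + \<epsilon>" for x
    have sPP: "sm P" unfolding P_def[abs_def] by (intro sm_add sm_sub sm_minus sm_lapl sP sV sm_const)
    define T where "T u = (LBINT x. (\<Sum>j\<in>UNIV. (rpd j \<Phi> x)^2) * (u x)^2)" for u
    have T0: "T u \<ge> 0" for u unfolding T_def by (intro integral_nonneg_AE AE_I2 mult_nonneg_nonneg sum_nonneg) auto
    have Pu: "(LBINT x. P x * (u x)^2) \<le> 2 * (sqrt (dir u) * sqrt (T u)) + 3 / 2 * dir u" if u: "rtest u" "vanish (2 * R) u" for u
    proof -
      have su: "sm u" by (rule rtest_sm[OF u(1)])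
      have u2: "rtest (\<lambda>x. (u x)^2)" by (rule rtest_power2[OF u(1)])
      have "(LBINT x. P x * (u x)^2) = (LBINT x. - (lapl \<Phi> x * (u x)^2) - V' x * (u x)^2 + \<epsilon> * (u x)^2)"
        unfolding P_def by (intro Bochner_Integration.integral_cong) (auto simp: algebra_simps)
      also have "\<dots> = - (LBINT x. lapl \<Phi> x * (u x)^2) - (LBINT x. V' x * (u x)^2) + \<epsilon> * (LBINT x. (u x)^2)"
        using rtest_integrable[OF rtest_mult2[OF sm_lapl[OF sP] u2]] rtest_integrable[OF rtest_mult2[OF sV u2]] rtest_integrable[OF u2] by simp
      finally have "(LBINT x. P x * (u x)^2) = - (LBINT x. lapl \<Phi> x * (u x)^2) - (LBINT x. V' x * (u x)^2) + \<epsilon> * (LBINT x. (u x)^2)" .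
      moreover have "- (LBINT x. lapl \<Phi> x * (u x)^2) \<le> 2 * (sqrt (dir u) * sqrt (T u))"
      proof -
        have "(LBINT x. lapl \<Phi> x * (u x)^2) = (\<Sum>j\<in>UNIV. (LBINT x. rpd j (rpd j \<Phi>) x * (u x)^2))"
          unfolding lapl_def sum_distrib_right by (intro Bochner_Integration.integral_sum rtest_integrable rtest_mult2 sm_rpd sP u2)
        also have "\<dots> = (\<Sum>j\<in>UNIV. - (LBINT x. rpd j \<Phi> x * rpd j (\<lambda>x. (u x)^2) x))"
          using integral_by_parts[OF sm_rpd[OF sP] rtest_sm[OF u2] disjI2[OF u2]] by simp
        also have "\<dots> = - (\<Sum>j\<in>UNIV. (LBINT x. 2 * (rpd j u x * (rpd j \<Phi> x * u x))))"
          unfolding rpd_power2[OF su] by (simp add: sum_negf mult_ac)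
        also have "(\<Sum>j\<in>UNIV. (LBINT x. 2 * (rpd j u x * (rpd j \<Phi> x * u x)))) = (LBINT x. 2 * (\<Sum>j\<in>UNIV. rpd j u x * (rpd j \<Phi> x * u x)))"
          unfolding sum_distrib_left by (intro Bochner_Integration.integral_sum[symmetric] rtest_integrable rtest_cmult rtest_mult1 rtest_rpd u sm_mult sm_rpd sP su)
        finally have "\<bar>LBINT x. lapl \<Phi> x * (u x)^2\<bar> = 2 * \<bar>LBINT x. (\<Sum>j\<in>UNIV. rpd j u x * (rpd j \<Phi> x * u x))\<bar>" by simp
        also have "\<dots> \<le> 2 * (sqrt (dir u) * sqrt (LBINT x. (\<Sum>j\<in>UNIV. (rpd j \<Phi> x * u x)^2)))"
          unfolding dir_def
          by (intro mult_left_mono integral_CS rtest_integrable rtest_grad_sq u rtest_sum rtest_power2 rtest_mult1 rtest_rpd Phi su)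
            (auto intro!: sm_borel sm_mult sm_rpd sP su)
        also have "(LBINT x. (\<Sum>j\<in>UNIV. (rpd j \<Phi> x * u x)^2)) = T u"
          unfolding T_def sum_distrib_right power_mult_distrib ..
        finally show ?thesis by linarith
      qed
      moreover have "- (LBINT x. V' x * (u x)^2) \<le> dir u / 2" using fV[OF u(1)] by linarith
      moreover have "\<epsilon> * (LBINT x. (u x)^2) \<le> dir u"
      proof -
        have q: "0 < 1 + (norm x)^2" for x :: "real^'d" by (simp add: add_pos_nonneg)
        have t: "rtest (\<lambda>x. (u x)^2 * inverse (1 + (norm x)^2))"
          by (intro rtest_mult1 u2 sm_inverse sm_add sm_const sm_norm_sq q)
        have "(LBINT x. (u x)^2) \<le> (LBINT x. (1 + (2 * R)^2) * ((u x)^2 / (1 + (norm x)^2)))"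
        proof (rule integral_mono)
          show "integrable lborel (\<lambda>x. (1 + (2 * R)^2) * ((u x)^2 / (1 + (norm x)^2)))"
            using rtest_integrable[OF t] by (simp add: divide_inverse)
          fix x
          show "(u x)^2 \<le> (1 + (2 * R)^2) * ((u x)^2 / (1 + (norm x)^2))"
          proof (cases "norm x \<le> 2 * R")
            case True
            then have "(norm x)^2 \<le> (2 * R)^2" by (intro power_mono) auto
            then have "(1 + (norm x)^2) * (u x)^2 \<le> (1 + (2 * R)^2) * (u x)^2" by (intro mult_right_mono) auto
            then show ?thesis using q[of x] by (simp add: pos_le_divide_eq mult.commute)
          next
            case False then show ?thesis using u(2) by (simp add: vanish_def)
          qed
        qed (rule rtest_integrable[OF u2])
        also have "\<dots> = (1 + (2 * R)^2) * (LBINT x. (u x)^2 / (1 + (norm x)^2))" by (rule integral_mult_right_zero)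
        also have "\<dots> \<le> (1 + (2 * R)^2) * (4 * dir u)" by (intro mult_left_mono hardy[OF d u(1)]) (simp add: add_nonneg_nonneg)
        finally have "\<epsilon> * (LBINT x. (u x)^2) \<le> \<epsilon> * ((1 + (2 * R)^2) * (4 * dir u))" using ep by (intro mult_left_mono) auto
        also have "\<dots> \<le> (1 / (4 * (1 + (2 * R)^2))) * ((1 + (2 * R)^2) * (4 * dir u))"
          using dir_nonneg[of u] by (intro mult_right_mono) (auto simp: \<epsilon>_def)
        also have "\<dots> = dir u"
        proof -
          have alg: "1 / (4 * a) * (a * (4 * b)) = b" if "a > 0" for a b :: real using that by simp
          have "0 < 1 + (2 * R)^2" by (simp add: add_pos_nonneg)
          then show ?thesis by (rule alg)
        qed
        finally show ?thesis .
      qed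
      ultimately show ?thesis by linarith
    qed
    \<comment> \<open>The pointwise supersolution inequality bounds T by \<integral> P u^2, which in
      turn contains sqrt T. Young's inequality absorbs half of T and leaves twice 2 + 3/2 times the
      energy.\<close>
    have T7: "T u \<le> 7 * dir u" if u: "rtest u" "vanish (2 * R) u" for u
    proof -
      have u2: "rtest (\<lambda>x. (u x)^2)" by (rule rtest_power2[OF u(1)])
      have "T u \<le> (LBINT x. P x * (u x)^2)" unfolding T_def
      proof (rule integral_mono)
        show "integrable lborel (\<lambda>x. (\<Sum>j\<in>UNIV. (rpd j \<Phi> x)^2) * (u x)^2)" by (intro rtest_integrable rtest_mult2 u2 rtest_sm[OF rtest_grad_sq[OF Phi]])
        show "integrable lborel (\<lambda>x. P x * (u x)^2)" by (intro rtest_integrable rtest_mult2 u2 sPP)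
        fix x show "(\<Sum>j\<in>UNIV. (rpd j \<Phi> x)^2) * (u x)^2 \<le> P x * (u x)^2"
          using sup[of x] u(2) by (cases "norm x \<le> 2 * R") (auto simp: P_def vanish_def intro!: mult_right_mono)
      qed
      also have "\<dots> \<le> 2 * (sqrt (dir u) * sqrt (T u)) + 3 / 2 * dir u" by (rule Pu[OF u])
      also have "2 * (sqrt (dir u) * sqrt (T u)) \<le> T u / 2 + 2 * dir u"
      proof -
        have "0 \<le> (2 * sqrt (dir u) - sqrt (T u))^2" by simp
        also have "\<dots> = 4 * dir u - 4 * (sqrt (dir u) * sqrt (T u)) + T u"
          using dir_nonneg[of u] T0[of u] by (simp add: power2_diff power_mult_distrib)
        finally show ?thesis by linarith
      qed
      finally show ?thesis by linarith
    qed
    let ?h = "cutat 0 R :: real^'d \<Rightarrow> real"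
    have h: "rtest ?h" using R by (intro cutat_rtest) auto
    have hv: "vanish (2 * R) ?h" using R by (intro cutat_vanish) auto
    \<comment> \<open>The cutoff is squared so that \<integral> v^2 \<mu> equals \<integral> P (v
      h)^2, with the test function v h supported in the larger ball.\<close>
    define \<mu> where "\<mu> x = (?h x)^2 * P x" for x
    have mu: "rtest \<mu>" unfolding \<mu>_def[abs_def] by (intro rtest_mult1 rtest_power2 h sPP)
    have mu0: "0 \<le> \<mu> x" for x
    proof (cases "norm x \<le> 2 * R")
      case True
      have "0 \<le> (\<Sum>j\<in>UNIV. (rpd j \<Phi> x)^2)" by (intro sum_nonneg) auto
      also have "\<dots> \<le> P x" using sup[OF True] by (simp add: P_def)
      finally show ?thesis by (simp add: \<mu>_def)
    next
      case False then show ?thesis using hv by (simp add: \<mu>_def vanish_def)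
    qed
    have tr: "trace_on (8 * \<kappa>) \<mu>" unfolding trace_on_def
    proof (intro conjI allI impI mu mu0)
      fix v :: "real^'d \<Rightarrow> real" assume v: "rtest v"
      let ?u = "\<lambda>x. v x * ?h x"
      have u: "rtest ?u" by (intro rtest_mult1 v rtest_sm[OF h])
      have uv: "vanish (2 * R) ?u" using hv by (auto simp: vanish_def)
      have "(LBINT x. (v x)^2 * \<mu> x) = (LBINT x. P x * (?u x)^2)"
        by (intro Bochner_Integration.integral_cong) (auto simp: \<mu>_def power_mult_distrib mult_ac)
      also have "\<dots> \<le> 2 * (sqrt (dir ?u) * sqrt (T ?u)) + 3 / 2 * dir ?u" by (rule Pu[OF u uv])
      \<comment> \<open>The crude bound 9 for 7 gives the integer 3; then 6 + 3/2 is rounded up to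
        8, the constant in the trace condition.\<close>
      also have "sqrt (T ?u) \<le> 3 * sqrt (dir ?u)"
      proof -
        have "sqrt (T ?u) \<le> sqrt (9 * dir ?u)" using T7[OF u uv] dir_nonneg[of ?u] by (intro real_sqrt_le_mono) linarith
        then show ?thesis by (simp add: real_sqrt_mult)
      qed
      also have "2 * (sqrt (dir ?u) * (3 * sqrt (dir ?u))) + 3 / 2 * dir ?u = 15 / 2 * dir ?u" using dir_nonneg[of ?u] by simp
      also have "\<dots> \<le> 8 * dir ?u" using dir_nonneg[of ?u] by simp
      also have "\<dots> \<le> 8 * (\<kappa> * dir v)" using kappa(2)[OF R v] by simp
      finally show "(LBINT x. (v x)^2 * \<mu> x) \<le> 8 * \<kappa> * dir v" using dir_nonneg[of ?u] by (simp add: mult_left_mono)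
    qed
    define s where "s = conv gam \<mu>"
    have ss: "sm s" unfolding s_def by (intro sm_conv locint_gam d mu)
    have ls: "lapl s x = - ?c * \<mu> x" for x unfolding s_def lapl_conv[OF locint_gam[OF d] mu] by (rule fundamental_solution[OF d mu])
    \<comment> \<open>The normalised Newton potential of \<mu> has Laplacian - \<mu>. Where the
      cutoff is 1, subtracting \<Phi> cancels its Laplacian contained in \<mu>.\<close>
    define \<psi> where "\<psi> x = (1 / ?c) * s x - \<Phi> x" for x
    have spsi: "sm \<psi>" unfolding \<psi>_def[abs_def] by (intro sm_sub sm_mult sm_const ss sP)
    have rpsi: "rpd j \<psi> = (\<lambda>x. (1 / ?c) * rpd j s x - rpd j \<Phi> x)" for j
    proof
      fix x
      have "rpd j (\<lambda>x. (1 / ?c) * s x + (- 1) * \<Phi> x) x = (1 / ?c) * rpd j s x + (- 1) * rpd j \<Phi> x"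
        by (subst rpd_add, (intro sm_diff sm_mult sm_const ss sP)+, subst rpd_cmult, rule sm_diff[OF ss], subst rpd_cmult, rule sm_diff[OF sP], rule refl)
      then show "rpd j \<psi> x = (1 / ?c) * rpd j s x - rpd j \<Phi> x" by (simp add: \<psi>_def[abs_def])
    qed
    have lpsi: "lapl \<psi> x = - \<mu> x - lapl \<Phi> x" for x
    proof -
      have "rpd j (rpd j \<psi>) x = (1 / ?c) * rpd j (rpd j s) x - rpd j (rpd j \<Phi>) x" for j
      proof -
        have "rpd j (\<lambda>x. (1 / ?c) * rpd j s x + (- 1) * rpd j \<Phi> x) x = (1 / ?c) * rpd j (rpd j s) x + (- 1) * rpd j (rpd j \<Phi>) x"
          by (subst rpd_add, (intro sm_diff sm_mult sm_const sm_rpd ss sP)+, subst rpd_cmult, rule sm_diff[OF sm_rpd[OF ss]], subst rpd_cmult, rule sm_diff[OF sm_rpd[OF sP]], rule refl)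
        then show ?thesis unfolding rpsi by simp
      qed
      then have "lapl \<psi> x = (1 / ?c) * lapl s x - lapl \<Phi> x" by (simp add: lapl_def sum_subtractf sum_distrib_left)
      then show ?thesis using cp by (simp add: ls)
    qed
    have "lapl \<psi> x = V' x - \<epsilon>" if "norm x \<le> R" for x
    proof -
      have "?h x = 1" using that R by (intro cutat_one) auto
      then show ?thesis unfolding lpsi \<mu>_def P_def by simp
    qed
    moreover have "(LBINT x. gsq \<psi> x * (u x)^2) \<le> C * dir u" if u: "rtest u" "vanish R u" for u
    proof -
      have u2: "rtest (\<lambda>x. (u x)^2)" by (rule rtest_power2[OF u(1)])
      have uv: "vanish (2 * R) u" using u(2) R by (auto intro: vanish_mono)
      have sj: "(LBINT x. (rpd j s x)^2 * (u x)^2) \<le> (?d - 2)^2 * C0 * dir u" for j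
      proof -
        let ?W = "I1 (\<lambda>z. ennreal (\<mu> z))"
        have [measurable]: "\<mu> \<in> borel_measurable borel" by (rule sm_borel[OF rtest_sm[OF mu]])
        note [measurable] = sm_borel[OF rtest_sm[OF u(1)]]
        have pw: "ennreal ((rpd j s x)^2 * (u x)^2) \<le> ennreal ((?d - 2)^2) * ((?W x)^2 * ennreal ((u x)^2))" for x
        proof -
          let ?w = "LBINT y. kr y * \<bar>\<mu> (x - y)\<bar>"
          have w0: "0 \<le> ?w" by (intro integral_nonneg_AE AE_I2) (simp add: kr_nonneg)
          have "\<bar>rpd j s x\<bar> \<le> (?d - 2) * ?w" unfolding s_def by (rule rpd_potential_le[OF d mu])
          then have "\<bar>rpd j s x\<bar>\<^sup>2 \<le> ((?d - 2) * ?w)^2" by (intro power_mono) auto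
          then have "(rpd j s x)^2 * (u x)^2 \<le> ((?d - 2)^2 * ?w^2) * (u x)^2" by (intro mult_right_mono) (auto simp: power_mult_distrib)
          then have "ennreal ((rpd j s x)^2 * (u x)^2) \<le> ennreal ((?d - 2)^2 * (?w^2 * (u x)^2))" by (intro ennreal_leI) (simp add: mult.assoc)
          also have "\<dots> = ennreal ((?d - 2)^2) * (ennreal ?w ^ 2 * ennreal ((u x)^2))" using w0 by (simp add: ennreal_mult ennreal_power)
          finally show ?thesis unfolding I1_conv_kr[OF d mu mu0] .
        qed
        have "ennreal (LBINT x. (rpd j s x)^2 * (u x)^2) = (LBNN x. ennreal ((rpd j s x)^2 * (u x)^2))"
          by (rule nn_integral_eq_integral[symmetric]) (auto intro!: rtest_integrable rtest_mult2 sm_power sm_rpd ss u2)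
        also have "\<dots> \<le> (LBNN x. ennreal ((?d - 2)^2) * ((?W x)^2 * ennreal ((u x)^2)))" by (intro nn_integral_mono pw)
        also have "\<dots> = ennreal ((?d - 2)^2) * (LBNN x. (?W x)^2 * ennreal ((u x)^2))" by (rule nn_integral_cmult) measurable
        also have "\<dots> \<le> ennreal ((?d - 2)^2) * ennreal (C0 * dir u)" by (intro mult_left_mono C0(2)[OF tr u(1)]) auto
        also have "\<dots> = ennreal ((?d - 2)^2 * C0 * dir u)" using C0(1) dir_nonneg[of u] by (subst ennreal_mult[symmetric]) (auto simp: mult.assoc)
        finally show ?thesis using C0(1) dir_nonneg[of u] by (subst (asm) ennreal_le_iff) auto
      qed
      have "(LBINT x. gsq \<psi> x * (u x)^2) \<le> (LBINT x. 2 * ((\<Sum>j\<in>UNIV. (rpd j \<Phi> x)^2) * (u x)^2) + (2 / ?c^2) * (\<Sum>j\<in>UNIV. (rpd j s x)^2 * (u x)^2))"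
      proof (rule integral_mono)
        show "integrable lborel (\<lambda>x. gsq \<psi> x * (u x)^2)" by (intro rtest_integrable rtest_mult2 u2 sm_sum sm_power sm_rpd spsi)
        show "integrable lborel (\<lambda>x. 2 * ((\<Sum>j\<in>UNIV. (rpd j \<Phi> x)^2) * (u x)^2) + (2 / ?c^2) * (\<Sum>j\<in>UNIV. (rpd j s x)^2 * (u x)^2))"
          by (intro rtest_integrable rtest_add rtest_cmult rtest_sum rtest_mult2 u2 sm_sum sm_power sm_rpd sP ss)
        fix x
        have "(rpd j \<psi> x)^2 \<le> 2 * (rpd j \<Phi> x)^2 + (2 / ?c^2) * (rpd j s x)^2" for j
        proof -
          have "(a - b)^2 \<le> 2 * b^2 + 2 * a^2" for a b :: real
            using zero_le_power2[of "a + b"] by (simp add: power2_eq_square algebra_simps)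
          from this[of "(1 / ?c) * rpd j s x" "rpd j \<Phi> x"] show ?thesis unfolding rpsi by (simp add: power_mult_distrib power_divide)
        qed
        then have "gsq \<psi> x * (u x)^2 \<le> (\<Sum>j\<in>UNIV. 2 * (rpd j \<Phi> x)^2 + (2 / ?c^2) * (rpd j s x)^2) * (u x)^2"
          by (intro mult_right_mono sum_mono) auto
        also have "\<dots> = 2 * ((\<Sum>j\<in>UNIV. (rpd j \<Phi> x)^2) * (u x)^2) + (2 / ?c^2) * (\<Sum>j\<in>UNIV. (rpd j s x)^2 * (u x)^2)"
          by (simp add: sum.distrib sum_distrib_left sum_distrib_right distrib_right mult.assoc)
        finally show "gsq \<psi> x * (u x)^2 \<le> 2 * ((\<Sum>j\<in>UNIV. (rpd j \<Phi> x)^2) * (u x)^2) + (2 / ?c^2) * (\<Sum>j\<in>UNIV. (rpd j s x)^2 * (u x)^2)" .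
      qed
      also have "\<dots> = 2 * T u + (2 / ?c^2) * (\<Sum>j\<in>UNIV. (LBINT x. (rpd j s x)^2 * (u x)^2))"
      proof -
        have i: "integrable lborel (\<lambda>x. (\<Sum>j\<in>UNIV. (rpd j \<Phi> x)^2) * (u x)^2)" "\<And>j. integrable lborel (\<lambda>x. (rpd j s x)^2 * (u x)^2)"
          by (intro rtest_integrable rtest_mult2 u2 sm_sum sm_power sm_rpd sP ss)+
        show ?thesis unfolding T_def using i by (simp add: Bochner_Integration.integral_sum)
      qed
      also have "\<dots> \<le> 2 * (7 * dir u) + (2 / ?c^2) * (\<Sum>j\<in>(UNIV::'d set). (?d - 2)\<^sup>2 * C0 * dir u)"
        using T7[OF u(1) uv] by (intro add_mono mult_left_mono sum_mono sj) auto
      also have "\<dots> = C * dir u" by (simp add: C_def algebra_simps)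
      finally show ?thesis .
    qed
    ultimately show ?thesis using spsi ep unfolding V'_def by blast
  qed
  have "C > 0" unfolding C_def using C0(1) by (intro add_pos_nonneg) auto
  then show thesis using that main by blast
qed

section \<open>Passage to the limit\<close>

text \<open>The squared cutoff is an admissible weight u^2 in the gradient bound of
  \<open>local_potential\<close>, which therefore bounds this energy; as a quadratic form it obeys
  the parallelogram law.\<close>

definition en :: "real \<Rightarrow> (real^'d::finite \<Rightarrow> real) \<Rightarrow> real" where
  "en S \<psi> = (LBINT x. gsq \<psi> x * (cutat 0 S x)^2)"

lemma en_nonneg: "0 \<le> en S \<psi>"
  unfolding en_def by (intro integral_nonneg_AE AE_I2 mult_nonneg_nonneg sum_nonneg) auto

lemma rtest_en: "S > 0 \<Longrightarrow> sm \<psi> \<Longrightarrow> rtest (\<lambda>x. gsq \<psi> x * (cutat 0 S x)^2)"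
  by (intro rtest_mult2 sm_sum sm_power sm_rpd rtest_power2 cutat_rtest)

lemma rpd_lincomb: "sm y \<Longrightarrow> sm z \<Longrightarrow> rpd j (\<lambda>x. a * y x + b * z x) x = a * rpd j y x + b * rpd j z x"
proof -
  assume s: "sm y" "sm z"
  have "rpd j (\<lambda>x. a * y x + b * z x) x = rpd j (\<lambda>x. a * y x) x + rpd j (\<lambda>x. b * z x) x"
    by (rule rpd_add[OF sm_diff[OF sm_mult[OF sm_const s(1)]] sm_diff[OF sm_mult[OF sm_const s(2)]]])
  then show ?thesis by (simp only: rpd_cmult[OF sm_diff[OF s(1)]] rpd_cmult[OF sm_diff[OF s(2)]])
qed

section \<open>A Poincare inequality with weighted mean zero\<close>

lemma increment_le:
  assumes s: "sm \<psi>"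
  shows "ennreal \<bar>\<psi> (x + h) - \<psi> x\<bar> \<le> ennreal (norm h) * (LBNN t. indicator {0..1} t * ennreal (\<Sum>j\<in>UNIV. \<bar>rpd j \<psi> (x + t *\<^sub>R h)\<bar>))"
proof -
  let ?D = "\<lambda>t. \<Sum>j\<in>UNIV. rpd j \<psi> (x + t *\<^sub>R h) * h $ j"
  have cj: "continuous_on A (\<lambda>t. rpd j \<psi> (x + t *\<^sub>R h))" for A j
    by (rule continuous_on_compose2[OF sm_cont[OF sm_rpd[OF s], of UNIV]]) (auto intro!: continuous_intros)
  have c: "continuous_on A ?D" for A by (intro continuous_intros cj)
  have i: "integrable lborel (\<lambda>t. indicator {0..1} t *\<^sub>R ?D t)" by (intro borel_integrable_compact c) auto
  have "(LBINT t. indicator {0..1} t *\<^sub>R ?D t) = \<psi> (x + 1 *\<^sub>R h) - \<psi> (x + 0 *\<^sub>R h)"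
  proof (rule integral_FTC_Icc)
    show "((\<lambda>t. \<psi> (x + t *\<^sub>R h)) has_vector_derivative ?D t) (at t within {0..1})" for t
      using directional_deriv[OF s, of x h t] by (simp add: has_real_derivative_iff_has_vector_derivative has_vector_derivative_at_within)
  qed (use c in auto)
  then have "\<bar>\<psi> (x + h) - \<psi> x\<bar> = \<bar>LBINT t. indicator {0..1} t *\<^sub>R ?D t\<bar>" by simp
  then have "ennreal \<bar>\<psi> (x + h) - \<psi> x\<bar> \<le> (LBNN t. ennreal \<bar>indicator {0..1} t *\<^sub>R ?D t\<bar>)"
    using integral_norm_bound_ennreal[OF i] by simp
  also have "\<dots> \<le> (LBNN t. ennreal (norm h) * (indicator {0..1} t * ennreal (\<Sum>j\<in>UNIV. \<bar>rpd j \<psi> (x + t *\<^sub>R h)\<bar>)))"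
  proof (rule nn_integral_mono)
    fix t
    have "ennreal \<bar>?D t\<bar> \<le> ennreal ((\<Sum>j\<in>UNIV. \<bar>rpd j \<psi> (x + t *\<^sub>R h)\<bar>) * norm h)" by (intro ennreal_leI lin_form_bound)
    also have "\<dots> = ennreal (norm h) * ennreal (\<Sum>j\<in>UNIV. \<bar>rpd j \<psi> (x + t *\<^sub>R h)\<bar>)" by (subst ennreal_mult) (auto simp: sum_nonneg mult.commute)
    finally show "ennreal \<bar>indicator {0..1} t *\<^sub>R ?D t\<bar> \<le> ennreal (norm h) * (indicator {0..1} t * ennreal (\<Sum>j\<in>UNIV. \<bar>rpd j \<psi> (x + t *\<^sub>R h)\<bar>))"
      by (cases "t \<in> {0..1}") auto
  qed
  also have "\<dots> = ennreal (norm h) * (LBNN t. indicator {0..1} t * ennreal (\<Sum>j\<in>UNIV. \<bar>rpd j \<psi> (x + t *\<^sub>R h)\<bar>))"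
  proof (rule nn_integral_cmult)
    have "continuous_on UNIV (\<lambda>t. \<Sum>j\<in>UNIV. \<bar>rpd j \<psi> (x + t *\<^sub>R h)\<bar>)"
      by (intro continuous_intros cj)
    note [measurable] = borel_measurable_continuous_onI[OF this]
    show "(\<lambda>t. indicator {0..1} t * ennreal (\<Sum>j\<in>UNIV. \<bar>rpd j \<psi> (x + t *\<^sub>R h)\<bar>)) \<in> borel_measurable lborel" by measurable
  qed
  finally show ?thesis .
qed

text \<open>As \<psi> has mean zero against w, \<psi>(x) is an average of \<psi>(x) - \<psi>(y).
  Each difference is bounded by the gradient along the segment, and Fubini with translations turns
  the segment integrals into one integral over a larger ball.\<close>

lemma poincare_nn:
  fixes \<psi> :: "real^'d::finite \<Rightarrow> real"
  assumes s: "sm \<psi>" and w: "mollifier w" "\<And>x. w x \<le> W" and z: "(LBINT x. w x * \<psi> x) = 0"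
    and f: "rtest f" "vanish R f" "\<And>x. \<bar>f x\<bar> \<le> M" and R: "R \<ge> 1"
  shows "ennreal \<bar>LBINT x. f x * \<psi> x\<bar> \<le> ennreal (M * W * (2 * R)) * emeasure lborel (cball (0::real^'d) (2 * R))
      * (LBNN x. indicator (cball 0 (3 * R)) x * ennreal (\<Sum>j\<in>UNIV. \<bar>rpd j \<psi> x\<bar>))"
proof -
  have w': "rtest w" "\<And>x. 0 \<le> w x" "vanish 1 w" "integral\<^sup>L lborel w = 1" using w by (auto simp: mollifier_def)
  have M0: "M \<ge> 0" using f(3)[of 0] by linarith
  have W0: "W \<ge> 0" using w(2)[of 0] w'(2)[of 0] by linarith
  note [measurable] = sm_borel[OF s] sm_borel[OF rtest_sm[OF f(1)]] sm_borel[OF rtest_sm[OF w'(1)]] sm_borel[OF sm_rpd[OF s]]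
  let ?g = "\<lambda>x. ennreal (\<Sum>j\<in>UNIV. \<bar>rpd j \<psi> x\<bar>)"
  let ?G = "LBNN x. indicator (cball 0 (3 * R)) x * ?g x"
  have iw: "integrable lborel (\<lambda>y. w y * \<psi> y)" by (intro rtest_integrable rtest_mult1 w' s)
  have eq: "f x * \<psi> x = (LBINT y. f x * (w y * (\<psi> x - \<psi> y)))" for x
  proof -
    have "(LBINT y. w y * (\<psi> x - \<psi> y)) = (LBINT y. w y * \<psi> x - w y * \<psi> y)" by (simp only: right_diff_distrib)
    also have "\<dots> = \<psi> x" using iw rtest_integrable[OF w'(1)] z w'(4) by simp
    finally show ?thesis by simp
  qed
  have "integrable lborel (\<lambda>x. f x * \<psi> x)" by (intro rtest_integrable rtest_mult1 f s)
  then have "ennreal \<bar>LBINT x. f x * \<psi> x\<bar> \<le> (LBNN x. ennreal \<bar>f x * \<psi> x\<bar>)"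
    using integral_norm_bound_ennreal[of lborel "\<lambda>x. f x * \<psi> x"] by simp
  also have "\<dots> \<le> (LBNN x. (LBNN y. ennreal \<bar>f x * (w y * (\<psi> x - \<psi> y))\<bar>))"
  proof (rule nn_integral_mono)
    fix x
    have "rtest (\<lambda>y. w y * (\<psi> x - \<psi> y))" by (intro rtest_mult1 w' sm_sub sm_const s)
    then have i: "integrable lborel (\<lambda>y. f x * (w y * (\<psi> x - \<psi> y)))" by (intro rtest_integrable rtest_cmult)
    show "ennreal \<bar>f x * \<psi> x\<bar> \<le> (LBNN y. ennreal \<bar>f x * (w y * (\<psi> x - \<psi> y))\<bar>)"
      unfolding eq[of x] using integral_norm_bound_ennreal[OF i] by (simp only: real_norm_def)
  qed
  \<comment> \<open>With the displacement h = y - x as variable, the point x + t h is a translate of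
    x for fixed h and t, so integrating over x removes the segment.\<close>
  also have "\<dots> = (LBNN x. (LBNN h. ennreal \<bar>f x * (w (h + x) * (\<psi> x - \<psi> (h + x)))\<bar>))"
    by (intro nn_integral_cong nn_integral_shift(3)[symmetric]) measurable
  also have "\<dots> \<le> (LBNN x. (LBNN h. (LBNN t. indicator (cball 0 (2 * R)) h * (indicator {0..1} t * (ennreal (M * W * (2 * R)) * (indicator (cball 0 (3 * R)) (x + t *\<^sub>R h) * ?g (x + t *\<^sub>R h)))))))"
  proof (intro nn_integral_mono)
    fix x h :: "real^'d"
    show "ennreal \<bar>f x * (w (h + x) * (\<psi> x - \<psi> (h + x)))\<bar> \<le> (LBNN t. indicator (cball 0 (2 * R)) h * (indicator {0..1} t * (ennreal (M * W * (2 * R)) * (indicator (cball 0 (3 * R)) (x + t *\<^sub>R h) * ?g (x + t *\<^sub>R h)))))"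
    proof (cases "norm x \<le> R \<and> norm (h + x) \<le> 1")
      case True
      have h: "norm h \<le> 2 * R" using True R norm_triangle_ineq4[of "h + x" x] by simp
      have xt: "norm (x + t *\<^sub>R h) \<le> 3 * R" if "t \<in> {0..1}" for t
      proof -
        have "\<bar>t\<bar> * norm h \<le> 1 * (2 * R)" using that h R by (intro mult_mono) auto
        then show ?thesis using True norm_triangle_ineq[of x "t *\<^sub>R h"] by simp
      qed
      have "ennreal \<bar>f x * (w (h + x) * (\<psi> x - \<psi> (h + x)))\<bar> \<le> ennreal (M * W) * ennreal \<bar>\<psi> (x + h) - \<psi> x\<bar>"
      proof -
        have "\<bar>f x\<bar> * (\<bar>w (h + x)\<bar> * \<bar>\<psi> (x + h) - \<psi> x\<bar>) \<le> M * (W * \<bar>\<psi> (x + h) - \<psi> x\<bar>)"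
          using f(3)[of x] w(2)[of "h + x"] w'(2)[of "h + x"] M0 W0 by (intro mult_mono) auto
        then show ?thesis using M0 W0 by (subst ennreal_mult[symmetric]) (auto simp: abs_mult add.commute abs_minus_commute mult.assoc intro!: ennreal_leI)
      qed
      also have "\<dots> \<le> ennreal (M * W) * (ennreal (2 * R) * (LBNN t. indicator {0..1} t * ?g (x + t *\<^sub>R h)))"
      proof (intro mult_left_mono order_trans[OF increment_le[OF s]])
        show "ennreal (norm h) * (LBNN t. indicator {0..1} t * ?g (x + t *\<^sub>R h)) \<le> ennreal (2 * R) * (LBNN t. indicator {0..1} t * ?g (x + t *\<^sub>R h))"
          using h by (intro mult_right_mono ennreal_leI) auto
      qed auto
      also have "\<dots> = ennreal (M * W * (2 * R)) * (LBNN t. indicator {0..1} t * ?g (x + t *\<^sub>R h))"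
        using M0 W0 R by (simp add: ennreal_mult mult.assoc)
      also have "\<dots> = (LBNN t. ennreal (M * W * (2 * R)) * (indicator {0..1} t * ?g (x + t *\<^sub>R h)))"
        by (rule nn_integral_cmult[symmetric]) measurable
      also have "\<dots> = (LBNN t. indicator (cball 0 (2 * R)) h * (indicator {0..1} t * (ennreal (M * W * (2 * R)) * (indicator (cball 0 (3 * R)) (x + t *\<^sub>R h) * ?g (x + t *\<^sub>R h)))))"
      proof (rule nn_integral_cong)
        fix t
        show "ennreal (M * W * (2 * R)) * (indicator {0..1} t * ?g (x + t *\<^sub>R h)) = indicator (cball 0 (2 * R)) h * (indicator {0..1} t * (ennreal (M * W * (2 * R)) * (indicator (cball 0 (3 * R)) (x + t *\<^sub>R h) * ?g (x + t *\<^sub>R h))))"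
          using h xt[of t] by (cases "t \<in> {0..1}") auto
      qed
      finally show ?thesis .
    next
      case False
      then have "f x * w (h + x) = 0" using f(2) w'(3) by (auto simp: vanish_def)
      then show ?thesis by auto
    qed
  qed
  also have "\<dots> = (LBNN h. (LBNN x. (LBNN t. indicator (cball 0 (2 * R)) h * (indicator {0..1} t * (ennreal (M * W * (2 * R)) * (indicator (cball 0 (3 * R)) (x + t *\<^sub>R h) * ?g (x + t *\<^sub>R h)))))))"
    by (rule lborel_pair.Fubini') measurable
  also have "\<dots> = (LBNN h. (LBNN t. (LBNN x. (indicator (cball 0 (2 * R)) h * (indicator {0..1} t * ennreal (M * W * (2 * R)))) * (indicator (cball 0 (3 * R)) (x + t *\<^sub>R h) * ?g (x + t *\<^sub>R h)))))"
    unfolding mult.assoc by (intro nn_integral_cong lborel_pair.Fubini') measurable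
  also have "\<dots> = (LBNN h. (LBNN t. (indicator (cball (0::real^'d) (2 * R)) h * (indicator {0..1::real} t * ennreal (M * W * (2 * R)))) * ?G))"
  proof (intro nn_integral_cong)
    fix h :: "real^'d" and t :: real
    have "(LBNN x. indicator (cball 0 (3 * R)) (x + t *\<^sub>R h) * ?g (x + t *\<^sub>R h)) = ?G"
      by (rule nn_integral_shift(3)[where f="\<lambda>x. indicator (cball 0 (3 * R)) x * ?g x"]) measurable
    moreover have "(LBNN x. (indicator (cball 0 (2 * R)) h * (indicator {0..1} t * ennreal (M * W * (2 * R)))) * (indicator (cball 0 (3 * R)) (x + t *\<^sub>R h) * ?g (x + t *\<^sub>R h)))
      = (indicator (cball 0 (2 * R)) h * (indicator {0..1} t * ennreal (M * W * (2 * R)))) * (LBNN x. indicator (cball 0 (3 * R)) (x + t *\<^sub>R h) * ?g (x + t *\<^sub>R h))"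
      by (rule nn_integral_cmult) measurable
    ultimately show "(LBNN x. (indicator (cball 0 (2 * R)) h * (indicator {0..1} t * ennreal (M * W * (2 * R)))) * (indicator (cball 0 (3 * R)) (x + t *\<^sub>R h) * ?g (x + t *\<^sub>R h)))
      = (indicator (cball 0 (2 * R)) h * (indicator {0..1} t * ennreal (M * W * (2 * R)))) * ?G" by simp
  qed
  also have "\<dots> = (LBNN h. (LBNN t. (indicator (cball (0::real^'d) (2 * R)) h * (ennreal (M * W * (2 * R)) * ?G)) * indicator {0..1::real} t))"
    by (intro nn_integral_cong) (simp only: mult_ac)
  also have "\<dots> = (LBNN h. (ennreal (M * W * (2 * R)) * ?G) * indicator (cball (0::real^'d) (2 * R)) h)"
    by (intro nn_integral_cong) (subst nn_integral_cmult_indicator, auto simp: mult.commute)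
  also have "\<dots> = (ennreal (M * W * (2 * R)) * ?G) * emeasure lborel (cball (0::real^'d) (2 * R))"
    by (rule nn_integral_cmult_indicator) auto
  finally show ?thesis by (simp only: mult_ac)
qed

text \<open>Cauchy-Schwarz against the cutoff passes from the L1 norm of the gradient to the
  weighted energy; \<open>S \<ge> 3 * R\<close> makes the weight 1 on the ball produced by
  \<open>poincare_nn\<close>.\<close>

lemma poincare:
  fixes w :: "real^'d::finite \<Rightarrow> real"
  assumes w: "mollifier w" and R: "R \<ge> 1" and S: "S \<ge> 3 * R"
  obtains B where "B \<ge> 0" "\<And>\<psi> f M. sm \<psi> \<Longrightarrow> (LBINT x. w x * \<psi> x) = 0 \<Longrightarrow> rtest f \<Longrightarrow> vanish R f \<Longrightarrow> (\<And>x. \<bar>f x\<bar> \<le> M) \<Longrightarrow>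
    \<bar>LBINT x. \<psi> x * f x\<bar> \<le> B * M * sqrt (en S \<psi>)"
proof -
  obtain W where W: "W > 0" "\<And>x. \<bar>w x\<bar> \<le> W" using rtest_bounded w unfolding mollifier_def by metis
  have S0: "S > 0" using R S by linarith
  let ?c = "cutat 0 S :: real^'d \<Rightarrow> real"
  have c: "rtest ?c" by (rule cutat_rtest[OF S0])
  define E where "E = measure lborel (cball (0::real^'d) (2 * R))"
  have E: "emeasure lborel (cball (0::real^'d) (2 * R)) = ennreal E"
    unfolding E_def by (rule emeasure_eq_ennreal_measure) (use emeasure_lborel_cball_finite[of "0::real^'d" "2 * R"] in auto)
  define X where "X = (LBINT x. (\<Sum>j\<in>(UNIV::'d set). (?c x)\<^sup>2))"
  have X0: "X \<ge> 0" unfolding X_def by (intro integral_nonneg_AE AE_I2 sum_nonneg) auto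
  define B where "B = W * (2 * R) * E * sqrt X"
  have E0: "E \<ge> 0" by (simp add: E_def)
  have B0: "B \<ge> 0" unfolding B_def using W R E0 X0 by simp
  have "\<bar>LBINT x. \<psi> x * f x\<bar> \<le> B * M * sqrt (en S \<psi>)"
    if s: "sm \<psi>" and z: "(LBINT x. w x * \<psi> x) = 0" and f: "rtest f" "vanish R f" "\<And>x. \<bar>f x\<bar> \<le> M" for \<psi> f M
  proof -
    have M0: "M \<ge> 0" using f(3)[of 0] by linarith
    define Y where "Y = (LBINT x. (\<Sum>j\<in>UNIV. ?c x * (\<bar>rpd j \<psi> x\<bar> * ?c x)))"
    note [measurable] = sm_borel[OF rtest_sm[OF c]] sm_borel[OF sm_rpd[OF s]]
    have Y: "integrable lborel (\<lambda>x. \<Sum>j\<in>UNIV. ?c x * (\<bar>rpd j \<psi> x\<bar> * ?c x))" "\<bar>Y\<bar> \<le> sqrt X * sqrt (en S \<psi>)"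
    proof -
      have e: "(\<Sum>j\<in>UNIV. (\<bar>rpd j \<psi> x\<bar> * ?c x)^2) = gsq \<psi> x * (?c x)^2" for x
        by (simp add: power_mult_distrib sum_distrib_right)
      have i: "integrable lborel (\<lambda>x. \<Sum>j\<in>(UNIV::'d set). (?c x)\<^sup>2)" "integrable lborel (\<lambda>x. \<Sum>j\<in>UNIV. (\<bar>rpd j \<psi> x\<bar> * ?c x)^2)"
        unfolding e by (intro rtest_integrable rtest_sum rtest_power2 c rtest_en S0 s)+
      show "integrable lborel (\<lambda>x. \<Sum>j\<in>UNIV. ?c x * (\<bar>rpd j \<psi> x\<bar> * ?c x))" by (rule integral_CS(1)[OF _ _ _ i]) auto
      show "\<bar>Y\<bar> \<le> sqrt X * sqrt (en S \<psi>)" unfolding Y_def X_def en_def e[symmetric] by (rule integral_CS(2)[OF _ _ _ i]) auto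
    qed
    have "ennreal \<bar>LBINT x. f x * \<psi> x\<bar> \<le> ennreal (M * W * (2 * R)) * ennreal E * (LBNN x. indicator (cball 0 (3 * R)) x * ennreal (\<Sum>j\<in>UNIV. \<bar>rpd j \<psi> x\<bar>))"
      unfolding E[symmetric] by (rule poincare_nn[OF s w _ z f R]) (use W(2) abs_le_D1 in blast)
    also have "\<dots> \<le> ennreal (M * W * (2 * R)) * ennreal E * (LBNN x. ennreal (\<Sum>j\<in>UNIV. ?c x * (\<bar>rpd j \<psi> x\<bar> * ?c x)))"
    proof (intro mult_left_mono nn_integral_mono)
      fix x
      show "indicator (cball 0 (3 * R)) x * ennreal (\<Sum>j\<in>UNIV. \<bar>rpd j \<psi> x\<bar>) \<le> ennreal (\<Sum>j\<in>UNIV. ?c x * (\<bar>rpd j \<psi> x\<bar> * ?c x))"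
      proof (cases "norm x \<le> 3 * R")
        case True then have "?c x = 1" using S S0 by (intro cutat_one) auto
        then show ?thesis using True by simp
      qed simp
    qed simp
    also have "(LBNN x. ennreal (\<Sum>j\<in>UNIV. ?c x * (\<bar>rpd j \<psi> x\<bar> * ?c x))) = ennreal Y"
      unfolding Y_def by (rule nn_integral_eq_integral[OF Y(1)]) (auto intro!: AE_I2 sum_nonneg mult_nonneg_nonneg cutat_range)
    also have "\<dots> \<le> ennreal (sqrt X * sqrt (en S \<psi>))" using Y(2) by (intro ennreal_leI) linarith
    finally have "ennreal \<bar>LBINT x. f x * \<psi> x\<bar> \<le> ennreal (M * W * (2 * R)) * ennreal E * ennreal (sqrt X * sqrt (en S \<psi>))" by (simp add: mult_left_mono)
    also have "\<dots> = ennreal (M * W * (2 * R) * E * (sqrt X * sqrt (en S \<psi>)))"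
      using M0 W R E0 X0 en_nonneg[of S \<psi>] by (simp add: ennreal_mult)
    finally have "\<bar>LBINT x. f x * \<psi> x\<bar> \<le> M * W * (2 * R) * E * (sqrt X * sqrt (en S \<psi>))"
      using M0 W R E0 X0 en_nonneg[of S \<psi>] by (subst (asm) ennreal_le_iff) auto
    then show ?thesis by (simp add: B_def mult_ac)
  qed
  then show thesis using that B0 by blast
qed

text \<open>The quantity bounded by \<open>e\<close> is the parallelogram defect of \<open>q n\<close>, so that it controls \<open>q n (y n - y m)\<close> for quadratic \<open>q n\<close>.\<close>

lemma nested_minimisers:
  fixes A :: "nat \<Rightarrow> 'a set" and q :: "nat \<Rightarrow> 'a \<Rightarrow> real" and mid :: "'a \<Rightarrow> 'a \<Rightarrow> 'a"
  assumes dec: "\<And>n m. n \<le> m \<Longrightarrow> A m \<subseteq> A n" and ne: "\<And>n. A n \<noteq> {}"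
    and q: "\<And>n y. y \<in> A n \<Longrightarrow> 0 \<le> q n y" "\<And>n y. y \<in> A n \<Longrightarrow> q n y \<le> 1" "\<And>n m y. n \<le> m \<Longrightarrow> y \<in> A m \<Longrightarrow> q n y \<le> q m y"
    and mid: "\<And>n y z. y \<in> A n \<Longrightarrow> z \<in> A n \<Longrightarrow> mid y z \<in> A n"
  obtains y where "\<And>n. y n \<in> A n" "\<And>e. e > 0 \<Longrightarrow> \<exists>N. \<forall>n m. N \<le> n \<longrightarrow> n \<le> m \<longrightarrow> 2 * q n (y n) + 2 * q n (y m) - 4 * q n (mid (y n) (y m)) \<le> e"
proof -
  define d where "d n = Inf (q n ` A n)" for n
  have bd: "bdd_below (q n ` A n)" for n using q(1) by (intro bdd_belowI[of _ 0]) auto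
  have dle: "d n \<le> q n y" if "y \<in> A n" for n y unfolding d_def using bd that by (intro cInf_lower) auto
  have "\<exists>y\<in>q n ` A n. y < d n + inverse (real (Suc n))" for n unfolding d_def using ne by (intro cInf_lessD) auto
  \<comment> \<open>Near minimality with error 1 / (n + 1) suffices, so no infimum has to be
    attained.\<close>
  then have "\<forall>n. \<exists>y. y \<in> A n \<and> q n y < d n + inverse (real (Suc n))" by blast
  then obtain y where y: "\<And>n. y n \<in> A n" "\<And>n. q n (y n) < d n + inverse (real (Suc n))" by metis
  have mono: "d n \<le> d m" if "n \<le> m" for n m
    unfolding d_def[of m]
  proof (rule cInf_greatest)
    fix v assume "v \<in> q m ` A m"
    then obtain x where x: "x \<in> A m" "v = q m x" by auto
    have "x \<in> A n" using dec[OF that] x by blast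
    from dle[OF this] q(3)[OF that x(1)] show "d n \<le> v" unfolding x(2) by linarith
  qed (use ne in simp)
  have b: "d n \<le> 1" for n using dle[OF y(1)] q(2)[OF y(1)] by (rule order_trans)
  have b0: "0 \<le> d n" for n unfolding d_def using ne q(1) by (intro cInf_greatest) auto
  have "Bseq d" using b b0 by (intro BseqI'[of _ 1]) (simp add: abs_of_nonneg)
  then have "convergent d" using mono by (intro Bseq_mono_convergent) auto
  then have C: "Cauchy d" by (rule convergent_Cauchy)
  have "\<exists>N. \<forall>n m. N \<le> n \<longrightarrow> n \<le> m \<longrightarrow> 2 * q n (y n) + 2 * q n (y m) - 4 * q n (mid (y n) (y m)) \<le> e" if e: "e > 0" for e
  proof -
    \<comment> \<open>Two near-minimality errors counted twice give e / 2, and twice the gap between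
      \<open>d m\<close> and \<open>d n\<close> gives at most e / 4.\<close>
    obtain N1 where N1: "\<And>n m. n \<ge> N1 \<Longrightarrow> m \<ge> N1 \<Longrightarrow> \<bar>d n - d m\<bar> < e / 8" using CauchyD[OF C, of "e/8"] e by (auto simp: real_norm_def)
    obtain N2 where N2: "inverse (real (Suc N2)) < e / 8" using reals_Archimedean[of "e/8"] e by auto
    have "2 * q n (y n) + 2 * q n (y m) - 4 * q n (mid (y n) (y m)) \<le> e" if n: "max N1 N2 \<le> n" "n \<le> m" for n m
    proof -
      have "y m \<in> A n" using y(1) dec n by blast
      then have "d n \<le> q n (mid (y n) (y m))" using dle mid y(1) by blast
      moreover have "q n (y m) \<le> q m (y m)" using q(3)[OF n(2) y(1)] .
      moreover have "inverse (real (Suc n)) \<le> inverse (real (Suc N2))" "inverse (real (Suc m)) \<le> inverse (real (Suc N2))" using n by (auto intro!: le_imp_inverse_le)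
      moreover have "d m - d n < e / 8"
      proof -
        have "\<bar>d m - d n\<bar> < e / 8" using n by (intro N1) auto
        then show ?thesis by linarith
      qed
      ultimately show ?thesis using y(2)[of n] y(2)[of m] N2 e by linarith
    qed
    then show ?thesis by blast
  qed
  with y(1) that show thesis by blast
qed

section \<open>Selection and convergence of potentials\<close>

lemma green: assumes p: "sm \<psi>" and f: "rtest f" shows "(LBINT x. \<psi> x * lapl f x) = (LBINT x. lapl \<psi> x * f x)"
proof -
  have sf: "sm f" by (rule rtest_sm[OF f])
  have "(LBINT x. \<psi> x * lapl f x) = (\<Sum>j\<in>UNIV. (LBINT x. \<psi> x * rpd j (rpd j f) x))"
    unfolding lapl_def sum_distrib_left by (intro Bochner_Integration.integral_sum rtest_integrable rtest_mult2 p rtest_rpd f)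
  also have "\<dots> = (\<Sum>j\<in>UNIV. (LBINT x. rpd j (rpd j \<psi>) x * f x))"
  proof (intro sum.cong refl)
    fix j
    have "(LBINT x. \<psi> x * rpd j (rpd j f) x) = - (LBINT x. rpd j \<psi> x * rpd j f x)"
      by (rule integral_by_parts[OF p sm_rpd[OF sf]]) (simp add: rtest_rpd f)
    also have "\<dots> = (LBINT x. rpd j (rpd j \<psi>) x * f x)"
      using integral_by_parts[OF sm_rpd[OF p] sf] f by simp
    finally show "(LBINT x. \<psi> x * rpd j (rpd j f) x) = (LBINT x. rpd j (rpd j \<psi>) x * f x)" .
  qed
  also have "\<dots> = (LBINT x. lapl \<psi> x * f x)"
    unfolding lapl_def sum_distrib_right by (intro Bochner_Integration.integral_sum[symmetric] rtest_integrable rtest_mult2 sm_rpd p f)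
  finally show ?thesis .
qed

text \<open>Identifies the defect in \<open>nested_minimisers\<close> with the energy of a
  difference. The linear combinations are written as in \<open>rpd_lincomb\<close>.\<close>

lemma en_parallelogram:
  assumes S: "S > 0" and y: "sm y" and z: "sm z"
  shows "2 * en S y + 2 * en S z - 4 * en S (\<lambda>x. (1/2) * y x + (1/2) * z x) = en S (\<lambda>x. 1 * y x + (-1) * z x)"
proof -
  have i: "integrable lborel (\<lambda>x. gsq \<psi> x * (cutat 0 S x)^2)" if "sm \<psi>" for \<psi> by (intro rtest_integrable rtest_en S that)
  have sc: "sm (\<lambda>x. a * y x + b * z x)" for a b by (intro sm_add sm_mult sm_const y z)
  have "en S (\<lambda>x. 1 * y x + (-1) * z x) = (LBINT x. 2 * (gsq y x * (cutat 0 S x)^2) + 2 * (gsq z x * (cutat 0 S x)^2) - 4 * ((\<Sum>j\<in>UNIV. (rpd j (\<lambda>x. (1/2) * y x + (1/2) * z x) x)^2) * (cutat 0 S x)^2))"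
    unfolding en_def
  proof (intro Bochner_Integration.integral_cong refl)
    fix x
    have "(\<Sum>j\<in>UNIV. (rpd j (\<lambda>x. 1 * y x + (-1) * z x) x)^2) = (\<Sum>j\<in>UNIV. 2 * (rpd j y x)^2 + 2 * (rpd j z x)^2 - 4 * (rpd j (\<lambda>x. (1/2) * y x + (1/2) * z x) x)^2)"
    proof (intro sum.cong refl)
      fix j
      have "(1 * a + (-1) * b)^2 = 2 * a^2 + 2 * b^2 - 4 * ((1/2) * a + (1/2) * b)^2" for a b :: real
        by (simp add: power2_eq_square field_simps)
      then show "(rpd j (\<lambda>x. 1 * y x + (-1) * z x) x)^2 = 2 * (rpd j y x)^2 + 2 * (rpd j z x)^2 - 4 * (rpd j (\<lambda>x. (1/2) * y x + (1/2) * z x) x)^2"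
        unfolding rpd_lincomb[OF y z] .
    qed
    also have "\<dots> = 2 * gsq y x + 2 * gsq z x - 4 * (\<Sum>j\<in>UNIV. (rpd j (\<lambda>x. (1/2) * y x + (1/2) * z x) x)^2)"
      by (simp only: sum_subtractf sum.distrib sum_distrib_left)
    finally show "(\<Sum>j\<in>UNIV. (rpd j (\<lambda>x. 1 * y x + (-1) * z x) x)^2) * (cutat 0 S x)^2 = 2 * (gsq y x * (cutat 0 S x)^2) + 2 * (gsq z x * (cutat 0 S x)^2) - 4 * ((\<Sum>j\<in>UNIV. (rpd j (\<lambda>x. (1/2) * y x + (1/2) * z x) x)^2) * (cutat 0 S x)^2)"
      by (simp only: left_diff_distrib distrib_right mult.assoc)
  qed
  also have "\<dots> = 2 * en S y + 2 * en S z - 4 * en S (\<lambda>x. (1/2) * y x + (1/2) * z x)"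
    unfolding en_def using i[OF y] i[OF z] i[OF sc[of "1/2" "1/2"]] by simp
  finally show ?thesis ..
qed

lemma fatou_AE:
  fixes F :: "nat \<Rightarrow> 'a \<Rightarrow> real"
  assumes [measurable]: "\<And>m. F m \<in> borel_measurable M" and lim: "AE x in M. (\<lambda>m. F m x) \<longlonglongrightarrow> f x"
    and b: "\<And>m. m \<ge> N \<Longrightarrow> (\<integral>\<^sup>+x. ennreal (F m x) \<partial>M) \<le> c"
  shows "(\<integral>\<^sup>+x. ennreal (f x) \<partial>M) \<le> c"
proof -
  have "(\<integral>\<^sup>+x. ennreal (f x) \<partial>M) = (\<integral>\<^sup>+x. liminf (\<lambda>m. ennreal (F m x)) \<partial>M)"
  proof (rule nn_integral_cong_AE, use lim in eventually_elim)
    case (elim x)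
    have "(\<lambda>m. ennreal (F m x)) \<longlonglongrightarrow> ennreal (f x)" by (rule tendsto_ennrealI[OF elim])
    then show ?case by (rule lim_imp_Liminf[OF sequentially_bot, symmetric])
  qed
  also have "\<dots> \<le> liminf (\<lambda>m. \<integral>\<^sup>+x. ennreal (F m x) \<partial>M)" by (rule nn_integral_liminf) measurable
  also have "\<dots> \<le> liminf (\<lambda>m. c)" by (intro Liminf_mono eventually_sequentiallyI[of N] b)
  also have "\<dots> = c" by (rule Liminf_const) simp
  finally show ?thesis .
qed

lemma summable_increments_convergent:
  fixes g :: "nat \<Rightarrow> real"
  assumes "(\<Sum>i. ennreal \<bar>g (Suc (i + k)) - g (i + k)\<bar>) \<noteq> \<infinity>"
  shows "convergent g"
proof -
  have "summable (\<lambda>i. \<bar>g (Suc (i + k)) - g (i + k)\<bar>)" using assms by (intro summable_suminf_not_top) auto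
  then have "summable (\<lambda>i. g (Suc (i + k)) - g (i + k))" by (rule summable_rabs_cancel)
  then have "convergent (\<lambda>n. \<Sum>i<n. g (Suc i + k) - g (i + k))" by (simp only: summable_iff_convergent add_Suc)
  then obtain l where "(\<lambda>n. \<Sum>i<n. g (Suc i + k) - g (i + k)) \<longlonglongrightarrow> l" by (auto simp only: convergent_def)
  then have "(\<lambda>n. g (n + k) - g (0 + k)) \<longlonglongrightarrow> l" by (simp only: sum_lessThan_telescope[of "\<lambda>i. g (i + k)"])
  from tendsto_add[OF this tendsto_const[of "g (0 + k)"]] have "(\<lambda>n. g (n + k)) \<longlonglongrightarrow> l + g (0 + k)" by (simp only: diff_add_cancel)
  from LIMSEQ_offset[OF this] show ?thesis by (auto simp only: convergent_def)
qed

text \<open>\<Psi> arises only as a functional: gradients converge in local L2, and the Poincare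
  inequality for functions normalised against \<open>w\<close> turns this into convergence of
  pairings. The bound of \<Psi> by the supremum alone will give a distribution of order
  zero.\<close>

lemma limit_potential:
  fixes V \<rho> :: "nat \<Rightarrow> real^'d::finite \<Rightarrow> real"
  assumes d: "CARD('d) \<ge> 3" and V: "\<And>n. continuous_on UNIV (V n)"
    and form: "\<And>n u. rtest u \<Longrightarrow> \<bar>LBINT x. V n x * (u x)^2\<bar> \<le> dir u / 2"
    and m: "\<And>n. mollifier (\<rho> n)" and lim: "\<And>f. rtest f \<Longrightarrow> (\<lambda>n. (LBINT x. conv (V n) (\<rho> n) x * f x)) \<longlonglongrightarrow> \<Lambda> f"
  obtains \<Psi> G C where "C > 0" "\<And>f g a b. rtest f \<Longrightarrow> rtest g \<Longrightarrow> \<Psi> (\<lambda>x. a * f x + b * g x) = a * \<Psi> f + b * \<Psi> g"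
    "\<And>R. \<exists>B\<ge>0. \<forall>f M. rtest f \<longrightarrow> vanish R f \<longrightarrow> (\<forall>x. \<bar>f x\<bar> \<le> M) \<longrightarrow> \<bar>\<Psi> f\<bar> \<le> B * M"
    "\<And>f. rtest f \<Longrightarrow> \<Psi> (lapl f) = \<Lambda> f" "\<And>j. G j \<in> borel_measurable borel"
    "\<And>j f. rtest f \<Longrightarrow> integrable lborel (\<lambda>x. G j x * f x)" "\<And>j f. rtest f \<Longrightarrow> - \<Psi> (rpd j f) = (LBINT x. G j x * f x)"
    "\<And>u. rtest u \<Longrightarrow> (LBNN x. ennreal ((\<Sum>j\<in>UNIV. (G j x)^2) * (u x)^2)) \<le> ennreal (C * dir u)"
proof -
  obtain C where C: "C > 0" and lp: "\<And>(V::real^'d \<Rightarrow> real) \<rho> R e0. continuous_on UNIV V \<Longrightarrow>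
     (\<And>u. rtest u \<Longrightarrow> \<bar>LBINT x. V x * (u x)^2\<bar> \<le> dir u / 2) \<Longrightarrow> mollifier \<rho> \<Longrightarrow> R \<ge> 1 \<Longrightarrow> e0 > 0 \<Longrightarrow>
     \<exists>\<psi> \<epsilon>. sm \<psi> \<and> 0 < \<epsilon> \<and> \<epsilon> \<le> e0 \<and> (\<forall>x. norm x \<le> R \<longrightarrow> lapl \<psi> x = conv V \<rho> x - \<epsilon>) \<and>
       (\<forall>u. rtest u \<longrightarrow> vanish R u \<longrightarrow> (LBINT x. gsq \<psi> x * (u x)^2) \<le> C * dir u)"
    using local_potential[OF d] by blast
  define er where "er n = inverse (real (Suc n))" for n
  have er: "er n > 0" "er \<longlonglongrightarrow> 0" for n unfolding er_def[abs_def] using LIMSEQ_inverse_real_of_nat by auto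
  define Q where "Q n \<psi> \<epsilon> \<longleftrightarrow> sm \<psi> \<and> 0 < \<epsilon> \<and> \<epsilon> \<le> er n \<and> (\<forall>x. norm x \<le> real n + 1 \<longrightarrow> lapl \<psi> x = conv (V n) (\<rho> n) x - \<epsilon>) \<and>
       (\<forall>u. rtest u \<longrightarrow> vanish (real n + 1) u \<longrightarrow> (LBINT x. gsq \<psi> x * (u x)^2) \<le> C * dir u)" for n \<psi> \<epsilon>
  have "\<exists>\<psi> \<epsilon>. Q n \<psi> \<epsilon>" for n unfolding Q_def by (rule lp[OF V form m _ er(1)]) auto
  then obtain p \<epsilon> where Q: "\<And>n. Q n (p n) (\<epsilon> n)" by metis
  have p: "\<And>n. sm (p n)" "\<And>n. 0 < \<epsilon> n" "\<And>n. \<epsilon> n \<le> er n"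
    "\<And>n x. norm x \<le> real n + 1 \<Longrightarrow> lapl (p n) x = conv (V n) (\<rho> n) x - \<epsilon> n"
    "\<And>n u. rtest u \<Longrightarrow> vanish (real n + 1) u \<Longrightarrow> (LBINT x. (\<Sum>j\<in>UNIV. (rpd j (p n) x)^2) * (u x)^2) \<le> C * dir u"
    using Q unfolding Q_def by blast+
  define w where "w = \<rho> 0"
  have mw: "mollifier w" and w: "rtest w" "integral\<^sup>L lborel w = 1" using m[of 0] by (auto simp: w_def mollifier_def)
  define err where "err n f = \<bar>(LBINT x. conv (V n) (\<rho> n) x * f x) - \<Lambda> f\<bar> + er n * (LBINT x. \<bar>f x\<bar>)" for n f
  have err0: "(\<lambda>n. err n f) \<longlonglongrightarrow> 0" if "rtest f" for f
  proof -
    have "(\<lambda>n. err n f) \<longlonglongrightarrow> \<bar>\<Lambda> f - \<Lambda> f\<bar> + 0 * (LBINT x. \<bar>f x\<bar>)"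
      unfolding err_def by (intro tendsto_intros lim that er(2))
    then show ?thesis by simp
  qed
  \<comment> \<open>All conditions survive midpoints. Allowing as defect any common bound of
    \<open>err k f\<close> over all \<open>k \<ge> n\<close>, instead of \<open>err n f\<close>, is
    what makes the sets decrease in n.\<close>
  define A where "A n = {\<psi>. sm \<psi> \<and> (\<forall>u. rtest u \<longrightarrow> vanish (real n + 1) u \<longrightarrow> (LBINT x. gsq \<psi> x * (u x)^2) \<le> C * dir u)
     \<and> (LBINT x. w x * \<psi> x) = 0 \<and> (\<forall>f \<delta>. rtest f \<longrightarrow> vanish (real n + 1) f \<longrightarrow> (\<forall>k\<ge>n. err k f \<le> \<delta>) \<longrightarrow> \<bar>(LBINT x. \<psi> x * lapl f x) - \<Lambda> f\<bar> \<le> \<delta>)}" for n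
  have Ad: "A k \<subseteq> A n" if "n \<le> k" for n k
  proof -
    have "vanish (real k + 1) f" if "vanish (real n + 1) f" for f :: "real^'d \<Rightarrow> real" using vanish_mono[OF that] \<open>n \<le> k\<close> by simp
    then show ?thesis unfolding A_def using that by (auto intro: order_trans)
  qed
  have An: "A n \<noteq> {}" for n
  proof -
    \<comment> \<open>Subtracting this mean leaves gradient and Laplacian unchanged and achieves the
      normalisation against w.\<close>
    define \<kappa> where "\<kappa> = (LBINT x. w x * p n x)"
    define q where "q x = p n x - \<kappa>" for x
    have sq: "sm q" unfolding q_def[abs_def] by (intro sm_sub p sm_const)
    have rq: "rpd j q = rpd j (p n)" for j unfolding q_def[abs_def] using rpd_add_const(2)[OF p(1)] by auto
    have lq: "lapl q = lapl (p n)" unfolding lapl_def[abs_def] rq ..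
    have "(LBINT x. w x * q x) = (LBINT x. w x * p n x - w x * \<kappa>)" unfolding q_def by (simp only: right_diff_distrib)
    also have "\<dots> = 0" using rtest_integrable[OF rtest_mult1[OF w(1) p(1)]] rtest_integrable[OF w(1)] w(2) by (simp add: \<kappa>_def)
    finally have q0: "(LBINT x. w x * q x) = 0" .
    have "\<bar>(LBINT x. q x * lapl f x) - \<Lambda> f\<bar> \<le> \<delta>" if f: "rtest f" "vanish (real n + 1) f" and dl: "\<forall>k\<ge>n. err k f \<le> \<delta>" for f \<delta>
    proof -
      have ic: "integrable lborel (\<lambda>x. conv (V n) (\<rho> n) x * f x)"
        using m[of n] by (intro rtest_integrable rtest_mult2 f sm_conv locint_cont V) (simp add: mollifier_def)
      have "(LBINT x. q x * lapl f x) = (LBINT x. lapl (p n) x * f x)" unfolding green[OF sq f(1)] lq ..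
      also have "\<dots> = (LBINT x. conv (V n) (\<rho> n) x * f x - \<epsilon> n * f x)"
      proof (intro Bochner_Integration.integral_cong refl)
        fix x show "lapl (p n) x * f x = conv (V n) (\<rho> n) x * f x - \<epsilon> n * f x"
          using p(4)[of x n] f(2) by (cases "norm x \<le> real n + 1") (auto simp: vanish_def left_diff_distrib)
      qed
      also have "\<dots> = (LBINT x. conv (V n) (\<rho> n) x * f x) - \<epsilon> n * (LBINT x. f x)"
        using ic rtest_integrable[OF f(1)] by simp
      finally have e: "(LBINT x. q x * lapl f x) = (LBINT x. conv (V n) (\<rho> n) x * f x) - \<epsilon> n * (LBINT x. f x)" .
      have "\<bar>\<epsilon> n * (LBINT x. f x)\<bar> \<le> er n * (LBINT x. \<bar>f x\<bar>)"
        unfolding abs_mult using p(2,3)[of n] by (intro mult_mono integral_abs_bound) auto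
      then have "\<bar>(LBINT x. q x * lapl f x) - \<Lambda> f\<bar> \<le> err n f" unfolding e err_def by linarith
      then show ?thesis using dl by (meson order_refl order_trans)
    qed
    then have "q \<in> A n" unfolding A_def using sq q0 p(5) by (auto simp: rq)
    then show ?thesis by blast
  qed
  \<comment> \<open>\<open>cutat 0 (h k)\<close> vanishes beyond \<open>2 * h k = k + 1\<close>, the
    radius on which members of \<open>A k\<close> satisfy the gradient bound.\<close>
  define h where "h k = (real k + 1) / 2" for k
  have h: "h k > 0" "2 * h k = real k + 1" for k by (auto simp: h_def)
  have cv: "rtest (cutat 0 (h k) :: real^'d \<Rightarrow> real)" "vanish (real k + 1) (cutat 0 (h k) :: real^'d \<Rightarrow> real)" for k
    using cutat_rtest[OF h(1)] cutat_vanish[OF h(1)[of k]] unfolding h(2) by auto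
  define E where "E k = C * dir (cutat 0 (h k) :: real^'d \<Rightarrow> real)" for k
  have E0: "E k \<ge> 0" for k unfolding E_def using C dir_nonneg by (intro mult_nonneg_nonneg) auto
  have enE: "en (h k) \<psi> \<le> E k" if "\<psi> \<in> A n" "k \<le> n" for \<psi> k n
  proof -
    have "vanish (real n + 1) (cutat 0 (h k) :: real^'d \<Rightarrow> real)" using vanish_mono[OF cv(2)] that(2) by simp
    then show ?thesis using that(1) cv(1) unfolding A_def E_def en_def by blast
  qed
  \<comment> \<open>The weights bound the k-th summand by 2^(-k-1) on the admissible sets. One
    functional with values below 1 thus controls every local energy.\<close>
  define c where "c k = (1/2) ^ Suc k / (E k + 1)" for k
  have c: "c k > 0" for k using E0[of k] by (simp add: c_def add_nonneg_pos)
  define q where "q n \<psi> = (\<Sum>k\<le>n. c k * en (h k) \<psi>)" for n and \<psi> :: "real^'d \<Rightarrow> real"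
  define mid where "mid y z = (\<lambda>x::real^'d. (1/2) * y x + (1/2) * z x :: real)" for y z
  define df where "df y z = (\<lambda>x::real^'d. 1 * y x + (-1) * z x :: real)" for y z
  have smA: "sm \<psi>" if "\<psi> \<in> A n" for \<psi> n using that by (simp add: A_def)
  obtain y where y: "\<And>n. y n \<in> A n" "\<And>e. e > 0 \<Longrightarrow> \<exists>N. \<forall>n m. N \<le> n \<longrightarrow> n \<le> m \<longrightarrow> 2 * q n (y n) + 2 * q n (y m) - 4 * q n (mid (y n) (y m)) \<le> e"
  proof (rule nested_minimisers[where A=A and q=q and mid=mid])
    show "A m \<subseteq> A n" if "n \<le> m" for n m using Ad[OF that] .
    show "A n \<noteq> {}" for n by (rule An)
    show "0 \<le> q n \<psi>" for n \<psi> unfolding q_def using c by (intro sum_nonneg mult_nonneg_nonneg en_nonneg) (auto intro: less_imp_le)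
    show "q n \<psi> \<le> q m \<psi>" if "n \<le> m" for n m \<psi>
      unfolding q_def using that by (intro sum_mono2 mult_nonneg_nonneg en_nonneg less_imp_le[OF c]) auto
    show "q n \<psi> \<le> 1" if "\<psi> \<in> A n" for n \<psi>
    proof -
      have "q n \<psi> \<le> (\<Sum>k\<le>n. (1/2) ^ Suc k)" unfolding q_def
      proof (rule sum_mono)
        fix k assume "k \<in> {..n}"
        then have "en (h k) \<psi> \<le> E k + 1" using enE[OF that, of k] by simp
        then have "c k * en (h k) \<psi> \<le> c k * (E k + 1)" using c[of k] by (intro mult_left_mono) auto
        also have "\<dots> = (1/2) ^ Suc k"
        proof -
          have "a / b * b = a" if "b > 0" for a b :: real using that by simp
          then show ?thesis unfolding c_def using E0[of k] by (simp only: add_nonneg_pos zero_less_one)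
        qed
        finally show "c k * en (h k) \<psi> \<le> (1/2) ^ Suc k" .
      qed
      also have "\<dots> \<le> 1"
      proof -
        have "(\<Sum>k\<le>n. (1/2::real) ^ Suc k) = 1 - (1/2) ^ Suc n" by (induction n) (auto simp: field_simps)
        then show ?thesis by simp
      qed
      finally show ?thesis .
    qed
    show "mid y z \<in> A n" if y: "y \<in> A n" and z: "z \<in> A n" for n y z
    proof -
      have sy: "sm y" and sz: "sm z" using smA y z by auto
      have sm': "sm (mid y z)" unfolding mid_def by (intro sm_add sm_mult sm_const sy sz)
      have rm: "rpd j (mid y z) x = (1/2) * rpd j y x + (1/2) * rpd j z x" for j x unfolding mid_def by (rule rpd_lincomb[OF sy sz])
      have "(LBINT x. (\<Sum>j\<in>UNIV. (rpd j (mid y z) x)^2) * (u x)^2) \<le> C * dir u" if u: "rtest u" "vanish (real n + 1) u" for u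
      proof -
        have i: "integrable lborel (\<lambda>x. gsq \<psi> x * (u x)^2)" if "sm \<psi>" for \<psi>
          by (intro rtest_integrable rtest_mult2 sm_sum sm_power sm_rpd that rtest_power2 u)
        have "(LBINT x. (\<Sum>j\<in>UNIV. (rpd j (mid y z) x)^2) * (u x)^2) \<le> (LBINT x. (1/2) * (gsq y x * (u x)^2) + (1/2) * (gsq z x * (u x)^2))"
        proof (rule integral_mono[OF i[OF sm']])
          show "integrable lborel (\<lambda>x. (1/2) * (gsq y x * (u x)^2) + (1/2) * (gsq z x * (u x)^2))"
            using i[OF sy] i[OF sz] by simp
          fix x
          have "(\<Sum>j\<in>UNIV. (rpd j (mid y z) x)^2) \<le> (\<Sum>j\<in>UNIV. (1/2) * (rpd j y x)^2 + (1/2) * (rpd j z x)^2)"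
          proof (rule sum_mono)
            fix j
            have "((1/2) * a + (1/2) * b)^2 \<le> (1/2) * a^2 + (1/2) * b^2" for a b :: real
              using zero_le_power2[of "a - b"] by (simp add: power2_eq_square field_simps)
            then show "(rpd j (mid y z) x)^2 \<le> (1/2) * (rpd j y x)^2 + (1/2) * (rpd j z x)^2" unfolding rm .
          qed
          then have "(\<Sum>j\<in>UNIV. (rpd j (mid y z) x)^2) * (u x)^2 \<le> (\<Sum>j\<in>UNIV. (1/2) * (rpd j y x)^2 + (1/2) * (rpd j z x)^2) * (u x)^2" by (rule mult_right_mono) simp
          also have "\<dots> = (1/2) * (gsq y x * (u x)^2) + (1/2) * (gsq z x * (u x)^2)"
            by (simp only: sum.distrib sum_distrib_left[symmetric] distrib_right mult.assoc)
          finally show "(\<Sum>j\<in>UNIV. (rpd j (mid y z) x)^2) * (u x)^2 \<le> (1/2) * (gsq y x * (u x)^2) + (1/2) * (gsq z x * (u x)^2)" .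
        qed
        also have "\<dots> = (1/2) * (LBINT x. gsq y x * (u x)^2) + (1/2) * (LBINT x. gsq z x * (u x)^2)"
          using i[OF sy] i[OF sz] by simp
        also have "\<dots> \<le> (1/2) * (C * dir u) + (1/2) * (C * dir u)" using y z u unfolding A_def by (intro add_mono mult_left_mono) auto
        finally show ?thesis by simp
      qed
      moreover have lin: "(LBINT x. mid y z x * g x) = (1/2) * (LBINT x. y x * g x) + (1/2) * (LBINT x. z x * g x)" if "rtest g" for g
      proof -
        have "(LBINT x. mid y z x * g x) = (LBINT x. (1/2) * (y x * g x) + (1/2) * (z x * g x))"
          unfolding mid_def by (simp only: distrib_right mult.assoc)
        then show ?thesis using rtest_integrable[OF rtest_mult2[OF sy that]] rtest_integrable[OF rtest_mult2[OF sz that]] by simp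
      qed
      moreover have "(LBINT x. w x * mid y z x) = 0" using lin[OF w(1)] y z unfolding A_def by (simp add: mult.commute)
      moreover have "\<bar>(LBINT x. mid y z x * lapl f x) - \<Lambda> f\<bar> \<le> \<delta>" if f: "rtest f" "vanish (real n + 1) f" and dl: "\<forall>k\<ge>n. err k f \<le> \<delta>" for f \<delta>
      proof -
        have "\<bar>(LBINT x. y x * lapl f x) - \<Lambda> f\<bar> \<le> \<delta>" "\<bar>(LBINT x. z x * lapl f x) - \<Lambda> f\<bar> \<le> \<delta>" using y z f dl unfolding A_def by blast+
        then show ?thesis unfolding lin[OF rtest_lapl[OF f(1)]] by linarith
      qed
      ultimately show ?thesis using sm' unfolding A_def by blast
    qed
  qed (use that in blast)
  have qd: "2 * q n \<phi> + 2 * q n \<psi> - 4 * q n (mid \<phi> \<psi>) = (\<Sum>k\<le>n. c k * en (h k) (df \<phi> \<psi>))" if "sm \<phi>" "sm \<psi>" for n \<phi> \<psi>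
  proof -
    have "(\<Sum>k\<le>n. c k * en (h k) (df \<phi> \<psi>)) = (\<Sum>k\<le>n. 2 * (c k * en (h k) \<phi>) + 2 * (c k * en (h k) \<psi>) - 4 * (c k * en (h k) (mid \<phi> \<psi>)))"
      unfolding df_def mid_def en_parallelogram[OF h(1) that, symmetric] by (intro sum.cong refl) (simp add: algebra_simps)
    then show ?thesis by (simp only: q_def sum_subtractf sum.distrib sum_distrib_left)
  qed
  \<comment> \<open>Dividing a defect of this size by any weight \<open>c k\<close> with
    \<open>k \<le> i\<close> leaves (1/4)^i, whose square root is summable.\<close>
  define b where "b i = (1/4) ^ i * Min (c ` {..i})" for i
  have bp: "b i > 0" for i unfolding b_def using c by (simp add: Min_gr_iff)
  have "\<forall>i. \<exists>N. \<forall>n m. N \<le> n \<longrightarrow> n \<le> m \<longrightarrow> 2 * q n (y n) + 2 * q n (y m) - 4 * q n (mid (y n) (y m)) \<le> b i" using y(2) bp by blast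
  then obtain N where N: "\<And>i n m. N i \<le> n \<Longrightarrow> n \<le> m \<Longrightarrow> 2 * q n (y n) + 2 * q n (y m) - 4 * q n (mid (y n) (y m)) \<le> b i" by metis
  \<comment> \<open>Summing the thresholds gives an index that is monotone in i and dominates both i
    and \<open>N i\<close>.\<close>
  define r where "r i = i + (\<Sum>l\<le>i. N l)" for i
  have ri: "i \<le> r i" "N i \<le> r i" for i unfolding r_def using member_le_sum[of i "{..i}" N] by auto
  have rm: "r i \<le> r k" if "i \<le> k" for i k unfolding r_def using that by (intro add_mono sum_mono2) auto
  define z where "z i = y (r i)" for i
  have zA: "z i \<in> A i" for i unfolding z_def using y(1) Ad[OF ri(1)] by blast
  have sz: "sm (z i)" for i using smA[OF zA] .
  have sdf: "sm (df (z i) (z k))" for i k unfolding df_def by (intro sm_add sm_mult sm_const sz)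
  have zC: "en (h k) (df (z i) (z l)) \<le> (1/4) ^ i" if "k \<le> i" "i \<le> l" for k i l
  proof -
    have "c k * en (h k) (df (z i) (z l)) \<le> (\<Sum>k\<le>r i. c k * en (h k) (df (z i) (z l)))"
      using that ri(1)[of i] c by (intro member_le_sum mult_nonneg_nonneg en_nonneg) (auto intro: less_imp_le)
    also have "\<dots> \<le> b i" unfolding qd[OF sz sz, symmetric] using N[OF ri(2) rm[OF that(2)]] by (simp add: z_def)
    also have "\<dots> \<le> (1/4) ^ i * c k" unfolding b_def using that by (intro mult_left_mono Min_le) auto
    finally have "c k * en (h k) (df (z i) (z l)) \<le> c k * (1/4) ^ i" by (simp add: mult.commute)
    then show ?thesis using c[of k] by simp
  qed
  have rdf: "rpd j (df (z i) (z l)) x = rpd j (z i) x - rpd j (z l) x" for i l j x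
    unfolding df_def rpd_lincomb[OF sz sz] by simp
  note [measurable] = sm_borel[OF sm_rpd[OF sz]] sm_borel[OF rtest_sm[OF cv(1)]]
  define G where "G j x = lim (\<lambda>i. rpd j (z i) x)" for j x
  have Gm [measurable]: "G j \<in> borel_measurable borel" for j unfolding G_def[abs_def] by (rule borel_measurable_lim_metric) measurable
  have "AE x in lborel. convergent (\<lambda>i. rpd j (z i) x)" for j
  proof -
    have "AE x in lborel. norm x \<le> h k \<longrightarrow> convergent (\<lambda>i. rpd j (z i) x)" for k
    proof -
      \<comment> \<open>Of the two cutoff factors one belongs to the energy of the difference, the
        other supplies the finite L2 norm in Cauchy-Schwarz. The increments are then summable in L1,
        hence almost everywhere, on the ball where the cutoff is 1.\<close>
      let ?F = "\<lambda>i x. ennreal \<bar>(rpd j (z (Suc (i + k))) x - rpd j (z (i + k)) x) * cutat 0 (h k) x * cutat 0 (h k) x\<bar>"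
      define X where "X = (\<integral>x. (cutat 0 (h k) x :: real)^2 \<partial>(lborel :: (real^'d) measure))"
      have b1: "(LBNN x. ?F i x) \<le> ennreal (sqrt X * (1/2) ^ i)" for i
      proof -
        let ?D = "\<lambda>x. rpd j (z (Suc (i + k))) x - rpd j (z (i + k)) x"
        have sD: "sm ?D" by (intro sm_sub sm_rpd sz)
        have t: "rtest (\<lambda>x. ?D x * cutat 0 (h k) x)" by (intro rtest_mult2 sD cv)
        have i1: "integrable lborel (\<lambda>x. \<bar>(?D x * cutat 0 (h k) x) * cutat 0 (h k) x\<bar>)"
          by (intro integrable_abs rtest_integrable rtest_mult1 t rtest_sm[OF cv(1)])
        have "(LBNN x. ?F i x) = ennreal (LBINT x. \<bar>?D x * cutat 0 (h k) x\<bar> * cutat 0 (h k) x)"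
        proof -
          have "\<bar>(?D x * cutat 0 (h k) x) * cutat 0 (h k) x\<bar> = \<bar>?D x * cutat 0 (h k) x\<bar> * cutat 0 (h k) x" for x
            using cutat_range(1)[of 0 "h k" x] by (simp only: abs_mult[of "?D x * cutat 0 (h k) x"] abs_of_nonneg)
          moreover have "(LBNN x. ?F i x) = ennreal (LBINT x. \<bar>(?D x * cutat 0 (h k) x) * cutat 0 (h k) x\<bar>)"
            by (rule nn_integral_eq_integral[OF i1]) simp
          ultimately show ?thesis by simp
        qed
        also have "\<dots> \<le> ennreal (sqrt (LBINT x. \<bar>?D x * cutat 0 (h k) x\<bar>\<^sup>2) * sqrt X)"
        proof (rule ennreal_leI)
          have "\<bar>LBINT x. \<bar>?D x * cutat 0 (h k) x\<bar> * cutat 0 (h k) x\<bar> \<le> sqrt (LBINT x. \<bar>?D x * cutat 0 (h k) x\<bar>\<^sup>2) * sqrt X"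
            unfolding X_def by (rule integral_CS1(2)) (auto intro!: rtest_integrable rtest_power2 t cv)
          then show "(LBINT x. \<bar>?D x * cutat 0 (h k) x\<bar> * cutat 0 (h k) x) \<le> sqrt (LBINT x. \<bar>?D x * cutat 0 (h k) x\<bar>\<^sup>2) * sqrt X" by linarith
        qed
        also have "\<dots> \<le> ennreal (sqrt X * (1/2) ^ i)"
        proof (rule ennreal_leI)
          have X0: "X \<ge> 0" by (simp add: X_def)
          have "(LBINT x. \<bar>?D x * cutat 0 (h k) x\<bar>\<^sup>2) \<le> en (h k) (df (z (i + k)) (z (Suc (i + k))))"
            unfolding en_def
          proof (rule integral_mono)
            show "integrable lborel (\<lambda>x. \<bar>?D x * cutat 0 (h k) x\<bar>\<^sup>2)" using rtest_integrable[OF rtest_power2[OF t]] by simp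
            show "integrable lborel (\<lambda>x. (\<Sum>j\<in>UNIV. (rpd j (df (z (i + k)) (z (Suc (i + k)))) x)^2) * (cutat 0 (h k) x)^2)"
              by (intro rtest_integrable rtest_en h sdf)
            fix x
            have "(?D x)^2 \<le> (\<Sum>j\<in>UNIV. (rpd j (df (z (i + k)) (z (Suc (i + k)))) x)^2)"
              unfolding rdf using member_le_sum[of j UNIV "\<lambda>j. (rpd j (z (i + k)) x - rpd j (z (Suc (i + k))) x)^2"] by (simp add: power2_commute)
            then show "\<bar>?D x * cutat 0 (h k) x\<bar>\<^sup>2 \<le> (\<Sum>j\<in>UNIV. (rpd j (df (z (i + k)) (z (Suc (i + k)))) x)^2) * (cutat 0 (h k) x)^2"
              by (simp add: power_mult_distrib mult_right_mono)
          qed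
          also have "\<dots> \<le> (1/4) ^ (i + k)" by (rule zC) auto
          also have "\<dots> \<le> (1/4) ^ i" by (intro power_decreasing) auto
          also have "(1/4::real) ^ i = ((1/2) ^ i)^2" by (simp add: power2_eq_square flip: power_mult_distrib)
          finally have "sqrt (LBINT x. \<bar>?D x * cutat 0 (h k) x\<bar>\<^sup>2) \<le> (1/2) ^ i" by (intro real_le_lsqrt) auto
          then show "sqrt (LBINT x. \<bar>?D x * cutat 0 (h k) x\<bar>\<^sup>2) * sqrt X \<le> sqrt X * (1/2) ^ i" using X0 by (subst mult.commute) (intro mult_left_mono, auto)
        qed
        finally show ?thesis .
      qed
      have "(LBNN x. (\<Sum>i. ?F i x)) = (\<Sum>i. (LBNN x. ?F i x))" by (rule nn_integral_suminf) measurable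
      also have "\<dots> \<le> (\<Sum>i. ennreal (sqrt X * (1/2) ^ i))" by (intro suminf_le b1) auto
      also have "\<dots> < \<infinity>"
      proof -
        have "summable (\<lambda>i. sqrt X * (1/2::real) ^ i)" by (intro summable_mult summable_geometric) auto
        then show ?thesis by (subst suminf_ennreal2) (auto simp: X_def)
      qed
      finally have "AE x in lborel. (\<Sum>i. ?F i x) \<noteq> \<infinity>" by (intro nn_integral_noteq_infinite) auto
      then show ?thesis
      proof eventually_elim
        case (elim x)
        show ?case
        proof
          assume "norm x \<le> h k"
          then have "cutat 0 (h k) x = 1" using h(1)[of k] by (intro cutat_one) auto
          then show "convergent (\<lambda>i. rpd j (z i) x)" using elim by (intro summable_increments_convergent[of _ k]) simp
        qed
      qed
    qed
    then have "AE x in lborel. \<forall>k. norm x \<le> h k \<longrightarrow> convergent (\<lambda>i. rpd j (z i) x)" by (simp only: AE_all_countable) blast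
    then show ?thesis
    proof eventually_elim
      case (elim x)
      obtain k :: nat where "2 * norm x \<le> real k" using real_arch_simple by blast
      then have "norm x \<le> h k" by (simp add: h_def)
      with elim show ?case by blast
    qed
  qed
  then have "AE x in lborel. \<forall>j. convergent (\<lambda>i. rpd j (z i) x)" by (simp add: AE_all_countable)
  then have Glim: "AE x in lborel. \<forall>j. (\<lambda>i. rpd j (z i) x) \<longlonglongrightarrow> G j x"
    by eventually_elim (auto simp: G_def convergent_LIMSEQ_iff)
  have Gu: "(LBNN x. ennreal ((\<Sum>j\<in>UNIV. (G j x)^2) * (u x)^2)) \<le> ennreal (C * dir u)" if u: "rtest u" for u
  proof -
    obtain R where R: "vanish R u" using u by (auto simp: rtest_def)
    obtain n0 :: nat where n0: "R \<le> real n0" using real_arch_simple by blast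
    note [measurable] = sm_borel[OF rtest_sm[OF u]]
    show ?thesis
    proof (rule fatou_AE[where F="\<lambda>i x. (\<Sum>j\<in>UNIV. (rpd j (z i) x)^2) * (u x)^2" and N=n0])
      show "AE x in lborel. (\<lambda>i. (\<Sum>j\<in>UNIV. (rpd j (z i) x)^2) * (u x)^2) \<longlonglongrightarrow> (\<Sum>j\<in>UNIV. (G j x)^2) * (u x)^2"
        using Glim by eventually_elim (intro tendsto_intros, auto)
      fix i assume "n0 \<le> i"
      then have "vanish (real i + 1) u" using vanish_mono[OF R] n0 by simp
      then have le: "(LBINT x. (\<Sum>j\<in>UNIV. (rpd j (z i) x)^2) * (u x)^2) \<le> C * dir u" using zA[of i] u unfolding A_def by blast
      have "(LBNN x. ennreal ((\<Sum>j\<in>UNIV. (rpd j (z i) x)^2) * (u x)^2)) = ennreal (LBINT x. (\<Sum>j\<in>UNIV. (rpd j (z i) x)^2) * (u x)^2)"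
        by (intro nn_integral_eq_integral rtest_integrable rtest_mult2 sm_sum sm_power sm_rpd sz rtest_power2 u) (auto intro!: AE_I2 mult_nonneg_nonneg sum_nonneg)
      then show "(LBNN x. ennreal ((\<Sum>j\<in>UNIV. (rpd j (z i) x)^2) * (u x)^2)) \<le> ennreal (C * dir u)" using le by (simp add: ennreal_leI)
    qed measurable
  qed
  \<comment> \<open>Fatou in the second index carries the estimate \<open>zC\<close> to the limit,
    so convergence to \<open>G\<close> has a rate in weighted L2.\<close>
  have Gd: "(LBNN x. ennreal (((rpd j (z n) x - G j x) * cutat 0 (h k) x)^2)) \<le> ennreal ((1/4) ^ n)" if kn: "k \<le> n" for j k n
  proof (rule fatou_AE[where F="\<lambda>i x. ((rpd j (z n) x - rpd j (z i) x) * cutat 0 (h k) x)^2" and N=n])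
    show "AE x in lborel. (\<lambda>i. ((rpd j (z n) x - rpd j (z i) x) * cutat 0 (h k) x)^2) \<longlonglongrightarrow> ((rpd j (z n) x - G j x) * cutat 0 (h k) x)\<^sup>2"
      using Glim by eventually_elim (intro tendsto_intros, auto)
    fix i assume "n \<le> i"
    have "(LBNN x. ennreal (((rpd j (z n) x - rpd j (z i) x) * cutat 0 (h k) x)^2)) \<le> (LBNN x. ennreal ((\<Sum>j\<in>UNIV. (rpd j (df (z n) (z i)) x)^2) * (cutat 0 (h k) x)^2))"
    proof (intro nn_integral_mono ennreal_leI)
      fix x
      have "(rpd j (z n) x - rpd j (z i) x)^2 \<le> (\<Sum>j\<in>UNIV. (rpd j (df (z n) (z i)) x)^2)"
        unfolding rdf using member_le_sum[of j UNIV "\<lambda>j. (rpd j (z n) x - rpd j (z i) x)^2"] by simp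
      then show "((rpd j (z n) x - rpd j (z i) x) * cutat 0 (h k) x)^2 \<le> (\<Sum>j\<in>UNIV. (rpd j (df (z n) (z i)) x)^2) * (cutat 0 (h k) x)^2"
        by (simp add: power_mult_distrib mult_right_mono)
    qed
    also have "\<dots> = ennreal (en (h k) (df (z n) (z i)))" unfolding en_def
      by (intro nn_integral_eq_integral rtest_integrable rtest_en h sdf) (auto intro!: AE_I2 mult_nonneg_nonneg sum_nonneg)
    also have "\<dots> \<le> ennreal ((1/4) ^ n)" by (intro ennreal_leI zC kn \<open>n \<le> i\<close>)
    finally show "(LBNN x. ennreal (((rpd j (z n) x - rpd j (z i) x) * cutat 0 (h k) x)^2)) \<le> ennreal ((1/4) ^ n)" .
  qed measurable
  \<comment> \<open>The index k is taken so large that the weight \<open>h k\<close> covers three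
    times the radius of the support, as \<open>poincare\<close> requires.\<close>
  have pe: "\<exists>B k. B \<ge> 0 \<and> (\<forall>\<psi> f M. sm \<psi> \<longrightarrow> (LBINT x. w x * \<psi> x) = 0 \<longrightarrow> rtest f \<longrightarrow> vanish R f \<longrightarrow> (\<forall>x. \<bar>f x\<bar> \<le> M) \<longrightarrow>
      \<bar>LBINT x. \<psi> x * f x\<bar> \<le> B * M * sqrt (en (h k) \<psi>))" for R
  proof -
    obtain k :: nat where "6 * max R 1 \<le> real k" using real_arch_simple by blast
    then have S: "h k \<ge> 3 * max R 1" by (simp add: h_def)
    obtain B where B: "B \<ge> 0" "\<And>\<psi> f M. sm \<psi> \<Longrightarrow> (LBINT x. w x * \<psi> x) = 0 \<Longrightarrow> rtest f \<Longrightarrow> vanish (max R 1) f \<Longrightarrow> (\<And>x. \<bar>f x\<bar> \<le> M) \<Longrightarrow>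
      \<bar>LBINT x. \<psi> x * f x\<bar> \<le> B * M * sqrt (en (h k) \<psi>)"
      by (rule poincare[OF mw _ S]) (simp, blast)
    have "vanish (max R 1) f" if "vanish R f" for f :: "real^'d \<Rightarrow> real" using vanish_mono[OF that] by simp
    with B show ?thesis by blast
  qed
  have z0: "(LBINT x. w x * z i x) = 0" for i using zA[of i] by (simp add: A_def)
  have zi: "integrable lborel (\<lambda>x. z i x * f x)" if "rtest f" for i f by (intro rtest_integrable rtest_mult2 sz that)
  have ldf: "(LBINT x. df (z i) (z l) x * f x) = (LBINT x. z i x * f x) - (LBINT x. z l x * f x)" if "rtest f" for i l f
  proof -
    have "(LBINT x. df (z i) (z l) x * f x) = (LBINT x. z i x * f x - z l x * f x)" unfolding df_def by (simp add: algebra_simps)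
    then show ?thesis using zi[OF that] by simp
  qed
  have w0: "(LBINT x. w x * df (z i) (z l) x) = 0" for i l using ldf[OF w(1), of i l] z0 by (simp add: mult.commute)
  define \<Psi> where "\<Psi> f = lim (\<lambda>i. (LBINT x. z i x * f x))" for f
  have Plim: "(\<lambda>i. (LBINT x. z i x * f x)) \<longlonglongrightarrow> \<Psi> f" if f: "rtest f" for f
  proof -
    obtain R where R: "vanish R f" using f by (auto simp: rtest_def)
    obtain M where M: "M > 0" "\<And>x. \<bar>f x\<bar> \<le> M" using rtest_bounded[OF f] by metis
    obtain B k where B: "B \<ge> 0" "\<And>\<psi> f M. sm \<psi> \<Longrightarrow> (LBINT x. w x * \<psi> x) = 0 \<Longrightarrow> rtest f \<Longrightarrow> vanish R f \<Longrightarrow> (\<forall>x. \<bar>f x\<bar> \<le> M) \<Longrightarrow>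
      \<bar>LBINT x. \<psi> x * f x\<bar> \<le> B * M * sqrt (en (h k) \<psi>)" using pe[of R] by blast
    have b: "\<bar>(LBINT x. z i x * f x) - (LBINT x. z l x * f x)\<bar> \<le> B * M * (1/2) ^ i" if "k \<le> i" "i \<le> l" for i l
    proof -
      have "\<bar>LBINT x. df (z i) (z l) x * f x\<bar> \<le> B * M * sqrt (en (h k) (df (z i) (z l)))" using B(2)[OF sdf w0 f R] M(2) by blast
      also have "\<dots> \<le> B * M * sqrt (((1/2) ^ i)^2)"
      proof (intro mult_left_mono real_sqrt_le_mono)
        have "(1/4::real) ^ i = ((1/2) ^ i)^2" by (simp add: power2_eq_square flip: power_mult_distrib)
        then show "en (h k) (df (z i) (z l)) \<le> ((1/2) ^ i)^2" using zC[OF that] by simp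
      qed (use B M in auto)
      finally show ?thesis unfolding ldf[OF f] by simp
    qed
    have "Cauchy (\<lambda>i. (LBINT x. z i x * f x))"
    proof (rule CauchyI')
      fix e :: real assume e: "e > 0"
      have "(\<lambda>i. B * M * (1/2) ^ i) \<longlonglongrightarrow> B * M * 0" by (intro tendsto_intros LIMSEQ_realpow_zero) auto
      then have "\<forall>\<^sub>F i in sequentially. B * M * (1/2) ^ i < e" using e by (intro order_tendstoD(2)) auto
      then obtain N where N: "\<And>i. i \<ge> N \<Longrightarrow> B * M * (1/2) ^ i < e" by (auto simp: eventually_sequentially)
      show "\<exists>M. \<forall>m\<ge>M. \<forall>n>m. dist (LBINT x. z m x * f x) (LBINT x. z n x * f x) < e"
      proof (intro exI[of _ "max N k"] allI impI)
        fix m n assume mn: "max N k \<le> m" "m < n"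
        have "dist (LBINT x. z m x * f x) (LBINT x. z n x * f x) \<le> B * M * (1/2) ^ m"
          unfolding dist_real_def using mn by (intro b) auto
        also have "\<dots> < e" using mn by (intro N) auto
        finally show "dist (LBINT x. z m x * f x) (LBINT x. z n x * f x) < e" .
      qed
    qed
    then show ?thesis unfolding \<Psi>_def by (simp add: Cauchy_convergent_iff convergent_LIMSEQ_iff)
  qed
  have P1: "\<Psi> (\<lambda>x. a * f x + b * g x) = a * \<Psi> f + b * \<Psi> g" if f: "rtest f" and g: "rtest g" for f g a b
  proof -
    have t: "rtest (\<lambda>x. a * f x + b * g x)" by (intro rtest_add rtest_cmult f g)
    have "(LBINT x. z i x * (a * f x + b * g x)) = a * (LBINT x. z i x * f x) + b * (LBINT x. z i x * g x)" for i
    proof -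
      have "(LBINT x. z i x * (a * f x + b * g x)) = (LBINT x. a * (z i x * f x) + b * (z i x * g x))"
        by (intro Bochner_Integration.integral_cong) (auto simp: algebra_simps)
      then show ?thesis using zi[OF f] zi[OF g] by simp
    qed
    then have "(\<lambda>i. (LBINT x. z i x * (a * f x + b * g x))) \<longlonglongrightarrow> a * \<Psi> f + b * \<Psi> g"
      by (simp only:) (intro tendsto_intros Plim f g)
    then show ?thesis using LIMSEQ_unique[OF Plim[OF t]] by blast
  qed
  have P2: "\<exists>B\<ge>0. \<forall>f M. rtest f \<longrightarrow> vanish R f \<longrightarrow> (\<forall>x. \<bar>f x\<bar> \<le> M) \<longrightarrow> \<bar>\<Psi> f\<bar> \<le> B * M" for R
  proof -
    obtain B k where B: "B \<ge> 0" "\<And>\<psi> f M. sm \<psi> \<Longrightarrow> (LBINT x. w x * \<psi> x) = 0 \<Longrightarrow> rtest f \<Longrightarrow> vanish R f \<Longrightarrow> (\<forall>x. \<bar>f x\<bar> \<le> M) \<Longrightarrow>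
      \<bar>LBINT x. \<psi> x * f x\<bar> \<le> B * M * sqrt (en (h k) \<psi>)" using pe[of R] by blast
    have "\<bar>\<Psi> f\<bar> \<le> (B * sqrt (E k)) * M" if f: "rtest f" "vanish R f" "\<forall>x. \<bar>f x\<bar> \<le> M" for f M
    proof (rule tendsto_upperbound[OF tendsto_rabs[OF Plim[OF f(1)]]])
      have M0: "M \<ge> 0" using f(3)[rule_format, of 0] by linarith
      show "\<forall>\<^sub>F i in sequentially. \<bar>LBINT x. z i x * f x\<bar> \<le> (B * sqrt (E k)) * M"
      proof (rule eventually_sequentiallyI[of k])
        fix i assume "k \<le> i"
        have "\<bar>LBINT x. z i x * f x\<bar> \<le> B * M * sqrt (en (h k) (z i))" by (rule B(2)[OF sz z0 f])
        also have "\<dots> \<le> B * M * sqrt (E k)" using enE[OF zA \<open>k \<le> i\<close>] B(1) M0 by (intro mult_left_mono real_sqrt_le_mono) auto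
        finally show "\<bar>LBINT x. z i x * f x\<bar> \<le> (B * sqrt (E k)) * M" by (simp add: mult_ac)
      qed
    qed simp
    moreover have "B * sqrt (E k) \<ge> 0" using B(1) E0 by simp
    ultimately show ?thesis by blast
  qed
  have P3: "\<Psi> (lapl f) = \<Lambda> f" if f: "rtest f" for f
  proof -
    obtain R where R: "vanish R f" using f by (auto simp: rtest_def)
    obtain n0 :: nat where n0: "R \<le> real n0" using real_arch_simple by blast
    have "(\<lambda>i. (LBINT x. z i x * lapl f x)) \<longlonglongrightarrow> \<Lambda> f"
    proof (rule LIMSEQ_I)
      fix e :: real assume e: "e > 0"
      \<comment> \<open>Once all later errors are below e / 2, membership of \<open>z i\<close> in
        \<open>A i\<close> bounds the defect in the Poisson equation by the same number.\<close>
      have "\<forall>\<^sub>F k in sequentially. err k f < e / 2" using e by (intro order_tendstoD(2)[OF err0[OF f]]) auto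
      then obtain N where N: "\<And>k. k \<ge> N \<Longrightarrow> err k f < e / 2" by (auto simp: eventually_sequentially)
      have "norm ((LBINT x. z i x * lapl f x) - \<Lambda> f) < e" if i: "i \<ge> max N n0" for i
      proof -
        have "vanish (real i + 1) f" using vanish_mono[OF R] n0 i by simp
        moreover have "\<forall>k\<ge>i. err k f \<le> e / 2" using N i by (auto intro: less_imp_le)
        ultimately have "\<bar>(LBINT x. z i x * lapl f x) - \<Lambda> f\<bar> \<le> e / 2" using zA[of i] f unfolding A_def by blast
        then show ?thesis using e by simp
      qed
      then show "\<exists>no. \<forall>n\<ge>no. norm ((LBINT x. z n x * lapl f x) - \<Lambda> f) < e" by blast
    qed
    then show ?thesis using LIMSEQ_unique[OF Plim[OF rtest_lapl[OF f]]] by blast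
  qed
  have P4: "integrable lborel (\<lambda>x. G j x * f x)" "- \<Psi> (rpd j f) = (LBINT x. G j x * f x)" if f: "rtest f" for j f
  proof -
    obtain R where R: "vanish R f" using f by (auto simp: rtest_def)
    obtain k :: nat where k: "2 * R \<le> real k" using real_arch_simple by blast
    note [measurable] = sm_borel[OF rtest_sm[OF f]]
    have cf: "cutat 0 (h k) x * f x = f x" for x
      using cutat_one[OF h(1)[of k], of x 0] R k by (cases "norm x \<le> R") (auto simp: vanish_def h_def)
    have i2: "integrable lborel (\<lambda>x. ((rpd j (z n) x - G j x) * cutat 0 (h k) x)^2)" if "k \<le> n" for n
      using order.strict_trans1[OF Gd[OF that], of \<infinity>] by (intro integrableI_nonneg) auto
    have n2: "(LBINT x. ((rpd j (z n) x - G j x) * cutat 0 (h k) x)^2) \<le> (1/4) ^ n" if "k \<le> n" for n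
    proof -
      have "ennreal (LBINT x. ((rpd j (z n) x - G j x) * cutat 0 (h k) x)^2) \<le> ennreal ((1/4) ^ n)"
        using Gd[OF that, of j] nn_integral_eq_integral[OF i2[OF that]] by simp
      then show ?thesis by simp
    qed
    have f2: "integrable lborel (\<lambda>x. (f x)^2)" by (intro rtest_integrable rtest_power2 f)
    have cs: "integrable lborel (\<lambda>x. (rpd j (z n) x - G j x) * f x)"
      "\<bar>LBINT x. (rpd j (z n) x - G j x) * f x\<bar> \<le> sqrt ((1/4) ^ n) * sqrt (LBINT x. (f x)^2)" if "k \<le> n" for n
    proof -
      have e: "((rpd j (z n) x - G j x) * cutat 0 (h k) x) * f x = (rpd j (z n) x - G j x) * f x" for x
        unfolding mult.assoc cf ..
      have "integrable lborel (\<lambda>x. ((rpd j (z n) x - G j x) * cutat 0 (h k) x) * f x)" by (rule integral_CS1(1)[OF _ _ i2[OF that] f2]) auto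
      then show "integrable lborel (\<lambda>x. (rpd j (z n) x - G j x) * f x)" unfolding e .
      have "\<bar>LBINT x. ((rpd j (z n) x - G j x) * cutat 0 (h k) x) * f x\<bar> \<le> sqrt (LBINT x. ((rpd j (z n) x - G j x) * cutat 0 (h k) x)^2) * sqrt (LBINT x. (f x)^2)"
        by (rule integral_CS1(2)[OF _ _ i2[OF that] f2]) auto
      also have "\<dots> \<le> sqrt ((1/4) ^ n) * sqrt (LBINT x. (f x)^2)" by (intro mult_right_mono real_sqrt_le_mono n2 that) auto
      finally show "\<bar>LBINT x. (rpd j (z n) x - G j x) * f x\<bar> \<le> sqrt ((1/4) ^ n) * sqrt (LBINT x. (f x)^2)" unfolding e .
    qed
    have ig: "integrable lborel (\<lambda>x. rpd j (z n) x * f x)" for n by (intro rtest_integrable rtest_mult2 sm_rpd sz f)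
    have "(\<lambda>x. G j x * f x) = (\<lambda>x. rpd j (z k) x * f x - (rpd j (z k) x - G j x) * f x)" by (simp add: algebra_simps)
    then show iG: "integrable lborel (\<lambda>x. G j x * f x)" using ig[of k] cs(1)[of k] by simp
    have df': "(LBINT x. (rpd j (z n) x - G j x) * f x) = (LBINT x. rpd j (z n) x * f x) - (LBINT x. G j x * f x)" for n
      unfolding left_diff_distrib using ig iG by simp
    have "(\<lambda>n. (LBINT x. rpd j (z n) x * f x)) \<longlonglongrightarrow> (LBINT x. G j x * f x)"
    proof (rule LIM_zero_cancel, rule Lim_null_comparison)
      show "\<forall>\<^sub>F n in sequentially. norm ((LBINT x. rpd j (z n) x * f x) - (LBINT x. G j x * f x)) \<le> sqrt ((1/4) ^ n) * sqrt (LBINT x. (f x)^2)"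
        using cs(2) unfolding df' by (intro eventually_sequentiallyI[of k]) simp
      have "(\<lambda>n. sqrt ((1/4::real) ^ n)) \<longlonglongrightarrow> sqrt 0" by (intro tendsto_intros LIMSEQ_realpow_zero) auto
      from tendsto_mult_right[OF this, of "sqrt (LBINT x. (f x)^2)"]
      show "(\<lambda>n. sqrt ((1/4) ^ n) * sqrt (LBINT x. (f x)^2)) \<longlonglongrightarrow> 0" by simp
    qed
    moreover have "(\<lambda>n. - (LBINT x. z n x * rpd j f x)) \<longlonglongrightarrow> - \<Psi> (rpd j f)" by (intro tendsto_minus Plim rtest_rpd f)
    moreover have "- (LBINT x. z n x * rpd j f x) = (LBINT x. rpd j (z n) x * f x)" for n
      using integral_by_parts[OF sz rtest_sm[OF f]] f by simp
    ultimately show "- \<Psi> (rpd j f) = (LBINT x. G j x * f x)" using LIMSEQ_unique by auto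
  qed
  show thesis by (rule that[OF C P1 P2 P3 Gm P4 Gu])
qed

section \<open>Mollification of real distributions\<close>

text \<open>The seminorm estimate uses a common bound \<open>M\<close> for the derivatives instead
  of suprema, so Lipschitz bounds for translates and mollifications can be inserted
  directly.\<close>

definition rdist :: "((real^'d::finite \<Rightarrow> real) \<Rightarrow> real) \<Rightarrow> bool" where
  "rdist T \<longleftrightarrow> (\<forall>a b f g. rtest f \<longrightarrow> rtest g \<longrightarrow> T (\<lambda>x. a * f x + b * g x) = a * T f + b * T g) \<and>
     (\<forall>R. \<exists>C N. 0 \<le> C \<and> (\<forall>f M. rtest f \<longrightarrow> vanish R f \<longrightarrow> (\<forall>is x. length is \<le> N \<longrightarrow> \<bar>dp is f x\<bar> \<le> M) \<longrightarrow> \<bar>T f\<bar> \<le> C * M))"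

lemma rdist_lin: "rdist T \<Longrightarrow> rtest f \<Longrightarrow> rtest g \<Longrightarrow> T (\<lambda>x. a * f x + b * g x) = a * T f + b * T g"
  unfolding rdist_def by blast

lemma rdist_bound:
  assumes "rdist T"
  obtains C N where "0 \<le> C" "\<And>f M. rtest f \<Longrightarrow> vanish R f \<Longrightarrow> (\<And>is x. length is \<le> N \<Longrightarrow> \<bar>dp is f x\<bar> \<le> M) \<Longrightarrow> \<bar>T f\<bar> \<le> C * M"
proof -
  have "\<exists>C N. 0 \<le> C \<and> (\<forall>f M. rtest f \<longrightarrow> vanish R f \<longrightarrow> (\<forall>is x. length is \<le> N \<longrightarrow> \<bar>dp is f x\<bar> \<le> M) \<longrightarrow> \<bar>T f\<bar> \<le> C * M)"
    using assms unfolding rdist_def by blast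
  then show thesis using that by blast
qed

section \<open>Translates of a test function\<close>

lemma dp_lincomb: "sm f \<Longrightarrow> sm g \<Longrightarrow> dp is (\<lambda>x. a * f x + b * g x) = (\<lambda>x. a * dp is f x + b * dp is g x)"
proof (induction "is")
  case (Cons i "is")
  show ?case unfolding dp.simps Cons.IH[OF Cons.prems] by (intro ext rpd_lincomb sm_dp Cons.prems)
qed simp

lemma dp_translate: "sm f \<Longrightarrow> dp is (\<lambda>x. f (x - a)) x = dp is f (x - a)"
  using dp_affine[of f "is" 1 "- a"] by simp

lemma vanish_translate: "vanish S f \<Longrightarrow> norm a \<le> R \<Longrightarrow> vanish (R + S) (\<lambda>x. f (x - a))"
  unfolding vanish_def
proof (intro allI impI)
  fix x :: "real^'a" assume "\<forall>x. S < norm x \<longrightarrow> f x = 0" "norm a \<le> R" "R + S < norm x"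
  moreover have "norm x \<le> norm (x - a) + norm a" using norm_triangle_ineq[of "x - a" a] by simp
  ultimately show "f (x - a) = 0" by auto
qed

lemma finite_lists_le: "finite {is :: 'd::finite list. length is \<le> N}"
  using finite_lists_length_le[of "UNIV :: 'd set" N] by simp

lemma rtest_lipschitz_dp:
  assumes h: "rtest h"
  obtains L where "0 < L" "\<And>is x y. length is \<le> N \<Longrightarrow> \<bar>dp is h x - dp is h y\<bar> \<le> L * norm (x - y)"
proof -
  have "\<forall>is. \<exists>L>0. \<forall>x y. \<bar>dp is h x - dp is h y\<bar> \<le> L * norm (x - y)"
    using rtest_lipschitz[OF rtest_dp[OF h]] by blast
  then obtain l where l: "\<And>is. 0 < l is" "\<And>is x y. \<bar>dp is h x - dp is h y\<bar> \<le> l is * norm (x - y)" by metis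
  define L where "L = (\<Sum>is | length is \<le> N. l is)"
  have le: "l is \<le> L" if "length is \<le> N" for "is"
    unfolding L_def using that l(1) by (intro member_le_sum finite_lists_le) (auto intro: less_imp_le)
  have "0 < L" using le[of "[]"] l(1)[of "[]"] by simp
  moreover have "\<bar>dp is h x - dp is h y\<bar> \<le> L * norm (x - y)" if "length is \<le> N" for "is" x y
    using l(2)[of "is" x y] mult_right_mono[OF le[OF that] norm_ge_zero[of "x - y"]] by linarith
  ultimately show thesis using that by blast
qed

text \<open>On a bounded set of translations the distribution has a fixed order N, and all
  derivatives of h up to that order share a Lipschitz constant.\<close>

lemma rdist_translate_lipschitz:
  assumes T: "rdist T" and h: "rtest h"
  obtains c where "0 \<le> c" "\<And>y z. norm y \<le> R \<Longrightarrow> norm z \<le> R \<Longrightarrow> \<bar>T (\<lambda>x. h (x - y)) - T (\<lambda>x. h (x - z))\<bar> \<le> c * norm (y - z)"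
proof -
  obtain S where S: "vanish S h" using h by (auto simp: rtest_def)
  have s: "sm h" by (rule rtest_sm[OF h])
  obtain C N where C: "0 \<le> C" "\<And>f M. rtest f \<Longrightarrow> vanish (R + S) f \<Longrightarrow> (\<And>is x. length is \<le> N \<Longrightarrow> \<bar>dp is f x\<bar> \<le> M) \<Longrightarrow> \<bar>T f\<bar> \<le> C * M"
    using rdist_bound[OF T] by blast
  obtain L where L: "0 < L" "\<And>is x y. length is \<le> N \<Longrightarrow> \<bar>dp is h x - dp is h y\<bar> \<le> L * norm (x - y)" using rtest_lipschitz_dp[OF h] by blast
  have "\<bar>T (\<lambda>x. h (x - y)) - T (\<lambda>x. h (x - z))\<bar> \<le> (C * L) * norm (y - z)" if y: "norm y \<le> R" and z: "norm z \<le> R" for y z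
  proof -
    let ?f = "\<lambda>x. 1 * h (x - y) + (-1) * h (x - z)"
    have "\<bar>T ?f\<bar> \<le> C * (L * norm (y - z))"
    proof (rule C(2))
      show "rtest ?f" by (intro rtest_add rtest_cmult rtest_translate h)
      show "vanish (R + S) ?f" using vanish_translate[OF S y] vanish_translate[OF S z] by (auto simp: vanish_def)
      fix "is" :: "'a list" and x assume l: "length is \<le> N"
      have "dp is ?f x = dp is h (x - y) - dp is h (x - z)"
        unfolding dp_lincomb[OF sm_translate(1)[OF s] sm_translate(1)[OF s]] dp_translate[OF s] by simp
      then show "\<bar>dp is ?f x\<bar> \<le> L * norm (y - z)" using L(2)[OF l, of "x - y" "x - z"] by (simp add: norm_minus_commute)
    qed
    moreover have "T ?f = 1 * T (\<lambda>x. h (x - y)) + (-1) * T (\<lambda>x. h (x - z))" by (rule rdist_lin[OF T rtest_translate(1)[OF h] rtest_translate(1)[OF h]])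
    ultimately show ?thesis by (simp add: mult.assoc)
  qed
  then show thesis using that[of "C * L"] C(1) L(1) by simp
qed

lemma rdist_translate_cont:
  assumes T: "rdist T" and h: "rtest h"
  shows "continuous_on UNIV (\<lambda>y. T (\<lambda>x. h (x - y)))"
  unfolding continuous_on_eq_continuous_at[OF open_UNIV]
proof
  fix y0 :: "real^'a"
  obtain c where c: "0 \<le> c" "\<And>y z. norm y \<le> norm y0 + 1 \<Longrightarrow> norm z \<le> norm y0 + 1 \<Longrightarrow> \<bar>T (\<lambda>x. h (x - y)) - T (\<lambda>x. h (x - z))\<bar> \<le> c * norm (y - z)"
    using rdist_translate_lipschitz[OF T h] by blast
  have "((\<lambda>y. T (\<lambda>x. h (x - y)) - T (\<lambda>x. h (x - y0))) \<longlongrightarrow> 0) (at y0)"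
  proof (rule Lim_null_comparison)
    show "\<forall>\<^sub>F y in at y0. norm (T (\<lambda>x. h (x - y)) - T (\<lambda>x. h (x - y0))) \<le> c * norm (y - y0)"
      unfolding eventually_at
    proof (intro exI[of _ 1] conjI ballI impI)
      fix y assume y: "y \<noteq> y0 \<and> dist y y0 < 1"
      have "norm y \<le> norm y0 + norm (y - y0)" using norm_triangle_ineq[of y0 "y - y0"] by simp
      then show "norm (T (\<lambda>x. h (x - y)) - T (\<lambda>x. h (x - y0))) \<le> c * norm (y - y0)" using c(2)[of y y0] y by (simp add: dist_norm)
    qed simp
    have "((\<lambda>y. c * norm (y - y0)) \<longlongrightarrow> c * norm (y0 - y0)) (at y0)" by (intro tendsto_intros)
    then show "((\<lambda>y. c * norm (y - y0)) \<longlongrightarrow> 0) (at y0)" by simp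
  qed
  then show "isCont (\<lambda>y. T (\<lambda>x. h (x - y))) y0" unfolding isCont_def by (rule LIM_zero_cancel)
qed

section \<open>Distributions applied to convolutions\<close>

lemma integrable_locint: assumes g: "integrable lborel g" shows "locint g"
  unfolding locint_def
proof (intro conjI allI)
  show "g \<in> borel_measurable borel" using borel_measurable_integrable[OF g] by simp
  show "integrable lborel (\<lambda>x. indicator (cball 0 R) x * g x)" for R
    using integrable_mult_indicator[OF _ g, of "cball 0 R"] by simp
qed

lemma rtest_conv_integrable: "integrable lborel g \<Longrightarrow> vanish R g \<Longrightarrow> rtest h \<Longrightarrow> rtest (conv g h)"
  unfolding rtest_def using vanish_conv sm_conv[OF integrable_locint] by (metis rtest_def)

lemma conv_add_left:
  assumes "integrable lborel g1" "integrable lborel g2" and h: "rtest h"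
  shows "conv (\<lambda>x. g1 x + g2 x) h x = conv g1 h x + conv g2 h x"
  unfolding conv_def distrib_right
  by (intro Bochner_Integration.integral_add conv_integrable integrable_locint assms)

text \<open>The difference of both sides is additive in \<open>g\<close> and at most \<open>const \<cdot> \<delta> \<cdot> \<integral>|g|\<close> when \<open>g\<close> lives in a \<open>\<delta>\<close>-ball; covering the support by such balls gives the same bound for every \<open>g\<close>.\<close>

lemma rdist_conv:
  fixes T :: "(real^'d::finite \<Rightarrow> real) \<Rightarrow> real"
  assumes T: "rdist T" and h: "rtest h" and g: "integrable lborel g" "vanish R g"
  shows "T (conv g h) = (LBINT y. g y * T (\<lambda>x. h (x - y)))"
proof -
  let ?t = "\<lambda>y. T (\<lambda>x. h (x - y))"
  obtain S where S: "vanish S h" using h by (auto simp: rtest_def)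
  have s: "sm h" by (rule rtest_sm[OF h])
  obtain C N where C: "0 \<le> C" "\<And>f M. rtest f \<Longrightarrow> vanish (R + S) f \<Longrightarrow> (\<And>is x. length is \<le> N \<Longrightarrow> \<bar>dp is f x\<bar> \<le> M) \<Longrightarrow> \<bar>T f\<bar> \<le> C * M"
    using rdist_bound[OF T] by blast
  obtain L where L: "0 < L" "\<And>is x y. length is \<le> N \<Longrightarrow> \<bar>dp is h x - dp is h y\<bar> \<le> L * norm (x - y)" using rtest_lipschitz_dp[OF h] by blast
  obtain c where c: "0 \<le> c" "\<And>y z. norm y \<le> R \<Longrightarrow> norm z \<le> R \<Longrightarrow> \<bar>?t y - ?t z\<bar> \<le> c * norm (y - z)"
    using rdist_translate_lipschitz[OF T h] by blast
  have tm[measurable]: "?t \<in> borel_measurable borel" by (rule borel_measurable_continuous_onI[OF rdist_translate_cont[OF T h]])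
  have tb: "\<exists>B\<ge>0. \<forall>y. norm y \<le> R \<longrightarrow> \<bar>?t y\<bar> \<le> B"
  proof -
    have "compact (?t ` cball 0 R)" by (intro compact_continuous_image continuous_on_subset[OF rdist_translate_cont[OF T h]]) auto
    from compact_imp_bounded[OF this] obtain B where "\<forall>v\<in>?t ` cball 0 R. norm v \<le> B" unfolding bounded_iff by blast
    then show ?thesis by (intro exI[of _ "max 0 B"]) (auto simp: le_max_iff_disj)
  qed
  have it: "integrable lborel (\<lambda>y. g y * ?t y)" if g: "integrable lborel g" "vanish R g" for g
  proof -
    obtain B where B: "B \<ge> 0" "\<And>y. norm y \<le> R \<Longrightarrow> \<bar>?t y\<bar> \<le> B" using tb by blast
    note [measurable] = borel_measurable_integrable[OF g(1)]
    show ?thesis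
    proof (rule integral_abs_le(1)[where g="\<lambda>y. \<bar>g y\<bar> * B"])
      show "(\<lambda>y. g y * ?t y) \<in> borel_measurable lborel" by measurable
      show "integrable lborel (\<lambda>y. \<bar>g y\<bar> * B)" using g(1) by simp
      show "\<bar>g y * ?t y\<bar> \<le> \<bar>g y\<bar> * B" for y
        using B(2)[of y] g(2) by (cases "norm y \<le> R") (auto simp: abs_mult vanish_def intro: mult_left_mono)
    qed
  qed
  define D where "D g = T (conv g h) - (LBINT y. g y * ?t y)" for g
  have add: "D (\<lambda>x. g1 x + g2 x) = D g1 + D g2" if g1: "integrable lborel g1" "vanish R g1" and g2: "integrable lborel g2" "vanish R g2" for g1 g2
  proof -
    have "conv (\<lambda>x. g1 x + g2 x) h = (\<lambda>x. 1 * conv g1 h x + 1 * conv g2 h x)" using conv_add_left[OF g1(1) g2(1) h] by auto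
    then have "T (conv (\<lambda>x. g1 x + g2 x) h) = 1 * T (conv g1 h) + 1 * T (conv g2 h)"
      using rdist_lin[OF T rtest_conv_integrable[OF g1 h] rtest_conv_integrable[OF g2 h]] by metis
    moreover have "(LBINT y. (g1 y + g2 y) * ?t y) = (LBINT y. g1 y * ?t y) + (LBINT y. g2 y * ?t y)"
      unfolding distrib_right using it[OF g1] it[OF g2] by simp
    ultimately show ?thesis unfolding D_def by simp
  qed
  have loc: "\<bar>D g\<bar> \<le> (C * L + c) * \<delta> * (LBINT y. \<bar>g y\<bar>)"
    if g: "integrable lborel g" "vanish R g" and a: "norm a \<le> R" and ga: "\<And>y. \<delta> \<le> norm (y - a) \<Longrightarrow> g y = 0" for g a \<delta>
  proof -
    note [measurable] = borel_measurable_integrable[OF g(1)]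
    define I where "I = integral\<^sup>L lborel g"
    define J where "J = (LBINT y. \<bar>g y\<bar>)"
    \<comment> \<open>Near a the function g acts like the point mass \<open>I\<close> at a; both
      terms of \<open>D g\<close> are compared with \<open>I * ?t a\<close>.\<close>
    let ?f = "\<lambda>x. 1 * conv g h x + (- I) * h (x - a)"
    have rc: "rtest (conv g h)" by (rule rtest_conv_integrable[OF g h])
    have "\<bar>T ?f\<bar> \<le> C * (L * \<delta> * J)"
    proof (rule C(2))
      show "rtest ?f" by (intro rtest_add rtest_cmult rc rtest_translate h)
      show "vanish (R + S) ?f" using vanish_conv[OF g(2) S] vanish_translate[OF S a] by (auto simp: vanish_def)
      fix "is" :: "'d list" and x assume l: "length is \<le> N"
      have ic: "integrable lborel (\<lambda>y. g y * dp is h (x - y))" by (rule conv_integrable[OF integrable_locint[OF g(1)] rtest_dp[OF h]])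
      have "dp is ?f x = conv g (dp is h) x - I * dp is h (x - a)"
        unfolding dp_lincomb[OF rtest_sm[OF rc] sm_translate(1)[OF s]] dp_translate[OF s] dp_conv[OF integrable_locint[OF g(1)] h] by simp
      also have "\<dots> = (LBINT y. g y * (dp is h (x - y) - dp is h (x - a)))"
        unfolding conv_def I_def right_diff_distrib using ic g(1) by simp
      finally have e: "dp is ?f x = (LBINT y. g y * (dp is h (x - y) - dp is h (x - a)))" .
      have "\<bar>LBINT y. g y * (dp is h (x - y) - dp is h (x - a))\<bar> \<le> (LBINT y. \<bar>g y\<bar> * (L * \<delta>))"
      proof (rule integral_abs_le(2))
        show "(\<lambda>y. g y * (dp is h (x - y) - dp is h (x - a))) \<in> borel_measurable lborel"
          unfolding right_diff_distrib using ic by (intro borel_measurable_diff borel_measurable_integrable) (use g in auto)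
        show "integrable lborel (\<lambda>y. \<bar>g y\<bar> * (L * \<delta>))" using g(1) by simp
        fix y
        show "\<bar>g y * (dp is h (x - y) - dp is h (x - a))\<bar> \<le> \<bar>g y\<bar> * (L * \<delta>)"
        proof (cases "\<delta> \<le> norm (y - a)")
          case False
          have "\<bar>dp is h (x - y) - dp is h (x - a)\<bar> \<le> L * norm (y - a)" using L(2)[OF l, of "x - y" "x - a"] by (simp add: norm_minus_commute)
          also have "\<dots> \<le> L * \<delta>" using False L(1) by (intro mult_left_mono) auto
          finally show ?thesis unfolding abs_mult by (rule mult_left_mono) simp
        qed (simp add: ga)
      qed
      then show "\<bar>dp is ?f x\<bar> \<le> L * \<delta> * J" unfolding e J_def by (simp add: mult.commute)
    qed
    moreover have "T ?f = 1 * T (conv g h) + (- I) * ?t a" by (rule rdist_lin[OF T rc rtest_translate(1)[OF h]])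
    moreover have "\<bar>(LBINT y. g y * ?t y) - I * ?t a\<bar> \<le> c * \<delta> * J"
    proof -
      have "(LBINT y. g y * ?t y) - I * ?t a = (LBINT y. g y * (?t y - ?t a))" unfolding right_diff_distrib I_def using it[OF g] g(1) by simp
      moreover have "\<bar>LBINT y. g y * (?t y - ?t a)\<bar> \<le> (LBINT y. \<bar>g y\<bar> * (c * \<delta>))"
      proof (rule integral_abs_le(2))
        show "(\<lambda>y. g y * (?t y - ?t a)) \<in> borel_measurable lborel" by measurable
        show "integrable lborel (\<lambda>y. \<bar>g y\<bar> * (c * \<delta>))" using g(1) by simp
        fix y
        show "\<bar>g y * (?t y - ?t a)\<bar> \<le> \<bar>g y\<bar> * (c * \<delta>)"
        proof (cases "\<delta> \<le> norm (y - a) \<or> R < norm y")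
          case False
          have "\<bar>?t y - ?t a\<bar> \<le> c * norm (y - a)" using False a by (intro c(2)) auto
          also have "\<dots> \<le> c * \<delta>" using False c(1) by (intro mult_left_mono) auto
          finally show ?thesis unfolding abs_mult by (rule mult_left_mono) simp
        next
          case True
          then have "g y = 0" using ga g(2) by (auto simp: vanish_def)
          then show ?thesis by simp
        qed
      qed
      ultimately show ?thesis unfolding J_def by (simp add: mult.commute)
    qed
    ultimately have "\<bar>D g\<bar> \<le> C * (L * \<delta> * J) + c * \<delta> * J" unfolding D_def by linarith
    then show ?thesis unfolding J_def by (simp add: distrib_right mult.assoc)
  qed
  \<comment> \<open>Cutting off the ball around one centre splits g into pieces with disjoint
    supports. Their L1 norms add up exactly, so the constant does not grow with the number of
    balls.\<close>
  have fin: "\<bar>D g\<bar> \<le> (C * L + c) * \<delta> * (LBINT y. \<bar>g y\<bar>)"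
    if "finite K" "K \<subseteq> cball 0 R" "integrable lborel g" "vanish R g" "\<And>y. (\<And>a. a \<in> K \<Longrightarrow> \<delta> \<le> norm (y - a)) \<Longrightarrow> g y = 0" for K g \<delta>
    using that
  proof (induction K arbitrary: g rule: finite_induct)
    case empty
    then have "g = (\<lambda>y. 0)" by auto
    moreover have "T (\<lambda>x. 0) = 0" using rdist_lin[OF T rtest_zero rtest_zero, of 0 0] by simp
    moreover have "conv (\<lambda>y. 0) h = (\<lambda>x. 0)" by (simp add: conv_def fun_eq_iff)
    ultimately show ?case by (simp add: D_def)
  next
    case (insert a K)
    let ?g1 = "\<lambda>y. indicator (ball a \<delta>) y * g y" and ?g2 = "\<lambda>y. indicator (- ball a \<delta>) y * g y"
    have i: "integrable lborel ?g1" "integrable lborel ?g2"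
      using integrable_mult_indicator[OF _ insert.prems(2), of "ball a \<delta>"] integrable_mult_indicator[OF _ insert.prems(2), of "- ball a \<delta>"] by auto
    have v: "vanish R ?g1" "vanish R ?g2" using insert.prems(3) by (auto simp: vanish_def)
    have e: "g y = ?g1 y + ?g2 y" for y by (auto simp: indicator_def)
    have "\<bar>D ?g1\<bar> \<le> (C * L + c) * \<delta> * (LBINT y. \<bar>?g1 y\<bar>)"
      by (rule loc[OF i(1) v(1), of a]) (use insert.prems(1) in \<open>auto simp: indicator_def dist_norm norm_minus_commute\<close>)
    moreover have "\<bar>D ?g2\<bar> \<le> (C * L + c) * \<delta> * (LBINT y. \<bar>?g2 y\<bar>)"
    proof (rule insert.IH[OF _ i(2) v(2)])
      show "K \<subseteq> cball 0 R" using insert.prems(1) by blast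
      fix y assume y: "\<And>b. b \<in> K \<Longrightarrow> \<delta> \<le> norm (y - b)"
      show "?g2 y = 0"
      proof (cases "y \<in> ball a \<delta>")
        case False
        then have "g y = 0" using y by (intro insert.prems(4)) (auto simp: dist_norm norm_minus_commute)
        then show ?thesis by simp
      qed simp
    qed
    moreover have "D g = D ?g1 + D ?g2" using add[OF i(1) v(1) i(2) v(2)] unfolding e[symmetric] .
    moreover have "(LBINT y. \<bar>g y\<bar>) = (LBINT y. \<bar>?g1 y\<bar>) + (LBINT y. \<bar>?g2 y\<bar>)"
    proof -
      have "(LBINT y. \<bar>g y\<bar>) = (LBINT y. \<bar>?g1 y\<bar> + \<bar>?g2 y\<bar>)"
        by (intro Bochner_Integration.integral_cong refl) (auto simp: indicator_def)
      then show ?thesis using integrable_abs[OF i(1)] integrable_abs[OF i(2)] by simp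
    qed
    ultimately show ?case by (simp only: distrib_left)
  qed
  \<comment> \<open>Total boundedness of the ball supplies finitely many centres for every radius
    \<delta>; letting \<delta> tend to 0 then gives D g = 0.\<close>
  have small: "\<bar>D g\<bar> \<le> (C * L + c) * \<delta> * (LBINT y. \<bar>g y\<bar>)" if d: "\<delta> > 0" for \<delta>
  proof -
    have sc: "seq_compact (cball (0::real^'d) R)" using compact_cball compact_eq_seq_compact_metric by blast
    have "\<exists>K. finite K \<and> K \<subseteq> cball (0::real^'d) R \<and> cball 0 R \<subseteq> (\<Union>x\<in>K. ball x \<delta>)"
      by (rule seq_compact_imp_totally_bounded[OF sc, rule_format, OF d])
    then obtain K where K: "finite K" "K \<subseteq> cball (0::real^'d) R" "cball (0::real^'d) R \<subseteq> (\<Union>x\<in>K. ball x \<delta>)" by (elim exE conjE)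
    show ?thesis
    proof (rule fin[OF K(1,2) g])
      fix y assume y: "\<And>a. a \<in> K \<Longrightarrow> \<delta> \<le> norm (y - a)"
      have "y \<notin> cball 0 R" using K(3) y by (fastforce simp: dist_norm norm_minus_commute)
      then show "g y = 0" using g(2) by (auto simp: vanish_def)
    qed
  qed
  define Z where "Z = (C * L + c) * (LBINT y. \<bar>g y\<bar>)"
  have Z0: "Z \<ge> 0" unfolding Z_def using C L c by (intro mult_nonneg_nonneg add_nonneg_nonneg) (auto intro: less_imp_le)
  have "\<bar>D g\<bar> \<le> 0 + e" if "e > 0" for e
  proof -
    have "\<bar>D g\<bar> \<le> Z * (e / (Z + 1))" using small[of "e / (Z + 1)"] that Z0 by (simp add: Z_def mult_ac)
    also have "\<dots> \<le> e" using that Z0 by (simp add: field_simps)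
    finally show ?thesis by simp
  qed
  then have "\<bar>D g\<bar> \<le> 0" by (rule field_le_epsilon)
  then show ?thesis by (simp add: D_def)
qed

section \<open>Approximation by mollification\<close>

lemma rdist_integral_conv:
  assumes "rdist T" "rtest h" "rtest g"
  shows "(LBINT y. T (\<lambda>x. h (x - y)) * g y) = T (conv g h)"
proof -
  obtain R where "vanish R g" using assms(3) by (auto simp: rtest_def)
  then show ?thesis using rdist_conv[OF assms(1,2) rtest_integrable[OF assms(3)]] by (simp add: mult.commute)
qed

text \<open>\<open>cutoff\<close> reaches out to radius 2, whence the factor 2 in the dilation for
  support radius 1 / (n + 1). Being even, the mollifier is its own transpose under
  convolution.\<close>

definition mseq :: "nat \<Rightarrow> real^'d::finite \<Rightarrow> real" where
  "mseq n x = cutoff ((2 * (real n + 1)) *\<^sub>R x) / (LBINT x. cutoff ((2 * (real n + 1)) *\<^sub>R (x::real^'d)))"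

lemma mseq:
  shows "mollifier (mseq n :: real^'d::finite \<Rightarrow> real)" "vanish (1 / (real n + 1)) (mseq n :: real^'d \<Rightarrow> real)" "mseq n (- x) = mseq n (x::real^'d)"
proof -
  let ?c = "\<lambda>x::real^'d. cutoff ((2 * (real n + 1)) *\<^sub>R x)"
  define I where "I = integral\<^sup>L lborel ?c"
  define r where "r = 1 / (2 * (real n + 1))"
  have r0: "r > 0" by (simp add: r_def)
  have nn: "norm ((2 * (real n + 1)) *\<^sub>R x) = 2 * (real n + 1) * norm x" for x :: "real^'d" by (subst norm_scaleR) simp
  have t: "rtest ?c" using rtest_affine[OF rtest_cutoff, of "2 * (real n + 1)" 0] by simp
  have "measure lborel (cball (0::real^'d) r) = (LBINT x. indicator (cball (0::real^'d) r) x)" by simp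
  also have "\<dots> \<le> I" unfolding I_def
  proof (rule integral_mono[OF _ rtest_integrable[OF t]])
    show "integrable lborel (indicator (cball (0::real^'d) r) :: _ \<Rightarrow> real)"
      using emeasure_lborel_cball_finite[of "0::real^'d" r] by (intro integrable_real_indicator) auto
    fix x :: "real^'d"
    show "indicator (cball 0 r) x \<le> ?c x"
    proof (cases "norm x \<le> r")
      case True
      then have "norm ((2 * (real n + 1)) *\<^sub>R x) \<le> 1" unfolding nn by (simp add: r_def field_simps)
      from cutoff_one[OF this] show ?thesis by (simp add: indicator_def)
    qed (simp add: cutoff_range)
  qed
  finally have I: "I > 0" using content_cball_pos[OF r0, of "0::real^'d"] by (simp add: measure_def)
  have m: "mseq n = (\<lambda>x. (1 / I) * ?c x)" by (auto simp: mseq_def I_def)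
  show v: "vanish (1 / (real n + 1)) (mseq n :: real^'d \<Rightarrow> real)"
    unfolding vanish_def
  proof (intro allI impI)
    fix x :: "real^'d" assume "1 / (real n + 1) < norm x"
    then have "2 \<le> norm ((2 * (real n + 1)) *\<^sub>R x)" unfolding nn by (simp add: field_simps)
    from cutoff_zero[OF this] show "mseq n x = 0" by (simp add: m)
  qed
  show "mollifier (mseq n :: real^'d \<Rightarrow> real)" unfolding mollifier_def
  proof (intro conjI allI)
    show "rtest (mseq n :: real^'d \<Rightarrow> real)" unfolding m by (rule rtest_cmult[OF t])
    show "0 \<le> mseq n (x :: real^'d)" for x unfolding m using I by (intro mult_nonneg_nonneg cutoff_range) simp
    show "vanish 1 (mseq n :: real^'d \<Rightarrow> real)" by (rule vanish_mono[OF v]) simp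
    show "integral\<^sup>L lborel (mseq n :: real^'d \<Rightarrow> real) = 1" unfolding m integral_mult_right_zero I_def[symmetric] using I by simp
  qed
  show "mseq n (- x) = mseq n x" unfolding mseq_def cutoff_def by simp
qed

text \<open>The second estimate preserves the Lipschitz constant, so the first can be applied again
  to an already mollified function.\<close>

lemma conv_mollifier_approx:
  assumes m: "mollifier \<rho>" "vanish e \<rho>" and f: "continuous_on UNIV f" "\<And>x y. \<bar>f x - f y\<bar> \<le> L * norm (x - y)" and L: "0 \<le> L"
  shows "\<bar>conv \<rho> f x - f x\<bar> \<le> L * e" "\<bar>conv \<rho> f x - conv \<rho> f y\<bar> \<le> L * norm (x - y)"
proof -
  have r: "rtest \<rho>" "\<And>x. 0 \<le> \<rho> x" "integral\<^sup>L lborel \<rho> = 1" using m by (auto simp: mollifier_def)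
  have ir: "integrable lborel \<rho>" by (rule rtest_integrable[OF r(1)])
  obtain R where R: "vanish R \<rho>" using r by (auto simp: rtest_def)
  have i: "integrable lborel (\<lambda>y. \<rho> y * f (x - y))" for x
  proof (rule cont_vanish_integrable)
    show "continuous_on UNIV (\<lambda>y. \<rho> y * f (x - y))"
      by (intro continuous_intros sm_cont rtest_sm r continuous_on_compose2[OF f(1)]) auto
    show "vanish R (\<lambda>y. \<rho> y * f (x - y))" using R by (auto simp: vanish_def)
  qed
  have "conv \<rho> f x - f x = (LBINT y. \<rho> y * (f (x - y) - f x))" unfolding conv_def right_diff_distrib using i[of x] ir r(3) by simp
  moreover have "\<bar>LBINT y. \<rho> y * (f (x - y) - f x)\<bar> \<le> (LBINT y. \<rho> y * (L * e))"
  proof (rule integral_abs_le(2))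
    show "(\<lambda>y. \<rho> y * (f (x - y) - f x)) \<in> borel_measurable lborel"
      unfolding right_diff_distrib using i[of x] ir by (intro borel_measurable_diff borel_measurable_integrable) auto
    show "integrable lborel (\<lambda>y. \<rho> y * (L * e))" using ir by simp
    fix y
    show "\<bar>\<rho> y * (f (x - y) - f x)\<bar> \<le> \<rho> y * (L * e)"
    proof (cases "norm y \<le> e")
      case True
      have "\<bar>f (x - y) - f x\<bar> \<le> L * norm y" using f(2)[of "x - y" x] by simp
      also have "\<dots> \<le> L * e" using True L by (intro mult_left_mono) auto
      finally show ?thesis unfolding abs_mult using r(2)[of y] by (simp add: mult_left_mono)
    next
      case False then show ?thesis using m(2) by (simp add: vanish_def)
    qed
  qed
  ultimately show "\<bar>conv \<rho> f x - f x\<bar> \<le> L * e" using r(3) by simp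
  have "conv \<rho> f x - conv \<rho> f y = (LBINT z. \<rho> z * (f (x - z) - f (y - z)))" unfolding conv_def right_diff_distrib using i[of x] i[of y] by simp
  moreover have "\<bar>LBINT z. \<rho> z * (f (x - z) - f (y - z))\<bar> \<le> (LBINT z. \<rho> z * (L * norm (x - y)))"
  proof (rule integral_abs_le(2))
    show "(\<lambda>z. \<rho> z * (f (x - z) - f (y - z))) \<in> borel_measurable lborel"
      unfolding right_diff_distrib using i by (intro borel_measurable_diff borel_measurable_integrable) auto
    show "integrable lborel (\<lambda>z. \<rho> z * (L * norm (x - y)))" using ir by simp
    show "\<bar>\<rho> z * (f (x - z) - f (y - z))\<bar> \<le> \<rho> z * (L * norm (x - y))" for z
      using f(2)[of "x - z" "y - z"] r(2)[of z] by (simp add: abs_mult mult_left_mono)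
  qed
  ultimately show "\<bar>conv \<rho> f x - conv \<rho> f y\<bar> \<le> L * norm (x - y)" using r(3) by simp
qed

text \<open>Two mollifications occur because one turns the distribution into a continuous function
  and another is built into \<open>supersolution\<close>. Each costs at most L / (n + 1) in every
  derivative up to the order of T.\<close>

lemma rdist_mollify_tendsto:
  fixes T :: "(real^'d::finite \<Rightarrow> real) \<Rightarrow> real"
  assumes T: "rdist T" and g: "rtest g"
  shows "(\<lambda>n. T (conv (conv g (mseq n)) (mseq n))) \<longlonglongrightarrow> T g"
proof -
  obtain R where R: "vanish R g" using g by (auto simp: rtest_def)
  have sg: "sm g" by (rule rtest_sm[OF g])
  obtain C N where C: "0 \<le> C" "\<And>f M. rtest f \<Longrightarrow> vanish (R + 2) f \<Longrightarrow> (\<And>is x. length is \<le> N \<Longrightarrow> \<bar>dp is f x\<bar> \<le> M) \<Longrightarrow> \<bar>T f\<bar> \<le> C * M"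
    using rdist_bound[OF T] by blast
  obtain L where L: "0 < L" "\<And>is x y. length is \<le> N \<Longrightarrow> \<bar>dp is g x - dp is g y\<bar> \<le> L * norm (x - y)" using rtest_lipschitz_dp[OF g] by blast
  have b: "norm (T (conv (conv g (mseq n)) (mseq n)) - T g) \<le> C * (2 * L) * (1 / (real n + 1))" for n
  proof -
    let ?m = "mseq n :: real^'d \<Rightarrow> real" let ?e = "1 / (real n + 1)"
    have m: "mollifier ?m" "vanish ?e ?m" by (rule mseq)+
    have mt: "rtest ?m" "vanish 1 ?m" using m by (auto simp: mollifier_def)
    have cm: "continuous_on UNIV ?m" by (rule sm_cont[OF rtest_sm[OF mt(1)]])
    have cc: "conv f ?m = conv ?m f" if "rtest f" for f by (intro conv_commute sm_borel rtest_sm that mt)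
    have t1: "rtest (conv ?m f)" if "rtest f" for f by (rule rtest_conv[OF cm mt(2) that])
    have e: "conv (conv g ?m) ?m = conv ?m (conv ?m g)" using cc[OF g] cc[OF t1[OF g]] by simp
    let ?f = "\<lambda>x. 1 * conv ?m (conv ?m g) x + (-1) * g x"
    have "\<bar>T ?f\<bar> \<le> C * (L * ?e + L * ?e)"
    proof (rule C(2))
      show "rtest ?f" by (intro rtest_add rtest_cmult t1 g)
      have "vanish (1 + (1 + R)) (conv ?m (conv ?m g))" by (intro vanish_conv mt R)
      then show "vanish (R + 2) ?f" using R by (auto simp: vanish_def)
      fix "is" :: "'d list" and x assume l: "length is \<le> N"
      have li: "locint ?m" by (rule locint_cont[OF cm])
      have "dp is ?f x = conv ?m (conv ?m (dp is g)) x - dp is g x"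
        unfolding dp_lincomb[OF rtest_sm[OF t1[OF t1[OF g]]] sg] dp_conv[OF li t1[OF g]] dp_conv[OF li g] by simp
      moreover have "\<bar>conv ?m (dp is g) x - dp is g x\<bar> \<le> L * ?e"
        by (rule conv_mollifier_approx(1)[OF m sm_cont[OF sm_dp[OF sg]] L(2)[OF l]]) (use L in auto)
      moreover have "\<bar>conv ?m (conv ?m (dp is g)) x - conv ?m (dp is g) x\<bar> \<le> L * ?e"
      proof (rule conv_mollifier_approx(1)[OF m sm_cont[OF rtest_sm[OF t1[OF rtest_dp[OF g]]]]])
        show "\<bar>conv ?m (dp is g) x - conv ?m (dp is g) y\<bar> \<le> L * norm (x - y)" for x y
          by (rule conv_mollifier_approx(2)[OF m sm_cont[OF sm_dp[OF sg]] L(2)[OF l]]) (use L in auto)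
      qed (use L in auto)
      ultimately show "\<bar>dp is ?f x\<bar> \<le> L * ?e + L * ?e" by linarith
    qed
    moreover have "T ?f = 1 * T (conv ?m (conv ?m g)) + (-1) * T g" by (rule rdist_lin[OF T t1[OF t1[OF g]] g])
    ultimately show ?thesis unfolding e by (simp add: mult.assoc)
  qed
  have "(\<lambda>n. T (conv (conv g (mseq n)) (mseq n)) - T g) \<longlonglongrightarrow> 0"
  proof (rule Lim_null_comparison[OF always_eventually[OF allI[OF b]]])
    have "(\<lambda>n. C * (2 * L) * (1 / (real n + 1))) \<longlonglongrightarrow> C * (2 * L) * 0"
      using LIMSEQ_inverse_real_of_nat by (intro tendsto_mult tendsto_const) (simp add: inverse_eq_divide add.commute)
    then show "(\<lambda>n. C * (2 * L) * (1 / (real n + 1))) \<longlonglongrightarrow> 0" by simp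
  qed
  then show ?thesis by (rule LIM_zero_cancel)
qed

text \<open>For \<open>a = p cos \<eta>\<close>, \<open>b = p sin \<eta>\<close> the skew expression \<open>b \<nabla>a - a \<nabla>b\<close> equals \<open>- p\<^sup>2 \<nabla>\<eta>\<close>, and the logarithmic phase turns this into \<open>- p \<nabla>p\<close> in the limit without increasing the energies by more than a factor \<open>2\<close>.\<close>

lemma skew_form_bound:
  fixes F :: "'d::finite \<Rightarrow> real^'d \<Rightarrow> real"
  assumes F: "\<And>j. continuous_on UNIV (F j)"
    and div: "\<And>\<eta>. rtest \<eta> \<Longrightarrow> (LBINT x. V x * \<eta> x) = - (\<Sum>j\<in>UNIV. (LBINT x. F j x * rpd j \<eta> x))"
    and skew: "\<And>a b. rtest a \<Longrightarrow> rtest b \<Longrightarrow> \<bar>LBINT x. (\<Sum>j\<in>UNIV. F j x * (b x * rpd j a x - a x * rpd j b x))\<bar> \<le> K * sqrt (dir a) * sqrt (dir b)"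
    and K: "K \<ge> 0" and p: "rtest p"
  shows "\<bar>LBINT x. V x * (p x)^2\<bar> \<le> 4 * K * dir p"
proof -
  have sp: "sm p" by (rule rtest_sm[OF p])
  define A where "A x = (\<Sum>j\<in>UNIV. F j x * (p x * rpd j p x))" for x
  have iAj: "integrable lborel (\<lambda>x. F j x * (p x * rpd j p x))" for j
    by (intro locint_rtest_integrable locint_cont F rtest_mult1 p sm_rpd sp)
  have iA: "integrable lborel A" unfolding A_def[abs_def] by (intro Bochner_Integration.integrable_sum iAj)
  \<comment> \<open>The regularised phase gives p^2 grad \<eta> = \<theta> p grad p; \<theta>
    replaces the value 1 belonging to log p.\<close>
  define \<theta> where "\<theta> e x = (p x)^2 / ((p x)^2 + e^2)" for e :: real and x
  have th: "0 \<le> \<theta> e x" "\<theta> e x \<le> 1" for e x unfolding \<theta>_def by (auto simp: divide_le_eq_1 add_nonneg_eq_0_iff sum_power2_gt_zero_iff)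
  have sth: "sm (\<theta> e)" if "e > 0" for e unfolding \<theta>_def[abs_def] using that by (intro sm_divide sm_power sm_add sm_const sp add_nonneg_pos) auto
  have est: "\<bar>LBINT x. - (\<theta> e x * A x)\<bar> \<le> 2 * K * dir p" if e: "e > 0" for e
  proof -
    let ?q = "\<lambda>x. (p x)^2 + e^2"
    have q0: "0 < ?q x" for x using e by (intro add_nonneg_pos) auto
    have sq: "sm ?q" by (intro sm_power sm_add sm_const sp)
    define \<eta> where "\<eta> x = (1/2) * ln (?q x)" for x
    have sl: "sm (\<lambda>x. ln (?q x))" by (rule sm_ln[OF sq q0])
    have se: "sm \<eta>" unfolding \<eta>_def[abs_def] by (intro sm_mult sm_const sl)
    have re: "rpd j \<eta> x = p x * rpd j p x / ?q x" for j x
    proof -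
      have "rpd j \<eta> x = (1/2) * rpd j (\<lambda>x. ln (?q x)) x" unfolding \<eta>_def[abs_def] by (rule rpd_cmult[OF sm_diff[OF sl]])
      also have "\<dots> = (1/2) * (2 * p x * rpd j p x / ?q x)"
        by (simp only: rpd_ln[OF sq q0] rpd_add_const(1)[OF sm_power[OF sp]] rpd_power2[OF sp])
      finally show ?thesis by simp
    qed
    have sc: "sm (\<lambda>x. cos (\<eta> x))" "sm (\<lambda>x. sin (\<eta> x))" by (rule sm_cos_sin[OF se])+
    have rc: "rpd j (\<lambda>x. cos (\<eta> x)) x = - sin (\<eta> x) * rpd j \<eta> x" "rpd j (\<lambda>x. sin (\<eta> x)) x = cos (\<eta> x) * rpd j \<eta> x" for j x
      by (rule rpd_chain(2)[OF _ sm_diff[OF se]], auto intro!: derivative_eq_intros)+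
    define a where "a x = p x * cos (\<eta> x)" for x
    define b where "b x = p x * sin (\<eta> x)" for x
    have ta: "rtest a" and tb: "rtest b" unfolding a_def[abs_def] b_def[abs_def] by (intro rtest_mult1 p sc)+
    have ra: "rpd j a x = rpd j p x * cos (\<eta> x) - p x * (sin (\<eta> x) * rpd j \<eta> x)" for j x
      unfolding a_def[abs_def] rpd_mult[OF sm_diff[OF sp] sm_diff[OF sc(1)]] rc by simp
    have rb: "rpd j b x = rpd j p x * sin (\<eta> x) + p x * (cos (\<eta> x) * rpd j \<eta> x)" for j x
      unfolding b_def[abs_def] rpd_mult[OF sm_diff[OF sp] sm_diff[OF sc(2)]] rc by simp
    have wr: "b x * rpd j a x - a x * rpd j b x = - ((p x)^2 * rpd j \<eta> x)" for j x
    proof -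
      have "b x * rpd j a x - a x * rpd j b x = - ((p x)^2 * rpd j \<eta> x * ((sin (\<eta> x))^2 + (cos (\<eta> x))^2))"
        unfolding ra rb a_def b_def by algebra
      then show ?thesis by simp
    qed
    \<comment> \<open>The phase acts as a rotation, so the squares add up to those of the
      derivatives of p and of p times the phase gradient; the latter is \<theta> times a derivative
      of p.\<close>
    have sqs: "(rpd j a x)^2 + (rpd j b x)^2 \<le> 2 * (rpd j p x)^2" for j x
    proof -
      have "(rpd j a x)^2 + (rpd j b x)^2 = ((rpd j p x)^2 + (p x * rpd j \<eta> x)^2) * ((sin (\<eta> x))^2 + (cos (\<eta> x))^2)"
        unfolding ra rb by algebra
      moreover have "p x * rpd j \<eta> x = \<theta> e x * rpd j p x" unfolding re \<theta>_def by (simp add: power2_eq_square)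
      moreover have "(\<theta> e x * rpd j p x)^2 \<le> 1 * (rpd j p x)^2"
        unfolding power_mult_distrib using th[of e x] by (intro mult_right_mono power_le_one) auto
      ultimately show ?thesis by simp
    qed
    have dirle: "dir c \<le> 2 * dir p" if c: "rtest c" "\<And>j x. (rpd j c x)^2 \<le> 2 * (rpd j p x)^2" for c
    proof -
      have "dir c \<le> (LBINT x. 2 * gsq p x)" unfolding dir_def
      proof (rule integral_mono[OF rtest_integrable[OF rtest_grad_sq[OF c(1)]]])
        show "integrable lborel (\<lambda>x. 2 * gsq p x)" by (intro rtest_integrable rtest_cmult rtest_grad_sq p)
        show "gsq c x \<le> 2 * gsq p x" for x
          unfolding sum_distrib_left by (intro sum_mono c(2))
      qed
      then show ?thesis by (simp add: dir_def)
    qed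
    have da: "dir a \<le> 2 * dir p"
    proof (rule dirle[OF ta])
      fix j x show "(rpd j a x)^2 \<le> 2 * (rpd j p x)^2" using sqs[of j x] zero_le_power2[of "rpd j b x"] by linarith
    qed
    have db: "dir b \<le> 2 * dir p"
    proof (rule dirle[OF tb])
      fix j x show "(rpd j b x)^2 \<le> 2 * (rpd j p x)^2" using sqs[of j x] zero_le_power2[of "rpd j a x"] by linarith
    qed
    have "(\<Sum>j\<in>UNIV. F j x * (b x * rpd j a x - a x * rpd j b x)) = - (\<theta> e x * A x)" for x
      unfolding wr re A_def \<theta>_def sum_distrib_left sum_negf[symmetric] by (intro sum.cong refl) simp
    then have "\<bar>LBINT x. - (\<theta> e x * A x)\<bar> \<le> K * sqrt (dir a) * sqrt (dir b)" using skew[OF ta tb] by (simp only:)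
    also have "\<dots> = K * (sqrt (dir a) * sqrt (dir b))" by (simp add: mult.assoc)
    also have "\<dots> \<le> K * (sqrt (2 * dir p) * sqrt (2 * dir p))"
      using da db dir_nonneg[of p] dir_nonneg[of b] K by (intro mult_left_mono mult_mono real_sqrt_le_mono) auto
    also have "\<dots> = 2 * K * dir p" using dir_nonneg[of p] by simp
    finally show ?thesis .
  qed
  define er where "er n = inverse (real (Suc n))" for n
  have er: "er n > 0" "er \<longlonglongrightarrow> 0" for n unfolding er_def[abs_def] using LIMSEQ_inverse_real_of_nat by auto
  have mA: "A \<in> borel_measurable lborel" using iA by (rule borel_measurable_integrable)
  have "(\<lambda>n. (LBINT x. - (\<theta> (er n) x * A x))) \<longlonglongrightarrow> (LBINT x. - A x)"
  proof (rule integral_dominated_convergence[where w="\<lambda>x. \<bar>A x\<bar>"])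
    show "(\<lambda>x. - A x) \<in> borel_measurable lborel" using mA by simp
    show "(\<lambda>x. - (\<theta> (er n) x * A x)) \<in> borel_measurable lborel" for n
      using mA sm_borel[OF sth[OF er(1)[of n]]] by simp
    show "integrable lborel (\<lambda>x. \<bar>A x\<bar>)" using iA by simp
    show "AE x in lborel. norm (- (\<theta> (er n) x * A x)) \<le> \<bar>A x\<bar>" for n
    proof (rule AE_I2)
      fix x
      have "\<theta> (er n) x * \<bar>A x\<bar> \<le> 1 * \<bar>A x\<bar>" using th by (intro mult_right_mono) auto
      then show "norm (- (\<theta> (er n) x * A x)) \<le> \<bar>A x\<bar>" using th(1)[of "er n" x] by (simp add: abs_mult)
    qed
    show "AE x in lborel. (\<lambda>n. - (\<theta> (er n) x * A x)) \<longlonglongrightarrow> - A x"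
    proof (rule AE_I2)
      fix x
      show "(\<lambda>n. - (\<theta> (er n) x * A x)) \<longlonglongrightarrow> - A x"
      \<comment> \<open>At zeros of p the factor \<theta> does not tend to 1, but \<open>A\<close>
        vanishes there.\<close>
      proof (cases "p x = 0")
        case True then have "A x = 0" by (simp add: A_def)
        then show ?thesis by simp
      next
        case False
        have "(\<lambda>n. - (\<theta> (er n) x * A x)) \<longlonglongrightarrow> - ((p x)^2 / ((p x)^2 + 0^2) * A x)"
          unfolding \<theta>_def using False by (intro tendsto_intros er(2)) auto
        then show ?thesis using False by simp
      qed
    qed
  qed
  from tendsto_rabs[OF this] have "\<bar>LBINT x. - A x\<bar> \<le> 2 * K * dir p"
    by (rule tendsto_upperbound) (use est[OF er(1)] in auto)
  then have bA: "\<bar>integral\<^sup>L lborel A\<bar> \<le> 2 * K * dir p" by simp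
  \<comment> \<open>Differentiating p^2 gives twice the integrand of \<open>A\<close>, which doubles
    the constant 2 K.\<close>
  have "(LBINT x. V x * (p x)^2) = - (\<Sum>j\<in>UNIV. (LBINT x. F j x * (2 * p x * rpd j p x)))"
    unfolding div[OF rtest_power2[OF p]] rpd_power2[OF sp] ..
  also have "\<dots> = - (\<Sum>j\<in>UNIV. 2 * (LBINT x. F j x * (p x * rpd j p x)))"
  proof -
    have "(LBINT x. F j x * (2 * p x * rpd j p x)) = 2 * (LBINT x. F j x * (p x * rpd j p x))" for j
      unfolding integral_mult_right_zero[symmetric] by (intro Bochner_Integration.integral_cong refl) simp
    then show ?thesis by simp
  qed
  also have "\<dots> = - 2 * integral\<^sup>L lborel A"
    unfolding A_def[abs_def] using Bochner_Integration.integral_sum[of UNIV lborel "\<lambda>j x. F j x * (p x * rpd j p x)"] iAj by (simp add: sum_distrib_left sum_negf)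
  finally show ?thesis using bA by simp
qed

text \<open>Bundles the outcome for one real vector field, with \<Lambda> standing for its
  divergence, so that rescaling and the complex combination can treat it as one object.\<close>

definition gradient_potential where
  "gradient_potential \<Lambda> \<Psi> G C \<longleftrightarrow> C > 0 \<and> (\<forall>f g a b. rtest f \<longrightarrow> rtest g \<longrightarrow> \<Psi> (\<lambda>x. a * f x + b * g x) = a * \<Psi> f + b * \<Psi> g) \<and>
    (\<forall>R. \<exists>B\<ge>0. \<forall>f M. rtest f \<longrightarrow> vanish R f \<longrightarrow> (\<forall>x. \<bar>f x\<bar> \<le> M) \<longrightarrow> \<bar>\<Psi> f\<bar> \<le> B * M) \<and>
    (\<forall>f. rtest f \<longrightarrow> \<Psi> (lapl f) = \<Lambda> f) \<and> (\<forall>j. G j \<in> borel_measurable borel) \<and>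
    (\<forall>j f. rtest f \<longrightarrow> integrable lborel (\<lambda>x. G j x * f x) \<and> - \<Psi> (rpd j f) = (LBINT x. G j x * f x)) \<and>
    (\<forall>u. rtest u \<longrightarrow> (LBNN x. ennreal ((\<Sum>j\<in>UNIV. (G j x)^2) * (u x)^2)) \<le> ennreal (C * dir u))"
  for \<Lambda> \<Psi> :: "(real^'d::finite \<Rightarrow> real) \<Rightarrow> real" and G :: "'d \<Rightarrow> real^'d \<Rightarrow> real" and C :: real

text \<open>\<open>skew_form_bound\<close> multiplies the constant by 4, so 1/8 yields exactly the
  form bound 1/2 required for coercivity.\<close>

lemma rdist_potential_unit:
  fixes T :: "'d::finite \<Rightarrow> (real^'d \<Rightarrow> real) \<Rightarrow> real"
  assumes d: "CARD('d) \<ge> 3" and T: "\<And>j. rdist (T j)"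
    and skew: "\<And>a b. rtest a \<Longrightarrow> rtest b \<Longrightarrow> \<bar>\<Sum>j\<in>UNIV. T j (\<lambda>x. b x * rpd j a x - a x * rpd j b x)\<bar> \<le> 1/8 * sqrt (dir a) * sqrt (dir b)"
  shows "\<exists>\<Psi> G C. gradient_potential (\<lambda>f. - (\<Sum>j\<in>UNIV. T j (rpd j f))) \<Psi> G C"
proof -
  let ?r = "\<lambda>n. mseq n :: real^'d \<Rightarrow> real"
  have m: "mollifier (?r n)" for n by (rule mseq)
  have mt: "rtest (?r n)" "vanish 1 (?r n)" "integral\<^sup>L lborel (?r n) = 1" "\<And>x. 0 \<le> ?r n x" for n using m[of n] by (auto simp: mollifier_def)
  define F where "F n j x = T j (\<lambda>y. mseq n (y - x))" for n j x
  define V where "V n x = - (\<Sum>j\<in>UNIV. T j (\<lambda>y. rpd j (mseq n) (y - x)))" for n x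
  have Fc: "continuous_on UNIV (F n j)" for n j unfolding F_def[abs_def] by (rule rdist_translate_cont[OF T mt(1)])
  have cr: "continuous_on UNIV (\<lambda>x. T j (\<lambda>y. rpd j (?r n) (y - x)))" for n j by (rule rdist_translate_cont[OF T rtest_rpd[OF mt(1)]])
  have Vc: "continuous_on UNIV (V n)" for n unfolding V_def[abs_def] by (intro continuous_on_minus continuous_on_sum cr)
  have Vi: "(LBINT x. V n x * \<eta> x) = - (\<Sum>j\<in>UNIV. T j (conv (rpd j \<eta>) (?r n)))" if e: "rtest \<eta>" for n \<eta>
  proof -
    have "(LBINT x. V n x * \<eta> x) = (LBINT x. - (\<Sum>j\<in>UNIV. T j (\<lambda>y. rpd j (?r n) (y - x)) * \<eta> x))"
      unfolding V_def by (simp add: sum_distrib_right)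
    also have "\<dots> = - (\<Sum>j\<in>UNIV. (LBINT x. T j (\<lambda>y. rpd j (?r n) (y - x)) * \<eta> x))"
      unfolding integral_minus by (subst Bochner_Integration.integral_sum) (auto intro!: locint_rtest_integrable locint_cont cr e)
    also have "\<dots> = - (\<Sum>j\<in>UNIV. T j (conv \<eta> (rpd j (?r n))))"
      unfolding rdist_integral_conv[OF T rtest_rpd[OF mt(1)] e] ..
    also have "\<dots> = - (\<Sum>j\<in>UNIV. T j (conv (rpd j \<eta>) (?r n)))"
      unfolding conv_by_parts[OF rtest_sm[OF e] mt(1), abs_def] by (simp only: eta_contract_eq)
    finally show ?thesis .
  qed
  have div: "(LBINT x. V n x * \<eta> x) = - (\<Sum>j\<in>UNIV. (LBINT x. F n j x * rpd j \<eta> x))" if e: "rtest \<eta>" for n \<eta>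
    unfolding Vi[OF e] F_def rdist_integral_conv[OF T mt(1) rtest_rpd[OF e]] ..
  have form: "\<bar>LBINT x. V n x * (u x)^2\<bar> \<le> dir u / 2" if u: "rtest u" for n u
  proof -
    have k: "0 \<le> (1/8::real)" by simp
    have "\<bar>LBINT x. V n x * (u x)^2\<bar> \<le> 4 * (1/8) * dir u"
    proof (rule skew_form_bound[OF Fc div _ k u])
      fix a b :: "real^'d \<Rightarrow> real" assume a: "rtest a" and b: "rtest b"
      \<comment> \<open>Pairing the mollified field with \<open>H\<close> is an average over y of T
        applied to translates of \<open>H\<close>. Both factors of the skew bound are translation
        invariant, so mollification keeps the constant.\<close>
      define H where "H j x = b x * rpd j a x - a x * rpd j b x" for j x
      have sa: "sm a" and sb: "sm b" using a b by (auto intro: rtest_sm)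
      have tH: "rtest (H j)" for j unfolding H_def[abs_def] by (intro rtest_sub rtest_mult1 a b sm_rpd sa sb)
      have cH: "continuous_on UNIV (\<lambda>y. T j (\<lambda>x. H j (x - y)))" for j by (rule rdist_translate_cont[OF T tH])
      define K where "K = 1/8 * sqrt (dir a) * sqrt (dir b)"
      have bd: "\<bar>\<Sum>j\<in>UNIV. T j (\<lambda>x. H j (x - y))\<bar> \<le> K" for y
        using skew[OF rtest_translate(1)[OF a, of y] rtest_translate(1)[OF b, of y]]
        unfolding H_def K_def rpd_translate(1)[OF sa] rpd_translate(1)[OF sb] dir_translate(3)[OF a] dir_translate(3)[OF b] .
      have "(LBINT x. (\<Sum>j\<in>UNIV. F n j x * H j x)) = (\<Sum>j\<in>UNIV. (LBINT x. F n j x * H j x))"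
        by (intro Bochner_Integration.integral_sum locint_rtest_integrable locint_cont Fc tH)
      also have "\<dots> = (\<Sum>j\<in>UNIV. T j (conv (H j) (?r n)))"
        unfolding F_def rdist_integral_conv[OF T mt(1) tH] ..
      also have "\<dots> = (\<Sum>j\<in>UNIV. T j (conv (?r n) (H j)))"
        using conv_commute[OF sm_borel[OF rtest_sm[OF tH]] sm_borel[OF rtest_sm[OF mt(1)[of n]]]] by simp
      also have "\<dots> = (\<Sum>j\<in>UNIV. (LBINT y. T j (\<lambda>x. H j (x - y)) * ?r n y))"
        unfolding rdist_integral_conv[OF T tH mt(1)] ..
      also have "\<dots> = (LBINT y. (\<Sum>j\<in>UNIV. T j (\<lambda>x. H j (x - y)) * ?r n y))"
        by (intro Bochner_Integration.integral_sum[symmetric] locint_rtest_integrable locint_cont cH mt)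
      finally have e: "(LBINT x. (\<Sum>j\<in>UNIV. F n j x * H j x)) = (LBINT y. (\<Sum>j\<in>UNIV. T j (\<lambda>x. H j (x - y)) * ?r n y))" .
      have "\<bar>LBINT y. (\<Sum>j\<in>UNIV. T j (\<lambda>x. H j (x - y)) * ?r n y)\<bar> \<le> (LBINT y. K * ?r n y)"
      proof (rule integral_abs_le(2))
        show "(\<lambda>y. \<Sum>j\<in>UNIV. T j (\<lambda>x. H j (x - y)) * ?r n y) \<in> borel_measurable lborel"
          by (intro borel_measurable_sum borel_measurable_integrable locint_rtest_integrable locint_cont cH mt)
        show "integrable lborel (\<lambda>y. K * ?r n y)" by (intro rtest_integrable rtest_cmult mt)
        show "\<bar>\<Sum>j\<in>UNIV. T j (\<lambda>x. H j (x - y)) * ?r n y\<bar> \<le> K * ?r n y" for y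
          unfolding sum_distrib_right[symmetric] abs_mult using mt(4)[of n y] by (simp add: mult_right_mono bd)
      qed
      also have "\<dots> = K" using mt(3)[of n] by simp
      finally show "\<bar>LBINT x. (\<Sum>j\<in>UNIV. F n j x * (b x * rpd j a x - a x * rpd j b x))\<bar> \<le> 1/8 * sqrt (dir a) * sqrt (dir b)"
        unfolding K_def using e by (simp only: H_def)
    qed
    then show ?thesis by simp
  qed
  have lim: "(\<lambda>n. (LBINT x. conv (V n) (?r n) x * f x)) \<longlonglongrightarrow> - (\<Sum>j\<in>UNIV. T j (rpd j f))" if f: "rtest f" for f
  proof -
    obtain R where R: "vanish R f" using f by (auto simp: rtest_def)
    have cf: "continuous_on UNIV f" by (rule sm_cont[OF rtest_sm[OF f]])
    have "(LBINT x. conv (V n) (?r n) x * f x) = - (\<Sum>j\<in>UNIV. T j (conv (conv (rpd j f) (?r n)) (?r n)))" for n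
    proof -
      have "(LBINT x. conv (V n) (?r n) x * f x) = (LBINT y. V n y * (LBINT x. ?r n (x - y) * f x))"
        by (rule conv_fubini[OF locint_cont[OF Vc] mt(1) cf R])
      also have "(\<lambda>y. (LBINT x. ?r n (x - y) * f x)) = conv f (?r n)"
      proof (intro ext)
        fix y
        have "?r n (x - y) = ?r n (y - x)" for x using mseq(3)[of n "y - x"] by simp
        then show "(LBINT x. ?r n (x - y) * f x) = conv f (?r n) y" unfolding conv_def by (simp only: mult.commute)
      qed
      also have "(LBINT y. V n y * conv f (?r n) y) = - (\<Sum>j\<in>UNIV. T j (conv (rpd j (conv f (?r n))) (?r n)))"
        by (rule Vi[OF rtest_conv[OF cf R mt(1)]])
      also have "\<dots> = - (\<Sum>j\<in>UNIV. T j (conv (conv (rpd j f) (?r n)) (?r n)))"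
        unfolding rpd_conv[OF locint_cont[OF cf] mt(1)] conv_by_parts[OF rtest_sm[OF f] mt(1), abs_def] by (simp only: eta_contract_eq)
      finally show ?thesis .
    qed
    then show ?thesis by (simp only:) (intro tendsto_minus tendsto_sum rdist_mollify_tendsto T rtest_rpd f)
  qed
  show ?thesis
    by (rule limit_potential[OF d Vc form m lim]) (unfold gradient_potential_def, blast+)
qed

lemma rdist_cmult: assumes T: "rdist T" shows "rdist (\<lambda>f. t * T f)"
  unfolding rdist_def
proof (intro conjI allI impI)
  show "t * T (\<lambda>x. a * f x + b * g x) = a * (t * T f) + b * (t * T g)" if "rtest f" "rtest g" for a b f g
    unfolding rdist_lin[OF T that] by (simp add: algebra_simps)
  fix R
  obtain C N where C: "0 \<le> C" "\<And>f M. rtest f \<Longrightarrow> vanish R f \<Longrightarrow> (\<And>is x. length is \<le> N \<Longrightarrow> \<bar>dp is f x\<bar> \<le> M) \<Longrightarrow> \<bar>T f\<bar> \<le> C * M"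
    using rdist_bound[OF T] by blast
  show "\<exists>C N. 0 \<le> C \<and> (\<forall>f M. rtest f \<longrightarrow> vanish R f \<longrightarrow> (\<forall>is x. length is \<le> N \<longrightarrow> \<bar>dp is f x\<bar> \<le> M) \<longrightarrow> \<bar>t * T f\<bar> \<le> C * M)"
  proof (intro exI[of _ "\<bar>t\<bar> * C"] exI[of _ N] conjI allI impI)
    show "0 \<le> \<bar>t\<bar> * C" using C(1) by simp
    fix f :: "real^'a \<Rightarrow> real" and M assume "rtest f" "vanish R f" "\<forall>is x. length is \<le> N \<longrightarrow> \<bar>dp is f x\<bar> \<le> M"
    then have "\<bar>T f\<bar> \<le> C * M" using C(2) by blast
    then show "\<bar>t * T f\<bar> \<le> \<bar>t\<bar> * C * M" unfolding abs_mult mult.assoc by (rule mult_left_mono) simp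
  qed
qed

lemma gradient_potential_scale:
  assumes "gradient_potential \<Lambda> \<Psi> G C" and s: "s > 0"
  shows "gradient_potential (\<lambda>f. s * \<Lambda> f) (\<lambda>f. s * \<Psi> f) (\<lambda>j x. s * G j x) (s^2 * C)"
proof -
  have P: "C > 0" "\<And>f g a b. rtest f \<Longrightarrow> rtest g \<Longrightarrow> \<Psi> (\<lambda>x. a * f x + b * g x) = a * \<Psi> f + b * \<Psi> g"
    "\<And>R. \<exists>B\<ge>0. \<forall>f M. rtest f \<longrightarrow> vanish R f \<longrightarrow> (\<forall>x. \<bar>f x\<bar> \<le> M) \<longrightarrow> \<bar>\<Psi> f\<bar> \<le> B * M"
    "\<And>f. rtest f \<Longrightarrow> \<Psi> (lapl f) = \<Lambda> f" "\<And>j. G j \<in> borel_measurable borel"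
    "\<And>j f. rtest f \<Longrightarrow> integrable lborel (\<lambda>x. G j x * f x)" "\<And>j f. rtest f \<Longrightarrow> - \<Psi> (rpd j f) = (LBINT x. G j x * f x)"
    "\<And>u. rtest u \<Longrightarrow> (LBNN x. ennreal ((\<Sum>j\<in>UNIV. (G j x)^2) * (u x)^2)) \<le> ennreal (C * dir u)"
    using assms(1) unfolding gradient_potential_def by blast+
  show ?thesis unfolding gradient_potential_def
  proof (intro conjI allI impI)
    show "0 < s^2 * C" using s P(1) by simp
    show "s * \<Psi> (\<lambda>x. a * f x + b * g x) = a * (s * \<Psi> f) + b * (s * \<Psi> g)" if "rtest f" "rtest g" for f g a b
      unfolding P(2)[OF that] by (simp add: algebra_simps)
    show "s * \<Psi> (lapl f) = s * \<Lambda> f" if "rtest f" for f unfolding P(4)[OF that] ..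
    show "(\<lambda>x. s * G j x) \<in> borel_measurable borel" for j using P(5)[of j] by simp
    show "integrable lborel (\<lambda>x. s * G j x * f x)" if "rtest f" for j f unfolding mult.assoc using P(6)[OF that] by simp
    show "- (s * \<Psi> (rpd j f)) = (LBINT x. s * G j x * f x)" if "rtest f" for j f
      unfolding mult.assoc using P(7)[OF that, of j, symmetric] by simp
    show "(LBNN x. ennreal ((\<Sum>j\<in>UNIV. (s * G j x)^2) * (u x)^2)) \<le> ennreal (s^2 * C * dir u)" if u: "rtest u" for u
    proof -
      note [measurable] = P(5) sm_borel[OF rtest_sm[OF u]]
      have "(LBNN x. ennreal ((\<Sum>j\<in>UNIV. (s * G j x)^2) * (u x)^2)) = (LBNN x. ennreal (s^2) * ennreal ((\<Sum>j\<in>UNIV. (G j x)^2) * (u x)^2))"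
      proof (rule nn_integral_cong)
        fix x
        have "(\<Sum>j\<in>UNIV. (s * G j x)^2) * (u x)^2 = s^2 * ((\<Sum>j\<in>UNIV. (G j x)^2) * (u x)^2)"
          by (simp only: power_mult_distrib sum_distrib_left[symmetric] mult.assoc)
        then show "ennreal ((\<Sum>j\<in>UNIV. (s * G j x)^2) * (u x)^2) = ennreal (s^2) * ennreal ((\<Sum>j\<in>UNIV. (G j x)^2) * (u x)^2)"
          by (simp only: ennreal_mult sum_nonneg mult_nonneg_nonneg zero_le_power2)
      qed
      also have "\<dots> = ennreal (s^2) * (LBNN x. ennreal ((\<Sum>j\<in>UNIV. (G j x)^2) * (u x)^2))" by (rule nn_integral_cmult) measurable
      also have "\<dots> \<le> ennreal (s^2) * ennreal (C * dir u)" by (intro mult_left_mono P(8) u) simp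
      also have "\<dots> = ennreal (s^2 * C * dir u)" using P(1) dir_nonneg[of u] by (simp add: ennreal_mult[symmetric] mult.assoc)
      finally show ?thesis .
    qed
    fix R
    obtain B where B: "B \<ge> 0" "\<And>f M. rtest f \<Longrightarrow> vanish R f \<Longrightarrow> (\<forall>x. \<bar>f x\<bar> \<le> M) \<Longrightarrow> \<bar>\<Psi> f\<bar> \<le> B * M" using P(3)[of R] by blast
    show "\<exists>B\<ge>0. \<forall>f M. rtest f \<longrightarrow> vanish R f \<longrightarrow> (\<forall>x. \<bar>f x\<bar> \<le> M) \<longrightarrow> \<bar>s * \<Psi> f\<bar> \<le> B * M"
    proof (intro exI[of _ "s * B"] conjI allI impI)
      show "0 \<le> s * B" using B(1) s by simp
      fix f :: "real^'a \<Rightarrow> real" and M assume "rtest f" "vanish R f" "\<forall>x. \<bar>f x\<bar> \<le> M"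
      then have "\<bar>\<Psi> f\<bar> \<le> B * M" by (rule B(2))
      then show "\<bar>s * \<Psi> f\<bar> \<le> s * B * M" using s by (simp add: abs_mult mult.assoc)
    qed
  qed
qed

lemma rdist_potential:
  fixes T :: "'d::finite \<Rightarrow> (real^'d \<Rightarrow> real) \<Rightarrow> real"
  assumes d: "CARD('d) \<ge> 3" and T: "\<And>j. rdist (T j)" and K: "K > 0"
    and skew: "\<And>a b. rtest a \<Longrightarrow> rtest b \<Longrightarrow> \<bar>\<Sum>j\<in>UNIV. T j (\<lambda>x. b x * rpd j a x - a x * rpd j b x)\<bar> \<le> K * sqrt (dir a) * sqrt (dir b)"
  obtains \<Psi> G C where "gradient_potential (\<lambda>f. - (\<Sum>j\<in>UNIV. T j (rpd j f))) \<Psi> G C"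
proof -
  \<comment> \<open>Scales the skew constant to 1/8; the potential is multiplied by
    \<open>8 * K\<close> afterwards.\<close>
  define t where "t = 1 / (8 * K)"
  have t: "t > 0" "t * K = 1/8" "8 * K * t = 1" using K by (auto simp: t_def)
  have "\<exists>\<Psi> G C. gradient_potential (\<lambda>f. - (\<Sum>j\<in>UNIV. t * T j (rpd j f))) \<Psi> G C"
  proof (rule rdist_potential_unit[OF d rdist_cmult[OF T]])
    fix a b :: "real^'d \<Rightarrow> real" assume "rtest a" "rtest b"
    from mult_left_mono[OF skew[OF this] less_imp_le[OF t(1)]]
    show "\<bar>\<Sum>j\<in>UNIV. t * T j (\<lambda>x. b x * rpd j a x - a x * rpd j b x)\<bar> \<le> 1/8 * sqrt (dir a) * sqrt (dir b)"
      unfolding sum_distrib_left[symmetric] abs_mult mult.assoc[symmetric] t(2) using t(1) by simp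
  qed
  then obtain \<Psi> G C where "gradient_potential (\<lambda>f. - (\<Sum>j\<in>UNIV. t * T j (rpd j f))) \<Psi> G C" by blast
  from gradient_potential_scale[OF this, of "8 * K"]
  have "gradient_potential (\<lambda>f. 8 * K * (- (\<Sum>j\<in>UNIV. t * T j (rpd j f)))) (\<lambda>f. 8 * K * \<Psi> f) (\<lambda>j x. 8 * K * G j x) ((8 * K)^2 * C)" using K by simp
  moreover have "8 * K * (- (\<Sum>j\<in>UNIV. t * T j (rpd j f))) = - (\<Sum>j\<in>UNIV. T j (rpd j f))" for f
    unfolding sum_distrib_left[symmetric] mult_minus_right mult.assoc[symmetric] t(3) by simp
  ultimately show thesis using that by simp
qed

section \<open>Complex distributions\<close>

lemma has_derivative_Complex:
  assumes "(a has_derivative a') F" "(b has_derivative b') F"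
  shows "((\<lambda>x. Complex (a x) (b x)) has_derivative (\<lambda>h. Complex (a' h) (b' h))) F"
  unfolding Complex_eq by (intro derivative_intros assms)

lemma pd_eqI: "(f has_derivative f') (at x) \<Longrightarrow> pd i f x = f' (axis i 1)"
  unfolding pd_def using frechet_derivative_at by metis

lemma rpd_Re_Im:
  assumes "f differentiable (at x)"
  shows "rpd i (\<lambda>x. Re (f x)) x = Re (pd i f x)" "rpd i (\<lambda>x. Im (f x)) x = Im (pd i f x)"
    "(\<lambda>x. Re (f x)) differentiable (at x)" "(\<lambda>x. Im (f x)) differentiable (at x)"
proof -
  obtain f' where f: "(f has_derivative f') (at x)" using assms unfolding differentiable_def by blast
  have r: "((\<lambda>x. Re (f x)) has_derivative (\<lambda>h. Re (f' h))) (at x)" by (rule bounded_linear.has_derivative[OF bounded_linear_Re f])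
  have i: "((\<lambda>x. Im (f x)) has_derivative (\<lambda>h. Im (f' h))) (at x)" by (rule bounded_linear.has_derivative[OF bounded_linear_Im f])
  show "rpd i (\<lambda>x. Re (f x)) x = Re (pd i f x)" unfolding rpd_eqI[OF r] pd_eqI[OF f] ..
  show "rpd i (\<lambda>x. Im (f x)) x = Im (pd i f x)" unfolding rpd_eqI[OF i] pd_eqI[OF f] ..
  show "(\<lambda>x. Re (f x)) differentiable (at x)" "(\<lambda>x. Im (f x)) differentiable (at x)" using r i unfolding differentiable_def by blast+
qed

lemma dp_Re_Im:
  assumes "smooth_fun f"
  shows "dp is (\<lambda>x. Re (f x)) = (\<lambda>x. Re (dpart is f x)) \<and> dp is (\<lambda>x. Im (f x)) = (\<lambda>x. Im (dpart is f x))"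
proof (induction "is")
  case (Cons i "is")
  have "dpart is f differentiable (at x)" for x using assms by (simp add: smooth_fun_def)
  from rpd_Re_Im(1,2)[OF this] show ?case by (simp add: Cons.IH fun_eq_iff)
qed simp

lemma smooth_sm: assumes "smooth_fun f" shows "sm (\<lambda>x. Re (f x))" "sm (\<lambda>x. Im (f x))"
proof -
  have "dpart is f differentiable (at x)" for "is" x using assms by (simp add: smooth_fun_def)
  from rpd_Re_Im(3,4)[OF this] show "sm (\<lambda>x. Re (f x))" "sm (\<lambda>x. Im (f x))" unfolding sm_def by (auto simp: dp_Re_Im[OF assms])
qed

lemma pd_Complex:
  assumes "sm a" "sm b"
  shows "pd i (\<lambda>x. Complex (a x) (b x)) x = Complex (rpd i a x) (rpd i b x)" "(\<lambda>x. Complex (a x) (b x)) differentiable (at x)"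
proof -
  obtain a' where a: "(a has_derivative a') (at x)" using sm_diff[OF assms(1)] unfolding differentiable_def by blast
  obtain b' where b: "(b has_derivative b') (at x)" using sm_diff[OF assms(2)] unfolding differentiable_def by blast
  note c = has_derivative_Complex[OF a b]
  show "pd i (\<lambda>x. Complex (a x) (b x)) x = Complex (rpd i a x) (rpd i b x)" unfolding pd_eqI[OF c] rpd_eqI[OF a] rpd_eqI[OF b] ..
  show "(\<lambda>x. Complex (a x) (b x)) differentiable (at x)" using c unfolding differentiable_def by blast
qed

lemma dpart_Complex: assumes "sm a" "sm b" shows "dpart is (\<lambda>x. Complex (a x) (b x)) = (\<lambda>x. Complex (dp is a x) (dp is b x))"
proof (induction "is")
  case (Cons i "is")
  show ?case unfolding dpart.simps dp.simps Cons.IH using pd_Complex(1)[OF sm_dp[OF assms(1)] sm_dp[OF assms(2)]] by (intro ext)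
qed simp

lemma smooth_Complex: assumes "sm a" "sm b" shows "smooth_fun (\<lambda>x. Complex (a x) (b x))"
  unfolding smooth_fun_def dpart_Complex[OF assms] using pd_Complex(2)[OF sm_dp[OF assms(1)] sm_dp[OF assms(2)]] by blast

section \<open>Complex test functions and their energy\<close>

lemma tsupp_vanish:
  assumes "tsupp f \<subseteq> cball 0 R" shows "vanish R (\<lambda>x. Re (f x))" "vanish R (\<lambda>x. Im (f x))"
proof -
  have "f x = 0" if "R < norm x" for x
  proof (rule ccontr)
    assume "f x \<noteq> 0"
    then have "x \<in> tsupp f" unfolding tsupp_def using closure_subset[of "{x. f x \<noteq> 0}"] by blast
    then show False using assms that by auto
  qed
  then show "vanish R (\<lambda>x. Re (f x))" "vanish R (\<lambda>x. Im (f x))" by (auto simp: vanish_def)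
qed

lemma vanish_tsupp: assumes "vanish R a" "vanish R b" shows "tsupp (\<lambda>x. Complex (a x) (b x)) \<subseteq> cball 0 R"
  unfolding tsupp_def
proof (rule closure_minimal)
  show "{x. Complex (a x) (b x) \<noteq> 0} \<subseteq> cball 0 R" using assms by (force simp: vanish_def complex_eq_iff)
qed simp

lemma compact_in_ball: assumes "compact (K :: (real^'d::finite) set)" obtains R where "R > 0" "K \<subseteq> cball 0 R"
proof -
  obtain R where "\<forall>x\<in>K. norm x \<le> R" using compact_imp_bounded[OF assms] unfolding bounded_iff by blast
  then have "K \<subseteq> cball 0 (max R 1)" by (auto simp: le_max_iff_disj)
  then show thesis using that[of "max R 1"] by simp
qed

lemma test_fun_rtest: assumes "test_fun f" shows "rtest (\<lambda>x. Re (f x))" "rtest (\<lambda>x. Im (f x))"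
proof -
  have s: "smooth_fun f" "compact (tsupp f)" using assms by (auto simp: test_fun_def)
  obtain R where "tsupp f \<subseteq> cball 0 R" using compact_in_ball[OF s(2)] by blast
  from tsupp_vanish[OF this] smooth_sm[OF s(1)] show "rtest (\<lambda>x. Re (f x))" "rtest (\<lambda>x. Im (f x))" unfolding rtest_def by blast+
qed

lemma rtest_test_fun: assumes a: "rtest a" and b: "rtest b" shows "test_fun (\<lambda>x. Complex (a x) (b x))"
proof -
  obtain R S where "vanish R a" "vanish S b" using a b by (auto simp: rtest_def)
  then have "vanish (max R S) a" "vanish (max R S) b" using vanish_mono[of R a "max R S"] vanish_mono[of S b "max R S"] by auto
  from vanish_tsupp[OF this] have "compact (tsupp (\<lambda>x. Complex (a x) (b x)))"
    unfolding compact_eq_bounded_closed using bounded_subset[OF bounded_cball] by (auto simp: tsupp_def)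
  then show ?thesis using smooth_Complex[OF rtest_sm[OF a] rtest_sm[OF b]] by (simp add: test_fun_def)
qed

lemma hnorm_sq: assumes "test_fun u" shows "(hnorm u)^2 = dir (\<lambda>x. Re (u x)) + dir (\<lambda>x. Im (u x))"
proof -
  have d: "u differentiable (at x)" for x using assms unfolding test_fun_def smooth_fun_def by (metis dpart.simps(1))
  note t = test_fun_rtest[OF assms]
  have "(\<Sum>j\<in>UNIV. (cmod (pd j u x))^2) = (\<Sum>j\<in>UNIV. (rpd j (\<lambda>x. Re (u x)) x)^2) + (\<Sum>j\<in>UNIV. (rpd j (\<lambda>x. Im (u x)) x)^2)" for x
    unfolding sum.distrib[symmetric] cmod_power2 rpd_Re_Im[OF d] ..
  then have "integral\<^sup>L lborel (\<lambda>x. \<Sum>j\<in>UNIV. (cmod (pd j u x))^2) = dir (\<lambda>x. Re (u x)) + dir (\<lambda>x. Im (u x))"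
    unfolding dir_def by (simp add: Bochner_Integration.integral_add rtest_integrable rtest_grad_sq t)
  then show ?thesis unfolding hnorm_def using dir_nonneg[of "\<lambda>x. Re (u x)"] dir_nonneg[of "\<lambda>x. Im (u x)"] by simp
qed

lemma rpd_0: "rpd i (\<lambda>x. 0) = (\<lambda>x. 0)" by (simp add: fun_eq_iff)

lemma dp_0: "dp is (\<lambda>x. 0) = (\<lambda>x. 0)" by (induction "is") (auto simp: rpd_0)

lemma hnorm_nonneg: "0 \<le> hnorm u"
  unfolding hnorm_def by (intro real_sqrt_ge_zero integral_nonneg_AE AE_I2 sum_nonneg) auto

lemma hnorm_real:
  fixes a :: "real^'d::finite \<Rightarrow> real"
  assumes a: "rtest a" shows "hnorm (\<lambda>x. Complex (a x) 0) = sqrt (dir a)"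
proof -
  have "(hnorm (\<lambda>x. Complex (a x) 0))^2 = dir a + dir (\<lambda>x::real^'d. 0 :: real)" using hnorm_sq[OF rtest_test_fun[OF a rtest_zero]] by simp
  also have "dir (\<lambda>x::real^'d. 0 :: real) = 0" unfolding dir_def rpd_0 by simp
  finally show ?thesis using hnorm_nonneg[of "\<lambda>x. Complex (a x) 0"] by (simp add: real_sqrt_unique)
qed

section \<open>Real and imaginary parts of a distribution\<close>

lemma distribution_lin: "distribution T \<Longrightarrow> test_fun f \<Longrightarrow> test_fun g \<Longrightarrow> T (\<lambda>x. a * f x + b * g x) = a * T f + b * T g"
  unfolding distribution_def by blast

lemma distribution_real_bound:
  fixes T :: "(real^'d::finite \<Rightarrow> complex) \<Rightarrow> complex"
  assumes T: "distribution T"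
  shows "\<exists>C N. 0 \<le> C \<and> (\<forall>f M. rtest f \<longrightarrow> vanish R f \<longrightarrow> (\<forall>is x. length is \<le> N \<longrightarrow> \<bar>dp is f x\<bar> \<le> M) \<longrightarrow> cmod (T (\<lambda>x. Complex (f x) 0)) \<le> C * M)"
proof -
  have "\<exists>C N. \<forall>f. test_fun f \<and> tsupp f \<subseteq> cball 0 R \<longrightarrow> cmod (T f) \<le> C * (\<Sum>is\<in>{is. length is \<le> N}. (SUP x. cmod (dpart is f x)))"
    using T compact_cball[of "0::real^'d" R] unfolding distribution_def by blast
  then obtain C N where C: "\<And>f. test_fun f \<Longrightarrow> tsupp f \<subseteq> cball 0 R \<Longrightarrow> cmod (T f) \<le> C * (\<Sum>is\<in>{is. length is \<le> N}. (SUP x. cmod (dpart is f x)))" by blast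
  \<comment> \<open>The number of derivative lists converts the sum of suprema into a single uniform
    bound.\<close>
  define k where "k = real (card {is :: 'd list. length is \<le> N})"
  have "cmod (T (\<lambda>x. Complex (f x) 0)) \<le> \<bar>C\<bar> * k * M"
    if f: "rtest f" "vanish R f" and M: "\<And>is x. length is \<le> N \<Longrightarrow> \<bar>dp is f x\<bar> \<le> M" for f M
  proof -
    let ?s = "\<lambda>is. SUP x. cmod (dpart is (\<lambda>x. Complex (f x) 0) x)"
    have e: "cmod (dpart is (\<lambda>x. Complex (f x) 0) x) = \<bar>dp is f x\<bar>" for "is" x
      unfolding dpart_Complex[OF rtest_sm[OF f(1)] sm_const] dp_0 by (simp add: cmod_def)
    have s: "0 \<le> ?s is" "?s is \<le> M" if "length is \<le> N" for "is"
    proof -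
      have "bdd_above (range (\<lambda>x. \<bar>dp is f x\<bar>))" using M[OF that] by (intro bdd_aboveI[of _ M]) auto
      then have "\<bar>dp is f 0\<bar> \<le> (SUP x. \<bar>dp is f x\<bar>)" by (intro cSUP_upper) auto
      then show "0 \<le> ?s is" unfolding e by linarith
      show "?s is \<le> M" unfolding e using M[OF that] by (intro cSUP_least) auto
    qed
    have "cmod (T (\<lambda>x. Complex (f x) 0)) \<le> C * (\<Sum>is\<in>{is. length is \<le> N}. ?s is)"
      by (rule C[OF rtest_test_fun[OF f(1) rtest_zero] vanish_tsupp[OF f(2)]]) (simp add: vanish_def)
    \<comment> \<open>The definition of a distribution leaves the sign of its constant open, hence
      the absolute value.\<close>
    also have "\<dots> \<le> \<bar>C\<bar> * (\<Sum>is\<in>{is. length is \<le> N}. ?s is)" using s(1) by (intro mult_right_mono sum_nonneg) auto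
    also have "\<dots> \<le> \<bar>C\<bar> * (k * M)"
      unfolding k_def using sum_bounded_above[of "{is. length is \<le> N}" ?s M] s(2) by (intro mult_left_mono) auto
    finally show ?thesis by (simp add: mult.assoc)
  qed
  then show ?thesis by (intro exI[of _ "\<bar>C\<bar> * k"] exI[of _ N]) (auto simp: k_def)
qed

lemma distribution_rdist:
  assumes T: "distribution T"
  shows "rdist (\<lambda>f. Re (T (\<lambda>x. Complex (f x) 0)))" "rdist (\<lambda>f. Im (T (\<lambda>x. Complex (f x) 0)))"
proof -
  have lin: "T (\<lambda>x. Complex (a * f x + b * g x) 0) = of_real a * T (\<lambda>x. Complex (f x) 0) + of_real b * T (\<lambda>x. Complex (g x) 0)"
    if "rtest f" "rtest g" for a b f g
  proof -
    have "(\<lambda>x. Complex (a * f x + b * g x) 0) = (\<lambda>x. of_real a * Complex (f x) 0 + of_real b * Complex (g x) 0)" by (simp add: complex_eq_iff fun_eq_iff)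
    then show ?thesis using distribution_lin[OF T rtest_test_fun[OF that(1) rtest_zero] rtest_test_fun[OF that(2) rtest_zero], of "of_real a" "of_real b"] by simp
  qed
  have bd: "\<exists>C N. 0 \<le> C \<and> (\<forall>f M. rtest f \<longrightarrow> vanish R f \<longrightarrow> (\<forall>is x. length is \<le> N \<longrightarrow> \<bar>dp is f x\<bar> \<le> M) \<longrightarrow> \<bar>p (T (\<lambda>x. Complex (f x) 0))\<bar> \<le> C * M)"
    if p: "\<And>z. \<bar>p z\<bar> \<le> cmod z" for R and p :: "complex \<Rightarrow> real"
    using distribution_real_bound[OF T, of R] order_trans[OF p] by meson
  show "rdist (\<lambda>f. Re (T (\<lambda>x. Complex (f x) 0)))"
    unfolding rdist_def using lin bd[OF abs_Re_le_cmod] by auto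
  show "rdist (\<lambda>f. Im (T (\<lambda>x. Complex (f x) 0)))"
    unfolding rdist_def using lin bd[OF abs_Im_le_cmod] by auto
qed

text \<open>The complex-linear extension of A + i B from real to complex test functions.\<close>

definition cext :: "((real^'d::finite \<Rightarrow> real) \<Rightarrow> real) \<Rightarrow> ((real^'d \<Rightarrow> real) \<Rightarrow> real) \<Rightarrow> (real^'d \<Rightarrow> complex) \<Rightarrow> complex" where
  "cext A B f = Complex (A (\<lambda>x. Re (f x)) - B (\<lambda>x. Im (f x))) (A (\<lambda>x. Im (f x)) + B (\<lambda>x. Re (f x)))"

lemma distribution_cext:
  assumes T: "distribution T" and f: "test_fun f"
  shows "T f = cext (\<lambda>f. Re (T (\<lambda>x. Complex (f x) 0))) (\<lambda>f. Im (T (\<lambda>x. Complex (f x) 0))) f"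
proof -
  have "f = (\<lambda>x. 1 * Complex (Re (f x)) 0 + \<i> * Complex (Im (f x)) 0)" by (simp add: complex_eq_iff fun_eq_iff)
  then have "T f = 1 * T (\<lambda>x. Complex (Re (f x)) 0) + \<i> * T (\<lambda>x. Complex (Im (f x)) 0)"
    using distribution_lin[OF T rtest_test_fun[OF test_fun_rtest(1)[OF f] rtest_zero] rtest_test_fun[OF test_fun_rtest(2)[OF f] rtest_zero], of 1 "\<i>"] by metis
  then show ?thesis by (simp add: cext_def complex_eq_iff)
qed

lemma cext_lin:
  assumes A: "\<And>f g a b. rtest f \<Longrightarrow> rtest g \<Longrightarrow> A (\<lambda>x. a * f x + b * g x) = a * A f + b * A g"
    and B: "\<And>f g a b. rtest f \<Longrightarrow> rtest g \<Longrightarrow> B (\<lambda>x. a * f x + b * g x) = a * B f + b * B g"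
    and f: "test_fun f" and g: "test_fun g"
  shows "cext A B (\<lambda>x. a * f x + b * g x) = a * cext A B f + b * cext A B g"
proof -
  note t = test_fun_rtest[OF f] test_fun_rtest[OF g]
  have l4: "D (\<lambda>x. (a1 * f1 x + a2 * f2 x) + (a3 * f3 x + a4 * f4 x)) = a1 * D f1 + a2 * D f2 + (a3 * D f3 + a4 * D f4)"
    if D: "\<And>f g a b. rtest f \<Longrightarrow> rtest g \<Longrightarrow> D (\<lambda>x. a * f x + b * g x) = a * D f + b * D g" and r: "rtest f1" "rtest f2" "rtest f3" "rtest f4"
    for D :: "(real^'a \<Rightarrow> real) \<Rightarrow> real" and a1 a2 a3 a4 f1 f2 f3 f4
  proof -
    have "D (\<lambda>x. 1 * (a1 * f1 x + a2 * f2 x) + 1 * (a3 * f3 x + a4 * f4 x)) = 1 * D (\<lambda>x. a1 * f1 x + a2 * f2 x) + 1 * D (\<lambda>x. a3 * f3 x + a4 * f4 x)"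
      by (intro D rtest_add rtest_cmult r)
    then show ?thesis by (simp only: mult_1 D[OF r(1,2)] D[OF r(3,4)])
  qed
  have e: "(\<lambda>x. Re (a * f x + b * g x)) = (\<lambda>x. (Re a * Re (f x) + (- Im a) * Im (f x)) + (Re b * Re (g x) + (- Im b) * Im (g x)))"
    "(\<lambda>x. Im (a * f x + b * g x)) = (\<lambda>x. (Re a * Im (f x) + Im a * Re (f x)) + (Re b * Im (g x) + Im b * Re (g x)))"
    by (auto simp: fun_eq_iff)
  have De: "D (\<lambda>x. Re (a * f x + b * g x)) = Re a * D (\<lambda>x. Re (f x)) + (- Im a) * D (\<lambda>x. Im (f x)) + (Re b * D (\<lambda>x. Re (g x)) + (- Im b) * D (\<lambda>x. Im (g x)))"
    "D (\<lambda>x. Im (a * f x + b * g x)) = Re a * D (\<lambda>x. Im (f x)) + Im a * D (\<lambda>x. Re (f x)) + (Re b * D (\<lambda>x. Im (g x)) + Im b * D (\<lambda>x. Re (g x)))"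
    if D: "\<forall>f g a b. rtest f \<longrightarrow> rtest g \<longrightarrow> D (\<lambda>x. a * f x + b * g x) = a * D f + b * D g" for D :: "(real^'a \<Rightarrow> real) \<Rightarrow> real"
    unfolding e by (rule l4[OF _ t(1,2,3,4)], rule D[rule_format]; assumption) (rule l4[OF _ t(2,1,4,3)], rule D[rule_format]; assumption)
  have A': "\<forall>f g a b. rtest f \<longrightarrow> rtest g \<longrightarrow> A (\<lambda>x. a * f x + b * g x) = a * A f + b * A g" using A by blast
  have B': "\<forall>f g a b. rtest f \<longrightarrow> rtest g \<longrightarrow> B (\<lambda>x. a * f x + b * g x) = a * B f + b * B g" using B by blast
  show ?thesis
    unfolding cext_def De[OF A'] De[OF B'] by (simp add: complex_eq_iff algebra_simps)
qed

lemma integral_Complex: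
  fixes a b :: "'x \<Rightarrow> real"
  assumes "integrable M a" "integrable M b"
  shows "(\<integral>x. Complex (a x) (b x) \<partial>M) = Complex (integral\<^sup>L M a) (integral\<^sup>L M b)"
proof -
  have "(\<integral>x. complex_of_real (a x) + \<i> * complex_of_real (b x) \<partial>M) = (\<integral>x. complex_of_real (a x) \<partial>M) + (\<integral>x. \<i> * complex_of_real (b x) \<partial>M)"
    by (intro Bochner_Integration.integral_add integrable_mult_right integrable_of_real assms)
  then show ?thesis unfolding Complex_eq by simp
qed

text \<open>Since both parts are bounded by the supremum alone, the continuity estimate holds with
  \<open>N = 0\<close>, where the only derivative list is the empty one.\<close>

lemma distribution_order_zero:
  assumes A: "\<And>f g a b. rtest f \<Longrightarrow> rtest g \<Longrightarrow> A (\<lambda>x. a * f x + b * g x) = a * A f + b * A g"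
    and B: "\<And>f g a b. rtest f \<Longrightarrow> rtest g \<Longrightarrow> B (\<lambda>x. a * f x + b * g x) = a * B f + b * B g"
    and Ab: "\<And>R. \<exists>b\<ge>0. \<forall>f M. rtest f \<longrightarrow> vanish R f \<longrightarrow> (\<forall>x. \<bar>f x\<bar> \<le> M) \<longrightarrow> \<bar>A f\<bar> \<le> b * M"
    and Bb: "\<And>R. \<exists>b\<ge>0. \<forall>f M. rtest f \<longrightarrow> vanish R f \<longrightarrow> (\<forall>x. \<bar>f x\<bar> \<le> M) \<longrightarrow> \<bar>B f\<bar> \<le> b * M"
  shows "distribution (cext A B)"
  unfolding distribution_def
proof (intro conjI allI impI)
  show "cext A B (\<lambda>x. a * f x + b * g x) = a * cext A B f + b * cext A B g" if "test_fun f" "test_fun g" for a b f g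
    by (rule cext_lin[OF A B that])
  fix K :: "(real^'a) set" assume "compact K"
  then obtain R where R: "K \<subseteq> cball 0 R" using compact_in_ball by blast
  obtain p where p: "p \<ge> 0" "\<And>f M. rtest f \<Longrightarrow> vanish R f \<Longrightarrow> (\<forall>x. \<bar>f x\<bar> \<le> M) \<Longrightarrow> \<bar>A f\<bar> \<le> p * M" using Ab[of R] by blast
  obtain q where q: "q \<ge> 0" "\<And>f M. rtest f \<Longrightarrow> vanish R f \<Longrightarrow> (\<forall>x. \<bar>f x\<bar> \<le> M) \<Longrightarrow> \<bar>B f\<bar> \<le> q * M" using Bb[of R] by blast
  have "cmod (cext A B f) \<le> (2 * p + 2 * q) * (\<Sum>is\<in>{is. length is \<le> 0}. (SUP x. cmod (dpart is f x)))" if f: "test_fun f" "tsupp f \<subseteq> K" for f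
  proof -
    note t = test_fun_rtest[OF f(1)]
    have v: "vanish R (\<lambda>x. Re (f x))" "vanish R (\<lambda>x. Im (f x))" using tsupp_vanish[of f R] f(2) R by auto
    define M where "M = (SUP x. cmod (f x))"
    obtain M1 where M1: "\<And>x. \<bar>Re (f x)\<bar> \<le> M1" using rtest_bounded[OF t(1)] by blast
    obtain M2 where M2: "\<And>x. \<bar>Im (f x)\<bar> \<le> M2" using rtest_bounded[OF t(2)] by blast
    have "cmod (f x) \<le> M1 + M2" for x using cmod_le[of "f x"] M1[of x] M2[of x] by linarith
    then have "bdd_above (range (\<lambda>x. cmod (f x)))" by (intro bdd_aboveI[of _ "M1 + M2"]) auto
    then have M: "cmod (f x) \<le> M" for x unfolding M_def by (intro cSUP_upper) auto
    have Mr: "\<forall>x. \<bar>Re (f x)\<bar> \<le> M" and Mi: "\<forall>x. \<bar>Im (f x)\<bar> \<le> M" using order_trans[OF abs_Re_le_cmod M] order_trans[OF abs_Im_le_cmod M] by blast+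
    have "cmod (cext A B f) \<le> \<bar>Re (cext A B f)\<bar> + \<bar>Im (cext A B f)\<bar>" by (rule cmod_le)
    also have "\<dots> \<le> (p * M + q * M) + (p * M + q * M)"
      using p(2)[OF t(1) v(1) Mr] p(2)[OF t(2) v(2) Mi] q(2)[OF t(1) v(1) Mr] q(2)[OF t(2) v(2) Mi] by (simp only: cext_def complex.sel)
    also have "\<dots> = (2 * p + 2 * q) * M" by (simp add: algebra_simps)
    finally show ?thesis unfolding M_def by simp
  qed
  then show "\<exists>C N. \<forall>f. test_fun f \<and> tsupp f \<subseteq> K \<longrightarrow> cmod (cext A B f) \<le> C * (\<Sum>is\<in>{is. length is \<le> N}. (SUP x. cmod (dpart is f x)))" by blast
qed

theorem mainTheorem6:
  fixes F :: "'d::finite \<Rightarrow> (real^'d \<Rightarrow> complex) \<Rightarrow> complex"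
  assumes dim: "CARD('d) \<ge> 3"
    and Fdist: "\<forall>j. distribution (F j)"
    and C_pos: "C > 0"
    and bound: "\<forall>u v. test_fun u \<longrightarrow> test_fun v \<longrightarrow>
        cmod (\<Sum>j\<in>UNIV. F j (\<lambda>x. v x * pd j (\<lambda>y. cnj (u y)) x - cnj (u x) * pd j v x))
          \<le> C * hnorm u * hnorm v"
  shows "\<exists>\<psi> G. distribution \<psi> \<and> (\<forall>f. test_fun f \<longrightarrow> dist_lap \<psi> f = dist_div F f) \<and>
            (\<forall>j. L2loc (G j) \<and> represented_by (dist_pd j \<psi>) (G j)) \<and>
            (\<exists>C'. \<forall>u. test_fun u \<longrightarrow>
               (\<integral>\<^sup>+ x. ennreal ((\<Sum>j\<in>UNIV. (cmod (G j x))\<^sup>2) * (cmod (u x))\<^sup>2) \<partial>lborel)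
                 \<le> ennreal (C' * (hnorm u)\<^sup>2))"
proof -
  have Fd: "distribution (F j)" for j using Fdist by blast
  define T1 where "T1 j f = Re (F j (\<lambda>x. Complex (f x) 0))" for j f
  define T2 where "T2 j f = Im (F j (\<lambda>x. Complex (f x) 0))" for j f
  have T: "rdist (T1 j)" "rdist (T2 j)" for j unfolding T1_def[abs_def] T2_def[abs_def] by (intro distribution_rdist Fd)+
  \<comment> \<open>On real test functions conjugation disappears, and the bound on the modulus
    holds for the real and the imaginary part of F at once.\<close>
  have skew: "cmod (\<Sum>j\<in>UNIV. F j (\<lambda>x. Complex (b x * rpd j a x - a x * rpd j b x) 0)) \<le> C * sqrt (dir a) * sqrt (dir b)"
    if a: "rtest a" and b: "rtest b" for a b
  proof -
    let ?u = "\<lambda>x. Complex (a x) 0" and ?v = "\<lambda>x. Complex (b x) 0"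
    have sa: "sm a" and sb: "sm b" using a b by (auto intro: rtest_sm)
    have c: "cnj (?u x) = ?u x" for x by (simp add: complex_eq_iff)
    have "(\<lambda>x. ?v x * pd j (\<lambda>y. cnj (?u y)) x - cnj (?u x) * pd j ?v x) = (\<lambda>x. Complex (b x * rpd j a x - a x * rpd j b x) 0)" for j
      unfolding c pd_Complex(1)[OF sa sm_const] pd_Complex(1)[OF sb sm_const] by (simp add: fun_eq_iff complex_eq_iff)
    then show ?thesis
      using bound[rule_format, OF rtest_test_fun[OF a rtest_zero] rtest_test_fun[OF b rtest_zero]] by (simp add: hnorm_real[OF a] hnorm_real[OF b])
  qed
  obtain P1 G1 C1 where "gradient_potential (\<lambda>f. - (\<Sum>j\<in>UNIV. T1 j (rpd j f))) P1 G1 C1"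
  proof (rule rdist_potential[OF dim T(1) C_pos])
    fix a b :: "real^'d \<Rightarrow> real" assume "rtest a" "rtest b"
    then show "\<bar>\<Sum>j\<in>UNIV. T1 j (\<lambda>x. b x * rpd j a x - a x * rpd j b x)\<bar> \<le> C * sqrt (dir a) * sqrt (dir b)"
      unfolding T1_def Re_sum[symmetric] by (intro order_trans[OF abs_Re_le_cmod skew])
  qed
  then have P1: "C1 > 0" "\<And>f g a b. rtest f \<Longrightarrow> rtest g \<Longrightarrow> P1 (\<lambda>x. a * f x + b * g x) = a * P1 f + b * P1 g"
    "\<And>R. \<exists>b\<ge>0. \<forall>f M. rtest f \<longrightarrow> vanish R f \<longrightarrow> (\<forall>x. \<bar>f x\<bar> \<le> M) \<longrightarrow> \<bar>P1 f\<bar> \<le> b * M"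
    "\<And>f. rtest f \<Longrightarrow> P1 (lapl f) = - (\<Sum>j\<in>UNIV. T1 j (rpd j f))" "\<And>j. G1 j \<in> borel_measurable borel"
    "\<And>j f. rtest f \<Longrightarrow> integrable lborel (\<lambda>x. G1 j x * f x)" "\<And>j f. rtest f \<Longrightarrow> - P1 (rpd j f) = (LBINT x. G1 j x * f x)"
    "\<And>u. rtest u \<Longrightarrow> (LBNN x. ennreal ((\<Sum>j\<in>UNIV. (G1 j x)^2) * (u x)^2)) \<le> ennreal (C1 * dir u)"
    unfolding gradient_potential_def by blast+
  obtain P2 G2 C2 where "gradient_potential (\<lambda>f. - (\<Sum>j\<in>UNIV. T2 j (rpd j f))) P2 G2 C2"
  proof (rule rdist_potential[OF dim T(2) C_pos])
    fix a b :: "real^'d \<Rightarrow> real" assume "rtest a" "rtest b"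
    then show "\<bar>\<Sum>j\<in>UNIV. T2 j (\<lambda>x. b x * rpd j a x - a x * rpd j b x)\<bar> \<le> C * sqrt (dir a) * sqrt (dir b)"
      unfolding T2_def Im_sum[symmetric] by (intro order_trans[OF abs_Im_le_cmod skew])
  qed
  then have P2: "C2 > 0" "\<And>f g a b. rtest f \<Longrightarrow> rtest g \<Longrightarrow> P2 (\<lambda>x. a * f x + b * g x) = a * P2 f + b * P2 g"
    "\<And>R. \<exists>b\<ge>0. \<forall>f M. rtest f \<longrightarrow> vanish R f \<longrightarrow> (\<forall>x. \<bar>f x\<bar> \<le> M) \<longrightarrow> \<bar>P2 f\<bar> \<le> b * M"
    "\<And>f. rtest f \<Longrightarrow> P2 (lapl f) = - (\<Sum>j\<in>UNIV. T2 j (rpd j f))" "\<And>j. G2 j \<in> borel_measurable borel"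
    "\<And>j f. rtest f \<Longrightarrow> integrable lborel (\<lambda>x. G2 j x * f x)" "\<And>j f. rtest f \<Longrightarrow> - P2 (rpd j f) = (LBINT x. G2 j x * f x)"
    "\<And>u. rtest u \<Longrightarrow> (LBNN x. ennreal ((\<Sum>j\<in>UNIV. (G2 j x)^2) * (u x)^2)) \<le> ennreal (C2 * dir u)"
    unfolding gradient_potential_def by blast+
  define \<psi> where "\<psi> = cext P1 P2"
  define G where "G j x = Complex (G1 j x) (G2 j x)" for j x
  note [measurable] = P1(5) P2(5)
  have pdRI: "(\<lambda>x. Re (pd j f x)) = rpd j (\<lambda>x. Re (f x))" "(\<lambda>x. Im (pd j f x)) = rpd j (\<lambda>x. Im (f x))" if "test_fun f" for f j
    using dp_Re_Im[of f "[j]"] that by (simp_all add: test_fun_def)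
  have D: "distribution \<psi>" unfolding \<psi>_def by (rule distribution_order_zero[OF P1(2) P2(2) P1(3) P2(3)])
  have lapD: "dist_lap \<psi> f = dist_div F f" if f: "test_fun f" for f
  proof -
    note t = test_fun_rtest[OF f]
    have sf: "smooth_fun f" using f by (simp add: test_fun_def)
    have tp: "test_fun (pd j f)" for j
    proof -
      have "pd j f = (\<lambda>x. Complex (rpd j (\<lambda>x. Re (f x)) x) (rpd j (\<lambda>x. Im (f x)) x))"
        unfolding pdRI[OF f, symmetric] by simp
      then show ?thesis using rtest_test_fun[OF rtest_rpd[OF t(1)] rtest_rpd[OF t(2)]] by simp
    qed
    have l: "(\<lambda>x. Re (lap f x)) = lapl (\<lambda>x. Re (f x))" "(\<lambda>x. Im (lap f x)) = lapl (\<lambda>x. Im (f x))"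
    proof -
      have "dp [j, j] (\<lambda>x. Re (f x)) x = Re (pd j (pd j f) x)" "dp [j, j] (\<lambda>x. Im (f x)) x = Im (pd j (pd j f) x)" for j x
        using dp_Re_Im[OF sf, of "[j, j]"] by simp_all
      then show "(\<lambda>x. Re (lap f x)) = lapl (\<lambda>x. Re (f x))" "(\<lambda>x. Im (lap f x)) = lapl (\<lambda>x. Im (f x))" by (simp_all add: lap_def lapl_def fun_eq_iff)
    qed
    have Fp: "F j (pd j f) = Complex (T1 j (rpd j (\<lambda>x. Re (f x))) - T2 j (rpd j (\<lambda>x. Im (f x)))) (T1 j (rpd j (\<lambda>x. Im (f x))) + T2 j (rpd j (\<lambda>x. Re (f x))))" for j
    proof -
      have "F j (pd j f) = cext (T1 j) (T2 j) (pd j f)" using distribution_cext[OF Fd tp] unfolding T1_def[abs_def] T2_def[abs_def] .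
      then show ?thesis unfolding cext_def pdRI[OF f] .
    qed
    have "dist_lap \<psi> f = Complex (- (\<Sum>j\<in>UNIV. T1 j (rpd j (\<lambda>x. Re (f x)))) - - (\<Sum>j\<in>UNIV. T2 j (rpd j (\<lambda>x. Im (f x)))))
       (- (\<Sum>j\<in>UNIV. T1 j (rpd j (\<lambda>x. Im (f x)))) + - (\<Sum>j\<in>UNIV. T2 j (rpd j (\<lambda>x. Re (f x)))))"
      unfolding dist_lap_def \<psi>_def cext_def l P1(4)[OF t(1)] P1(4)[OF t(2)] P2(4)[OF t(1)] P2(4)[OF t(2)] ..
    also have "\<dots> = dist_div F f"
      unfolding dist_div_def dist_pd_def Fp by (simp add: complex_eq_iff sum_negf sum_subtractf sum.distrib)
    finally show ?thesis .
  qed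
  have rep: "represented_by (dist_pd j \<psi>) (G j)" for j
    unfolding represented_by_def
  proof (intro allI impI)
    fix f :: "real^'d \<Rightarrow> complex" assume f: "test_fun f"
    note t = test_fun_rtest[OF f]
    have "(LBINT x. G j x * f x) = (LBINT x. Complex (G1 j x * Re (f x) - G2 j x * Im (f x)) (G1 j x * Im (f x) + G2 j x * Re (f x)))"
      unfolding G_def by (intro Bochner_Integration.integral_cong refl) (simp add: complex_eq_iff)
    also have "\<dots> = Complex (LBINT x. G1 j x * Re (f x) - G2 j x * Im (f x)) (LBINT x. G1 j x * Im (f x) + G2 j x * Re (f x))"
      by (intro integral_Complex Bochner_Integration.integrable_diff Bochner_Integration.integrable_add P1(6) P2(6) t)
    also have "\<dots> = Complex (- P1 (rpd j (\<lambda>x. Re (f x))) - - P2 (rpd j (\<lambda>x. Im (f x)))) (- P1 (rpd j (\<lambda>x. Im (f x))) + - P2 (rpd j (\<lambda>x. Re (f x))))"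
      using P1(6,7)[OF t(1), of j] P1(6,7)[OF t(2), of j] P2(6,7)[OF t(1), of j] P2(6,7)[OF t(2), of j] by simp
    also have "\<dots> = dist_pd j \<psi> f" unfolding dist_pd_def \<psi>_def cext_def pdRI[OF f] by (simp add: complex_eq_iff)
    finally show "dist_pd j \<psi> f = (LBINT x. G j x * f x)" ..
  qed
  have sq: "(cmod (G j x))^2 = (G1 j x)^2 + (G2 j x)^2" for j x by (simp add: G_def cmod_power2)
  have L2: "L2loc (G j)" for j unfolding L2loc_def
  proof (intro conjI allI impI)
    show "G j \<in> borel_measurable lborel" unfolding G_def[abs_def] borel_measurable_complex_iff by simp
    fix K :: "(real^'d) set" assume "compact K"
    then obtain R where R: "R > 0" "K \<subseteq> cball 0 R" using compact_in_ball by blast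
    \<comment> \<open>Local square integrability is the trace inequality tested with a cutoff that
      equals 1 on K.\<close>
    let ?u = "cutat 0 R :: real^'d \<Rightarrow> real"
    have u: "rtest ?u" by (rule cutat_rtest[OF R(1)])
    note [measurable] = sm_borel[OF rtest_sm[OF u]]
    have "(LBNN x. indicator K x * ennreal ((cmod (G j x))^2)) \<le> (LBNN x. ennreal ((\<Sum>j\<in>UNIV. (G1 j x)^2) * (?u x)^2) + ennreal ((\<Sum>j\<in>UNIV. (G2 j x)^2) * (?u x)^2))"
    proof (rule nn_integral_mono)
      fix x
      show "indicator K x * ennreal ((cmod (G j x))^2) \<le> ennreal ((\<Sum>j\<in>UNIV. (G1 j x)^2) * (?u x)^2) + ennreal ((\<Sum>j\<in>UNIV. (G2 j x)^2) * (?u x)^2)"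
      proof (cases "x \<in> K")
        case True
        then have c: "?u x = 1" using R by (intro cutat_one) auto
        have "(G1 j x)^2 \<le> (\<Sum>j\<in>UNIV. (G1 j x)^2)" "(G2 j x)^2 \<le> (\<Sum>j\<in>UNIV. (G2 j x)^2)" by (intro member_le_sum; simp)+
        then have "ennreal ((G1 j x)^2) + ennreal ((G2 j x)^2) \<le> ennreal (\<Sum>j\<in>UNIV. (G1 j x)^2) + ennreal (\<Sum>j\<in>UNIV. (G2 j x)^2)"
          by (intro add_mono ennreal_leI)
        then show ?thesis using True by (simp add: c sq)
      qed simp
    qed
    also have "\<dots> = (LBNN x. ennreal ((\<Sum>j\<in>UNIV. (G1 j x)^2) * (?u x)^2)) + (LBNN x. ennreal ((\<Sum>j\<in>UNIV. (G2 j x)^2) * (?u x)^2))"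
      by (rule nn_integral_add) measurable
    also have "\<dots> \<le> ennreal (C1 * dir ?u) + ennreal (C2 * dir ?u)" by (intro add_mono P1(8) P2(8) u)
    also have "\<dots> < \<infinity>" by simp
    finally show "(LBNN x. indicator K x * ennreal ((cmod (G j x))^2)) < \<infinity>" .
  qed
  have tr: "(LBNN x. ennreal ((\<Sum>j\<in>UNIV. (cmod (G j x))^2) * (cmod (u x))^2)) \<le> ennreal ((C1 + C2) * (hnorm u)^2)" if u: "test_fun u" for u
  proof -
    note t = test_fun_rtest[OF u]
    note [measurable] = sm_borel[OF rtest_sm[OF t(1)]] sm_borel[OF rtest_sm[OF t(2)]]
    let ?a = "\<lambda>x. (\<Sum>j\<in>UNIV. (G1 j x)^2)" and ?b = "\<lambda>x. (\<Sum>j\<in>UNIV. (G2 j x)^2)"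
    have "(LBNN x. ennreal ((\<Sum>j\<in>UNIV. (cmod (G j x))^2) * (cmod (u x))^2))
      = (LBNN x. (ennreal (?a x * (Re (u x))^2) + ennreal (?a x * (Im (u x))^2)) + (ennreal (?b x * (Re (u x))^2) + ennreal (?b x * (Im (u x))^2)))"
    proof (rule nn_integral_cong)
      fix x
      have a: "0 \<le> ?a x" and b: "0 \<le> ?b x" by (auto intro: sum_nonneg)
      have e: "(\<Sum>j\<in>UNIV. (cmod (G j x))^2) * (cmod (u x))^2 = (?a x * (Re (u x))^2 + ?a x * (Im (u x))^2) + (?b x * (Re (u x))^2 + ?b x * (Im (u x))^2)"
        unfolding sq sum.distrib cmod_power2[of "u x"] by (simp only: distrib_left distrib_right)
      show "ennreal ((\<Sum>j\<in>UNIV. (cmod (G j x))^2) * (cmod (u x))^2) = (ennreal (?a x * (Re (u x))^2) + ennreal (?a x * (Im (u x))^2)) + (ennreal (?b x * (Re (u x))^2) + ennreal (?b x * (Im (u x))^2))"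
        unfolding e by (simp only: ennreal_plus add_nonneg_nonneg mult_nonneg_nonneg a b zero_le_power2)
    qed
    also have "\<dots> = ((LBNN x. ennreal (?a x * (Re (u x))^2)) + (LBNN x. ennreal (?a x * (Im (u x))^2)))
      + ((LBNN x. ennreal (?b x * (Re (u x))^2)) + (LBNN x. ennreal (?b x * (Im (u x))^2)))"
      by (simp add: nn_integral_add)
    also have "\<dots> \<le> (ennreal (C1 * dir (\<lambda>x. Re (u x))) + ennreal (C1 * dir (\<lambda>x. Im (u x)))) + (ennreal (C2 * dir (\<lambda>x. Re (u x))) + ennreal (C2 * dir (\<lambda>x. Im (u x))))"
      by (intro add_mono P1(8) P2(8) t)
    also have "\<dots> = ennreal ((C1 * dir (\<lambda>x. Re (u x)) + C1 * dir (\<lambda>x. Im (u x))) + (C2 * dir (\<lambda>x. Re (u x)) + C2 * dir (\<lambda>x. Im (u x))))"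
      by (simp only: ennreal_plus add_nonneg_nonneg mult_nonneg_nonneg dir_nonneg less_imp_le[OF P1(1)] less_imp_le[OF P2(1)])
    also have "\<dots> = ennreal ((C1 + C2) * (hnorm u)^2)" unfolding hnorm_sq[OF u] by (simp only: distrib_left distrib_right add_ac)
    finally show ?thesis .
  qed
  show ?thesis using D lapD rep L2 tr by blast
qed

end
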